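(* Let $F\in\mathcal{DM}^\infty(H\Omega)$ and $g\in L^\infty(\Omega)$ with $|D_Hg|(\Omega)<+\infty$. Then $gF\in\mathcal{DM}^\infty(H\Omega)$. Moreover, let $\rho$ be an admissible mollifier and $g_\varepsilon:=\rho_\varepsilon*g$. For every sequence $\tilde\varepsilon_k\to0^+$ there exist a subsequence $\varepsilon_k$, a function $\tilde g\in L^\infty(\Omega;|\operatorname{div}F|)$ and a finite signed Radon measure $(F,D_Hg)$ on $\Omega$ such that $g_{\varepsilon_k}\rightharpoonup^*\tilde g$ weakly* in $L^\infty(\Omega;|\operatorname{div}F|)$, $\langle F,\nabla_Hg_{\varepsilon_k}\rangle\,\mu\rightharpoonup(F,D_Hg)$ locally weakly* in $\Omega$, and $$\operatorname{div}(gF)=\tilde g\,\operatorname{div}F+(F,D_Hg)$$ as measures on $\Omega$. In addition $|(F,D_Hg)|\le\|F\|_{\infty,\Omega}|D_Hg|$, the absolutely continuous part of $(F,D_Hg)$ with respect to $\mu$ is $\langle F,\nabla_Hg\rangle\,\mu$ (with $\nabla_Hg$ the density of the absolutely continuous part of $D_Hg$), and its singular part $(F,D_Hg)^s$ satisfies $|(F,D_Hg)^s|\le\|F\|_{\infty,\Omega}|D^s_Hg|$.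
   Context: Setting and notation. $\mathbb G$ is a stratified group: a connected, simply connected nilpotent Lie group whose Lie algebra admits a stratification $\mathfrak g=V_1\oplus\cdots\oplus V_\iota$ with $[V_1,V_j]=V_{j+1}$, $V_\iota\neq\{0\}$, $V_{\iota+1}=\{0\}$; via exponential (graded) coordinates $\mathbb G$ is identified with $\mathbb R^q$, so that $0$ is the identity and $x^{-1}=-x$. $\delta_r$ ($r>0$) are the intrinsic dilations ($\delta_rp=r^ip$ on the $i$-th layer). $X_1,\dots,X_q$ are the left invariant vector fields agreeing at $0$ with a fixed graded basis, and $X_1,\dots,X_m$ ($m=\dim V_1$) are the horizontal ones; the horizontal subbundle has fibres $H_p\mathbb G=\mathrm{span}\{X_1(p),\dots,X_m(p)\}$, with the left invariant scalar product $\langle\cdot,\cdot\rangle$ making $X_1,\dots,X_m$ orthonormal and norm $|\cdot|$. $Q=\sum_i i\dim V_i$. The Haar measure $\mu$ is Lebesgue measure $\mathcal L^q$ in these coordinates ($dx$). $d$ is a fixed homogeneous distance (continuous, left invariant, $d(\delta_rx,\delta_ry)=rd(x,y)$), $\|x\|=d(x,0)$, $B(x,r)=\{y:d(y,x)<r\}$; $d^{\mathcal R}(x,y)=\|xy^{-1}\|$ is the associated right invariant distance with balls $B^{\mathcal R}(x,r)$. $\mathcal S^\alpha$ denotes the spherical $\alpha$-dimensional Hausdorff measure built with $d$-balls. $\Omega\subset\mathbb G$ is open and $\Omega^{\mathcal R}_\varepsilon=\{x:\inf_{y\notin\Omega}d^{\mathcal R}(x,y)>\varepsilon\}$. Horizontal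 calculus. $f\in C^1_H(\Omega)$ means $X_1f,\dots,X_mf$ exist and are continuous in $\Omega$; $\nabla_Hf=\sum_{j=1}^m(X_jf)X_j$. A horizontal field is a measurable section $F=\sum_{j=1}^mF_jX_j$ of $H\Omega$; $L^p(H\Omega)$ consists of those with $|F|\in L^p(\Omega)$; $\|F\|_{\infty,A}=\operatorname{ess\,sup}_A|F|$; $C_c(H\Omega)$, $C^1_c(H\Omega)$ are those with continuous, resp. $C^1$, compactly supported coefficients. The divergence of $F\in L^1_{loc}(H\Omega)$ is the distribution $\varphi\mapsto-\int_\Omega\langle F,\nabla_H\varphi\rangle\,dx$, $\varphi\in C^\infty_c(\Omega)$. $\mathcal{DM}^p(H\Omega)$ ($1\le p\le\infty$) is the space of $F\in L^p(H\Omega)$ whose divergence is a finite signed Radon measure $\operatorname{div}F$ on $\Omega$; $F\in\mathcal{DM}^p_{loc}(H\Omega)$ if $F\in\mathcal{DM}^p(HW)$ for every open $W\Subset\Omega$. BV and perimeter. For $f\in L^1_{loc}(\Omega)$ let $|D_Hf|(\Omega)=\sup\{\int_\Omega f\operatorname{div}\phi\,dx:\phi\in C^1_c(H\Omega),|\phi|\le1\}$. If this is finite, $|D_Hf|$ is a finite Radon measure and there is a $|D_Hf|$-measurable horizontal section $\sigma_f$ with $|\sigma_f|=1$ a.e. and $\int f\operatorname{div}\phi\,dx=-\int\langle\phi,\sigma_f\rangle\,d|D_Hf|$; $D_Hf:=\sigma_f|D_Hf|$, with scalar components $D_{X_j}f$. $f\in BV_H(\Omega)$ if also $f\in L^1(\Omega)$;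 $f\in BV_{H,loc}(\Omega)$ if $f\in BV_H(U)$ for every open $U\Subset\Omega$. One has the decomposition $D_Hf=\nabla_Hf\,\mu+D^s_Hf$ with $\nabla_Hf\in L^1(H\Omega)$ (the approximate differential) and $D^s_Hf\perp\mu$. A measurable $E$ has finite (resp. locally finite) h-perimeter in $\Omega$ if $|D_H\chi_E|(\Omega)<\infty$ (resp. $\chi_E\in BV_{H,loc}(\Omega)$); $\nu_E=-\sigma_{\chi_E}$ is the measure theoretic exterior horizontal normal. The reduced boundary $\partial^*_HE$ is the set of $x$ with $|D_H\chi_E|(B(x,r))>0$ for all $r>0$ such that $\lim_{r\to0}|D_H\chi_E|(B(x,r))^{-1}\int_{B(x,r)}\nu_E\,d|D_H\chi_E|$ exists and has norm $1$. Mollification. For $\rho\in C_c(B(0,1))$ (extended by $0$) let $\rho_\varepsilon(x)=\varepsilon^{-Q}\rho(\delta_{1/\varepsilon}x)$; for $f\in L^1_{loc}(\Omega)$ and a signed Radon measure $\nu$ on $\Omega$, $\rho_\varepsilon*f(x)=\int_\Omega\rho_\varepsilon(xy^{-1})f(y)\,dy$ and $\rho_\varepsilon*\nu(x)=\int_\Omega\rho_\varepsilon(xy^{-1})\,d\nu(y)$ (well defined at least for $x\in\Omega^{\mathcal R}_{2\varepsilon}$), and $\rho_\varepsilon*D_Hf=\sum_j(\rho_\varepsilon*D_{X_j}f)X_j$. $\rho$ is an admissible mollifier if $\rho\in C_c(B(0,1))$, $\rho\ge0$, $\rho(x)=\rho(x^{-1})$ and $\int\rho\,dx=1$. A family of (scalar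 or horizontal-vector) measures $\nu_\varepsilon$, each defined on $\Omega^{\mathcal R}_{2\varepsilon}$ or on $\Omega$, converges locally weakly* to $\nu$ in $\Omega$ ($\nu_\varepsilon\rightharpoonup\nu$) if $\int\langle\phi, d\nu_\varepsilon\rangle\to\int\langle\phi, d\nu\rangle$ for every $\phi\in C_c(\Omega)$ (resp. $\phi\in C_c(H\Omega)$). *)

theory Defs
  imports "HOL-Analysis.Analysis"
begin

text \<open>Polynomial functions of a pair of points (used to express that the
group law is polynomial, as it is in exponential coordinates).\<close>
inductive polyfun :: "((real^'n) \<times> (real^'n) \<Rightarrow> real) \<Rightarrow> bool" where
  pconst: "polyfun (\<lambda>z. c)"
| pfst: "polyfun (\<lambda>z. fst z $ i)"
| psnd: "polyfun (\<lambda>z. snd z $ i)"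
| padd: "polyfun f \<Longrightarrow> polyfun g \<Longrightarrow> polyfun (\<lambda>z. f z + g z)"
| pmul: "polyfun f \<Longrightarrow> polyfun g \<Longrightarrow> polyfun (\<lambda>z. f z * g z)"

definition dil :: "('n::finite \<Rightarrow> nat) \<Rightarrow> real \<Rightarrow> real^'n \<Rightarrow> real^'n" where
  "dil deg r x = (\<chi> i. r ^ deg i * x $ i)"

text \<open>Homogeneous dimension Q = sum_i i dim V_i.\<close>
definition homdim :: "('n::finite \<Rightarrow> nat) \<Rightarrow> real" where
  "homdim deg = real (\<Sum>i\<in>UNIV. deg i)"

definition layer :: "('n::finite \<Rightarrow> nat) \<Rightarrow> nat \<Rightarrow> (real^'n) set" where
  "layer deg k = span {axis i 1 | i. deg i = k}"

definition hor :: "('n::finite \<Rightarrow> nat) \<Rightarrow> 'n set" where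
  "hor deg = {j. deg j = 1}"

text \<open>Group commutator quotient; its limit at 0 is the Lie bracket of the
Lie algebra (identified with real^'n via X \<mapsto> X(0)) in exponential coordinates.\<close>
definition comm_quot :: "(real^'n \<Rightarrow> real^'n \<Rightarrow> real^'n) \<Rightarrow> real^'n \<Rightarrow> real^'n \<Rightarrow> real \<Rightarrow> real^'n" where
  "comm_quot gmul v w t =
     (1 / t^2) *\<^sub>R gmul (gmul (gmul (t *\<^sub>R v) (t *\<^sub>R w)) (-(t *\<^sub>R v))) (-(t *\<^sub>R w))"

definition lie_br :: "(real^'n \<Rightarrow> real^'n \<Rightarrow> real^'n) \<Rightarrow> real^'n \<Rightarrow> real^'n \<Rightarrow> real^'n" where
  "lie_br gmul v w = Lim (at 0) (comm_quot gmul v w)"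

text \<open>gmul is the group law of a stratified group written in exponential
coordinates w.r.t. a graded basis (the standard basis; deg i is the layer of e_i):
0 is the identity, x^{-1} = -x, t \<mapsto> t x are the one-parameter subgroups
(exponential coordinates), and V_k = layer k satisfy [V_1,V_k] = V_{k+1}.\<close>
definition stratified_exp :: "(real^'n::finite \<Rightarrow> real^'n \<Rightarrow> real^'n) \<Rightarrow> ('n \<Rightarrow> nat) \<Rightarrow> bool" where
  "stratified_exp gmul deg \<longleftrightarrow>
     (\<forall>x y z. gmul (gmul x y) z = gmul x (gmul y z)) \<and>
     (\<forall>x. gmul 0 x = x \<and> gmul x 0 = x) \<and>
     (\<forall>x. gmul x (-x) = 0 \<and> gmul (-x) x = 0) \<and>
     (\<forall>i. polyfun (\<lambda>z. gmul (fst z) (snd z) $ i)) \<and>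
     (\<forall>x s t. gmul (s *\<^sub>R x) (t *\<^sub>R x) = (s + t) *\<^sub>R x) \<and>
     (\<forall>i. deg i \<ge> 1) \<and>
     (\<forall>v w. \<exists>L. (comm_quot gmul v w \<longlongrightarrow> L) (at 0)) \<and>
     (\<forall>k\<ge>1. span {lie_br gmul v w | v w. v \<in> layer deg 1 \<and> w \<in> layer deg k}
                = layer deg (Suc k))"

definition homdist :: "(real^'n::finite \<Rightarrow> real^'n \<Rightarrow> real^'n) \<Rightarrow> ('n \<Rightarrow> nat)
    \<Rightarrow> (real^'n \<Rightarrow> real^'n \<Rightarrow> real) \<Rightarrow> bool" where
  "homdist gmul deg d \<longleftrightarrow>
     (\<forall>x y. d x y = 0 \<longleftrightarrow> x = y) \<and> (\<forall>x y. d x y = d y x) \<and>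
     (\<forall>x y z. d x z \<le> d x y + d y z) \<and>
     continuous_on UNIV (\<lambda>z. d (fst z) (snd z)) \<and>
     (\<forall>x y z. d (gmul z x) (gmul z y) = d x y) \<and>
     (\<forall>r>0. \<forall>x y. d (dil deg r x) (dil deg r y) = r * d x y)"

text \<open>Left invariant vector field X_j (X_j(0) = e_j) applied to f at p.\<close>
definition XX :: "(real^'n \<Rightarrow> real^'n \<Rightarrow> real^'n) \<Rightarrow> 'n \<Rightarrow> (real^'n \<Rightarrow> real) \<Rightarrow> real^'n \<Rightarrow> real" where
  "XX gmul j f p = deriv (\<lambda>t. f (gmul p (t *\<^sub>R axis j 1))) 0"

text \<open>Horizontal sections are represented by maps F :: real^'n \<Rightarrow> real^'n;
only the horizontal components F x $ j, j \<in> hor deg, are used.\<close>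
definition hnorm :: "('n::finite \<Rightarrow> nat) \<Rightarrow> real^'n \<Rightarrow> real" where
  "hnorm deg v = sqrt (\<Sum>j\<in>hor deg. (v $ j)^2)"

definition hinner :: "('n::finite \<Rightarrow> nat) \<Rightarrow> real^'n \<Rightarrow> real^'n \<Rightarrow> real" where
  "hinner deg v w = (\<Sum>j\<in>hor deg. v $ j * w $ j)"

definition hgrad :: "(real^'n \<Rightarrow> real^'n \<Rightarrow> real^'n) \<Rightarrow> (real^'n \<Rightarrow> real) \<Rightarrow> real^'n \<Rightarrow> real^'n" where
  "hgrad gmul f p = (\<chi> j. XX gmul j f p)"

definition partial :: "'n::finite \<Rightarrow> (real^'n \<Rightarrow> real) \<Rightarrow> real^'n \<Rightarrow> real" where
  "partial i f x = frechet_derivative f (at x) (axis i 1)"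

coinductive smooth_fun :: "(real^'n::finite \<Rightarrow> real) \<Rightarrow> bool" where
  "f differentiable_on UNIV \<Longrightarrow> (\<And>i. smooth_fun (partial i f)) \<Longrightarrow> smooth_fun f"

definition C1fun :: "(real^'n::finite \<Rightarrow> real) \<Rightarrow> bool" where
  "C1fun f \<longleftrightarrow> f differentiable_on UNIV \<and> (\<forall>i. continuous_on UNIV (partial i f))"

definition csupp_in :: "(real^'n::finite) set \<Rightarrow> (real^'n \<Rightarrow> real) \<Rightarrow> bool" where
  "csupp_in \<Omega> f \<longleftrightarrow> compact (closure {x. f x \<noteq> 0}) \<and> closure {x. f x \<noteq> 0} \<subseteq> \<Omega>"

definition testfun :: "(real^'n::finite) set \<Rightarrow> (real^'n \<Rightarrow> real) \<Rightarrow> bool" where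
  "testfun \<Omega> \<phi> \<longleftrightarrow> smooth_fun \<phi> \<and> csupp_in \<Omega> \<phi>"

definition Ccfun :: "(real^'n::finite) set \<Rightarrow> (real^'n \<Rightarrow> real) \<Rightarrow> bool" where
  "Ccfun \<Omega> \<phi> \<longleftrightarrow> continuous_on UNIV \<phi> \<and> csupp_in \<Omega> \<phi>"

definition C1c_unit_hfield :: "('n::finite \<Rightarrow> nat) \<Rightarrow> (real^'n) set \<Rightarrow> (real^'n \<Rightarrow> real^'n) \<Rightarrow> bool" where
  "C1c_unit_hfield deg \<Omega> \<phi> \<longleftrightarrow>
     (\<forall>j\<in>hor deg. C1fun (\<lambda>x. \<phi> x $ j) \<and> csupp_in \<Omega> (\<lambda>x. \<phi> x $ j)) \<and>
     (\<forall>x. hnorm deg (\<phi> x) \<le> 1)"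

definition hdiv :: "(real^'n \<Rightarrow> real^'n \<Rightarrow> real^'n) \<Rightarrow> ('n::finite \<Rightarrow> nat) \<Rightarrow> (real^'n \<Rightarrow> real^'n) \<Rightarrow> real^'n \<Rightarrow> real" where
  "hdiv gmul deg \<phi> x = (\<Sum>j\<in>hor deg. XX gmul j (\<lambda>y. \<phi> y $ j) x)"

definition Hvar :: "(real^'n \<Rightarrow> real^'n \<Rightarrow> real^'n) \<Rightarrow> ('n::finite \<Rightarrow> nat) \<Rightarrow> (real^'n) set
    \<Rightarrow> (real^'n \<Rightarrow> real) \<Rightarrow> ereal" where
  "Hvar gmul deg \<Omega> f = (SUP \<phi>\<in>{\<phi>. C1c_unit_hfield deg \<Omega> \<phi>}.
       ereal (LINT x:\<Omega>|lebesgue. f x * hdiv gmul deg \<phi> x))"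

definition Linf_on :: "(real^'n::finite) set \<Rightarrow> (real^'n \<Rightarrow> real) \<Rightarrow> bool" where
  "Linf_on \<Omega> g \<longleftrightarrow> set_borel_measurable lebesgue \<Omega> g \<and>
     (\<exists>C. AE x in lebesgue. x \<in> \<Omega> \<longrightarrow> \<bar>g x\<bar> \<le> C)"

definition LinfH :: "('n::finite \<Rightarrow> nat) \<Rightarrow> (real^'n) set \<Rightarrow> (real^'n \<Rightarrow> real^'n) \<Rightarrow> bool" where
  "LinfH deg \<Omega> F \<longleftrightarrow> (\<forall>j\<in>hor deg. set_borel_measurable lebesgue \<Omega> (\<lambda>x. F x $ j)) \<and>
     (\<exists>C. AE x in lebesgue. x \<in> \<Omega> \<longrightarrow> hnorm deg (F x) \<le> C)"

definition hsupnorm :: "('n::finite \<Rightarrow> nat) \<Rightarrow> (real^'n) set \<Rightarrow> (real^'n \<Rightarrow> real^'n) \<Rightarrow> real" where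
  "hsupnorm deg \<Omega> F = Inf {C. C \<ge> 0 \<and> (AE x in lebesgue. x \<in> \<Omega> \<longrightarrow> hnorm deg (F x) \<le> C)}"

text \<open>A finite signed Borel measure on \<Omega> is a real-valued countably additive
set function on the Borel subsets of \<Omega> (values on other sets are irrelevant).
On an open subset of real^'n finite Borel measures are automatically Radon.\<close>
definition fsm :: "(real^'n::finite) set \<Rightarrow> ((real^'n) set \<Rightarrow> real) \<Rightarrow> bool" where
  "fsm \<Omega> \<nu> \<longleftrightarrow> (\<forall>A::nat \<Rightarrow> (real^'n) set.
      (\<forall>i. A i \<in> sets borel \<and> A i \<subseteq> \<Omega>) \<and> disjoint_family A \<longrightarrow>
      (\<lambda>i. \<nu> (A i)) sums \<nu> (\<Union>i. A i))"

definition tvarv :: "'i set \<Rightarrow> (real^'n::finite) set \<Rightarrow> ('i \<Rightarrow> (real^'n) set \<Rightarrow> real)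
    \<Rightarrow> (real^'n) set \<Rightarrow> real" where
  "tvarv I \<Omega> \<nu> A = Sup {(\<Sum>B\<in>P. sqrt (\<Sum>j\<in>I. (\<nu> j B)^2)) | P.
      finite P \<and> disjoint P \<and> (\<forall>B\<in>P. B \<in> sets borel \<and> B \<subseteq> A \<inter> \<Omega>)}"

definition tvar :: "(real^'n::finite) set \<Rightarrow> ((real^'n) set \<Rightarrow> real) \<Rightarrow> (real^'n) set \<Rightarrow> real" where
  "tvar \<Omega> \<nu> A = Sup {(\<Sum>B\<in>P. \<bar>\<nu> B\<bar>) | P.
      finite P \<and> disjoint P \<and> (\<forall>B\<in>P. B \<in> sets borel \<and> B \<subseteq> A \<inter> \<Omega>)}"

definition tvm :: "(real^'n::finite) set \<Rightarrow> ((real^'n) set \<Rightarrow> real) \<Rightarrow> (real^'n) measure" where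
  "tvm \<Omega> \<nu> = measure_of UNIV (sets borel) (\<lambda>A. ennreal (tvar \<Omega> \<nu> A))"

definition posm :: "(real^'n::finite) set \<Rightarrow> ((real^'n) set \<Rightarrow> real) \<Rightarrow> (real^'n) measure" where
  "posm \<Omega> \<nu> = measure_of UNIV (sets borel)
      (\<lambda>A. ennreal (Sup {\<nu> B | B. B \<in> sets borel \<and> B \<subseteq> A \<inter> \<Omega>}))"

definition sint :: "(real^'n::finite) set \<Rightarrow> ((real^'n) set \<Rightarrow> real) \<Rightarrow> (real^'n \<Rightarrow> real) \<Rightarrow> real" where
  "sint \<Omega> \<nu> f = integral\<^sup>L (posm \<Omega> \<nu>) f - integral\<^sup>L (posm \<Omega> (\<lambda>A. - \<nu> A)) f"

definition sing_leb :: "(real^'n::finite) set \<Rightarrow> ((real^'n) set \<Rightarrow> real) \<Rightarrow> bool" where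
  "sing_leb \<Omega> \<nu> \<longleftrightarrow> (\<exists>N\<in>sets borel. N \<subseteq> \<Omega> \<and> emeasure lebesgue N = 0 \<and> tvar \<Omega> \<nu> (\<Omega> - N) = 0)"

definition is_hdiv :: "(real^'n \<Rightarrow> real^'n \<Rightarrow> real^'n) \<Rightarrow> ('n::finite \<Rightarrow> nat) \<Rightarrow> (real^'n) set
    \<Rightarrow> (real^'n \<Rightarrow> real^'n) \<Rightarrow> ((real^'n) set \<Rightarrow> real) \<Rightarrow> bool" where
  "is_hdiv gmul deg \<Omega> F \<nu> \<longleftrightarrow> fsm \<Omega> \<nu> \<and>
     (\<forall>\<phi>. testfun \<Omega> \<phi> \<longrightarrow>
        - (LINT x:\<Omega>|lebesgue. hinner deg (F x) (hgrad gmul \<phi> x)) = sint \<Omega> \<nu> \<phi>)"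

definition DMinf :: "(real^'n \<Rightarrow> real^'n \<Rightarrow> real^'n) \<Rightarrow> ('n::finite \<Rightarrow> nat) \<Rightarrow> (real^'n) set
    \<Rightarrow> (real^'n \<Rightarrow> real^'n) \<Rightarrow> bool" where
  "DMinf gmul deg \<Omega> F \<longleftrightarrow> LinfH deg \<Omega> F \<and> (\<exists>\<nu>. is_hdiv gmul deg \<Omega> F \<nu>)"

definition is_DH :: "(real^'n \<Rightarrow> real^'n \<Rightarrow> real^'n) \<Rightarrow> ('n::finite \<Rightarrow> nat) \<Rightarrow> (real^'n) set
    \<Rightarrow> (real^'n \<Rightarrow> real) \<Rightarrow> ('n \<Rightarrow> (real^'n) set \<Rightarrow> real) \<Rightarrow> bool" where
  "is_DH gmul deg \<Omega> g Dg \<longleftrightarrow> (\<forall>j\<in>hor deg. fsm \<Omega> (Dg j) \<and>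
     (\<forall>\<phi>. testfun \<Omega> \<phi> \<longrightarrow>
        (LINT x:\<Omega>|lebesgue. g x * XX gmul j \<phi> x) = - sint \<Omega> (Dg j) \<phi>))"

definition admissible_moll :: "(real^'n::finite \<Rightarrow> real) \<Rightarrow> (real^'n \<Rightarrow> real^'n \<Rightarrow> real) \<Rightarrow> bool" where
  "admissible_moll \<rho> d \<longleftrightarrow> continuous_on UNIV \<rho> \<and> compact (closure {x. \<rho> x \<noteq> 0}) \<and>
     closure {x. \<rho> x \<noteq> 0} \<subseteq> {x. d x 0 < 1} \<and>
     (\<forall>x. \<rho> x \<ge> 0) \<and> (\<forall>x. \<rho> (-x) = \<rho> x) \<and> (LINT x|lebesgue. \<rho> x) = 1"

definition moll :: "('n::finite \<Rightarrow> nat) \<Rightarrow> (real^'n \<Rightarrow> real) \<Rightarrow> real \<Rightarrow> real^'n \<Rightarrow> real" where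
  "moll deg \<rho> \<epsilon> x = \<epsilon> powr (- homdim deg) * \<rho> (dil deg (1 / \<epsilon>) x)"

definition mconv :: "(real^'n \<Rightarrow> real^'n \<Rightarrow> real^'n) \<Rightarrow> ('n::finite \<Rightarrow> nat) \<Rightarrow> (real^'n) set
    \<Rightarrow> (real^'n \<Rightarrow> real) \<Rightarrow> real \<Rightarrow> (real^'n \<Rightarrow> real) \<Rightarrow> real^'n \<Rightarrow> real" where
  "mconv gmul deg \<Omega> \<rho> \<epsilon> f x = (LINT y:\<Omega>|lebesgue. moll deg \<rho> \<epsilon> (gmul x (-y)) * f y)"

end

theory Submission
  imports Defs "HOL-Complex_Analysis.Great_Picard"
begin

text \<open>The kernels \<open>\<eta> (x y\<inverse>)\<close> are invariant under simultaneous right translation of \<open>x\<close> and \<open>y\<close>, so a left invariant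
  field \<open>X\<^sub>j\<close> acting on \<open>x\<close> is minus the same field acting on \<open>y\<close>. Testing \<open>div F\<close> with
  \<open>\<phi>(x) \<eta> (x y\<inverse>)\<close> and integrating against \<open>g(y)\<close> therefore gives, with \<open>g\<^sub>\<epsilon> = \<rho>\<^sub>\<epsilon> * g\<close>,
  the product rule \<open>\<integral> \<phi> g\<^sub>\<epsilon> d(div F) = - \<integral> g\<^sub>\<epsilon> \<langle>F, \<nabla>\<phi>\<rangle> - \<Sum>\<^sub>j \<integral> \<rho>\<^sub>\<epsilon> * (\<phi> F\<^sub>j) dD\<^sub>jg\<close>, without any
  derivative of \<open>\<rho>\<close>. Up to a uniformly small error the last integrand is \<open>\<phi> (\<rho>\<^sub>\<epsilon> * F\<^sub>j)\<close>. Weak* compactness of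
  bounded sequences in \<open>L\<^sup>\<infinity>(|div F|)\<close> and \<open>L\<^sup>\<infinity>(|D\<^sub>jg|)\<close> yields limits \<open>g~\<close> of \<open>g\<^sub>\<epsilon>\<close> and
  \<open>F~\<^sub>j\<close> of \<open>\<rho>\<^sub>\<epsilon> * F\<^sub>j\<close>, and the pairing is \<open>\<Sum>\<^sub>j F~\<^sub>j D\<^sub>jg\<close>. The bound by \<open>\<parallel>F\<parallel> |D g|\<close>
  holds before the limit because the mollified field is bounded by \<open>\<parallel>F\<parallel>\<close> everywhere, and the same argument applies to the
  singular part, as the absolutely continuous part converges to \<open>\<langle>F, \<nabla>g\<rangle>\<close>.\<close>

section \<open>Finite signed measures\<close>

text \<open>Two obstacles shape the argument. \<open>\<rho>\<close> is only continuous, so the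
  mollified \<open>g\<close> need not be differentiable for reasons of the kernel; its horizontal
  derivatives exist because, for smooth approximations of the kernel, they can be rewritten as
  mollifications of the measure \<open>D_j g\<close>, a form that is stable under uniform limits.
  And div F and D_H g may charge Lebesgue null sets, on which \<open>F\<close> and \<open>g\<close>
  have no meaningful values. Mollified functions do have values there, but nothing beyond a uniform
  bound controls them, which is why compactness is applied in these very measures and yields limits
  along subsequences only. The measures |D_j g| differ from one another, so the limits of the
  components of the field are taken separately and carry no joint Euclidean bound; the estimates by
  vector variations are obtained for mollified fields on each Borel set and then passed to the
  limit. Measures are given as real set functions whose variations and integrals are defined by
  suprema. A Hahn decomposition rewrites each as a positive measure with a density of modulus 1, and
  all computations take place there.\<close>

lemma fsm_sums:
  assumes "fsm \<Omega> \<nu>" "\<And>i. A i \<in> sets borel" "\<And>i. A i \<subseteq> \<Omega>" "disjoint_family A"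
  shows "(\<lambda>i::nat. \<nu> (A i)) sums \<nu> (\<Union>i. A i)"
  using assms unfolding fsm_def by blast

lemma fsm_empty: assumes "fsm \<Omega> \<nu>" shows "\<nu> {} = 0"
proof -
  have "(\<lambda>i::nat. \<nu> {}) sums \<nu> (\<Union>i::nat. {})"
    by (rule fsm_sums[OF assms]) (auto simp: disjoint_family_on_def)
  then show ?thesis
    using sums_summable summable_const_iff by blast
qed

lemma fsm_Un:
  assumes "fsm \<Omega> \<nu>" "A \<in> sets borel" "B \<in> sets borel" "A \<subseteq> \<Omega>" "B \<subseteq> \<Omega>" "A \<inter> B = {}"
  shows "\<nu> (A \<union> B) = \<nu> A + \<nu> B"
proof -
  have 1: "(\<lambda>i. \<nu> (binaryset A B i)) sums \<nu> (\<Union>i. binaryset A B i)"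
    by (rule fsm_sums[OF assms(1)]) (use assms in \<open>auto simp: binaryset_def disjoint_family_on_def\<close>)
  have 2: "(\<lambda>i. \<nu> (binaryset A B i)) sums (\<nu> A + \<nu> B)"
    by (rule binaryset_sums) (rule fsm_empty[OF assms(1)])
  show ?thesis using sums_unique2[OF 1 2] by (simp add: UN_binaryset_eq)
qed

lemma fsm_Diff:
  assumes "fsm \<Omega> \<nu>" "A \<in> sets borel" "B \<in> sets borel" "B \<subseteq> A" "A \<subseteq> \<Omega>"
  shows "\<nu> (A - B) = \<nu> A - \<nu> B"
proof -
  have "\<nu> (B \<union> (A - B)) = \<nu> B + \<nu> (A - B)"
    by (rule fsm_Un[OF assms(1)]) (use assms in auto)
  moreover have "B \<union> (A - B) = A" using assms by blast
  ultimately show ?thesis by simp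
qed

text \<open>Sets with almost the most negative mass available are removed one after another. The
  removed sets are disjoint, so their masses are summable and tend to 0; a set of negative mass
  inside the remainder would have forced removals bounded away from 0. Removing negative mass can
  only raise the value, whence \<open>\<nu> A \<le> \<nu> P\<close>.\<close>

lemma fsm_positive_subset:
  fixes \<Omega> :: "(real^'n) set"
  assumes fsm: "fsm \<Omega> \<nu>" and A: "A \<in> sets borel" "A \<subseteq> \<Omega>"
  obtains P where "P \<in> sets borel" "P \<subseteq> A" "\<nu> A \<le> \<nu> P"
    "\<And>B. B \<in> sets borel \<Longrightarrow> B \<subseteq> P \<Longrightarrow> 0 \<le> \<nu> B"
proof -
  \<comment> \<open>The infimum of \<open>\<nu>\<close> over the Borel subsets of \<open>X\<close>
    is not known to be finite, so a mass of at most -1 is accepted in place of one that reaches half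
    of the infimum.\<close>
  define good where "good X B \<longleftrightarrow> B \<subseteq> X \<and> B \<in> sets borel \<and> \<nu> B \<le> 0 \<and>
      (\<nu> B \<le> -1 \<or> (\<forall>C\<in>sets borel. C \<subseteq> X \<longrightarrow> 2 * \<nu> B \<le> \<nu> C))" for X B
  have ex: "\<exists>B. good X B" for X
  proof (cases "\<exists>C\<in>sets borel. C \<subseteq> X \<and> \<nu> C \<le> -1")
    case True
    then obtain C where "C \<in> sets borel" "C \<subseteq> X" "\<nu> C \<le> -1" by blast
    then show ?thesis unfolding good_def by (intro exI[of _ C]) auto
  next
    case False
    define I where "I = \<nu> ` {C \<in> sets borel. C \<subseteq> X}"
    have ne: "I \<noteq> {}" unfolding I_def by blast
    have bdd: "bdd_below I" unfolding I_def bdd_below_def using False by (intro exI[of _ "-1"]) force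
    have I0: "Inf I \<le> 0" using cInf_lower[OF _ bdd, of 0] fsm_empty[OF fsm] unfolding I_def
      by (metis (mono_tags, lifting) bot.extremum image_eqI mem_Collect_eq sets.empty_sets)
    have low: "Inf I \<le> \<nu> C" if "C \<in> sets borel" "C \<subseteq> X" for C
      using cInf_lower[OF _ bdd, of "\<nu> C"] that unfolding I_def by blast
    show ?thesis
    proof (cases "Inf I = 0")
      case True then show ?thesis unfolding good_def
        using low fsm_empty[OF fsm] by (intro exI[of _ "{}"]) auto
    next
      case False
      then have "Inf I < Inf I / 2" using I0 by simp
      then obtain B where "B \<in> sets borel" "B \<subseteq> X" "\<nu> B < Inf I / 2"
        using cInf_less_iff[OF ne bdd] unfolding I_def by blast
      then show ?thesis unfolding good_def using low I0 by (intro exI[of _ B]) force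
    qed
  qed
  define f where "f X = (SOME B. good X B)" for X
  have f: "good X (f X)" for X unfolding f_def using someI_ex[OF ex] .
  define As where "As = rec_nat A (\<lambda>_ X. X - f X)"
  have As0: "As 0 = A" and AsS: "As (Suc k) = As k - f (As k)" for k unfolding As_def by auto
  define B where "B k = f (As k)" for k
  have Bb: "B k \<in> sets borel" "B k \<subseteq> As k" "\<nu> (B k) \<le> 0"
    and Bg: "\<nu> (B k) \<le> -1 \<or> (\<forall>C\<in>sets borel. C \<subseteq> As k \<longrightarrow> 2 * \<nu> (B k) \<le> \<nu> C)" for k
    using f[of "As k"] unfolding good_def B_def by auto
  have dec: "As l \<subseteq> As k - B k" if "k < l" for k l
    using that by (induction l) (auto simp: AsS B_def less_Suc_eq)
  have Asub: "As k \<subseteq> A" for k by (induction k) (auto simp: As0 AsS)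
  have dis: "B k \<inter> B l = {}" if "k < l" for k l using dec[OF that] Bb(2)[of l] by blast
  have disj: "disjoint_family B" unfolding disjoint_family_on_def
    using dis by (metis Int_commute nat_neq_iff)
  have sums: "(\<lambda>k. \<nu> (B k)) sums \<nu> (\<Union>k. B k)"
    by (rule fsm_sums[OF fsm Bb(1) _ disj]) (use Bb(2) Asub A in blast)
  have lim: "(\<lambda>k. \<nu> (B k)) \<longlonglongrightarrow> 0" using sums by (simp add: sums_iff summable_LIMSEQ_zero)
  have UB: "(\<Union>k. B k) \<in> sets borel" "(\<Union>k. B k) \<subseteq> A" using Bb Asub by blast+
  define P where "P = A - (\<Union>k. B k)"
  have "P \<subseteq> As k" for k by (induction k) (auto simp: P_def As0 AsS B_def)
  note PA = this
  show ?thesis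
  proof (rule that[of P])
    show "P \<in> sets borel" "P \<subseteq> A" using A UB unfolding P_def by auto
    have "\<nu> (\<Union>k. B k) \<le> 0" using sums_le[OF Bb(3) sums sums_zero] .
    then show "\<nu> A \<le> \<nu> P" unfolding P_def using fsm_Diff[OF fsm A(1) UB A(2)] by simp
    \<comment> \<open>As \<open>\<nu> (B k)\<close> tends to 0, its being at most -1 eventually
      fails. The other alternative then applies to \<open>C\<close>, which lies in every
      \<open>As k\<close>, and bounds \<open>\<nu> C\<close> below by
      \<open>2 * \<nu> (B k)\<close>.\<close>
    show "0 \<le> \<nu> C" if C: "C \<in> sets borel" "C \<subseteq> P" for C
    proof (rule tendsto_upperbound[of "\<lambda>k. 2 * \<nu> (B k)" "2 * 0" sequentially, simplified])
      show "(\<lambda>k. \<nu> (B k)) \<longlonglongrightarrow> 0" by (rule lim)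
      have "\<forall>\<^sub>F k in sequentially. \<nu> (B k) > -1" using order_tendstoD(1)[OF lim, of "-1"] by simp
      then show "\<forall>\<^sub>F k in sequentially. 2 * \<nu> (B k) \<le> \<nu> C"
      proof eventually_elim
        case (elim k)
        with Bg[of k] C PA[of k] show ?case by auto
      qed
    qed
  qed
qed

text \<open>A positive set of largest mass works: choose positive sets whose masses approach the
  supremum; their union is again positive and attains it. A set of positive mass left outside would
  contain a positive set of at least this mass, by \<open>fsm_positive_subset\<close>, and adjoining
  it would exceed the maximum.\<close>

lemma fsm_Hahn:
  fixes \<Omega> :: "(real^'n) set"
  assumes fsm: "fsm \<Omega> \<nu>"
  obtains H where "H \<in> sets borel" "H \<subseteq> \<Omega>"
    "\<And>B. B \<in> sets borel \<Longrightarrow> B \<subseteq> H \<Longrightarrow> 0 \<le> \<nu> B"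
    "\<And>B. B \<in> sets borel \<Longrightarrow> B \<subseteq> \<Omega> - H \<Longrightarrow> \<nu> B \<le> 0"
proof -
  define pos where "pos P \<longleftrightarrow> P \<in> sets borel \<and> P \<subseteq> \<Omega> \<and> (\<forall>B\<in>sets borel. B \<subseteq> P \<longrightarrow> 0 \<le> \<nu> B)" for P
  \<comment> \<open>The supremum is taken in \<open>ereal\<close> because the masses of positive
    sets are not known to be bounded at this point.\<close>
  define S where "S = (\<lambda>P. ereal (\<nu> P)) ` {P. pos P}"
  have "pos {}" unfolding pos_def using fsm_empty[OF fsm] by auto
  then have "S \<noteq> {}" unfolding S_def by auto
  then obtain f :: "nat \<Rightarrow> ereal" where f: "range f \<subseteq> S" "Sup S = (SUP i. f i)"
    using Sup_countable_SUP by blast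
  have "\<forall>i. \<exists>P. pos P \<and> f i = ereal (\<nu> P)" using f(1) unfolding S_def by (auto simp: subset_eq)
  then obtain P where P: "\<And>i. pos (P i)" "\<And>i. f i = ereal (\<nu> (P i))" by metis
  have posU: "pos (\<Union>i. Q i)" if Q: "\<And>i::nat. pos (Q i)" for Q
    unfolding pos_def
  proof (intro conjI ballI impI)
    show "(\<Union>i. Q i) \<in> sets borel" "(\<Union>i. Q i) \<subseteq> \<Omega>" using Q unfolding pos_def by auto
    fix B assume B: "B \<in> sets borel" "B \<subseteq> (\<Union>i. Q i)"
    have meas: "disjointed Q i \<in> sets borel" for i
      using sets.range_disjointed_sets[of Q borel] Q unfolding pos_def by auto
    have "(\<lambda>i. \<nu> (B \<inter> disjointed Q i)) sums \<nu> (\<Union>i. B \<inter> disjointed Q i)"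
    proof (rule fsm_sums[OF fsm])
      show "disjoint_family (\<lambda>i. B \<inter> disjointed Q i)"
        using disjoint_family_disjointed[of Q] unfolding disjoint_family_on_def by blast
      show "B \<inter> disjointed Q i \<in> sets borel" for i using B meas by auto
      show "B \<inter> disjointed Q i \<subseteq> \<Omega>" for i using B Q unfolding pos_def by blast
    qed
    also have "(\<Union>i. B \<inter> disjointed Q i) = B" using B(2) UN_disjointed_eq[of Q] by blast
    finally have s: "(\<lambda>i. \<nu> (B \<inter> disjointed Q i)) sums \<nu> B" .
    have "0 \<le> \<nu> (B \<inter> disjointed Q i)" for i
      using Q[of i] B meas[of i] disjointed_subset[of Q i] unfolding pos_def by blast
    then show "0 \<le> \<nu> B" using sums_le[OF _ sums_zero s] by blast
  qed
  define H where "H = (\<Union>i. P i)"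
  have H: "pos H" unfolding H_def by (rule posU[OF P(1)])
  have Hmax: "\<nu> Q \<le> \<nu> H" if "pos Q" for Q
  proof -
    have "f i \<le> ereal (\<nu> H)" for i
    proof -
      have "0 \<le> \<nu> (H - P i)" using H P(1)[of i] unfolding pos_def by blast
      also have "\<dots> = \<nu> H - \<nu> (P i)"
        by (rule fsm_Diff[OF fsm]) (use H P(1)[of i] in \<open>auto simp: pos_def H_def\<close>)
      finally show ?thesis by (simp add: P(2))
    qed
    then have "Sup S \<le> ereal (\<nu> H)" unfolding f(2) by (rule SUP_least)
    moreover have "ereal (\<nu> Q) \<le> Sup S" by (rule Sup_upper) (use that in \<open>auto simp: S_def\<close>)
    ultimately show ?thesis using ereal_less_eq(3) order_trans by blast
  qed
  show ?thesis
  proof (rule that[of H])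
    show "H \<in> sets borel" "H \<subseteq> \<Omega>" "\<And>B. B \<in> sets borel \<Longrightarrow> B \<subseteq> H \<Longrightarrow> 0 \<le> \<nu> B"
      using H unfolding pos_def by auto
    fix B assume B: "B \<in> sets borel" "B \<subseteq> \<Omega> - H"
    obtain Q where Q: "Q \<in> sets borel" "Q \<subseteq> B" "\<nu> B \<le> \<nu> Q"
        "\<And>C. C \<in> sets borel \<Longrightarrow> C \<subseteq> Q \<Longrightarrow> 0 \<le> \<nu> C"
      using fsm_positive_subset[OF fsm B(1)] B by blast
    have "pos Q" using Q B unfolding pos_def by blast
    then have "pos (\<Union>i::nat. if i = 0 then H else Q)" by (intro posU) (use H in auto)
    moreover have "(\<Union>i::nat. if i = 0 then H else Q) = H \<union> Q"
      by (auto split: if_splits)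
    ultimately have "pos (H \<union> Q)" by simp
    then have "\<nu> (H \<union> Q) \<le> \<nu> H" by (rule Hmax)
    also have "\<nu> (H \<union> Q) = \<nu> H + \<nu> Q"
      by (rule fsm_Un[OF fsm]) (use H Q B in \<open>auto simp: pos_def\<close>)
    finally show "\<nu> B \<le> 0" using Q by simp
  qed
qed

text \<open>Jordan and polar decomposition in one statement: \<open>\<theta>\<close> is 1 on the
  Hahn set and -1 elsewhere. It replaces the suprema in \<open>tvar\<close>, \<open>tvm\<close>,
  \<open>posm\<close> and \<open>sint\<close> by integrals against one finite positive measure on
  the whole space that does not see the complement of \<open>\<Omega>\<close>.\<close>

lemma fsm_representation:
  fixes \<Omega> :: "(real^'n) set"
  assumes fsm: "fsm \<Omega> \<nu>" and Om: "\<Omega> \<in> sets borel"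
  obtains \<theta> where "finite_measure (tvm \<Omega> \<nu>)" "sets (tvm \<Omega> \<nu>) = sets borel"
    "emeasure (tvm \<Omega> \<nu>) (-\<Omega>) = 0"
    "\<And>A. A \<in> sets borel \<Longrightarrow> tvar \<Omega> \<nu> A = measure (tvm \<Omega> \<nu>) A"
    "\<theta> \<in> borel_measurable borel" "\<And>x. \<bar>\<theta> x\<bar> = 1"
    "\<And>f. f \<in> borel_measurable borel \<Longrightarrow> integrable (tvm \<Omega> \<nu>) f \<Longrightarrow>
        sint \<Omega> \<nu> f = (\<integral>x. \<theta> x * f x \<partial>tvm \<Omega> \<nu>)"
    "\<And>A. A \<in> sets borel \<Longrightarrow> A \<subseteq> \<Omega> \<Longrightarrow> \<nu> A = (\<integral>x. \<theta> x * indicator A x \<partial>tvm \<Omega> \<nu>)"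
proof -
  obtain H where H: "H \<in> sets borel" "H \<subseteq> \<Omega>"
    and Hp: "\<And>B. B \<in> sets borel \<Longrightarrow> B \<subseteq> H \<Longrightarrow> 0 \<le> \<nu> B"
    and Hn: "\<And>B. B \<in> sets borel \<Longrightarrow> B \<subseteq> \<Omega> - H \<Longrightarrow> \<nu> B \<le> 0"
    using fsm_Hahn[OF fsm] by metis
  \<comment> \<open>\<open>\<nu>\<close> on the Hahn set minus \<open>\<nu>\<close> on the rest is
    the candidate for the total variation; the supremum in \<open>tvar\<close> is attained by
    splitting \<open>A\<close> into these two pieces.\<close>
  define t where "t A = \<nu> (A \<inter> H) - \<nu> (A \<inter> (\<Omega> - H))" for A
  have tpos: "0 \<le> \<nu> (A \<inter> H)" "\<nu> (A \<inter> (\<Omega> - H)) \<le> 0" if "A \<in> sets borel" for A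
    using that H Om by (auto intro!: Hp Hn)
  define m where "m = measure_of UNIV (sets borel) (\<lambda>A. ennreal (t A))"
  have sets_m: "sets m = sets borel" unfolding m_def using sets.sigma_sets_eq[of borel] by simp
  have space_m: "space m = UNIV" unfolding m_def by simp
  have em: "emeasure m A = ennreal (t A)" if A: "A \<in> sets borel" for A
  proof (rule emeasure_measure_of[OF m_def])
    show "sets borel \<subseteq> Pow UNIV" by simp
    show "A \<in> sets m" using A sets_m by simp
    show "positive (sets m) (\<lambda>A. ennreal (t A))"
      unfolding positive_def t_def using fsm_empty[OF fsm] by simp
    show "countably_additive (sets m) (\<lambda>A. ennreal (t A))"
      unfolding countably_additive_def sets_m
    proof (intro allI impI)
      fix B :: "nat \<Rightarrow> (real^'n) set"
      assume B: "range B \<subseteq> sets borel" "disjoint_family B" "\<Union> (range B) \<in> sets borel"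
      have "(\<lambda>i. \<nu> (B i \<inter> H)) sums \<nu> (\<Union>i. B i \<inter> H)"
        by (rule fsm_sums[OF fsm]) (use B H in \<open>auto simp: disjoint_family_on_def\<close>)
      moreover have "(\<lambda>i. \<nu> (B i \<inter> (\<Omega> - H))) sums \<nu> (\<Union>i. B i \<inter> (\<Omega> - H))"
        by (rule fsm_sums[OF fsm]) (use B H Om in \<open>auto simp: disjoint_family_on_def\<close>)
      ultimately have "(\<lambda>i. t (B i)) sums t (\<Union>i. B i)"
        unfolding t_def by (simp add: sums_diff)
      moreover have "0 \<le> t (B i)" for i
      proof -
        have "B i \<in> sets borel" using B by blast
        from tpos[OF this] show ?thesis unfolding t_def by simp
      qed
      ultimately show "(\<Sum>i. ennreal (t (B i))) = ennreal (t (\<Union> (range B)))"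
        by (intro suminf_ennreal_eq) auto
    qed
  qed
  have fin: "finite_measure m" by (rule finite_measureI) (simp add: space_m em)
  interpret m: finite_measure m by (rule fin)
  have mm: "measure m A = t A" if "A \<in> sets borel" for A
    using em[OF that] tpos[OF that] unfolding t_def measure_def by simp
  have nu: "\<nu> A = measure m (A \<inter> H) - measure m (A - H)" if A: "A \<in> sets borel" "A \<subseteq> \<Omega>" for A
  proof -
    have "A \<inter> H \<inter> H = A \<inter> H" "A \<inter> H \<inter> (\<Omega> - H) = {}" "(A - H) \<inter> H = {}" "(A - H) \<inter> (\<Omega> - H) = A - H"
      using A by auto
    then have "t (A \<inter> H) = \<nu> (A \<inter> H)" "t (A - H) = - \<nu> (A - H)"
      using fsm_empty[OF fsm] unfolding t_def by simp_all
    moreover have "\<nu> A = \<nu> (A \<inter> H) + \<nu> (A - H)"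
      using fsm_Un[OF fsm, of "A \<inter> H" "A - H"] A H by (auto simp: Int_Diff_Un)
    ultimately show ?thesis using A H by (simp add: mm)
  qed
  have out: "emeasure m (- \<Omega>) = 0"
  proof -
    have "- \<Omega> \<inter> H = {}" "- \<Omega> \<inter> (\<Omega> - H) = {}" using H by auto
    then show ?thesis using Om fsm_empty[OF fsm] by (simp add: em t_def)
  qed
  have outm: "measure m A = measure m (A \<inter> \<Omega>)" if "A \<in> sets borel" for A
  proof -
    have "measure m A = measure m ((A \<inter> \<Omega>) \<union> (A - \<Omega>))" by (simp add: Int_Diff_Un)
    also have "\<dots> = measure m (A \<inter> \<Omega>)"
    proof (rule measure_Un_null_set)
      have "emeasure m (A - \<Omega>) \<le> emeasure m (- \<Omega>)" by (rule emeasure_mono) (use Om sets_m in auto)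
      then show "A - \<Omega> \<in> null_sets m" using out that Om sets_m by (auto simp: null_sets_def)
    qed (use that Om sets_m in auto)
    finally show ?thesis .
  qed
  have tvar_eq: "tvar \<Omega> \<nu> A = measure m A" if A: "A \<in> sets borel" for A
    unfolding tvar_def
  proof (rule cSup_eq_maximum)
    let ?P = "{A \<inter> H, A \<inter> (\<Omega> - H)}"
    \<comment> \<open>The two pieces can coincide only when both are empty, and then the sum over
      the partition has a single term.\<close>
    have "(\<Sum>B\<in>?P. \<bar>\<nu> B\<bar>) = measure m A"
    proof (cases "A \<inter> H = A \<inter> (\<Omega> - H)")
      case True
      then have e: "A \<inter> H = {}" "A \<inter> (\<Omega> - H) = {}" by blast+
      show ?thesis using e mm[OF A] fsm_empty[OF fsm] by (simp add: t_def)
    next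
      case False
      then show ?thesis using tpos[OF A] mm[OF A] by (simp add: t_def)
    qed
    then show "measure m A \<in> {(\<Sum>B\<in>P. \<bar>\<nu> B\<bar>) | P.
      finite P \<and> disjoint P \<and> (\<forall>B\<in>P. B \<in> sets borel \<and> B \<subseteq> A \<inter> \<Omega>)}"
      using A H Om by (intro CollectI exI[of _ ?P]) (auto simp: disjoint_def)
  next
    fix x assume "x \<in> {(\<Sum>B\<in>P. \<bar>\<nu> B\<bar>) | P.
      finite P \<and> disjoint P \<and> (\<forall>B\<in>P. B \<in> sets borel \<and> B \<subseteq> A \<inter> \<Omega>)}"
    then obtain P where P: "x = (\<Sum>B\<in>P. \<bar>\<nu> B\<bar>)" "finite P" "disjoint P"
      "\<And>B. B\<in>P \<Longrightarrow> B \<in> sets borel \<and> B \<subseteq> A \<inter> \<Omega>" by auto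
    have "x \<le> (\<Sum>B\<in>P. measure m B)" unfolding P(1)
    proof (rule sum_mono)
      fix B assume "B \<in> P"
      then have B: "B \<in> sets borel" "B \<subseteq> \<Omega>" using P(4) by auto
      have "measure m B = measure m (B \<inter> H) + measure m (B - H)"
        using m.finite_measure_Union[of "B \<inter> H" "B - H"] B H sets_m by (auto simp: Int_Diff_Un)
      then show "\<bar>\<nu> B\<bar> \<le> measure m B" unfolding nu[OF B] by (simp add: abs_le_iff)
    qed
    also have "\<dots> = measure m (\<Union>P)"
      using m.finite_measure_finite_Union[of P "\<lambda>x. x"] P(2,3) P(4) sets_m
      by (force simp: disjoint_def disjoint_family_on_def)
    also have "\<dots> \<le> measure m A" by (rule m.finite_measure_mono) (use P A sets_m in auto)
    finally show "x \<le> measure m A" .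
  qed
  have sig: "sigma_sets UNIV (sets borel) = sets (borel :: (real^'n) measure)"
    using sets.sigma_sets_eq[of borel] by simp
  have tvm_eq: "tvm \<Omega> \<nu> = m"
  proof -
    have "tvm \<Omega> \<nu> = measure_of UNIV (sets borel) (emeasure m)"
      unfolding tvm_def by (rule measure_of_eq) (auto simp: sig tvar_eq m.emeasure_eq_measure)
    then show ?thesis using measure_of_of_measure[of m] by (simp add: sets_m space_m)
  qed
  \<comment> \<open>The positive part of a set function is the restriction of \<open>m\<close> to
    \<open>G\<close> as soon as the supremum over subsets of \<open>A\<close> is the mass of
    \<open>A \<inter> G\<close>. This serves \<open>\<nu>\<close> with \<open>G = H\<close> and
    \<open>- \<nu>\<close> with \<open>G = - H\<close>; the latter includes the complement of
    \<open>\<Omega>\<close>, which is null.\<close>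
  have pos_eq: "posm \<Omega> \<mu> = density m (indicator G)"
    if G: "G \<in> sets borel" and max: "\<And>A. A \<in> sets borel \<Longrightarrow>
      Sup {\<mu> B | B. B \<in> sets borel \<and> B \<subseteq> A \<inter> \<Omega>} = measure m (A \<inter> G)" for G \<mu>
  proof -
    have "posm \<Omega> \<mu> = measure_of UNIV (sets borel) (emeasure (density m (indicator G)))"
      unfolding posm_def
    proof (rule measure_of_eq)
      fix A :: "(real^'n) set" assume "A \<in> sigma_sets UNIV (sets borel)"
      then have A: "A \<in> sets borel" by (simp add: sig)
      have "emeasure (density m (indicator G)) A = emeasure m (A \<inter> G)"
      proof -
        have "emeasure (density m (indicator G)) A = (\<integral>\<^sup>+x. indicator G x * indicator A x \<partial>m)"
          by (rule emeasure_density) (use A G sets_m in auto)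
        also have "\<dots> = (\<integral>\<^sup>+x. indicator (A \<inter> G) x \<partial>m)"
          by (intro nn_integral_cong) (auto simp: indicator_def)
        also have "\<dots> = emeasure m (A \<inter> G)"
          by (rule nn_integral_indicator) (use A G sets_m in auto)
        finally show ?thesis .
      qed
      then show "ennreal (Sup {\<mu> B |B. B \<in> sets borel \<and> B \<subseteq> A \<inter> \<Omega>}) = emeasure (density m (indicator G)) A"
        using max[OF A] by (simp add: m.emeasure_eq_measure)
    qed simp
    then show ?thesis using measure_of_of_measure[of "density m (indicator G)"]
      by (simp add: sets_m space_m)
  qed
  have p1: "posm \<Omega> \<nu> = density m (indicator H)"
  proof (rule pos_eq[OF H(1)], rule cSup_eq_maximum)
    fix A :: "(real^'n) set" assume A: "A \<in> sets borel"
    have "A \<inter> H \<subseteq> \<Omega>" "A \<inter> H \<inter> H = A \<inter> H" using H by auto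
    moreover have "measure m (A \<inter> H - H) = measure m {}" by (rule arg_cong[of _ _ "measure m"]) auto
    ultimately have "measure m (A \<inter> H) = \<nu> (A \<inter> H)" using nu[of "A \<inter> H"] A H by simp
    then show "measure m (A \<inter> H) \<in> {\<nu> B | B. B \<in> sets borel \<and> B \<subseteq> A \<inter> \<Omega>}" using A H by auto
    fix x assume "x \<in> {\<nu> B | B. B \<in> sets borel \<and> B \<subseteq> A \<inter> \<Omega>}"
    then obtain B where B: "x = \<nu> B" "B \<in> sets borel" "B \<subseteq> A" "B \<subseteq> \<Omega>" by auto
    have "x \<le> measure m (B \<inter> H)" using B nu[of B] by simp
    also have "\<dots> \<le> measure m (A \<inter> H)" by (rule m.finite_measure_mono) (use B A H sets_m in auto)
    finally show "x \<le> measure m (A \<inter> H)" .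
  qed
  have p2: "posm \<Omega> (\<lambda>A. - \<nu> A) = density m (indicator (-H))"
  proof (rule pos_eq, use H in simp, rule cSup_eq_maximum)
    fix A :: "(real^'n) set" assume A: "A \<in> sets borel"
    have "measure m (A \<inter> -H) = measure m (A \<inter> (\<Omega> - H))"
    proof -
      have "A \<inter> -H \<inter> \<Omega> = A \<inter> (\<Omega> - H)" by auto
      then show ?thesis using outm[of "A \<inter> -H"] A H by simp
    qed
    also have "\<dots> = - \<nu> (A \<inter> (\<Omega> - H))"
    proof -
      have "A \<inter> (\<Omega> - H) \<inter> H = {}" "A \<inter> (\<Omega> - H) - H = A \<inter> (\<Omega> - H)" "A \<inter> (\<Omega> - H) \<subseteq> \<Omega>" by auto
      then show ?thesis using nu[of "A \<inter> (\<Omega> - H)"] A H Om by simp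
    qed
    finally show "measure m (A \<inter> -H) \<in> {- \<nu> B | B. B \<in> sets borel \<and> B \<subseteq> A \<inter> \<Omega>}" 
      using A H Om by auto
    fix x assume "x \<in> {- \<nu> B | B. B \<in> sets borel \<and> B \<subseteq> A \<inter> \<Omega>}"
    then obtain B where B: "x = - \<nu> B" "B \<in> sets borel" "B \<subseteq> A" "B \<subseteq> \<Omega>" by auto
    have "x \<le> measure m (B - H)" using B nu[of B] by simp
    also have "\<dots> \<le> measure m (A \<inter> -H)" by (rule m.finite_measure_mono) (use B A H sets_m in auto)
    finally show "x \<le> measure m (A \<inter> -H)" .
  qed
  define \<theta> where "\<theta> x = indicator H x - (indicator (-H) x :: real)" for x
  have \<theta>m: "\<theta> \<in> borel_measurable borel" unfolding \<theta>_def using H by measurable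
  have sint: "sint \<Omega> \<nu> f = (\<integral>x. \<theta> x * f x \<partial>m)"
    if f: "f \<in> borel_measurable borel" "integrable m f" for f
  proof -
    have d: "(\<integral>x. f x \<partial>density m (indicator G)) = (\<integral>x. indicator G x * f x \<partial>m)"
      if "G \<in> sets borel" for G
    proof -
      have "density m (indicator G) = density m (\<lambda>x. ennreal (indicator G x))"
        by (rule density_cong) (use sets_m that in \<open>auto simp: indicator_def\<close>)
      then show ?thesis using integral_density[of f m "indicator G"] that f sets_m
        by (simp add: measurable_cong_sets[OF sets_m refl])
    qed
    have i: "integrable m (\<lambda>x. indicator G x * f x)" if "G \<in> sets borel" for G
      using integrable_mult_indicator[of G m f] that f sets_m by simp
    show ?thesis unfolding sint_def p1 p2 \<theta>_def using H i[of H] i[of "-H"]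
      by (simp add: d left_diff_distrib)
  qed
  show ?thesis
  proof (rule that[of \<theta>], unfold tvm_eq)
    show "\<bar>\<theta> x\<bar> = 1" for x unfolding \<theta>_def by (auto simp: indicator_def)
    fix A :: "(real^'n) set" assume A: "A \<in> sets borel" "A \<subseteq> \<Omega>"
    have "(\<lambda>x. \<theta> x * indicator A x) = (\<lambda>x. indicator (A \<inter> H) x - indicator (A - H) x)"
      unfolding \<theta>_def by (auto simp: indicator_def)
    then show "\<nu> A = (\<integral>x. \<theta> x * indicator A x \<partial>m)" using nu[OF A] A H sets_m space_m 
      by (simp add: Bochner_Integration.integral_diff m.emeasure_eq_measure)
  qed (use fin sets_m out tvar_eq \<theta>m sint in auto)
qed

section \<open>Weak* compactness\<close>

text \<open>The integrals over the sets of a countable generating \<open>\<inter>\<close>-stable family converge along a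
  diagonal subsequence, hence over all Borel sets. The limit set function plus \<open>C * M\<close> is a positive
  measure, and \<open>g + C\<close> is its Radon-Nikodym density.\<close>
lemma weak_star_compact:
  fixes M :: "'a::second_countable_topology measure" and f :: "nat \<Rightarrow> 'a \<Rightarrow> real"
  assumes fin: "finite_measure M" and sets_M: "sets M = sets borel"
    and f: "\<And>k. f k \<in> borel_measurable borel" and bd: "\<And>k x. \<bar>f k x\<bar> \<le> C"
  obtains r g where "strict_mono (r :: nat \<Rightarrow> nat)" "g \<in> borel_measurable borel" "\<And>x. \<bar>g x\<bar> \<le> C"
    "\<And>h. integrable M h \<Longrightarrow> (\<lambda>k. \<integral>x. f (r k) x * h x \<partial>M) \<longlonglongrightarrow> (\<integral>x. g x * h x \<partial>M)"
proof -
  interpret M: finite_measure M by (rule fin)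
  have space_M: "space M = UNIV" using sets_eq_imp_space_eq[OF sets_M] by simp
  have fM [measurable]: "f k \<in> borel_measurable M" for k
    using f[of k] by (simp add: measurable_cong_sets[OF sets_M refl])
  have C0: "0 \<le> C" using bd[of 0 undefined] by linarith
  have fint: "integrable M (f k)" for k
    by (rule M.integrable_const_bound[of _ C]) (auto simp: bd)
  define L where "L k A = (LINT x:A|M. f k x)" for k A
  have si: "set_integrable M A (f k)" if "A \<in> sets M" for A k
    unfolding set_integrable_def using integrable_mult_indicator[OF that fint] by simp
  have Lb: "\<bar>L k A\<bar> \<le> C * measure M A" if A: "A \<in> sets M" for k A
  proof -
    have "\<bar>L k A\<bar> \<le> (\<integral>x. C * indicator A x \<partial>M)" unfolding L_def set_lebesgue_integral_def
    proof (rule order_trans[OF integral_abs_bound integral_mono])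
      show "integrable M (\<lambda>x. \<bar>indicator A x *\<^sub>R f k x\<bar>)"
        using si[OF A] unfolding set_integrable_def by (rule integrable_abs)
      show "integrable M (\<lambda>x. C * indicator A x)"
        by (intro integrable_mult_right integrable_real_indicator A) (simp add: M.emeasure_eq_measure)
      show "\<bar>indicator A x *\<^sub>R f k x\<bar> \<le> C * indicator A x" for x
        using bd[of k x] by (simp add: indicator_def)
    qed
    then show ?thesis using A by (simp add: space_M)
  qed
  obtain B :: "'a set set" where B: "countable B" "topological_basis B" using ex_countable_basis by blast
  \<comment> \<open>Finite intersections of a countable basis are still countable and generating,
    and now closed under intersection, so the induction over disjoint unions can start from
    convergence on \<open>D\<close>. The empty intersection contributes \<open>UNIV\<close>, which
    the complement step uses.\<close>
  define D where "D = Inter ` {F. finite F \<and> F \<subseteq> B}"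
  have D: "countable D" unfolding D_def by (intro countable_image countable_Collect_finite_subset B)
  have DU: "UNIV \<in> D" unfolding D_def by (auto intro!: image_eqI[of _ _ "{}"])
  have DI: "Int_stable D" unfolding Int_stable_def D_def
  proof (clarsimp)
    fix F G assume "finite F" "F \<subseteq> B" "finite G" "G \<subseteq> B"
    then show "\<Inter>F \<inter> \<Inter>G \<in> Inter ` {F. finite F \<and> F \<subseteq> B}"
      by (intro image_eqI[of _ _ "F \<union> G"]) auto
  qed
  have DB: "D \<subseteq> sets borel"
  proof
    fix A assume "A \<in> D"
    then obtain F where F: "finite F" "F \<subseteq> B" "A = \<Inter>F" unfolding D_def by auto
    then have "open A" using topological_basis_open[OF B(2)] by (auto intro!: open_Inter)
    then show "A \<in> sets borel" by simp
  qed
  have sig: "sets borel = sigma_sets UNIV D"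
  proof
    have "B \<subseteq> D" unfolding D_def by (auto intro!: image_eqI[of _ _ "{_}"])
    moreover have "sets borel = sigma_sets UNIV B"
      using borel_eq_countable_basis[OF B] by (metis sets_measure_of Pow_UNIV top_greatest)
    ultimately show "sets borel \<subseteq> sigma_sets UNIV D" by (simp add: sigma_sets_mono')
    show "sigma_sets UNIV D \<subseteq> sets borel" using DB sets.sigma_sets_subset[of D borel] by simp
  qed
  have "norm (L k A) \<le> C * measure M UNIV" if "A \<in> D" for k A
  proof -
    have "A \<in> sets M" using that DB sets_M by auto
    from Lb[OF this, of k] M.bounded_measure[of A] C0 show ?thesis
      by (simp add: space_M) (meson mult_left_mono order_trans)
  qed
  then obtain r where r: "strict_mono (r :: nat \<Rightarrow> nat)" "\<And>A. A \<in> D \<Longrightarrow> \<exists>l. (\<lambda>k. L (r k) A) \<longlonglongrightarrow> l"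
    using function_convergent_subsequence[OF D, of L] by metis
  define l where "l A = lim (\<lambda>k. L (r k) A)" for A
  have Lsums: "(\<lambda>i. L k (A i)) sums L k (\<Union>i. A i)"
    if A: "range A \<subseteq> sets borel" "disjoint_family A" for k and A :: "nat \<Rightarrow> 'a set"
  proof -
    have AM: "A i \<in> sets M" for i using A sets_M by auto
    have "L k (\<Union>i. A i) = (\<Sum>i. L k (A i))" unfolding L_def
      by (rule lebesgue_integral_countable_add[OF AM]) (use A si AM in \<open>auto simp: disjoint_family_on_def\<close>)
    moreover have "summable (\<lambda>i. L k (A i))"
    proof (rule summable_comparison_test'[of "\<lambda>i. C * measure M (A i)" 0])
      show "summable (\<lambda>i. C * measure M (A i))"
        using M.finite_measure_UNION[of A] A AM by (intro summable_mult) (auto simp: sums_iff)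
    qed (use Lb AM in auto)
    ultimately show ?thesis by (simp add: sums_iff)
  qed
  \<comment> \<open>The domination by \<open>C * measure M (A i)\<close> does not depend on
    \<open>k\<close>, so Tannery's theorem exchanges the limit in \<open>k\<close> with the
    countable sum. This serves twice: for convergence on disjoint unions in the induction and for
    countable additivity of the limit.\<close>
  have Tann: "(\<lambda>k. L (r k) (\<Union>i. A i)) \<longlonglongrightarrow> (\<Sum>i. l (A i)) \<and> summable (\<lambda>i. l (A i))"
    if A: "range A \<subseteq> sets borel" "disjoint_family A" and c: "\<And>i. (\<lambda>k. L (r k) (A i)) \<longlonglongrightarrow> l (A i)"
    for A :: "nat \<Rightarrow> 'a set"
  proof -
    have AM: "A i \<in> sets M" for i using A sets_M by auto
    have "eventually (\<lambda>n. summable (\<lambda>k. norm (L (r n) (A k)))) sequentially \<and>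
           summable (\<lambda>n. norm (l (A n))) \<and>
           ((\<lambda>n. suminf (\<lambda>k. L (r n) (A k))) \<longlonglongrightarrow> suminf (\<lambda>i. l (A i)))"
    proof (rule tannerys_theorem[OF c, where M = "\<lambda>i. C * measure M (A i)"])
      show "summable (\<lambda>i. C * measure M (A i))"
        using M.finite_measure_UNION[of A] A AM by (intro summable_mult) (auto simp: sums_iff)
    qed (use Lb AM in \<open>auto intro!: always_eventually\<close>)
    then show ?thesis using sums_unique[OF Lsums[OF A]] summable_norm_cancel[of "\<lambda>i. l (A i)"] by auto
  qed
  have DP: "D \<subseteq> Pow UNIV" by simp
  have conv: "convergent (\<lambda>k. L (r k) A)" if "A \<in> sets borel" for A
    using DI DP that[unfolded sig]
  proof (induct rule: sigma_sets_induct_disjoint)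
    case (basic A) then show ?case using r(2) convergent_def by blast
  next
    case empty show ?case by (simp add: L_def set_lebesgue_integral_def convergent_const)
  next
    case (compl A)
    have A: "A \<in> sets M" using compl sig sets_M by simp
    have "L (r k) (UNIV - A) = L (r k) UNIV - L (r k) A" for k
      unfolding L_def using set_integral_Un[of A "UNIV - A" M "f (r k)"] si[OF A] si[of "UNIV - A"] A
      by (simp add: sets.compl_sets[of A M, unfolded space_M])
    moreover have "convergent (\<lambda>k. L (r k) UNIV)" using r(2)[OF DU] convergent_def by blast
    ultimately show ?case using compl by (simp add: convergent_diff)
  next
    case (union A)
    then have "\<And>i. (\<lambda>k. L (r k) (A i)) \<longlonglongrightarrow> l (A i)" unfolding l_def by (simp add: convergent_LIMSEQ_iff)
    with union Tann[of A] show ?case using sig convergent_def by blast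
  qed
  have lim: "(\<lambda>k. L (r k) A) \<longlonglongrightarrow> l A" if "A \<in> sets borel" for A
    using conv[OF that] unfolding l_def by (simp add: convergent_LIMSEQ_iff)
  have lb: "\<bar>l A\<bar> \<le> C * measure M A" if A: "A \<in> sets borel" for A
    by (rule tendsto_upperbound[OF tendsto_rabs[OF lim[OF A]]]) (use A Lb sets_M in \<open>auto intro!: always_eventually\<close>)
  define N0 where "N0 A = l A + C * measure M A" for A
  \<comment> \<open>The upper bound yields absolute continuity with respect to \<open>M\<close> and
    later the bound \<open>2 * C\<close> on the density.\<close>
  have N0: "0 \<le> N0 A" "N0 A \<le> 2 * C * measure M A" if "A \<in> sets borel" for A
    using lb[OF that] unfolding N0_def by linarith+
  define N where "N = measure_of UNIV (sets borel) (\<lambda>A. ennreal (N0 A))"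
  have sets_N: "sets N = sets borel" unfolding N_def using sets.sigma_sets_eq[of borel] by simp
  have emN: "emeasure N A = ennreal (N0 A)" if A: "A \<in> sets borel" for A
  proof (rule emeasure_measure_of[OF N_def])
    show "A \<in> sets N" using A sets_N by simp
    have "l {} = 0" using lb[of "{}"] by simp
    then show "positive (sets N) (\<lambda>A. ennreal (N0 A))" unfolding positive_def N0_def by simp
    show "countably_additive (sets N) (\<lambda>A. ennreal (N0 A))"
      unfolding countably_additive_def sets_N
    proof (intro allI impI)
      fix A :: "nat \<Rightarrow> 'a set"
      assume A: "range A \<subseteq> sets borel" "disjoint_family A" "\<Union> (range A) \<in> sets borel"
      have "l (\<Union>i. A i) = (\<Sum>i. l (A i))" "summable (\<lambda>i. l (A i))"
        using Tann[OF A(1,2)] lim A LIMSEQ_unique[OF lim[OF A(3)]] by auto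
      then have "(\<lambda>i. l (A i)) sums l (\<Union>i. A i)" by (simp add: sums_iff)
      moreover have "(\<lambda>i. C * measure M (A i)) sums (C * measure M (\<Union>i. A i))"
        by (intro sums_mult M.finite_measure_UNION) (use A sets_M in auto)
      ultimately have "(\<lambda>i. N0 (A i)) sums N0 (\<Union>i. A i)" unfolding N0_def by (rule sums_add)
      then show "(\<Sum>i. ennreal (N0 (A i))) = ennreal (N0 (\<Union> (range A)))"
        by (intro suminf_ennreal_eq) (use A N0 in auto)
    qed
  qed auto
  have "absolutely_continuous M N" unfolding absolutely_continuous_def
  proof
    fix A assume "A \<in> null_sets M"
    then have A: "A \<in> sets borel" "measure M A = 0" using sets_M by (auto simp: null_sets_def measure_def)
    then have "N0 A = 0" using N0[OF A(1)] by simp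
    then show "A \<in> null_sets N" using A sets_N emN by (auto simp: null_sets_def)
  qed
  then obtain \<phi> where \<phi> [measurable]: "\<phi> \<in> borel_measurable M" and dens: "density M \<phi> = N"
    using M.Radon_Nikodym[of N] sets_N sets_M by auto
  have nnN: "(\<integral>\<^sup>+x. \<phi> x * indicator A x \<partial>M) = ennreal (N0 A)" if "A \<in> sets borel" for A
    using emeasure_density[of \<phi> M A] that emN[OF that] sets_M dens by simp
  have "(\<integral>\<^sup>+x. \<phi> x \<partial>M) < \<infinity>" using nnN[of UNIV] by simp
  then have fin\<phi>: "AE x in M. \<phi> x \<noteq> \<infinity>" by (intro nn_integral_noteq_infinite) auto
  define u where "u x = enn2real (\<phi> x)" for x
  have um [measurable]: "u \<in> borel_measurable M" unfolding u_def by measurable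
  have u\<phi>: "AE x in M. ennreal (u x) = \<phi> x" using fin\<phi> by eventually_elim (simp add: u_def less_top)
  have uI: "has_bochner_integral M (\<lambda>x. indicator A x * u x) (N0 A)" if A: "A \<in> sets borel" for A
  proof (rule has_bochner_integral_nn_integral)
    have "(\<integral>\<^sup>+x. ennreal (indicator A x * u x) \<partial>M) = (\<integral>\<^sup>+x. \<phi> x * indicator A x \<partial>M)"
      using u\<phi> by (intro nn_integral_cong_AE) (auto simp: indicator_def)
    then show "(\<integral>\<^sup>+x. ennreal (indicator A x * u x) \<partial>M) = ennreal (N0 A)" using nnN[OF A] by simp
  qed (use A N0 sets_M in \<open>auto simp: u_def\<close>)
  have ub: "AE x in M. u x \<le> 2 * C"
  proof -
    define S where "S = {x. 2 * C < u x}"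
    have S: "S \<in> sets borel" using measurable_sets[OF um, of "{2*C<..}"] unfolding S_def
      by (simp add: space_M sets_M vimage_def)
    have hb: "has_bochner_integral M (\<lambda>x. indicator S x * u x - (2 * C) * indicator S x) (N0 S - 2 * C * measure M S)"
      by (intro has_bochner_integral_diff uI[OF S] has_bochner_integral_mult_right has_bochner_integral_real_indicator)
        (use S sets_M M.emeasure_eq_measure in auto)
    have "(\<integral>x. indicator S x * u x - (2 * C) * indicator S x \<partial>M) \<le> 0"
      using has_bochner_integral_integral_eq[OF hb] N0(2)[OF S] by simp
    moreover have nn: "0 \<le> indicator S x * u x - (2 * C) * indicator S x" for x
      by (auto simp: S_def indicator_def)
    moreover have "0 \<le> (\<integral>x. indicator S x * u x - (2 * C) * indicator S x \<partial>M)"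
      by (rule Bochner_Integration.integral_nonneg) (rule nn)
    ultimately have "(\<integral>x. indicator S x * u x - (2 * C) * indicator S x \<partial>M) = 0" by linarith
    then have "AE x in M. indicator S x * u x - (2 * C) * indicator S x = 0"
      using integral_nonneg_eq_0_iff_AE[of M "\<lambda>x. indicator S x * u x - (2 * C) * indicator S x"]
        nn hb has_bochner_integral_iff by blast
    then show ?thesis by eventually_elim (auto simp: S_def indicator_def split: if_splits)
  qed
  \<comment> \<open>Since \<open>0 \<le> u\<close> everywhere and \<open>u \<le> 2 * C\<close>
    almost everywhere, clamping changes \<open>u - C\<close> only on a null set and makes the bound
    hold at every point.\<close>
  define g where "g x = max (- C) (min C (u x - C))" for x
  have gm [measurable]: "g \<in> borel_measurable M" unfolding g_def by measurable
  have gb: "\<bar>g x\<bar> \<le> C" for x unfolding g_def using C0 by auto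
  have gA: "(\<integral>x. g x * indicator A x \<partial>M) = l A" if A: "A \<in> sets borel" for A
  proof -
    have "(\<integral>x. g x * indicator A x \<partial>M) = (\<integral>x. indicator A x * u x - C * indicator A x \<partial>M)"
    proof (rule integral_cong_AE)
      show "AE x in M. g x * indicator A x = indicator A x * u x - C * indicator A x"
        using ub by eventually_elim (auto simp: g_def indicator_def u_def)
    qed (use A sets_M in auto)
    also have "\<dots> = N0 A - C * measure M A"
      by (intro has_bochner_integral_integral_eq has_bochner_integral_diff uI[OF A] 
        has_bochner_integral_mult_right has_bochner_integral_real_indicator)
        (use A sets_M M.emeasure_eq_measure in auto)
    finally show ?thesis unfolding N0_def by simp
  qed
  have main: "(\<lambda>k. \<integral>x. f (r k) x * h x \<partial>M) \<longlonglongrightarrow> (\<integral>x. g x * h x \<partial>M)" if "integrable M h" for h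
    using that
  proof (induction rule: integrable_induct)
    case (base A c)
    then have A: "A \<in> sets borel" using sets_M by simp
    have "(\<lambda>k. c * L (r k) A) \<longlonglongrightarrow> c * l A" by (intro tendsto_intros lim A)
    then show ?case using gA[OF A]
      by (simp add: L_def set_lebesgue_integral_def mult.commute mult.left_commute)
  next
    case (add h1 h2)
    have i: "integrable M (\<lambda>x. f k x * h x)" "integrable M (\<lambda>x. g x * h x)" if "integrable M h" for k h
      by (rule Bochner_Integration.integrable_bound[of _ "\<lambda>x. C * h x"],
          use that bd gb C0 in \<open>auto simp: abs_mult intro!: mult_right_mono\<close>)+
    show ?case using tendsto_add[OF add(3,4)] add(1,2) by (simp add: i distrib_left)
  next
    case (lim h s)
    have i: "integrable M (\<lambda>x. f k x * h x)" "integrable M (\<lambda>x. g x * h x)" if "integrable M h" for k h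
      by (rule Bochner_Integration.integrable_bound[of _ "\<lambda>x. C * h x"],
          use that bd gb C0 in \<open>auto simp: abs_mult intro!: mult_right_mono\<close>)+
    have sh: "integrable M (\<lambda>x. \<bar>h x - s j x\<bar>)" for j using lim by auto
    have to0: "(\<lambda>j. \<integral>x. \<bar>h x - s j x\<bar> \<partial>M) \<longlonglongrightarrow> (\<integral>x. 0 \<partial>M)"
    proof (rule integral_dominated_convergence[of _ _ _ "\<lambda>x. 3 * \<bar>h x\<bar>"])
      show "AE x in M. (\<lambda>j. \<bar>h x - s j x\<bar>) \<longlonglongrightarrow> 0"
      proof (rule AE_I2)
        fix x assume "x \<in> space M"
        then have "(\<lambda>j. \<bar>h x - s j x\<bar>) \<longlonglongrightarrow> \<bar>h x - h x\<bar>" by (intro tendsto_intros lim)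
        then show "(\<lambda>j. \<bar>h x - s j x\<bar>) \<longlonglongrightarrow> 0" by simp
      qed
      show "AE x in M. norm \<bar>h x - s j x\<bar> \<le> 3 * \<bar>h x\<bar>" for j
      proof (rule AE_I2)
        fix x assume "x \<in> space M"
        then have "\<bar>s j x\<bar> \<le> 2 * \<bar>h x\<bar>" using lim(3)[of x j] by simp
        then show "norm \<bar>h x - s j x\<bar> \<le> 3 * \<bar>h x\<bar>" by simp
      qed
    qed (use lim sh in auto)
    \<comment> \<open>The bound \<open>C\<close> is common to all \<open>f (r k)\<close> and to the
      limit \<open>g\<close>, so one approximant \<open>s j\<close> close to \<open>h\<close> in
      \<open>L^1\<close> serves for all \<open>k\<close> at once.\<close>
    have diff: "\<bar>(\<integral>x. v x * h x \<partial>M) - (\<integral>x. v x * s j x \<partial>M)\<bar> \<le> C * (\<integral>x. \<bar>h x - s j x\<bar> \<partial>M)"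
      if v: "\<And>x. \<bar>v x\<bar> \<le> C" and vi: "integrable M (\<lambda>x. v x * h x)" "integrable M (\<lambda>x. v x * s j x)" for v j
    proof -
      have "\<bar>(\<integral>x. v x * h x \<partial>M) - (\<integral>x. v x * s j x \<partial>M)\<bar> = \<bar>\<integral>x. v x * h x - v x * s j x \<partial>M\<bar>"
        using vi by simp
      also have "\<dots> \<le> (\<integral>x. C * \<bar>h x - s j x\<bar> \<partial>M)"
      proof (rule order_trans[OF integral_abs_bound integral_mono])
        show "\<bar>v x * h x - v x * s j x\<bar> \<le> C * \<bar>h x - s j x\<bar>" for x
          using mult_right_mono[OF v[of x], of "\<bar>h x - s j x\<bar>"] by (simp add: abs_mult[symmetric] right_diff_distrib)
      qed (use vi sh in auto)
      finally show ?thesis by simp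
    qed
    show ?case
    proof (rule LIMSEQ_I)
      fix e :: real assume e: "0 < e"
      have "(\<lambda>j. C * (\<integral>x. \<bar>h x - s j x\<bar> \<partial>M)) \<longlonglongrightarrow> C * 0" using tendsto_mult_left[OF to0, of C] by simp
      from order_tendstoD(2)[OF this, of "e/3"] e
      have "\<forall>\<^sub>F j in sequentially. C * (\<integral>x. \<bar>h x - s j x\<bar> \<partial>M) < e / 3" by simp
      then obtain j where j: "C * (\<integral>x. \<bar>h x - s j x\<bar> \<partial>M) < e / 3"
        using eventually_happens'[OF sequentially_bot] by blast
      obtain k0 where k0: "\<And>k. k \<ge> k0 \<Longrightarrow> norm ((\<integral>x. f (r k) x * s j x \<partial>M) - (\<integral>x. g x * s j x \<partial>M)) < e / 3"
        using LIMSEQ_D[OF lim(5)[of j], of "e/3"] e by auto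
      show "\<exists>no. \<forall>k\<ge>no. norm ((\<integral>x. f (r k) x * h x \<partial>M) - (\<integral>x. g x * h x \<partial>M)) < e"
      proof (intro exI[of _ k0] allI impI)
        fix k assume "k \<ge> k0"
        from k0[OF this] j diff[of "f (r k)" j, OF bd i(1)[OF lim(4)] i(1)[OF lim(1)]]
          diff[of g j, OF gb i(2)[OF lim(4)] i(2)[OF lim(1)]]
        show "norm ((\<integral>x. f (r k) x * h x \<partial>M) - (\<integral>x. g x * h x \<partial>M)) < e"
          unfolding real_norm_def by linarith
      qed
    qed
  qed
  show ?thesis
    by (rule that[OF r(1) _ gb main])
      (use gm in \<open>simp_all add: measurable_cong_sets[OF sets_M refl]\<close>)
qed

text \<open>The measures may be unrelated to one another, so compactness is applied to them one by
  one, each time along a subsequence of the previous one; limits already obtained survive.\<close>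

lemma weak_star_compact_family:
  fixes M :: "'i \<Rightarrow> 'a::second_countable_topology measure" and f :: "'i \<Rightarrow> nat \<Rightarrow> 'a \<Rightarrow> real"
  assumes "finite I"
    and "\<And>i. i \<in> I \<Longrightarrow> finite_measure (M i)" "\<And>i. i \<in> I \<Longrightarrow> sets (M i) = sets borel"
    and "\<And>i k. i \<in> I \<Longrightarrow> f i k \<in> borel_measurable borel" "\<And>i k x. i \<in> I \<Longrightarrow> \<bar>f i k x\<bar> \<le> C i"
  shows "\<exists>r g. strict_mono (r :: nat \<Rightarrow> nat) \<and> (\<forall>i\<in>I. g i \<in> borel_measurable borel \<and> (\<forall>x. \<bar>g i x\<bar> \<le> C i) \<and>
    (\<forall>h. integrable (M i) h \<longrightarrow>
      (\<lambda>k. \<integral>x. f i (r k) x * h x \<partial>M i) \<longlonglongrightarrow> (\<integral>x. g i x * h x \<partial>M i)))"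
  using assms
proof (induction I rule: finite_induct)
  case empty
  then show ?case using strict_mono_id by fastforce
next
  case (insert i I)
  have "\<exists>r g. strict_mono (r :: nat \<Rightarrow> nat) \<and> (\<forall>i\<in>I. g i \<in> borel_measurable borel \<and> (\<forall>x. \<bar>g i x\<bar> \<le> C i) \<and>
    (\<forall>h. integrable (M i) h \<longrightarrow>
      (\<lambda>k. \<integral>x. f i (r k) x * h x \<partial>M i) \<longlonglongrightarrow> (\<integral>x. g i x * h x \<partial>M i)))"
    by (rule insert.IH) (use insert.prems in auto)
  then obtain r g where r: "strict_mono (r :: nat \<Rightarrow> nat)" and
    G: "\<forall>i\<in>I. g i \<in> borel_measurable borel \<and> (\<forall>x. \<bar>g i x\<bar> \<le> C i) \<and>
    (\<forall>h. integrable (M i) h \<longrightarrow>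
      (\<lambda>k. \<integral>x. f i (r k) x * h x \<partial>M i) \<longlonglongrightarrow> (\<integral>x. g i x * h x \<partial>M i))" by blast
  have g: "\<And>i. i \<in> I \<Longrightarrow> g i \<in> borel_measurable borel" "\<And>i x. i \<in> I \<Longrightarrow> \<bar>g i x\<bar> \<le> C i"
    "\<And>i h. i \<in> I \<Longrightarrow> integrable (M i) h \<Longrightarrow>
      (\<lambda>k. \<integral>x. f i (r k) x * h x \<partial>M i) \<longlonglongrightarrow> (\<integral>x. g i x * h x \<partial>M i)"
    using G by blast+
  obtain r' g' where r': "strict_mono (r' :: nat \<Rightarrow> nat)" and
    g': "g' \<in> borel_measurable borel" "\<And>x. \<bar>g' x\<bar> \<le> C i"
    "\<And>h. integrable (M i) h \<Longrightarrow>
      (\<lambda>k. \<integral>x. f i (r (r' k)) x * h x \<partial>M i) \<longlonglongrightarrow> (\<integral>x. g' x * h x \<partial>M i)"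
    using weak_star_compact[of "M i" "\<lambda>k. f i (r k)" "C i"] insert.prems by auto
  show ?case
  proof (intro exI[of _ "r \<circ> r'"] exI[of _ "g(i := g')"] conjI ballI)
    show "strict_mono (r \<circ> r')" using r r' by (rule strict_mono_o)
    fix j assume j: "j \<in> insert i I"
    show "(g(i := g')) j \<in> borel_measurable borel" "\<forall>x. \<bar>(g(i := g')) j x\<bar> \<le> C j" using j g g' by auto
    show "\<forall>h. integrable (M j) h \<longrightarrow> (\<lambda>k. \<integral>x. f j ((r \<circ> r') k) x * h x \<partial>M j)
         \<longlonglongrightarrow> (\<integral>x. (g(i := g')) j x * h x \<partial>M j)"
    proof (cases "j = i")
      case True then show ?thesis using g'(3) by simp
    next
      case False
      then have "j \<in> I" using j by simp
      then show ?thesis using False LIMSEQ_subseq_LIMSEQ[OF g(3) r'] by (simp add: o_def)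
    qed
  qed
qed

section \<open>Total variation of vector measures\<close>

text \<open>The cells are the level sets of the vector of integers
  \<open>\<lfloor>u j x / \<delta>\<rfloor>\<close>; boundedness leaves finitely many of them. On
  such a partition bounded densities are constant up to \<open>\<delta>\<close>, which connects
  integrals with variations defined through finite families of sets.\<close>

lemma finite_oscillation_partition:
  fixes u :: "'j \<Rightarrow> 'a::topological_space \<Rightarrow> real"
  assumes J: "finite J" and u: "\<And>j. j \<in> J \<Longrightarrow> u j \<in> borel_measurable borel"
    and bd: "\<And>j x. j \<in> J \<Longrightarrow> \<bar>u j x\<bar> \<le> C" and \<delta>: "0 < \<delta>"
  obtains P where "finite P" "disjoint P" "\<Union>P = UNIV" "\<And>B. B \<in> P \<Longrightarrow> B \<in> sets borel \<and> B \<noteq> {}"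
    "\<And>B x y j. B \<in> P \<Longrightarrow> x \<in> B \<Longrightarrow> y \<in> B \<Longrightarrow> j \<in> J \<Longrightarrow> \<bar>u j x - u j y\<bar> \<le> \<delta>"
proof -
  define q where "q x = (\<lambda>j\<in>J. \<lfloor>u j x / \<delta>\<rfloor>)" for x
  define N where "N = \<lceil>C / \<delta>\<rceil> + 1"
  have "q x \<in> J \<rightarrow>\<^sub>E {-N..N}" for x
  proof (rule PiE_I)
    fix j assume j: "j \<in> J"
    have "\<bar>u j x / \<delta>\<bar> \<le> C / \<delta>" using bd[OF j, of x] \<delta> by (simp add: divide_right_mono)
    then have "u j x / \<delta> \<le> C / \<delta>" "- (C / \<delta>) \<le> u j x / \<delta>" unfolding abs_le_iff by linarith+
    then have "- \<lceil>C / \<delta>\<rceil> - 1 \<le> \<lfloor>u j x / \<delta>\<rfloor>" "\<lfloor>u j x / \<delta>\<rfloor> \<le> \<lceil>C / \<delta>\<rceil> + 1" by linarith+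
    then show "q x j \<in> {-N..N}" unfolding q_def N_def using j by simp
  qed (simp add: q_def)
  then have "range q \<subseteq> J \<rightarrow>\<^sub>E {-N..N}" by blast
  then have fin: "finite (range q)" using finite_PiE[OF J, of "\<lambda>_. {-N..N}"] finite_subset by blast
  define P where "P = (\<lambda>v. q -` {v}) ` range q"
  show ?thesis
  proof (rule that[of P])
    show "finite P" unfolding P_def using fin by simp
    show "disjoint P" unfolding P_def disjoint_def by auto
    show "\<Union>P = UNIV" unfolding P_def by auto
    show "B \<in> sets borel \<and> B \<noteq> {}" if "B \<in> P" for B
    proof -
      have "\<exists>x. B = q -` {q x}" using that unfolding P_def by (auto simp del: vimage_singleton_eq)
      then obtain x where B: "B = q -` {q x}" by blast
      have "B = (\<Inter>j\<in>J. {y. of_int \<lfloor>u j x / \<delta>\<rfloor> \<le> u j y / \<delta> \<and> u j y / \<delta> < of_int \<lfloor>u j x / \<delta>\<rfloor> + 1}) \<inter> UNIV"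
        unfolding B by (auto simp: q_def fun_eq_iff floor_eq_iff restrict_def split: if_splits)
      moreover have "{y. of_int \<lfloor>u j x / \<delta>\<rfloor> \<le> u j y / \<delta> \<and> u j y / \<delta> < of_int \<lfloor>u j x / \<delta>\<rfloor> + 1} \<in> sets borel"
        if "j \<in> J" for j
      proof -
        have [measurable]: "u j \<in> borel_measurable borel" by (rule u[OF that])
        have "{y \<in> space borel. of_int \<lfloor>u j x / \<delta>\<rfloor> \<le> u j y / \<delta> \<and> u j y / \<delta> < of_int \<lfloor>u j x / \<delta>\<rfloor> + 1} \<in> sets borel"
          by measurable
        then show ?thesis by simp
      qed
      ultimately have "B \<in> sets borel" using J by (cases "J = {}") (auto intro!: sets.finite_INT)
      then show ?thesis using B by auto
    qed
    fix B x y j assume B: "B \<in> P" "x \<in> B" "y \<in> B" "j \<in> J"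
    then have "q x = q y" unfolding P_def by auto
    then have "\<lfloor>u j x / \<delta>\<rfloor> = \<lfloor>u j y / \<delta>\<rfloor>" using B(4) unfolding q_def by (metis restrict_apply')
    then have "\<bar>u j x / \<delta> - u j y / \<delta>\<bar> \<le> 1" by linarith
    then show "\<bar>u j x - u j y\<bar> \<le> \<delta>" using \<delta> by (simp add: diff_divide_distrib[symmetric] abs_divide)
  qed
qed

lemma integrable_bounded_mult:
  fixes k f :: "'a::topological_space \<Rightarrow> real"
  assumes "sets M = sets borel" "integrable M k" "f \<in> borel_measurable borel" "\<And>x. \<bar>f x\<bar> \<le> C"
  shows "integrable M (\<lambda>x. k x * f x)"
proof (rule Bochner_Integration.integrable_bound[of _ "\<lambda>x. C * k x"])
  have "f \<in> borel_measurable M" using assms by (simp add: measurable_cong_sets[OF assms(1) refl])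
  then show "(\<lambda>x. k x * f x) \<in> borel_measurable M" using assms(2) by measurable
  have "0 \<le> C" using assms(4)[of undefined] by linarith
  then show "AE x in M. norm (k x * f x) \<le> norm (C * k x)"
    using assms(4) by (intro AE_I2) (simp add: abs_mult mult.commute mult_right_mono)
qed (use assms in simp)

text \<open>The sum stands for a signed measure combined from densities with respect to unrelated
  positive measures. If it vanishes on every Borel set, it vanishes on functions constant on the
  cells of a finite partition, and \<open>f\<close> is a uniform limit of these; the error is at
  most \<open>\<delta>\<close> times the total mass \<open>K\<close> of the densities.\<close>

lemma sum_integral_zero:
  fixes k :: "'i \<Rightarrow> 'a::topological_space \<Rightarrow> real"
  assumes I: "finite I" and M: "\<And>i. i \<in> I \<Longrightarrow> sets (M i) = sets borel"
    and k: "\<And>i. i \<in> I \<Longrightarrow> integrable (M i) (k i)"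
    and zero: "\<And>A. A \<in> sets borel \<Longrightarrow> (\<Sum>i\<in>I. \<integral>x. k i x * indicator A x \<partial>M i) = 0"
    and f: "f \<in> borel_measurable borel" "\<And>x. \<bar>f x\<bar> \<le> C"
  shows "(\<Sum>i\<in>I. \<integral>x. k i x * f x \<partial>M i) = 0"
proof -
  define K where "K = (\<Sum>i\<in>I. \<integral>x. \<bar>k i x\<bar> \<partial>M i)"
  have "\<bar>\<Sum>i\<in>I. \<integral>x. k i x * f x \<partial>M i\<bar> \<le> \<delta> * K" if \<delta>: "0 < \<delta>" for \<delta>
  proof -
    obtain P where P: "finite P" "disjoint P" "\<Union>P = UNIV" "\<And>B. B \<in> P \<Longrightarrow> B \<in> sets borel \<and> B \<noteq> {}"
      and osc: "\<And>B x y j. B \<in> P \<Longrightarrow> x \<in> B \<Longrightarrow> y \<in> B \<Longrightarrow> \<bar>f x - f y\<bar> \<le> \<delta>"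
      using finite_oscillation_partition[of "{()}" "\<lambda>_. f" C \<delta>] f \<delta> by auto
    define p where "p B = (SOME x. x \<in> B)" for B :: "'a set"
    have p: "p B \<in> B" if "B \<in> P" for B using P(4)[OF that] unfolding p_def by (simp add: some_in_eq)
    have i: "integrable (M i) (\<lambda>x. k i x * indicator B x)" if "i \<in> I" "B \<in> P" for i B
      by (rule integrable_bounded_mult[OF M[OF that(1)] k[OF that(1)], of _ 1])
        (use P(4) that in \<open>auto intro!: borel_measurable_indicator simp: indicator_le_1\<close>)
    have int_f: "integrable (M i) (\<lambda>x. k i x * f x)" if "i \<in> I" for i
      by (rule integrable_bounded_mult[OF M[OF that] k[OF that] f])
    define s where "s x = (\<Sum>B\<in>P. f (p B) * indicator B x)" for x
    have ks: "k i x * s x = (\<Sum>B\<in>P. f (p B) * (k i x * indicator B x))" for i x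
      unfolding s_def by (simp add: sum_distrib_left mult_ac)
    have int_s: "integrable (M i) (\<lambda>x. k i x * s x)" if "i \<in> I" for i
      unfolding ks using i that by (intro Bochner_Integration.integrable_sum integrable_mult_right) auto
    have "(\<Sum>i\<in>I. \<integral>x. k i x * s x \<partial>M i) = (\<Sum>i\<in>I. \<Sum>B\<in>P. f (p B) * (\<integral>x. k i x * indicator B x \<partial>M i))"
      unfolding ks using i by (intro sum.cong refl) (simp add: Bochner_Integration.integral_sum)
    also have "\<dots> = (\<Sum>B\<in>P. f (p B) * (\<Sum>i\<in>I. \<integral>x. k i x * indicator B x \<partial>M i))"
      by (simp only: sum_distrib_left) (rule sum.swap)
    also have "\<dots> = 0" using zero P(4) by simp
    finally have s0: "(\<Sum>i\<in>I. \<integral>x. k i x * s x \<partial>M i) = 0" .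
    have fs: "\<bar>f x - s x\<bar> \<le> \<delta>" for x
    proof -
      obtain B where B: "B \<in> P" "x \<in> B" using P(3) by (metis UNIV_I UnionE)
      have "(\<Sum>D\<in>P - {B}. f (p D) * indicator D x) = 0"
        using P(2) B by (intro sum.neutral) (auto simp: disjoint_def indicator_def)
      then have "s x = f (p B)" unfolding s_def using B
        by (simp only: sum.remove[OF P(1) B(1)]) (simp add: indicator_def)
      then show ?thesis using osc[OF B(1) B(2) p[OF B(1)]] by simp
    qed
    have "\<bar>\<Sum>i\<in>I. \<integral>x. k i x * f x \<partial>M i\<bar> = \<bar>(\<Sum>i\<in>I. \<integral>x. k i x * f x \<partial>M i) - (\<Sum>i\<in>I. \<integral>x. k i x * s x \<partial>M i)\<bar>"
      by (simp add: s0)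
    also have "\<dots> = \<bar>\<Sum>i\<in>I. \<integral>x. k i x * f x - k i x * s x \<partial>M i\<bar>"
      by (simp add: int_f int_s sum_subtractf)
    also have "\<dots> \<le> (\<Sum>i\<in>I. \<bar>\<integral>x. k i x * f x - k i x * s x \<partial>M i\<bar>)" by (rule sum_abs)
    also have "\<dots> \<le> (\<Sum>i\<in>I. \<integral>x. \<delta> * \<bar>k i x\<bar> \<partial>M i)"
    proof (rule sum_mono, rule order_trans[OF integral_abs_bound integral_mono])
      fix i x assume "i \<in> I"
      show "\<bar>k i x * f x - k i x * s x\<bar> \<le> \<delta> * \<bar>k i x\<bar>"
        using mult_left_mono[OF fs[of x] abs_ge_zero[of "k i x"]]
        by (simp only: right_diff_distrib[symmetric] abs_mult mult.commute[of \<delta>])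
    qed (use k int_f int_s in auto)
    also have "\<dots> = \<delta> * K" unfolding K_def by (simp add: sum_distrib_left)
    finally show ?thesis .
  qed
  note le = this
  have "K \<ge> 0" unfolding K_def by (intro sum_nonneg Bochner_Integration.integral_nonneg) auto
  show ?thesis
  proof (rule ccontr)
    assume ne: "(\<Sum>i\<in>I. \<integral>x. k i x * f x \<partial>M i) \<noteq> 0"
    define a where "a = \<bar>\<Sum>i\<in>I. \<integral>x. k i x * f x \<partial>M i\<bar>"
    have a: "a > 0" using ne unfolding a_def by simp
    have "a \<le> a / (2 * (K + 1)) * K" using le[of "a / (2 * (K + 1))"] a \<open>K \<ge> 0\<close> unfolding a_def by simp
    also have "\<dots> = a * (K / (2 * (K + 1)))" by simp
    also have "\<dots> < a * 1" by (rule mult_strict_left_mono[OF _ a]) (use \<open>K \<ge> 0\<close> in \<open>simp add: field_simps\<close>)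
    finally show False by simp
  qed
qed

text \<open>The pairing and the divergence of the product are built in this form, as densities over
  several positive measures. Countable additivity is dominated convergence for each summand.\<close>

lemma fsm_sum_density:
  fixes \<Omega> :: "(real^'n) set"
  assumes I: "finite I" and M: "\<And>i. i \<in> I \<Longrightarrow> sets (M i) = sets borel"
    and k: "\<And>i. i \<in> I \<Longrightarrow> integrable (M i) (k i)"
    and \<nu>: "\<And>A. A \<in> sets borel \<Longrightarrow> A \<subseteq> \<Omega> \<Longrightarrow> \<nu> A = (\<Sum>i\<in>I. \<integral>x. k i x * indicator A x \<partial>M i)"
  shows "fsm \<Omega> \<nu>"
  unfolding fsm_def
proof (intro allI impI, elim conjE)
  fix A :: "nat \<Rightarrow> (real^'n) set"
  assume A: "\<forall>i. A i \<in> sets borel \<and> A i \<subseteq> \<Omega>" "disjoint_family A"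
  have "(\<lambda>n. \<integral>x. k i x * indicator (A n) x \<partial>M i) sums (\<integral>x. k i x * indicator (\<Union>n. A n) x \<partial>M i)"
    if i: "i \<in> I" for i
  proof -
    have s: "set_integrable (M i) B (k i)" if "B \<in> sets borel" for B
      unfolding set_integrable_def using integrable_mult_indicator[of B "M i" "k i"] k[OF i] M[OF i] that by simp
    have "(\<lambda>n. \<integral>x. indicator (\<Union>m<n. A m) x * k i x \<partial>M i) \<longlonglongrightarrow> (\<integral>x. indicator (\<Union>n. A n) x * k i x \<partial>M i)"
    proof (rule integral_dominated_convergence[of _ _ _ "\<lambda>x. \<bar>k i x\<bar>"])
      show "AE x in M i. (\<lambda>n. indicator (\<Union>m<n. A m) x * k i x) \<longlonglongrightarrow> indicator (\<Union>n. A n) x * k i x"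
        by (intro AE_I2 tendsto_intros LIMSEQ_indicator_UN)
      have AM: "(\<Union>n. A n) \<in> sets (M i)" "(\<Union>m<n. A m) \<in> sets (M i)" for n using A M[OF i] by auto
      show "(\<lambda>x. indicator (\<Union>n. A n) x * k i x) \<in> borel_measurable (M i)"
        "(\<lambda>x. indicator (\<Union>m<n. A m) x * k i x) \<in> borel_measurable (M i)" for n
        using AM k[OF i] by (intro borel_measurable_times borel_measurable_indicator; auto)+
    qed (use k[OF i] in \<open>auto simp: indicator_def\<close>)
    moreover have "(\<integral>x. indicator (\<Union>m<n. A m) x * k i x \<partial>M i) = (\<Sum>m<n. \<integral>x. indicator (A m) x * k i x \<partial>M i)" for n
    proof -
      have "(\<integral>x. indicator (\<Union>m<n. A m) x * k i x \<partial>M i) = (\<integral>x. (\<Sum>m<n. indicator (A m) x * k i x) \<partial>M i)"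
      proof (rule Bochner_Integration.integral_cong[OF refl])
        fix x
        have "indicator (\<Union>m<n. A m) x = (\<Sum>m<n. indicator (A m) x :: real)"
          using A by (intro indicator_UN_disjoint) (auto simp: disjoint_family_on_def)
        then show "indicator (\<Union>m<n. A m) x * k i x = (\<Sum>m<n. indicator (A m) x * k i x)"
          by (simp add: sum_distrib_right)
      qed
      also have "\<dots> = (\<Sum>m<n. \<integral>x. indicator (A m) x * k i x \<partial>M i)"
        by (rule Bochner_Integration.integral_sum) (use s A in \<open>auto simp: set_integrable_def\<close>)
      finally show ?thesis .
    qed
    ultimately show ?thesis unfolding sums_def by (simp add: mult.commute)
  qed
  then have "(\<lambda>n. \<Sum>i\<in>I. \<integral>x. k i x * indicator (A n) x \<partial>M i) sums (\<Sum>i\<in>I. \<integral>x. k i x * indicator (\<Union>n. A n) x \<partial>M i)"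
    by (rule sums_sum)
  moreover have "\<nu> (A n) = (\<Sum>i\<in>I. \<integral>x. k i x * indicator (A n) x \<partial>M i)" for n
    by (rule \<nu>) (use A in auto)
  moreover have "\<nu> (\<Union>n. A n) = (\<Sum>i\<in>I. \<integral>x. k i x * indicator (\<Union>n. A n) x \<partial>M i)"
    by (rule \<nu>) (use A in auto)
  ultimately show "(\<lambda>n. \<nu> (A n)) sums \<nu> (\<Union>n. A n)" by simp
qed

text \<open>\<open>sint\<close> is defined through the positive and negative parts of
  \<open>\<nu>\<close>, which are not those of the summands. Both sides are therefore compared
  through \<open>sum_integral_zero\<close>: the polar form of \<open>\<nu>\<close> enters as one
  more summand, at index \<open>None\<close>, and the given densities enter with reversed
  sign.\<close>

lemma sint_sum_density:
  fixes \<Omega> :: "(real^'n) set"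
  assumes I: "finite I" and M: "\<And>i. i \<in> I \<Longrightarrow> sets (M i) = sets borel"
    and k: "\<And>i. i \<in> I \<Longrightarrow> integrable (M i) (k i)"
    and \<nu>: "\<And>A. A \<in> sets borel \<Longrightarrow> A \<subseteq> \<Omega> \<Longrightarrow> \<nu> A = (\<Sum>i\<in>I. \<integral>x. k i x * indicator A x \<partial>M i)"
    and out: "\<And>i. i \<in> I \<Longrightarrow> emeasure (M i) (-\<Omega>) = 0"
    and Om: "\<Omega> \<in> sets borel"
    and f: "f \<in> borel_measurable borel" "\<And>x. \<bar>f x\<bar> \<le> C"
  shows "sint \<Omega> \<nu> f = (\<Sum>i\<in>I. \<integral>x. k i x * f x \<partial>M i)"
proof -
  have fsm: "fsm \<Omega> \<nu>" by (rule fsm_sum_density[OF I M k \<nu>])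
  obtain \<theta> where fin: "finite_measure (tvm \<Omega> \<nu>)" and sm: "sets (tvm \<Omega> \<nu>) = sets borel"
    and out0: "emeasure (tvm \<Omega> \<nu>) (-\<Omega>) = 0"
    and th: "\<theta> \<in> borel_measurable borel" "\<And>x. \<bar>\<theta> x\<bar> = 1"
    and si: "\<And>f. f \<in> borel_measurable borel \<Longrightarrow> integrable (tvm \<Omega> \<nu>) f \<Longrightarrow>
        sint \<Omega> \<nu> f = (\<integral>x. \<theta> x * f x \<partial>tvm \<Omega> \<nu>)"
    and rep: "\<And>A. A \<in> sets borel \<Longrightarrow> A \<subseteq> \<Omega> \<Longrightarrow> \<nu> A = (\<integral>x. \<theta> x * indicator A x \<partial>tvm \<Omega> \<nu>)"
    by (rule fsm_representation[OF fsm Om]) (rule that, assumption+)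
  interpret m: finite_measure "tvm \<Omega> \<nu>" by (rule fin)
  note mc = measurable_cong_sets[OF sm refl]
  have thi: "integrable (tvm \<Omega> \<nu>) \<theta>"
    by (rule m.integrable_const_bound[of _ 1]) (use th in \<open>auto simp: mc\<close>)
  have fi: "integrable (tvm \<Omega> \<nu>) f"
    by (rule m.integrable_const_bound[of _ C]) (use f in \<open>auto simp: mc\<close>)
  define M' where "M' = case_option (tvm \<Omega> \<nu>) M"
  define k' where "k' = case_option \<theta> (\<lambda>i x. - k i x)"
  \<comment> \<open>\<open>\<nu>\<close> is described only on subsets of \<open>\<Omega>\<close>;
    all measures involved are null on the complement, so \<open>A\<close> may be replaced by
    \<open>A \<inter> \<Omega>\<close>.\<close>
  have ind: "(\<integral>x. h x * indicator A x \<partial>N) = (\<integral>x. h x * indicator (A \<inter> \<Omega>) x \<partial>N)"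
    if N: "sets N = sets borel" "emeasure N (-\<Omega>) = 0" "h \<in> borel_measurable N" "A \<in> sets borel"
    for N and h :: "real^'n \<Rightarrow> real" and A
  proof (rule integral_cong_AE)
    have "AE x in N. x \<notin> -\<Omega>"
      using N Om by (intro AE_not_in) (auto simp: null_sets_def)
    then show "AE x in N. h x * indicator A x = h x * indicator (A \<inter> \<Omega>) x"
      by eventually_elim (auto simp: indicator_def)
    have "A \<in> sets N" "A \<inter> \<Omega> \<in> sets N" using N Om by auto
    then show "(\<lambda>x. h x * indicator A x) \<in> borel_measurable N"
      "(\<lambda>x. h x * indicator (A \<inter> \<Omega>) x) \<in> borel_measurable N"
      using N(3) by (auto intro!: borel_measurable_times borel_measurable_indicator)
  qed
  have "(\<Sum>i\<in>insert None (Some ` I). \<integral>x. k' i x * f x \<partial>M' i) = 0"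
  proof (rule sum_integral_zero[OF _ _ _ _ f])
    show "finite (insert None (Some ` I))" using I by simp
    show "sets (M' i) = sets borel" if "i \<in> insert None (Some ` I)" for i
      using that M sm by (auto simp: M'_def)
    show "integrable (M' i) (k' i)" if "i \<in> insert None (Some ` I)" for i
      using that k thi by (auto simp: M'_def k'_def)
    fix A :: "(real^'n) set" assume A: "A \<in> sets borel"
    have "(\<integral>x. \<theta> x * indicator A x \<partial>tvm \<Omega> \<nu>) = \<nu> (A \<inter> \<Omega>)"
      using ind[OF sm out0 _ A, of \<theta>] rep[of "A \<inter> \<Omega>"] A Om th by (simp add: mc)
    also have "\<dots> = (\<Sum>i\<in>I. \<integral>x. k i x * indicator (A \<inter> \<Omega>) x \<partial>M i)" by (rule \<nu>) (use A Om in auto)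
    also have "\<dots> = (\<Sum>i\<in>I. \<integral>x. k i x * indicator A x \<partial>M i)"
      by (intro sum.cong refl ind[symmetric] M out A) (use k in auto)
    finally show "(\<Sum>i\<in>insert None (Some ` I). \<integral>x. k' i x * indicator A x \<partial>M' i) = 0"
      using I by (simp add: M'_def k'_def sum.reindex sum_negf)
  qed
  then have "(\<integral>x. \<theta> x * f x \<partial>tvm \<Omega> \<nu>) = (\<Sum>i\<in>I. \<integral>x. k i x * f x \<partial>M i)"
    using I by (simp add: M'_def k'_def sum.reindex sum_negf)
  then show ?thesis using si[OF f(1) fi] by simp
qed

text \<open>\<open>Sup\<close> on the reals is informative only for sets bounded above. The bound
  here is the sum of the scalar variations: the Euclidean norm is at most the sum of the moduli of
  the components, and each scalar variation is a finite measure.\<close>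

lemma tvarv_ge:
  fixes \<Omega> :: "(real^'n) set"
  assumes J: "finite J" and fsm: "\<forall>j\<in>J. fsm \<Omega> (\<nu> j)" and Om: "\<Omega> \<in> sets borel"
    and P: "finite P" "disjoint P" "\<And>B. B \<in> P \<Longrightarrow> B \<in> sets borel \<and> B \<subseteq> A \<inter> \<Omega>"
  shows "(\<Sum>B\<in>P. sqrt (\<Sum>j\<in>J. (\<nu> j B)^2)) \<le> tvarv J \<Omega> \<nu> A"
  unfolding tvarv_def
proof (rule cSup_upper)
  show "(\<Sum>B\<in>P. sqrt (\<Sum>j\<in>J. (\<nu> j B)\<^sup>2)) \<in> {\<Sum>B\<in>P. sqrt (\<Sum>j\<in>J. (\<nu> j B)\<^sup>2) |P.
     finite P \<and> disjoint P \<and> (\<forall>B\<in>P. B \<in> sets borel \<and> B \<subseteq> A \<inter> \<Omega>)}" using P by blast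
  have "(\<Sum>B\<in>P. sqrt (\<Sum>j\<in>J. (\<nu> j B)\<^sup>2)) \<le> (\<Sum>j\<in>J. tvar \<Omega> (\<nu> j) \<Omega>)"
    if P: "finite P" "disjoint P" "\<forall>B\<in>P. B \<in> sets borel \<and> B \<subseteq> A \<inter> \<Omega>" for P
  proof -
    have "(\<Sum>B\<in>P. sqrt (\<Sum>j\<in>J. (\<nu> j B)\<^sup>2)) \<le> (\<Sum>B\<in>P. \<Sum>j\<in>J. \<bar>\<nu> j B\<bar>)"
    proof (rule sum_mono)
      fix B
      have "L2_set (\<lambda>j. \<nu> j B) J \<le> (\<Sum>j\<in>J. \<bar>\<nu> j B\<bar>)" by (rule L2_set_le_sum_abs)
      then show "sqrt (\<Sum>j\<in>J. (\<nu> j B)\<^sup>2) \<le> (\<Sum>j\<in>J. \<bar>\<nu> j B\<bar>)" unfolding L2_set_def .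
    qed
    also have "\<dots> = (\<Sum>j\<in>J. \<Sum>B\<in>P. \<bar>\<nu> j B\<bar>)" by (rule sum.swap)
    also have "\<dots> \<le> (\<Sum>j\<in>J. tvar \<Omega> (\<nu> j) \<Omega>)"
    proof (rule sum_mono)
      fix j assume j: "j \<in> J"
      obtain \<theta> where fin: "finite_measure (tvm \<Omega> (\<nu> j))" and sm: "sets (tvm \<Omega> (\<nu> j)) = sets borel"
        and tv: "\<And>A. A \<in> sets borel \<Longrightarrow> tvar \<Omega> (\<nu> j) A = measure (tvm \<Omega> (\<nu> j)) A"
        and th: "\<theta> \<in> borel_measurable borel" "\<And>x. \<bar>\<theta> x\<bar> = 1"
        and rep: "\<And>A. A \<in> sets borel \<Longrightarrow> A \<subseteq> \<Omega> \<Longrightarrow> \<nu> j A = (\<integral>x. \<theta> x * indicator A x \<partial>tvm \<Omega> (\<nu> j))"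
        by (rule fsm_representation[OF fsm[rule_format, OF j] Om]) (rule that, assumption+)
      interpret m: finite_measure "tvm \<Omega> (\<nu> j)" by (rule fin)
      have sp: "space (tvm \<Omega> (\<nu> j)) = UNIV" using sets_eq_imp_space_eq[OF sm] by simp
      have "(\<Sum>B\<in>P. \<bar>\<nu> j B\<bar>) \<le> (\<Sum>B\<in>P. measure (tvm \<Omega> (\<nu> j)) B)"
      proof (rule sum_mono)
        fix B assume "B \<in> P"
        then have B: "B \<in> sets borel" "B \<subseteq> \<Omega>" using P by auto
        have ii: "integrable (tvm \<Omega> (\<nu> j)) (indicator B :: _ \<Rightarrow> real)"
          using B sm by (intro integrable_real_indicator) (auto simp: m.emeasure_eq_measure)
        have "\<bar>\<nu> j B\<bar> \<le> (\<integral>x. indicator B x \<partial>tvm \<Omega> (\<nu> j))" unfolding rep[OF B]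
        proof (rule integral_abs_bound_integral)
          show "integrable (tvm \<Omega> (\<nu> j)) (\<lambda>x. \<theta> x * indicator B x)"
          proof (rule Bochner_Integration.integrable_bound[OF ii])
            show "(\<lambda>x. \<theta> x * indicator B x) \<in> borel_measurable (tvm \<Omega> (\<nu> j))"
              using th B by (simp add: measurable_cong_sets[OF sm refl])
          qed (auto simp: th abs_mult)
        qed (auto simp: ii th abs_mult)
        then show "\<bar>\<nu> j B\<bar> \<le> measure (tvm \<Omega> (\<nu> j)) B" by (simp add: sp)
      qed
      also have "\<dots> = measure (tvm \<Omega> (\<nu> j)) (\<Union>P)"
        using m.finite_measure_finite_Union[of P "\<lambda>x. x"] P sm
        by (force simp: disjoint_def disjoint_family_on_def)
      also have "\<dots> \<le> measure (tvm \<Omega> (\<nu> j)) \<Omega>" by (rule m.finite_measure_mono) (use P Om sm in auto)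
      finally show "(\<Sum>B\<in>P. \<bar>\<nu> j B\<bar>) \<le> tvar \<Omega> (\<nu> j) \<Omega>" using tv[OF Om] by simp
    qed
    finally show ?thesis .
  qed
  then show "bdd_above {\<Sum>B\<in>P. sqrt (\<Sum>j\<in>J. (\<nu> j B)\<^sup>2) |P.
     finite P \<and> disjoint P \<and> (\<forall>B\<in>P. B \<in> sets borel \<and> B \<subseteq> A \<inter> \<Omega>)}" 
    by (intro bdd_aboveI) blast
qed

lemma tvarv_nonneg:
  fixes \<Omega> :: "(real^'n) set"
  assumes "finite J" "\<forall>j\<in>J. fsm \<Omega> (\<nu> j)" "\<Omega> \<in> sets borel"
  shows "0 \<le> tvarv J \<Omega> \<nu> A"
  using tvarv_ge[OF assms, where P = "{}"] by (simp add: disjoint_def)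

text \<open>Families admissible for \<open>A\<close> and for \<open>B\<close> merge into one for the
  union. This superadditivity, valid for arbitrary disjoint sets, yields monotonicity and the
  summation over partitions below.\<close>

lemma tvarv_Un_ge:
  fixes \<Omega> :: "(real^'n) set"
  assumes J: "finite J" and fsm: "\<forall>j\<in>J. fsm \<Omega> (\<nu> j)" and Om: "\<Omega> \<in> sets borel"
    and dis: "A \<inter> B = {}"
  shows "tvarv J \<Omega> \<nu> A + tvarv J \<Omega> \<nu> B \<le> tvarv J \<Omega> \<nu> (A \<union> B)"
proof -
  define S where "S P = (\<Sum>B\<in>P. sqrt (\<Sum>j\<in>J. (\<nu> j B)\<^sup>2))" for P
  define ok where "ok A P \<longleftrightarrow> finite P \<and> disjoint P \<and> (\<forall>B\<in>P. B \<in> sets borel \<and> B \<subseteq> A \<inter> \<Omega>)" for A P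
  have tv: "tvarv J \<Omega> \<nu> A = Sup {S P | P. ok A P}" for A unfolding tvarv_def S_def ok_def ..
  have ne: "{S P | P. ok A P} \<noteq> {}" for A unfolding ok_def by (auto intro!: exI[of _ "{}"] simp: disjoint_def)
  have key: "S P + S Q \<le> tvarv J \<Omega> \<nu> (A \<union> B)" if P: "ok A P" and Q: "ok B Q" for P Q
  proof -
    \<comment> \<open>The two families can share only the empty set, which carries no mass.\<close>
    have "P \<inter> Q \<subseteq> {{}}" using P Q dis unfolding ok_def by blast
    then have "S (P \<inter> Q) = 0" unfolding S_def
      using fsm_empty[OF fsm[rule_format]] by (intro sum.neutral ballI) (auto dest!: subsetD)
    then have "S P + S Q = S (P \<union> Q)" unfolding S_def
      using sum.union_inter[of P Q "\<lambda>B. sqrt (\<Sum>j\<in>J. (\<nu> j B)\<^sup>2)"] P Q by (simp add: ok_def)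
    also have "\<dots> \<le> tvarv J \<Omega> \<nu> (A \<union> B)" unfolding S_def
    proof (rule tvarv_ge[OF J fsm Om])
      show "disjoint (P \<union> Q)"
        using P Q dis unfolding ok_def by (intro disjoint_union) blast+
    qed (use P Q in \<open>auto simp: ok_def\<close>)
    finally show ?thesis .
  qed
  have "tvarv J \<Omega> \<nu> A \<le> tvarv J \<Omega> \<nu> (A \<union> B) - S Q" if Q: "ok B Q" for Q
    unfolding tv[of A] by (rule cSup_least[OF ne]) (use key[OF _ Q] in force)
  then have "S Q \<le> tvarv J \<Omega> \<nu> (A \<union> B) - tvarv J \<Omega> \<nu> A" if "ok B Q" for Q using that by force
  then have "tvarv J \<Omega> \<nu> B \<le> tvarv J \<Omega> \<nu> (A \<union> B) - tvarv J \<Omega> \<nu> A"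
    unfolding tv[of B] by (intro cSup_least[OF ne]) auto
  then show ?thesis by simp
qed

lemma tvarv_sum_le:
  fixes \<Omega> :: "(real^'n) set"
  assumes J: "finite J" and fsm: "\<forall>j\<in>J. fsm \<Omega> (\<nu> j)" and Om: "\<Omega> \<in> sets borel"
    and P: "finite P" "disjoint P"
  shows "(\<Sum>B\<in>P. tvarv J \<Omega> \<nu> B) \<le> tvarv J \<Omega> \<nu> (\<Union>P)"
  using P
proof (induction P rule: finite_induct)
  case empty then show ?case using tvarv_nonneg[OF J fsm Om] by simp
next
  case (insert B P)
  have "B \<inter> \<Union>P = {}" using insert.prems insert.hyps by (auto simp: disjoint_def)
  then have "tvarv J \<Omega> \<nu> B + tvarv J \<Omega> \<nu> (\<Union>P) \<le> tvarv J \<Omega> \<nu> (B \<union> \<Union>P)"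
    by (rule tvarv_Un_ge[OF J fsm Om])
  moreover have "disjoint P" using insert.prems by (auto simp: disjoint_def)
  ultimately show ?case using insert by simp
qed

lemma tvarv_mono:
  fixes \<Omega> :: "(real^'n) set"
  assumes J: "finite J" and fsm: "\<forall>j\<in>J. fsm \<Omega> (\<nu> j)" and Om: "\<Omega> \<in> sets borel"
    and AB: "A \<subseteq> B"
  shows "tvarv J \<Omega> \<nu> A \<le> tvarv J \<Omega> \<nu> B"
  using tvarv_Un_ge[OF J fsm Om, where A = A and B = "B - A"] tvarv_nonneg[OF J fsm Om, where A = "B - A"] AB
  by (simp add: Un_absorb1)

text \<open>A bound set by set upgrades to the variation, because \<open>tvarv\<close> is
  superadditive over the disjoint sets of a competing family.\<close>

lemma tvar_le_tvarv:
  fixes \<Omega> :: "(real^'n) set"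
  assumes J: "finite J" and fsm: "\<forall>j\<in>J. fsm \<Omega> (\<nu> j)" and Om: "\<Omega> \<in> sets borel"
    and C: "0 \<le> C" and le: "\<And>B. B \<in> sets borel \<Longrightarrow> B \<subseteq> \<Omega> \<Longrightarrow> \<bar>\<mu> B\<bar> \<le> C * tvarv J \<Omega> \<nu> B"
  shows "tvar \<Omega> \<mu> A \<le> C * tvarv J \<Omega> \<nu> A"
  unfolding tvar_def
proof (rule cSup_least)
  show "{\<Sum>B\<in>P. \<bar>\<mu> B\<bar> |P. finite P \<and> disjoint P \<and> (\<forall>B\<in>P. B \<in> sets borel \<and> B \<subseteq> A \<inter> \<Omega>)} \<noteq> {}"
    by (auto intro!: exI[of _ "{}"] simp: disjoint_def)
  fix x assume "x \<in> {\<Sum>B\<in>P. \<bar>\<mu> B\<bar> |P. finite P \<and> disjoint P \<and> (\<forall>B\<in>P. B \<in> sets borel \<and> B \<subseteq> A \<inter> \<Omega>)}"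
  then obtain P where P: "x = (\<Sum>B\<in>P. \<bar>\<mu> B\<bar>)" "finite P" "disjoint P" "\<And>B. B\<in>P \<Longrightarrow> B \<in> sets borel \<and> B \<subseteq> A \<inter> \<Omega>"
    by auto
  have "x \<le> (\<Sum>B\<in>P. C * tvarv J \<Omega> \<nu> B)" unfolding P(1) by (rule sum_mono) (use P(4) le in auto)
  also have "\<dots> = C * (\<Sum>B\<in>P. tvarv J \<Omega> \<nu> B)" by (simp add: sum_distrib_left)
  also have "\<dots> \<le> C * tvarv J \<Omega> \<nu> (\<Union>P)"
    by (intro mult_left_mono C tvarv_sum_le[OF J fsm Om P(2,3)])
  also have "\<dots> \<le> C * tvarv J \<Omega> \<nu> A"
    by (intro mult_left_mono C tvarv_mono[OF J fsm Om]) (use P(4) in auto)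
  finally show "x \<le> C * tvarv J \<Omega> \<nu> A" .
qed

text \<open>Both sides are compared on a partition into sets on which \<open>u\<close> is almost constant.\<close>
lemma sum_density_le_tvarv:
  fixes \<Omega> :: "(real^'n) set" and u :: "'j \<Rightarrow> real^'n \<Rightarrow> real"
  assumes J: "finite J" and fsm: "\<forall>j\<in>J. fsm \<Omega> (\<nu> j)" and Om: "\<Omega> \<in> sets borel"
    and M: "\<And>j. j \<in> J \<Longrightarrow> sets (M j) = sets borel"
    and k: "\<And>j. j \<in> J \<Longrightarrow> integrable (M j) (k j)"
    and rep: "\<And>j A. j \<in> J \<Longrightarrow> A \<in> sets borel \<Longrightarrow> A \<subseteq> \<Omega> \<Longrightarrow> \<nu> j A = (\<integral>x. k j x * indicator A x \<partial>M j)"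
    and u: "\<And>j. j \<in> J \<Longrightarrow> u j \<in> borel_measurable borel"
    and bd: "\<And>x. sqrt (\<Sum>j\<in>J. (u j x)^2) \<le> C"
    and A: "A \<in> sets borel" "A \<subseteq> \<Omega>"
  shows "\<bar>\<Sum>j\<in>J. \<integral>x. k j x * (u j x * indicator A x) \<partial>M j\<bar> \<le> C * tvarv J \<Omega> \<nu> A"
proof -
  define K where "K = (\<Sum>j\<in>J. \<integral>x. \<bar>k j x\<bar> \<partial>M j)"
  have K: "K \<ge> 0" unfolding K_def by (intro sum_nonneg Bochner_Integration.integral_nonneg) auto
  have C: "0 \<le> C" using bd[of 0] by (meson order_trans real_sqrt_ge_zero sum_nonneg zero_le_power2)
  have ub: "\<bar>u j x\<bar> \<le> C" if "j \<in> J" for j x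
  proof -
    have "\<bar>u j x\<bar> \<le> L2_set (\<lambda>j. u j x) J"
      using member_le_L2_set[OF J that, of "\<lambda>j. \<bar>u j x\<bar>"] by (simp add: L2_set_def)
    then show ?thesis using bd[of x] unfolding L2_set_def by linarith
  qed
  have "\<bar>\<Sum>j\<in>J. \<integral>x. k j x * (u j x * indicator A x) \<partial>M j\<bar> \<le> C * tvarv J \<Omega> \<nu> A + \<delta> * K" if \<delta>: "0 < \<delta>" for \<delta>
  proof -
    obtain P where P: "finite P" "disjoint P" "\<Union>P = UNIV" "\<And>B. B \<in> P \<Longrightarrow> B \<in> sets borel \<and> B \<noteq> {}"
      and osc: "\<And>B x y j. B \<in> P \<Longrightarrow> x \<in> B \<Longrightarrow> y \<in> B \<Longrightarrow> j \<in> J \<Longrightarrow> \<bar>u j x - u j y\<bar> \<le> \<delta>"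
      using finite_oscillation_partition[of J u C \<delta>, OF J u ub \<delta>] by metis
    define p where "p B = (SOME x. x \<in> B)" for B :: "(real^'n) set"
    have p: "p B \<in> B" if "B \<in> P" for B using P(4)[OF that] unfolding p_def by (simp add: some_in_eq)
    have i: "integrable (M j) (\<lambda>x. k j x * indicator (A \<inter> B) x)" if "j \<in> J" "B \<in> P" for j B
      by (rule integrable_bounded_mult[OF M[OF that(1)] k[OF that(1)], of _ 1])
        (use P(4) that A in \<open>auto intro!: borel_measurable_indicator simp: indicator_le_1\<close>)
    have int_f: "integrable (M j) (\<lambda>x. k j x * (u j x * indicator A x))" if "j \<in> J" for j
      by (rule integrable_bounded_mult[OF M[OF that] k[OF that], of _ C])
        (use ub[OF that] u[OF that] A C in \<open>auto simp: indicator_def\<close>)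
    define s where "s j x = (\<Sum>B\<in>P. u j (p B) * indicator (A \<inter> B) x)" for j x
    have ks: "k j x * s j x = (\<Sum>B\<in>P. u j (p B) * (k j x * indicator (A \<inter> B) x))" for j x
      unfolding s_def by (simp add: sum_distrib_left mult_ac)
    have int_s: "integrable (M j) (\<lambda>x. k j x * s j x)" if "j \<in> J" for j
      unfolding ks using i that by (intro Bochner_Integration.integrable_sum integrable_mult_right) auto
    have "(\<Sum>j\<in>J. \<integral>x. k j x * s j x \<partial>M j) = (\<Sum>j\<in>J. \<Sum>B\<in>P. u j (p B) * (\<integral>x. k j x * indicator (A \<inter> B) x \<partial>M j))"
      unfolding ks using i by (intro sum.cong refl) (simp add: Bochner_Integration.integral_sum)
    also have "\<dots> = (\<Sum>j\<in>J. \<Sum>B\<in>P. u j (p B) * \<nu> j (A \<inter> B))"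
      by (intro sum.cong refl arg_cong2[of _ _ _ _ "(*)"] rep[symmetric]) (use P(4) A in auto)
    also have "\<dots> = (\<Sum>B\<in>P. \<Sum>j\<in>J. u j (p B) * \<nu> j (A \<inter> B))" by (rule sum.swap)
    finally have s0: "(\<Sum>j\<in>J. \<integral>x. k j x * s j x \<partial>M j) = (\<Sum>B\<in>P. \<Sum>j\<in>J. u j (p B) * \<nu> j (A \<inter> B))" .
    have "\<bar>\<Sum>B\<in>P. \<Sum>j\<in>J. u j (p B) * \<nu> j (A \<inter> B)\<bar> \<le> (\<Sum>B\<in>P. \<bar>\<Sum>j\<in>J. u j (p B) * \<nu> j (A \<inter> B)\<bar>)" by (rule sum_abs)
    also have "\<dots> \<le> (\<Sum>B\<in>P. C * tvarv J \<Omega> \<nu> (A \<inter> B))"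
    proof (rule sum_mono)
      fix B assume B: "B \<in> P"
      have "\<bar>\<Sum>j\<in>J. u j (p B) * \<nu> j (A \<inter> B)\<bar> \<le> (\<Sum>j\<in>J. \<bar>u j (p B)\<bar> * \<bar>\<nu> j (A \<inter> B)\<bar>)"
        by (rule order_trans[OF sum_abs]) (simp add: abs_mult)
      \<comment> \<open>Cauchy-Schwarz at one sample point of the cell: here the Euclidean bound on
        the vector \<open>u\<close> meets the Euclidean norm in \<open>tvarv\<close>.\<close>
      also have "\<dots> \<le> L2_set (\<lambda>j. u j (p B)) J * L2_set (\<lambda>j. \<nu> j (A \<inter> B)) J"
        by (rule L2_set_mult_ineq)
      also have "\<dots> \<le> C * L2_set (\<lambda>j. \<nu> j (A \<inter> B)) J"
        by (rule mult_right_mono) (use bd[of "p B"] in \<open>auto simp: L2_set_def intro!: sum_nonneg\<close>)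
      also have "\<dots> \<le> C * tvarv J \<Omega> \<nu> (A \<inter> B)"
        using tvarv_ge[OF J fsm Om, where P = "{A \<inter> B}" and A = "A \<inter> B"] A P(4)[OF B]
        by (intro mult_left_mono C) (auto simp: L2_set_def disjoint_def)
      finally show "\<bar>\<Sum>j\<in>J. u j (p B) * \<nu> j (A \<inter> B)\<bar> \<le> C * tvarv J \<Omega> \<nu> (A \<inter> B)" .
    qed
    also have "\<dots> = C * (\<Sum>B\<in>P. tvarv J \<Omega> \<nu> (A \<inter> B))" by (simp add: sum_distrib_left)
    also have "\<dots> \<le> C * tvarv J \<Omega> \<nu> A"
    proof (rule mult_left_mono[OF _ C])
      \<comment> \<open>Different cells can meet \<open>A\<close> in the same set only if that set
        is empty, and its variation is 0; hence the sum may be taken over the image family.\<close>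
      have "(\<Sum>B\<in>P. tvarv J \<Omega> \<nu> (A \<inter> B)) = (\<Sum>D\<in>(\<lambda>B. A \<inter> B) ` P. tvarv J \<Omega> \<nu> D)"
      proof (rule sum.reindex_nontrivial[OF P(1), symmetric, unfolded o_def])
        fix B D assume BD: "B \<in> P" "D \<in> P" "B \<noteq> D" "A \<inter> B = A \<inter> D"
        then have e: "A \<inter> B = {}" using P(2) unfolding disjoint_def by blast
        have "tvarv J \<Omega> \<nu> {} + tvarv J \<Omega> \<nu> {} \<le> tvarv J \<Omega> \<nu> {}"
          using tvarv_Un_ge[OF J fsm Om, where A = "{}" and B = "{}"] by simp
        then show "tvarv J \<Omega> \<nu> (A \<inter> B) = 0" using tvarv_nonneg[OF J fsm Om, where A = "{}"] e by simp
      qed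
      also have "\<dots> \<le> tvarv J \<Omega> \<nu> (\<Union>((\<lambda>B. A \<inter> B) ` P))"
        by (rule tvarv_sum_le[OF J fsm Om]) (use P(1,2) in \<open>auto simp: disjoint_def\<close>)
      also have "\<Union>((\<lambda>B. A \<inter> B) ` P) = A" using P(3) by blast
      finally show "(\<Sum>B\<in>P. tvarv J \<Omega> \<nu> (A \<inter> B)) \<le> tvarv J \<Omega> \<nu> A" .
    qed
    finally have sb: "\<bar>\<Sum>j\<in>J. \<integral>x. k j x * s j x \<partial>M j\<bar> \<le> C * tvarv J \<Omega> \<nu> A" unfolding s0 .
    have us: "\<bar>u j x * indicator A x - s j x\<bar> \<le> \<delta>" if j: "j \<in> J" for j x
    proof -
      obtain B where B: "B \<in> P" "x \<in> B" using P(3) by (metis UNIV_I UnionE)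
      have "(\<Sum>D\<in>P - {B}. u j (p D) * indicator (A \<inter> D) x) = 0"
        using P(2) B by (intro sum.neutral) (auto simp: disjoint_def indicator_def)
      then have "s j x = u j (p B) * indicator A x" unfolding s_def using B
        by (simp only: sum.remove[OF P(1) B(1)]) (simp add: indicator_def)
      then show ?thesis using osc[OF B(1) B(2) p[OF B(1)] j] \<delta> by (simp add: indicator_def)
    qed
    have "\<bar>(\<Sum>j\<in>J. \<integral>x. k j x * (u j x * indicator A x) \<partial>M j) - (\<Sum>j\<in>J. \<integral>x. k j x * s j x \<partial>M j)\<bar>
      = \<bar>\<Sum>j\<in>J. \<integral>x. k j x * (u j x * indicator A x) - k j x * s j x \<partial>M j\<bar>"
      by (simp add: int_f int_s sum_subtractf)
    also have "\<dots> \<le> (\<Sum>j\<in>J. \<bar>\<integral>x. k j x * (u j x * indicator A x) - k j x * s j x \<partial>M j\<bar>)" by (rule sum_abs)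
    also have "\<dots> \<le> (\<Sum>j\<in>J. \<integral>x. \<delta> * \<bar>k j x\<bar> \<partial>M j)"
    proof (rule sum_mono, rule order_trans[OF integral_abs_bound integral_mono])
      fix j x assume "j \<in> J"
      from mult_left_mono[OF us[OF this, of x] abs_ge_zero[of "k j x"]]
      show "\<bar>k j x * (u j x * indicator A x) - k j x * s j x\<bar> \<le> \<delta> * \<bar>k j x\<bar>"
        by (simp only: right_diff_distrib[symmetric] abs_mult mult.commute[of \<delta>])
    qed (use k int_f int_s in auto)
    also have "\<dots> = \<delta> * K" unfolding K_def by (simp add: sum_distrib_left)
    finally show ?thesis using sb by linarith
  qed
  note le = this
  show ?thesis
  proof (rule field_le_epsilon)
    fix e :: real assume e: "0 < e"
    have "e / (K + 1) * K \<le> e" using e K by (simp add: field_simps)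
    then show "\<bar>\<Sum>j\<in>J. \<integral>x. k j x * (u j x * indicator A x) \<partial>M j\<bar> \<le> C * tvarv J \<Omega> \<nu> A + e"
      using le[of "e / (K + 1)"] e K by (smt (verit) divide_pos_pos)
  qed
qed

section \<open>Smooth kernels\<close>

text \<open>Differentiation stays inside the polynomials, direction by direction. The smoothness of
  test functions, the polynomial Jacobian of translations and the formula for kernel derivatives all
  rest on this.\<close>

lemma real_polynomial_function_derivative:
  fixes p :: "'a::real_normed_vector \<Rightarrow> real"
  assumes "real_polynomial_function p"
  shows "\<exists>p'. (\<forall>x. (p has_derivative p' x) (at x)) \<and> (\<forall>v. real_polynomial_function (\<lambda>x. p' x v))"
  using assms
proof (induction rule: real_polynomial_function.induct)
  case (linear f)
  then show ?case by (intro exI[of _ "\<lambda>_. f"]) (auto intro: bounded_linear_imp_has_derivative real_polynomial_function.intros(2))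
next
  case (const c)
  then show ?case by (intro exI[of _ "\<lambda>_ _. 0"]) (auto intro: real_polynomial_function.intros(2))
next
  case (add f g)
  then obtain f' g' where "\<And>x. (f has_derivative f' x) (at x)" "\<And>v. real_polynomial_function (\<lambda>x. f' x v)"
    "\<And>x. (g has_derivative g' x) (at x)" "\<And>v. real_polynomial_function (\<lambda>x. g' x v)" by blast
  then show ?case
    by (intro exI[of _ "\<lambda>x v. f' x v + g' x v"])
      (auto intro: has_derivative_add real_polynomial_function.intros(3))
next
  case (mult f g)
  then obtain f' g' where d: "\<And>x. (f has_derivative f' x) (at x)" "\<And>v. real_polynomial_function (\<lambda>x. f' x v)"
    "\<And>x. (g has_derivative g' x) (at x)" "\<And>v. real_polynomial_function (\<lambda>x. g' x v)" by blast
  show ?case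
    by (intro exI[of _ "\<lambda>x v. f x * g' x v + f' x v * g x"])
      (use d mult(1,2) in \<open>fast intro: has_derivative_mult real_polynomial_function.intros(3,4)\<close>)
qed

text \<open>\<open>smooth_fun\<close> is coinductive: smoothness is proved by exhibiting a class of functions
  (\<open>smooth_gen\<close> below) that is closed under directional derivatives. It contains the functions
  \<open>expk k\<close> because derivatives of \<open>exp (- 1 / t)\<close> are combinations of them.\<close>
definition expk :: "nat \<Rightarrow> real \<Rightarrow> real" where
  "expk k t = (if t > 0 then exp (- 1 / t) / t ^ k else 0)"

lemma expk_tendsto_0: "(expk k \<longlongrightarrow> 0) (at_right 0)"
proof -
  have "((\<lambda>t. inverse t ^ k / exp (inverse t :: real)) \<longlongrightarrow> 0) (at_right 0)"
    by (rule filterlim_compose[OF tendsto_power_div_exp_0 filterlim_inverse_at_top_right])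
  then show ?thesis
    by (rule Lim_transform_eventually)
      (auto simp: eventually_at_right_less expk_def exp_minus divide_simps
        intro!: eventually_mono[OF eventually_at_right_less[of 0]])
qed

lemma expk_has_derivative:
  "(expk k has_real_derivative (expk (k + 2) t - real k * expk (k + 1) t)) (at t)"
proof -
  consider "t > 0" | "t < 0" | "t = 0" by linarith
  then show ?thesis
  proof cases
    case 1
    have "((\<lambda>t. exp (- 1 / t) / t ^ k) has_real_derivative (expk (k + 2) t - real k * expk (k + 1) t)) (at t)"
    proof (cases k)
      case 0
      then show ?thesis using 1
        by (auto intro!: derivative_eq_intros simp: expk_def power2_eq_square)
    next
      case (Suc l)
      have "((\<lambda>t. exp (- 1 / t) / t ^ k) has_real_derivative
          ((exp (- 1 / t) * (1 / t\<^sup>2)) * t ^ k - exp (- 1 / t) * (real k * t ^ (k - 1))) / (t ^ k * t ^ k)) (at t)"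
        using 1 by (auto intro!: derivative_eq_intros simp: power2_eq_square)
      moreover have "((exp (- 1 / t) * (1 / t\<^sup>2)) * t ^ k - exp (- 1 / t) * (real k * t ^ (k - 1))) / (t ^ k * t ^ k)
        = expk (k + 2) t - real k * expk (k + 1) t"
        using 1 Suc by (simp add: expk_def divide_simps power_add power2_eq_square) (simp add: algebra_simps)
      ultimately show ?thesis by simp
    qed
    then show ?thesis
      by (rule has_field_derivative_transform_within_open[of _ _ _ "{0<..}"]) (use 1 in \<open>auto simp: expk_def\<close>)
  next
    case 2
    have "((\<lambda>t. 0) has_real_derivative 0) (at t)" by simp
    then have "(expk k has_real_derivative 0) (at t)"
      by (rule has_field_derivative_transform_within_open[of _ _ _ "{..<0}"]) (use 2 in \<open>auto simp: expk_def\<close>)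
    then show ?thesis using 2 by (simp add: expk_def)
  next
    case 3
    \<comment> \<open>At the origin the left difference quotients vanish and the right ones are
      \<open>expk (k + 1) h\<close>, which tends to 0.\<close>
    have "((\<lambda>h. (expk k (0 + h) - expk k 0) / h) \<longlongrightarrow> 0) (at 0)"
      unfolding filterlim_at_split
    proof
      show "((\<lambda>h. (expk k (0 + h) - expk k 0) / h) \<longlongrightarrow> 0) (at_left 0)"
        by (rule Lim_transform_eventually[OF tendsto_const])
          (auto simp: expk_def intro!: eventually_mono[OF eventually_at_left_real[of "-1" 0]])
      show "((\<lambda>h. (expk k (0 + h) - expk k 0) / h) \<longlongrightarrow> 0) (at_right 0)"
        by (rule Lim_transform_eventually[OF expk_tendsto_0[of "k+1"]])
          (auto simp: expk_def intro!: eventually_mono[OF eventually_at_right_less[of 0]])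
    qed
    then show ?thesis unfolding DERIV_def using 3 by (simp add: expk_def)
  qed
qed

lemma smooth_funD:
  fixes f :: "real^'n::finite \<Rightarrow> real"
  assumes "smooth_fun f"
  shows "f differentiable at x" "smooth_fun (partial i f)"
  using assms by (auto elim: smooth_fun.cases simp: differentiable_on_def)

lemma has_derivative_partial:
  fixes f :: "real^'n::finite \<Rightarrow> real"
  assumes "f differentiable at x"
  shows "(f has_derivative (\<lambda>v. \<Sum>i\<in>UNIV. v $ i * partial i f x)) (at x)"
proof -
  have d: "(f has_derivative frechet_derivative f (at x)) (at x)" using assms frechet_derivative_works by blast
  have "frechet_derivative f (at x) v = (\<Sum>i\<in>UNIV. v $ i * partial i f x)" for v
  proof -
    have l: "linear (frechet_derivative f (at x))" using d has_derivative_linear by blast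
    have "v = (\<Sum>i\<in>UNIV. v $ i *\<^sub>R axis i 1)" using basis_expansion[of v] by (simp add: scalar_mult_eq_scaleR)
    then have "frechet_derivative f (at x) v = frechet_derivative f (at x) (\<Sum>i\<in>UNIV. v $ i *\<^sub>R axis i 1)" by simp
    also have "\<dots> = (\<Sum>i\<in>UNIV. v $ i * partial i f x)"
      by (simp add: linear_sum[OF l] linear_cmul[OF l] partial_def)
    finally show ?thesis .
  qed
  then show ?thesis using d by presburger
qed

inductive smooth_gen :: "(real^'n::finite \<Rightarrow> real) \<Rightarrow> bool" where
  comp: "smooth_fun f \<Longrightarrow> polynomial_function (p :: real^'n \<Rightarrow> real^'n) \<Longrightarrow> smooth_gen (\<lambda>x. f (p x))"
| poly: "real_polynomial_function q \<Longrightarrow> smooth_gen q"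
| expk: "real_polynomial_function q \<Longrightarrow> smooth_gen (\<lambda>x. expk k (q x))"
| add: "smooth_gen f \<Longrightarrow> smooth_gen g \<Longrightarrow> smooth_gen (\<lambda>x. f x + g x)"
| mult: "smooth_gen f \<Longrightarrow> smooth_gen g \<Longrightarrow> smooth_gen (\<lambda>x. f x * g x)"

lemma smooth_gen_sum:
  assumes "finite I" "\<And>i. i \<in> I \<Longrightarrow> smooth_gen (f i)"
  shows "smooth_gen (\<lambda>x. \<Sum>i\<in>I. f i x)"
  using assms
  by (induction I rule: finite_induct) (auto intro: smooth_gen.intros real_polynomial_function.intros(2))

text \<open>Chain rule inside the class: partial derivatives of a \<open>smooth_fun\<close> are
  \<open>smooth_fun\<close> again, so their compositions with the same polynomial map are covered by
  the rule \<open>comp\<close>, and the derivative of \<open>expk k\<close> is a combination of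
  \<open>expk (k + 1)\<close> and \<open>expk (k + 2)\<close>.\<close>

lemma smooth_gen_derivative:
  assumes "smooth_gen f"
  shows "\<exists>f'. (\<forall>x. (f has_derivative f' x) (at x)) \<and> (\<forall>v. smooth_gen (\<lambda>x. f' x v))"
  using assms
proof (induction rule: smooth_gen.induct)
  case (comp f p)
  have pi: "real_polynomial_function (\<lambda>x. p x $ i)" for i
    using comp(2) bounded_linear_vec_nth[of i] unfolding polynomial_function_def o_def by blast
  have "\<forall>i. \<exists>q. (\<forall>x. ((\<lambda>x. p x $ i) has_derivative q x) (at x)) \<and> (\<forall>v. real_polynomial_function (\<lambda>x. q x v))"
    using real_polynomial_function_derivative[OF pi] by blast
  then obtain q where q: "\<And>i x. ((\<lambda>x. p x $ i) has_derivative q i x) (at x)"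
    "\<And>i v. real_polynomial_function (\<lambda>x. q i x v)" by metis
  have dp: "(p has_derivative (\<lambda>v. \<chi> i. q i x v)) (at x)" for x
  proof -
    have *: "(p has_derivative frechet_derivative p (at x)) (at x)"
      using differentiable_at_polynomial_function[OF comp(2)] frechet_derivative_works by blast
    have "frechet_derivative p (at x) v = (\<chi> i. q i x v)" for v
    proof (subst vec_eq_iff, intro allI)
      fix i
      have "((\<lambda>x. p x $ i) has_derivative (\<lambda>v. frechet_derivative p (at x) v $ i)) (at x)"
        by (rule bounded_linear.has_derivative[OF bounded_linear_vec_nth *])
      from has_derivative_unique[OF this q(1)[of i x]]
      have "(\<lambda>v. frechet_derivative p (at x) v $ i) = q i x" .
      then show "frechet_derivative p (at x) v $ i = (\<chi> i. q i x v) $ i" by (simp add: fun_eq_iff)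
    qed
    then have "frechet_derivative p (at x) = (\<lambda>v. \<chi> i. q i x v)" by (rule ext)
    with * show ?thesis by simp
  qed
  show ?case
  proof (intro exI[of _ "\<lambda>x v. \<Sum>i\<in>UNIV. q i x v * partial i f (p x)"] conjI allI)
    show "((\<lambda>x. f (p x)) has_derivative (\<lambda>v. \<Sum>i\<in>UNIV. q i x v * partial i f (p x))) (at x)" for x
      using has_derivative_compose[OF dp has_derivative_partial[OF smooth_funD(1)[OF comp(1)]]] by simp
    show "smooth_gen (\<lambda>x. \<Sum>i\<in>UNIV. q i x v * partial i f (p x))" for v
      by (intro smooth_gen_sum smooth_gen.mult smooth_gen.poly q(2) smooth_gen.comp[OF smooth_funD(2)[OF comp(1)] comp(2)]) simp
  qed
next
  case (poly q)
  then show ?case using real_polynomial_function_derivative smooth_gen.poly by metis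
next
  case (expk q k)
  obtain q' where q: "\<And>x. (q has_derivative q' x) (at x)" "\<And>v. real_polynomial_function (\<lambda>x. q' x v)"
    using real_polynomial_function_derivative[OF expk] by blast
  show ?case
  proof (intro exI[of _ "\<lambda>x v. (expk (k + 2) (q x) + (- real k) * expk (k + 1) (q x)) * q' x v"] conjI allI)
    show "((\<lambda>x. expk k (q x)) has_derivative (\<lambda>v. (expk (k + 2) (q x) + (- real k) * expk (k + 1) (q x)) * q' x v)) (at x)" for x
      using has_derivative_compose[OF q(1) expk_has_derivative[of k "q x", unfolded has_field_derivative_def]] by simp
    show "smooth_gen (\<lambda>x. (expk (k + 2) (q x) + (- real k) * expk (k + 1) (q x)) * q' x v)" for v
      by (intro smooth_gen.mult smooth_gen.add smooth_gen.expk smooth_gen.poly expk q(2) real_polynomial_function.intros(2))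
  qed
next
  case (add f g)
  then obtain f' g' where "\<And>x. (f has_derivative f' x) (at x)" "\<And>v. smooth_gen (\<lambda>x. f' x v)"
    "\<And>x. (g has_derivative g' x) (at x)" "\<And>v. smooth_gen (\<lambda>x. g' x v)" by blast
  then show ?case
    by (intro exI[of _ "\<lambda>x v. f' x v + g' x v"]) (auto intro: has_derivative_add smooth_gen.add)
next
  case (mult f g)
  then obtain f' g' where d: "\<And>x. (f has_derivative f' x) (at x)" "\<And>v. smooth_gen (\<lambda>x. f' x v)"
    "\<And>x. (g has_derivative g' x) (at x)" "\<And>v. smooth_gen (\<lambda>x. g' x v)" by blast
  show ?case
    by (intro exI[of _ "\<lambda>x v. f x * g' x v + f' x v * g x"])
      (use d mult(1,2) in \<open>fast intro: has_derivative_mult smooth_gen.add smooth_gen.mult\<close>)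
qed

lemma smooth_gen_smooth:
  assumes "smooth_gen f"
  shows "smooth_fun f"
  using assms
proof (coinduction arbitrary: f)
  case smooth_fun
  obtain f' where f': "\<And>x. (f has_derivative f' x) (at x)" "\<And>v. smooth_gen (\<lambda>x. f' x v)"
    using smooth_gen_derivative[OF smooth_fun] by blast
  have "partial i f = (\<lambda>x. f' x (axis i 1))" for i
    unfolding partial_def by (simp add: frechet_derivative_at[OF f'(1), symmetric])
  moreover have "f differentiable_on UNIV"
    using f'(1) by (auto simp: differentiable_on_def differentiable_def)
  ultimately show ?case using f'(2) by auto
qed

lemma smooth_fun_compose_polynomial:
  "smooth_fun f \<Longrightarrow> polynomial_function (p :: real^'n::finite \<Rightarrow> real^'n) \<Longrightarrow> smooth_fun (\<lambda>x. f (p x))"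
  by (rule smooth_gen_smooth[OF smooth_gen.comp])

lemma smooth_fun_mult:
  fixes f g :: "real^'n::finite \<Rightarrow> real"
  assumes "smooth_fun f" "smooth_fun g"
  shows "smooth_fun (\<lambda>x. f x * g x)"
  by (intro smooth_gen_smooth smooth_gen.mult)
    (use smooth_gen.comp[OF assms(1) polynomial_function_id] smooth_gen.comp[OF assms(2) polynomial_function_id] in simp_all)

lemma smooth_fun_continuous_on:
  assumes "smooth_fun f" shows "continuous_on S f"
  using smooth_funD(1)[OF assms] by (meson continuous_at_imp_continuous_on differentiable_imp_continuous_within)

text \<open>Weierstrass approximation of \<open>\<kappa> / b\<close>, where \<open>b\<close> is a smooth function that is positive
  exactly on the ball of radius \<open>R\<close>.\<close>
lemma smooth_approximation:
  fixes \<kappa> :: "real^'n::finite \<Rightarrow> real"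
  assumes \<kappa>: "continuous_on UNIV \<kappa>" and R: "R0 < R" "0 < R" and supp: "\<And>x. \<kappa> x \<noteq> 0 \<Longrightarrow> norm x \<le> R0"
  obtains \<eta> where "\<And>k::nat. smooth_fun (\<eta> k)" "\<And>k x. R \<le> norm x \<Longrightarrow> \<eta> k x = 0"
    "\<And>k x. \<bar>\<eta> k x - \<kappa> x\<bar> \<le> 1 / real (Suc k)"
proof -
  define b where "b x = expk 0 (R\<^sup>2 - x \<bullet> x)" for x :: "real^'n"
  have bq: "real_polynomial_function (\<lambda>x::real^'n. R\<^sup>2 - x \<bullet> x)"
    unfolding inner_vec_def
    by (intro real_polynomial_function_diff real_polynomial_function_sum real_polynomial_function.intros(2))
      (auto         intro!: real_polynomial_function.intros(4)[OF real_polynomial_function.intros(1) real_polynomial_function.intros(1)] bounded_linear_vec_nth)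
  have b01: "0 \<le> b x" "b x \<le> 1" for x unfolding b_def expk_def by auto
  have bpos: "0 < b x \<longleftrightarrow> norm x < R" for x
  proof -
    have "(norm x)\<^sup>2 < R\<^sup>2 \<longleftrightarrow> norm x < R"
      using R power2_less_imp_less[of "norm x" R] power_strict_mono[of "norm x" R 2] by auto
    then show ?thesis unfolding b_def expk_def by (auto simp: dot_square_norm)
  qed
  have b0: "b x = 0" if "R \<le> norm x" for x using bpos[of x] b01(1)[of x] that by linarith
  have bsm: "smooth_gen b" unfolding b_def by (rule smooth_gen.expk[OF bq])
  have bc: "continuous_on S b" for S by (rule smooth_fun_continuous_on[OF smooth_gen_smooth[OF bsm]])
  define h where "h x = \<kappa> x / b x" for x
  \<comment> \<open>The two open sets cover the space and overlap where \<open>\<kappa>\<close>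
    already vanishes. Outside the ball of radius \<open>R\<close> the quotient is 0 divided by 0,
    hence 0 by convention, in agreement with its value beyond \<open>R0\<close>.\<close>
  have "continuous_on ({x. norm x < R} \<union> {x. R0 < norm x}) h"
  proof (rule continuous_on_open_Un)
    show "open {x::real^'n. norm x < R}" "open {x::real^'n. R0 < norm x}"
      by (auto intro!: open_Collect_less continuous_intros)
    show "continuous_on {x. norm x < R} h" unfolding h_def
      by (rule continuous_on_divide[OF continuous_on_subset[OF \<kappa>] bc]) (use bpos in force)+
    show "continuous_on {x. R0 < norm x} h"
    proof (rule continuous_on_eq[OF continuous_on_const])
      show "0 = h x" if "x \<in> {x. R0 < norm x}" for x using supp[of x] that unfolding h_def by force
    qed
  qed
  moreover have "{x::real^'n. norm x < R} \<union> {x. R0 < norm x} = UNIV" using R by force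
  ultimately have hc: "continuous_on S h" for S using continuous_on_subset by (metis top_greatest)
  have "\<exists>p. real_polynomial_function p \<and> (\<forall>x\<in>cball 0 R. \<bar>h x - p x\<bar> < 1 / real (Suc k))" for k
  proof -
    have pos: "0 < 1 / real (Suc k)" by simp
    obtain g where "real_polynomial_function g" "\<And>x. x \<in> cball 0 R \<Longrightarrow> \<bar>h x - g x\<bar> < 1 / real (Suc k)"
      by (rule Stone_Weierstrass_real_polynomial_function[OF compact_cball hc pos]) (rule that, assumption+)
    then show ?thesis by blast
  qed
  then obtain p where p: "\<And>k. real_polynomial_function (p k)"
    "\<And>k x. x \<in> cball 0 R \<Longrightarrow> \<bar>h x - p k x\<bar> < 1 / real (Suc k)" by metis
  \<comment> \<open>Multiplying the polynomial by \<open>b\<close> cuts its support to the ball and,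
    as \<open>b \<le> 1\<close>, does not enlarge the error.\<close>
  show ?thesis
  proof (rule that[of "\<lambda>k x. p k x * b x"])
    show "smooth_fun (\<lambda>x. p k x * b x)" for k
      by (intro smooth_gen_smooth smooth_gen.mult smooth_gen.poly p(1) bsm)
    show "p k x * b x = 0" if "R \<le> norm x" for k x using b0[OF that] by simp
    fix k x
    show "\<bar>p k x * b x - \<kappa> x\<bar> \<le> 1 / real (Suc k)"
    proof (cases "norm x < R")
      case True
      then have "\<kappa> x = h x * b x" unfolding h_def using bpos[of x] by simp
      then have "\<bar>p k x * b x - \<kappa> x\<bar> = \<bar>h x - p k x\<bar> * b x"
        using b01(1)[of x] by (simp add: left_diff_distrib[symmetric] abs_mult abs_minus_commute)
      also have "\<dots> \<le> 1 / real (Suc k) * 1"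
        using p(2)[of x k] True b01[of x] by (intro mult_mono) auto
      finally show ?thesis by simp
    next
      case False
      then have "\<kappa> x = 0" using supp[of x] R by force
      then show ?thesis using b0[of x] False by simp
    qed
  qed
qed

section \<open>Polynomial group laws\<close>

text \<open>Units of a polynomial ring are constants: on each line through 0 both functions become
  polynomials in one variable, and their degrees add up to 0.\<close>

lemma real_polynomial_function_unit_const:
  fixes f g :: "'a::euclidean_space \<Rightarrow> real"
  assumes f: "real_polynomial_function f" and g: "real_polynomial_function g"
    and fg: "\<And>x. f x * g x = 1"
  shows "f x = f 0"
proof -
  have line: "\<exists>p. \<forall>t. h (t *\<^sub>R x) = poly p t" if h: "real_polynomial_function h" for h :: "'a \<Rightarrow> real"
  proof -
    have "polynomial_function (\<lambda>t::real. t *\<^sub>R x)"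
      by (rule polynomial_function_bounded_linear) (rule bounded_linear_scaleR_left)
    then have "real_polynomial_function (h \<circ> (\<lambda>t::real. t *\<^sub>R x))"
      using real_polynomial_function_compose h by blast
    then obtain a n where "h \<circ> (\<lambda>t::real. t *\<^sub>R x) = (\<lambda>t. \<Sum>i\<le>n. a i * t ^ i)"
      using real_polynomial_function_imp_sum by blast
    then have "h (t *\<^sub>R x) = poly (\<Sum>i\<le>n. monom (a i) i) t" for t
      by (simp add: o_def fun_eq_iff poly_sum poly_monom)
    then show ?thesis by blast
  qed
  obtain p q where p: "\<And>t. f (t *\<^sub>R x) = poly p t" and q: "\<And>t. g (t *\<^sub>R x) = poly q t"
    using line[OF f] line[OF g] by blast
  have "poly (p * q) = poly 1" using fg by (auto simp: fun_eq_iff p[symmetric] q[symmetric])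
  then have pq: "p * q = 1" by (simp only: poly_eq_poly_eq_iff)
  then have "p \<noteq> 0" "q \<noteq> 0" by auto
  then have "degree p = 0" using pq degree_mult_eq[of p q] by simp
  then obtain c where "p = [:c:]" by (rule degree_eq_zeroE)
  then show ?thesis using p[of 1] p[of 0] by simp
qed

lemma polynomial_function_Pair:
  fixes a :: "'a::real_normed_vector \<Rightarrow> 'b::real_normed_vector" and b :: "'a \<Rightarrow> 'c::real_normed_vector"
  assumes "polynomial_function a" "polynomial_function b"
  shows "polynomial_function (\<lambda>x. (a x, b x))"
proof -
  have bl: "bounded_linear (\<lambda>u::'b. (u, 0::'c))" "bounded_linear (\<lambda>u::'c. (0::'b, u))"
    by (intro bounded_linear_Pair bounded_linear_ident bounded_linear_zero)+
  have "polynomial_function (\<lambda>x. (a x, 0) + (0, b x))"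
    using polynomial_function_add[OF polynomial_function_compose[OF assms(1) polynomial_function_bounded_linear[OF bl(1)]]
      polynomial_function_compose[OF assms(2) polynomial_function_bounded_linear[OF bl(2)]]]
    unfolding o_def .
  then show ?thesis by simp
qed

lemma polynomial_function_vec_iff:
  fixes p :: "'a::real_normed_vector \<Rightarrow> real^'n::finite"
  shows "polynomial_function p \<longleftrightarrow> (\<forall>i. real_polynomial_function (\<lambda>x. p x $ i))"
  unfolding polynomial_function_iff_Basis_inner[of p] Basis_vec_def
  by (simp add: inner_axis)

lemma polyfun_real_polynomial_function:
  assumes "polyfun f" shows "real_polynomial_function f"
  using assms
proof (induction rule: polyfun.induct)
  case (pfst i)
  then show ?case
    by (intro real_polynomial_function.intros(1))
      (rule bounded_linear_compose[OF bounded_linear_vec_nth bounded_linear_fst])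
next
  case (psnd i)
  then show ?case
    by (intro real_polynomial_function.intros(1))
      (rule bounded_linear_compose[OF bounded_linear_vec_nth bounded_linear_snd])
qed (auto intro: real_polynomial_function.intros(2,3,4))

text \<open>The algebra of exponential coordinates, separated from the grading so that it can be
  transported to another index type. \<open>one_param\<close> makes straight lines through 0
  one-parameter subgroups, whose right translations are the flows of the left invariant
  fields.\<close>

locale polynomial_group =
  fixes gmul :: "real^'n::finite \<Rightarrow> real^'n \<Rightarrow> real^'n"
  assumes assoc: "gmul (gmul x y) z = gmul x (gmul y z)"
    and left_zero [simp]: "gmul 0 x = x" and right_zero [simp]: "gmul x 0 = x"
    and right_inv [simp]: "gmul x (- x) = 0" and left_inv [simp]: "gmul (- x) x = 0"
    and poly: "polyfun (\<lambda>z. gmul (fst z) (snd z) $ i)"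
    and one_param: "gmul (s *\<^sub>R x) (t *\<^sub>R x) = (s + t) *\<^sub>R x"
begin

text \<open>Unchanged when \<open>x\<close> and \<open>y\<close> are multiplied on the right by the
  same element, and turned into its inverse when they are exchanged.\<close>

definition q :: "real^'n \<Rightarrow> real^'n \<Rightarrow> real^'n" where "q x y = gmul x (- y)"

lemma gmul_cancel [simp]: "gmul (gmul x y) (- y) = x" "gmul (gmul x (- y)) y = x"
  "gmul (- x) (gmul x y) = y" "gmul x (gmul (- x) y) = y"
  by (simp_all add: assoc) (simp_all add: assoc[symmetric])

lemma minus_gmul: "- gmul x y = gmul (- y) (- x)"
proof -
  have "gmul (- gmul x y) (gmul (gmul x y) (gmul (- y) (- x))) = gmul (- y) (- x)" by simp
  moreover have "gmul (gmul x y) (gmul (- y) (- x)) = 0" by (simp add: assoc[symmetric])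
  ultimately show ?thesis by simp
qed

lemma minus_q: "- q x y = q y x"
  by (simp add: q_def minus_gmul)

lemma q_inverse: "gmul (- q x y) x = y" "gmul (q x y) y = x"
  by (simp_all add: q_def minus_gmul assoc)

lemma q_0 [simp]: "q x 0 = x" by (simp add: q_def)

lemma gmul_polynomial:
  fixes a b :: "'a::real_normed_vector \<Rightarrow> real^'n"
  assumes "polynomial_function a" "polynomial_function b"
  shows "polynomial_function (\<lambda>x. gmul (a x) (b x))"
proof -
  have "polynomial_function (\<lambda>z. gmul (fst z) (snd z))"
    unfolding polynomial_function_vec_iff using polyfun_real_polynomial_function[OF poly] by blast
  from polynomial_function_compose[OF polynomial_function_Pair[OF assms] this]
  show ?thesis by (simp add: o_def)
qed

lemma continuous_on_gmul [continuous_intros]: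
  fixes a b :: "'a::topological_space \<Rightarrow> real^'n"
  assumes "continuous_on S a" "continuous_on S b"
  shows "continuous_on S (\<lambda>x. gmul (a x) (b x))"
proof -
  have "polynomial_function (\<lambda>z :: (real^'n) \<times> (real^'n). gmul (fst z) (snd z))"
    by (intro gmul_polynomial polynomial_function_bounded_linear bounded_linear_fst bounded_linear_snd)
  then have "continuous_on T (\<lambda>z. gmul (fst z) (snd z))" for T
    by (rule continuous_on_polymonial_function)
  from continuous_on_compose2[OF this[of UNIV] continuous_on_Pair[OF assms]]
  show ?thesis by simp
qed

lemma continuous_on_q [continuous_intros]:
  "continuous_on S a \<Longrightarrow> continuous_on S b \<Longrightarrow> continuous_on S (\<lambda>x. q (a x) (b x))"
  unfolding q_def by (intro continuous_intros)

text \<open>The Jacobian determinant of a right translation is a polynomial with polynomial inverse,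
  hence constant; so Lebesgue measure is right invariant.\<close>
lemma right_translation_jacobian:
  obtains D where "\<And>x. ((\<lambda>x. gmul x y) has_derivative D x) (at x)" "\<And>x. det (matrix (D x)) = 1"
proof -
  have "\<forall>i. \<exists>p'. (\<forall>z. ((\<lambda>z. gmul (fst z) (snd z) $ i) has_derivative p' z) (at z)) \<and>
      (\<forall>v. real_polynomial_function (\<lambda>z. p' z v))"
    using real_polynomial_function_derivative[OF polyfun_real_polynomial_function[OF poly]] by blast
  then obtain p where "\<forall>i. (\<forall>z. ((\<lambda>z. gmul (fst z) (snd z) $ i) has_derivative p i z) (at z)) \<and>
      (\<forall>v. real_polynomial_function (\<lambda>z. p i z v))" unfolding choice_iff by blast
  then have p: "\<And>i z. ((\<lambda>z. gmul (fst z) (snd z) $ i) has_derivative p i z) (at z)"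
      "\<And>i v. real_polynomial_function (\<lambda>z. p i z v)" by blast+
  define D where "D z v = (\<chi> i. p i z (v, 0))" for z v
  have D: "((\<lambda>x. gmul x y) has_derivative D (x, y)) (at x)" for x y
  proof -
    have "((\<lambda>x. gmul x y $ i) has_derivative (\<lambda>v. p i (x, y) (v, 0))) (at x)" for i
    proof -
      have "((\<lambda>x. (x, y)) has_derivative (\<lambda>v. (v, 0))) (at x)" by (auto intro!: derivative_eq_intros)
      from has_derivative_compose[OF this p(1)[of i "(x, y)"]] show ?thesis by simp
    qed
    then show ?thesis
      unfolding D_def by (subst has_derivative_componentwise_within)
        (auto simp: Basis_vec_def inner_axis)
  qed
  have lin: "linear (D z)" for z using has_derivative_linear[OF D[of "snd z" "fst z"]] by simp
  define J where "J z = det (matrix (D z))" for z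
  have Jpoly: "real_polynomial_function J"
    unfolding J_def det_def matrix_def D_def
    by (intro real_polynomial_function_sum real_polynomial_function.intros(4) real_polynomial_function.intros(2)
        real_polynomial_function_prod) (use p(2) in \<open>auto simp: finite_permutations\<close>)
  \<comment> \<open>Chain rule for the translation by \<open>y\<close> followed by the one by
    \<open>- y\<close>, whose composite is the identity: the Jacobian has a reciprocal of the same
    polynomial kind.\<close>
  have mult: "J z * J (gmul (fst z) (snd z), - snd z) = 1" for z
  proof -
    define x y where "x = fst z" "y = snd z"
    have "((\<lambda>u. gmul (gmul u y) (- y)) has_derivative (\<lambda>v. D (gmul x y, - y) (D (x, y) v))) (at x)"
      by (rule has_derivative_compose[OF D D])
    then have "((\<lambda>u. u) has_derivative (\<lambda>v. D (gmul x y, - y) (D (x, y) v))) (at x)" by simp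
    then have id: "D (gmul x y, - y) \<circ> D (x, y) = id"
      using has_derivative_unique[OF _ has_derivative_ident] by (auto simp: o_def id_def)
    have "J (gmul x y, - y) * J (x, y) = det (matrix (D (gmul x y, - y) \<circ> D (x, y)))"
      unfolding J_def by (simp add: matrix_compose[OF lin lin] det_mul)
    also have "\<dots> = 1" unfolding id by (simp add: matrix_id_mat_1)
    finally show ?thesis by (simp add: x_y_def mult.commute)
  qed
  have Jpoly': "real_polynomial_function (\<lambda>z. J (gmul (fst z) (snd z), - snd z))"
  proof -
    have "polynomial_function (\<lambda>z :: (real^'n) \<times> (real^'n). (gmul (fst z) (snd z), - snd z))"
      by (intro polynomial_function_Pair gmul_polynomial polynomial_function_bounded_linear
          bounded_linear_fst bounded_linear_snd bounded_linear_minus)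
    from real_polynomial_function_compose[OF this Jpoly] show ?thesis by (simp add: o_def)
  qed
  \<comment> \<open>The constant is read off at the origin, where the translation by 0 is the
    identity.\<close>
  have "((\<lambda>x. gmul x 0) has_derivative (\<lambda>v. v)) (at 0)" by simp
  from has_derivative_unique[OF D[of 0 0] this] have "D (0, 0) = (\<lambda>v. v)" .
  then have "J 0 = 1" unfolding J_def by (simp add: zero_prod_def matrix_id_mat_1[unfolded id_def])
  then have "J z = 1" for z
    using real_polynomial_function_unit_const[OF Jpoly Jpoly' mult] by metis
  then show ?thesis using that[of "\<lambda>x. D (x, y)"] D unfolding J_def by blast
qed

lemma borel_measurable_gmul [measurable (raw)]:
  assumes "f \<in> M \<rightarrow>\<^sub>M borel" "g \<in> M \<rightarrow>\<^sub>M borel"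
  shows "(\<lambda>x. gmul (f x) (g x)) \<in> M \<rightarrow>\<^sub>M borel"
proof -
  have "(\<lambda>z. gmul (fst z) (snd z)) \<in> borel_measurable borel"
    by (intro borel_measurable_continuous_onI continuous_intros)
  from measurable_compose[OF borel_measurable_Pair[OF assms] this] show ?thesis by simp
qed

lemma borel_measurable_q [measurable (raw)]:
  assumes "f \<in> M \<rightarrow>\<^sub>M borel" "g \<in> M \<rightarrow>\<^sub>M borel"
  shows "(\<lambda>x. q (f x) (g x)) \<in> M \<rightarrow>\<^sub>M borel"
  unfolding q_def using assms by measurable

end

text \<open>Boxes determine Lebesgue measure. The preimage of a box under translation by
  \<open>y\<close> is its image under translation by \<open>- y\<close>, and this change of
  variables has Jacobian 1.\<close>

lemma lborel_right_invariant_wellorder: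
  fixes gmul :: "real^'n::{finite,wellorder} \<Rightarrow> real^'n::_ \<Rightarrow> real^'n::_"
  assumes "polynomial_group gmul"
  shows "distr lborel borel (\<lambda>x. gmul x y) = lborel"
proof -
  interpret polynomial_group gmul by fact
  show ?thesis
proof (rule lborel_eqI[symmetric])
  fix l u :: "real^'n::_"
  assume lu: "\<And>b. b \<in> Basis \<Longrightarrow> l \<bullet> b \<le> u \<bullet> b"
  obtain D where D: "\<And>x. ((\<lambda>x. gmul x (- y)) has_derivative D x) (at x)" "\<And>x. det (matrix (D x)) = 1"
    using right_translation_jacobian by blast
  have vim: "(\<lambda>x. gmul x y) -` box l u = (\<lambda>x. gmul x (- y)) ` box l u"
    by (auto simp: image_iff) (metis gmul_cancel(1))
  have bl: "box l u \<in> lmeasurable" by simp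
  have ci: "(\<lambda>x. abs (det (matrix (D x)))) integrable_on box l u"
    using integrable_on_const[OF bl] D(2) by simp
  have inj: "inj_on (\<lambda>x. gmul x (- y)) (box l u)"
    by (rule inj_onI) (metis gmul_cancel(2))
  have dw: "\<And>x. x \<in> box l u \<Longrightarrow> ((\<lambda>x. gmul x (- y)) has_derivative D x) (at x within box l u)"
    using D(1) has_derivative_at_withinI by blast
  have bm: "box l u \<in> sets lebesgue" by simp
  have lm: "(\<lambda>x. gmul x (- y)) ` box l u \<in> lmeasurable"
    using measurable_differentiable_image_eq[OF bm dw inj] ci by simp
  have "measure lebesgue ((\<lambda>x. gmul x (- y)) ` box l u) = integral (box l u) (\<lambda>x. \<bar>det (matrix (D x))\<bar>)"
    using measure_differentiable_image_eq[OF bm dw inj] ci by simp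
  also have "\<dots> = measure lebesgue (box l u)" using D(2) by (simp add: lmeasure_integral[OF bl])
  finally have m: "measure lebesgue ((\<lambda>x. gmul x (- y)) ` box l u) = measure lebesgue (box l u)" .
  have "emeasure (distr lborel borel (\<lambda>x. gmul x y)) (box l u) = emeasure lborel ((\<lambda>x. gmul x (- y)) ` box l u)"
    by (subst emeasure_distr) (auto simp: vim)
  also have "\<dots> = emeasure lebesgue ((\<lambda>x. gmul x (- y)) ` box l u)"
  proof -
    have "(\<lambda>x. gmul x y) -` box l u \<inter> space borel \<in> sets borel" by (rule measurable_sets) measurable
    then have "(\<lambda>x. gmul x (- y)) ` box l u \<in> sets borel" by (simp add: vim)
    then show ?thesis by simp
  qed
  also have "\<dots> = emeasure lebesgue (box l u)"
    using m by (simp only: emeasure_eq_measure2[OF lm] emeasure_eq_measure2[OF bl])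
  also have "\<dots> = (\<Prod>b\<in>Basis. (u - l) \<bullet> b)" using lu by (simp add: emeasure_lborel_box)
  finally show "emeasure (distr lborel borel (\<lambda>x. gmul x y)) (box l u) = (\<Prod>b\<in>Basis. (u - l) \<bullet> b)" .
qed simp
qed

section \<open>Well-ordered copies of finite index types\<close>

typedef ('a::finite) ordered_copy = "{..<CARD('a)}"
  by (rule exI[of _ 0]) simp

instantiation ordered_copy :: (finite) linorder
begin
definition "less_eq_ordered_copy (x :: 'a ordered_copy) (y :: 'a ordered_copy) \<longleftrightarrow> Rep_ordered_copy x \<le> Rep_ordered_copy y"
definition "less_ordered_copy (x :: 'a ordered_copy) (y :: 'a ordered_copy) \<longleftrightarrow> Rep_ordered_copy x < Rep_ordered_copy y"
instance
  by standard (auto simp: less_eq_ordered_copy_def less_ordered_copy_def Rep_ordered_copy_inject)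
end

instance ordered_copy :: (finite) wellorder
proof
  fix P :: "'a ordered_copy \<Rightarrow> bool" and a
  assume "\<And>x. (\<And>y. y < x \<Longrightarrow> P y) \<Longrightarrow> P x"
  then show "P a" unfolding less_ordered_copy_def by (rule measure_induct_rule)
qed

instance ordered_copy :: (finite) finite
proof
  have "(UNIV :: 'a ordered_copy set) = Abs_ordered_copy ` {..<CARD('a)}"
    by (rule type_definition.univ[OF type_definition_ordered_copy])
  moreover have "finite (Abs_ordered_copy ` {..<CARD('a)} :: 'a ordered_copy set)" by simp
  ultimately show "finite (UNIV :: 'a ordered_copy set)" by (simp only:)
qed

lemma card_ordered_copy: "CARD('a::finite ordered_copy) = CARD('a)"
  using type_definition.card[OF type_definition_ordered_copy[where 'a='a]] by simp

lemma prod_Basis_vec: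
  fixes x :: "real^'n::finite"
  shows "(\<Prod>b\<in>Basis. x \<bullet> b) = (\<Prod>i\<in>UNIV. x $ i)"
proof -
  have "(\<Prod>b\<in>Basis. x \<bullet> b) = (\<Prod>b\<in>(\<lambda>i. axis i 1) ` UNIV. x \<bullet> b)"
    by (rule prod.cong) (auto simp: Basis_vec_def)
  also have "\<dots> = (\<Prod>i\<in>UNIV. x \<bullet> axis i 1)"
    by (subst prod.reindex) (auto simp: inj_on_def axis_eq_axis)
  finally show ?thesis by (simp add: inner_axis)
qed

text \<open>Renaming coordinates along a bijection permutes the side lengths of a box, so its volume
  is unchanged.\<close>

lemma lborel_distr_reindex:
  fixes h :: "'m::finite \<Rightarrow> 'n::finite"
  assumes h: "bij h"
  shows "distr lborel borel (\<lambda>x::real^'n. \<chi> i. x $ h i) = (lborel :: (real^'m) measure)"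
proof (rule lborel_eqI[symmetric])
  fix l u :: "real^'m"
  assume lu: "\<And>b. b \<in> Basis \<Longrightarrow> l \<bullet> b \<le> u \<bullet> b"
  let ?T = "\<lambda>x::real^'n. \<chi> i. x $ h i"
  define l' u' where "l' = (\<chi> k. l $ inv h k)" "u' = (\<chi> k. u $ inv h k)"
  have [measurable]: "?T \<in> borel_measurable borel"
    by (intro borel_measurable_continuous_onI continuous_intros)
  have vim: "?T -` box l u = box l' u'"
    using h by (auto simp: mem_box_cart l'_u'_def bij_is_surj surj_f_inv_f)
      (metis bij_inv_eq_iff h)+
  have le: "l $ i \<le> u $ i" for i using lu[of "axis i 1"] by (simp add: inner_axis)
  have "emeasure (distr lborel borel ?T) (box l u) = emeasure lborel (box l' u')"
    by (subst emeasure_distr) (auto simp: vim)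
  also have "\<dots> = (\<Prod>k\<in>UNIV. (u' - l') $ k)"
  proof -
    have "l' \<bullet> b \<le> u' \<bullet> b" if "b \<in> Basis" for b
      using that le by (auto simp: Basis_vec_def inner_axis l'_u'_def)
    then show ?thesis by (simp add: emeasure_lborel_box prod_Basis_vec)
  qed
  also have "(\<Prod>k\<in>UNIV. (u' - l') $ k) = (\<Prod>i\<in>UNIV. (u - l) $ i)"
    using prod.reindex_bij_betw[OF bij_imp_bij_inv[OF h], of "\<lambda>i. (u - l) $ i"] by (simp add: l'_u'_def)
  finally show "emeasure (distr lborel borel ?T) (box l u) = (\<Prod>b\<in>Basis. (u - l) \<bullet> b)"
    by (simp add: prod_Basis_vec)
qed simp

context polynomial_group
begin

text \<open>The change of variables theorem of the library needs a well-ordered index type, so the group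
  law is transported to a copy of \<open>real^'n\<close> with such an index type.\<close>
lemma lborel_right_invariant: "distr lborel borel (\<lambda>x. gmul x y) = lborel"
proof -
  obtain h :: "'n \<Rightarrow> 'n ordered_copy" where h: "bij h"
    using finite_same_card_bij[of "UNIV :: 'n set" "UNIV :: 'n ordered_copy set"]
    by (auto simp: card_ordered_copy)
  define T where "T x = (\<chi> i. x $ inv h i)" for x :: "real^'n"
  define S where "S x = (\<chi> k. x $ h k)" for x :: "real^'n ordered_copy"
  have ST [simp]: "S (T x) = x" for x unfolding S_def T_def using h by (simp add: vec_eq_iff bij_is_inj)
  have TS [simp]: "T (S x) = x" for x unfolding S_def T_def using h by (simp add: vec_eq_iff bij_is_surj surj_f_inv_f)
  have Sm: "S (- x) = - S x" "S 0 = 0" "S (c *\<^sub>R x) = c *\<^sub>R S x" for x c unfolding S_def by (simp_all add: vec_eq_iff)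
  have Tm: "T 0 = 0" "T (c *\<^sub>R x) = c *\<^sub>R T x" for x c unfolding T_def by (simp_all add: vec_eq_iff)
  define g' where "g' x y = T (gmul (S x) (S y))" for x y
  have pf: "polyfun f \<Longrightarrow> polyfun (\<lambda>z. f (S (fst z), S (snd z)))" for f
    by (induction rule: polyfun.induct) (auto simp: S_def intro: polyfun.intros)
  have "polynomial_group g'"
  proof
    show "polyfun (\<lambda>z. g' (fst z) (snd z) $ i)" for i
      using pf[OF poly[of "inv h i"]] by (simp add: g'_def T_def)
  qed (simp_all add: g'_def Sm Tm assoc one_param)
  then have inv: "distr lborel borel (\<lambda>x. g' x (T y)) = lborel" by (rule lborel_right_invariant_wellorder)
  have T: "distr lborel borel T = lborel" unfolding T_def[abs_def]
    by (rule lborel_distr_reindex[OF bij_imp_bij_inv[OF h]])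
  have S: "distr lborel borel S = lborel" unfolding S_def[abs_def] by (rule lborel_distr_reindex[OF h])
  have [measurable]: "T \<in> borel_measurable borel" "S \<in> borel_measurable borel" unfolding T_def S_def
    by (intro borel_measurable_continuous_onI continuous_intros)+
  have [measurable]: "(\<lambda>x. g' x (T y)) \<in> borel_measurable borel" unfolding g'_def by measurable
  have "lborel = distr (distr (distr lborel borel T) borel (\<lambda>x. g' x (T y))) borel S"
    by (simp add: T inv S)
  also have "\<dots> = distr lborel borel (\<lambda>x. gmul x y)"
    by (simp add: distr_distr o_def g'_def)
  finally show ?thesis by simp
qed

lemma integral_right_translate:
  fixes f :: "real^'n \<Rightarrow> real"
  assumes "f \<in> borel_measurable borel"
  shows "(\<integral>x. f (gmul x y) \<partial>lborel) = (\<integral>x. f x \<partial>lborel)"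
  using integral_distr[of "\<lambda>x. gmul x y" lborel borel f] assms lborel_right_invariant by simp

lemma integrable_right_translate:
  fixes f :: "real^'n \<Rightarrow> real"
  assumes "integrable lborel f"
  shows "integrable lborel (\<lambda>x. f (gmul x y))"
proof -
  have "f \<in> borel_measurable borel" using borel_measurable_integrable[OF assms] by simp
  then have "integrable (distr lborel borel (\<lambda>x. gmul x y)) f \<longleftrightarrow> integrable lborel (\<lambda>x. f (gmul x y))"
    by (intro integrable_distr_eq) auto
  then show ?thesis using assms lborel_right_invariant by simp
qed

section \<open>Horizontal derivatives of right invariant kernels\<close>

abbreviation E :: "'n \<Rightarrow> real \<Rightarrow> real^'n" where "E j t \<equiv> t *\<^sub>R axis j 1"

text \<open>The map taking \<open>(x, t, y)\<close> to \<open>q (gmul x (E j t)) y\<close> is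
  polynomial. \<open>V i x y\<close> is the \<open>i\<close>-th component of its velocity at
  \<open>t = 0\<close>: it is continuous and independent of \<open>\<eta>\<close>, so derivatives,
  continuity and supports of kernel derivatives can be read off one formula.\<close>

lemma XX_kernel_formula:
  fixes j :: 'n
  obtains V where "\<And>i. continuous_on UNIV (\<lambda>(x, y). V i x y)"
    "\<And>\<eta> x y. smooth_fun \<eta> \<Longrightarrow>
      ((\<lambda>t. \<eta> (q (gmul x (E j t)) y)) has_real_derivative (\<Sum>i\<in>UNIV. V i x y * partial i \<eta> (q x y))) (at 0)"
proof -
  define c where "c w = q (gmul (fst w) (E j (fst (snd w)))) (snd (snd w))" for w :: "(real^'n) \<times> real \<times> (real^'n)"
  have "polynomial_function c" unfolding c_def q_def
    by (intro gmul_polynomial polynomial_function_bounded_linear)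
      (intro bounded_linear_fst bounded_linear_minus bounded_linear_scaleR_left[THEN bounded_linear_compose]
        bounded_linear_compose[OF bounded_linear_fst bounded_linear_snd]
        bounded_linear_compose[OF bounded_linear_snd bounded_linear_snd])+
  then have ci: "real_polynomial_function (\<lambda>w. c w $ i)" for i unfolding polynomial_function_vec_iff by blast
  have "\<forall>i. \<exists>p'. (\<forall>z. ((\<lambda>w. c w $ i) has_derivative p' z) (at z)) \<and>
      (\<forall>v. real_polynomial_function (\<lambda>z. p' z v))"
    using real_polynomial_function_derivative[OF ci] by blast
  then obtain p where "\<forall>i. (\<forall>z. ((\<lambda>w. c w $ i) has_derivative p i z) (at z)) \<and>
      (\<forall>v. real_polynomial_function (\<lambda>z. p i z v))" unfolding choice_iff by blast
  then have p: "\<And>i z. ((\<lambda>w. c w $ i) has_derivative p i z) (at z)"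
      "\<And>i v. real_polynomial_function (\<lambda>z. p i z v)" by blast+
  define V where "V i x y = p i (x, 0, y) (0, 1, 0)" for i x y
  show ?thesis
  proof (rule that[of V])
    fix i
    have "continuous_on UNIV (\<lambda>z. p i z (0, 1, 0))"
      using p(2)[of i "(0, 1, 0)"] continuous_on_polymonial_function real_polynomial_function_eq by blast
    then have "continuous_on UNIV (\<lambda>u :: (real^'n) \<times> (real^'n). p i (fst u, 0, snd u) (0, 1, 0))"
      by (rule continuous_on_compose2) (auto intro!: continuous_intros)
    then show "continuous_on UNIV (\<lambda>(x, y). V i x y)" unfolding V_def by (simp add: case_prod_beta)
  next
    fix \<eta> :: "real^'n \<Rightarrow> real" and x y assume sm: "smooth_fun \<eta>"
    have d: "((\<lambda>t. c (x, t, y)) has_derivative (\<lambda>s. \<chi> i. s * V i x y)) (at 0)"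
    proof -
      have "((\<lambda>t. c (x, t, y) $ i) has_derivative (\<lambda>s. s * V i x y)) (at 0)" for i
      proof -
        have "((\<lambda>t. (x, t, y)) has_derivative (\<lambda>s. (0, s, 0))) (at (0::real))" by (auto intro!: derivative_eq_intros)
        from has_derivative_compose[OF this p(1)[of i "(x, 0, y)"]]
        have "((\<lambda>t. c (x, t, y) $ i) has_derivative (\<lambda>s. p i (x, 0, y) (0, s, 0))) (at 0)" by simp
        moreover have "p i (x, 0, y) (0, s, 0) = s * V i x y" for s
        proof -
          have "p i (x, 0, y) (s *\<^sub>R (0, 1, 0)) = s *\<^sub>R p i (x, 0, y) (0, 1, 0)"
            using has_derivative_linear[OF p(1)] linear_cmul by blast
          then show ?thesis by (simp add: V_def)
        qed
        ultimately show ?thesis by simp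
      qed
      then show ?thesis
        by (subst has_derivative_componentwise_within) (auto simp: Basis_vec_def inner_axis)
    qed
    have c0: "c (x, 0, y) = q x y" unfolding c_def by simp
    from has_derivative_compose[OF d has_derivative_partial[OF smooth_funD(1)[OF sm]]]
    have "((\<lambda>t. \<eta> (c (x, t, y))) has_derivative (\<lambda>s. \<Sum>i\<in>UNIV. s * V i x y * partial i \<eta> (q x y))) (at 0)"
      by (simp add: c0)
    then have "((\<lambda>t. \<eta> (q (gmul x (E j t)) y)) has_derivative (\<lambda>s. \<Sum>i\<in>UNIV. s * V i x y * partial i \<eta> (q x y))) (at 0)"
      by (simp only: c_def fst_conv snd_conv)
    then show "((\<lambda>t. \<eta> (q (gmul x (E j t)) y)) has_real_derivative (\<Sum>i\<in>UNIV. V i x y * partial i \<eta> (q x y))) (at 0)"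
      unfolding has_field_derivative_def
      by (rule has_derivative_eq_rhs) (auto simp: fun_eq_iff sum_distrib_right intro!: sum.cong)
  qed
qed

text \<open>The formula at \<open>t = 0\<close> propagates to every \<open>t\<close> because the
  curves \<open>E j\<close> are one-parameter subgroups. The swap rule is the group identity
  \<open>q x (gmul y (E j t)) = q (gmul x (E j (- t))) y\<close>: moving \<open>y\<close> along the
  field is moving \<open>x\<close> backwards.\<close>

lemma
  fixes \<eta> :: "real^'n \<Rightarrow> real"
  assumes sm: "smooth_fun \<eta>"
  shows XX_kernel_has_derivative:
      "((\<lambda>t. \<eta> (q (gmul x (E j t)) y)) has_real_derivative XX gmul j (\<lambda>x. \<eta> (q x y)) (gmul x (E j t))) (at t)"
    and XX_kernel_continuous: "continuous_on UNIV (\<lambda>(x, y). XX gmul j (\<lambda>x. \<eta> (q x y)) x)"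
    and XX_kernel_swap: "XX gmul j (\<lambda>y. \<eta> (q x y)) y = - XX gmul j (\<lambda>x. \<eta> (q x y)) x"
    and XX_kernel_zero: "(\<And>z. R \<le> norm z \<Longrightarrow> \<eta> z = 0) \<Longrightarrow> R < norm (q x y) \<Longrightarrow> XX gmul j (\<lambda>x. \<eta> (q x y)) x = 0"
proof -
  obtain V where V: "\<And>i. continuous_on UNIV (\<lambda>(x, y). V i x y)"
    and d': "\<And>\<eta> x y. smooth_fun \<eta> \<Longrightarrow>
      ((\<lambda>t. \<eta> (q (gmul x (E j t)) y)) has_real_derivative (\<Sum>i\<in>UNIV. V i x y * partial i \<eta> (q x y))) (at 0)"
    by (rule XX_kernel_formula[of j]) (rule that, assumption+)
  note d = d'[OF sm]
  have XX: "XX gmul j (\<lambda>x. \<eta> (q x y)) x = (\<Sum>i\<in>UNIV. V i x y * partial i \<eta> (q x y))" for x y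
    unfolding XX_def using DERIV_imp_deriv[OF d] by simp
  show "((\<lambda>t. \<eta> (q (gmul x (E j t)) y)) has_real_derivative XX gmul j (\<lambda>x. \<eta> (q x y)) (gmul x (E j t))) (at t)"
  proof -
    have "((\<lambda>s. \<eta> (q (gmul (gmul x (E j t)) (E j s)) y)) has_real_derivative XX gmul j (\<lambda>x. \<eta> (q x y)) (gmul x (E j t))) (at 0)"
      unfolding XX by (rule d)
    then have "((\<lambda>s. \<eta> (q (gmul x (E j (s + t))) y)) has_real_derivative XX gmul j (\<lambda>x. \<eta> (q x y)) (gmul x (E j t))) (at 0)"
      by (simp only: assoc one_param add.commute)
    then show ?thesis using DERIV_shift[of "\<lambda>u. \<eta> (q (gmul x (E j u)) y)" _ 0 t] by simp
  qed
  show "continuous_on UNIV (\<lambda>(x, y). XX gmul j (\<lambda>x. \<eta> (q x y)) x)"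
  proof -
    have "continuous_on UNIV (\<lambda>z. partial i \<eta> (q (fst z) (snd z)))" for i
      by (rule continuous_on_compose2[OF smooth_fun_continuous_on[OF smooth_funD(2)[OF sm], of UNIV]])
        (auto intro!: continuous_intros)
    then show ?thesis unfolding XX case_prod_beta
      using V by (intro continuous_on_sum continuous_on_mult) (simp_all add: case_prod_beta)
  qed
  show "XX gmul j (\<lambda>y. \<eta> (q x y)) y = - XX gmul j (\<lambda>x. \<eta> (q x y)) x"
  proof -
    have e: "q x (gmul y (E j t)) = q (gmul x (E j (- t))) y" for t
      unfolding q_def by (simp add: minus_gmul assoc)
    have "((\<lambda>t. \<eta> (q (gmul x (E j t)) y)) has_real_derivative XX gmul j (\<lambda>x. \<eta> (q x y)) x) (at (- 0))"
      using d[of x y] XX by simp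
    from DERIV_chain2[OF this DERIV_minus[OF DERIV_ident]]
    have "((\<lambda>t. \<eta> (q x (gmul y (E j t)))) has_real_derivative - XX gmul j (\<lambda>x. \<eta> (q x y)) x) (at 0)"
      unfolding e by simp
    then show ?thesis unfolding XX_def[of gmul j "\<lambda>y. \<eta> (q x y)"] by (rule DERIV_imp_deriv)
  qed
  assume z: "\<And>z. R \<le> norm z \<Longrightarrow> \<eta> z = 0" and R: "R < norm (q x y)"
  have "partial i \<eta> (q x y) = 0" for i
  proof -
    have "((\<lambda>_. 0) has_derivative (\<lambda>_. 0)) (at (q x y))" by simp
    then have "(\<eta> has_derivative (\<lambda>_. 0)) (at (q x y))"
      by (rule has_derivative_transform_within_open[of _ _ _ _ "{w. R < norm w}"])
        (use z R in \<open>auto intro!: open_Collect_less continuous_intros\<close>)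
    then have "(\<lambda>_. 0) = frechet_derivative \<eta> (at (q x y))" by (rule frechet_derivative_at)
    then show ?thesis unfolding partial_def by metis
  qed
  then show "XX gmul j (\<lambda>x. \<eta> (q x y)) x = 0" unfolding XX by simp
qed

text \<open>A single function is the kernel at \<open>y = 0\<close>, where
  \<open>q x 0 = x\<close>.\<close>

lemma XX_has_derivative:
  assumes "smooth_fun \<phi>"
  shows "((\<lambda>t. \<phi> (gmul x (E j t))) has_real_derivative XX gmul j \<phi> (gmul x (E j t))) (at t)"
  using XX_kernel_has_derivative[OF assms, of x j 0 t] by simp

lemma XX_continuous:
  assumes "smooth_fun \<phi>"
  shows "continuous_on UNIV (XX gmul j \<phi>)"
proof -
  have "continuous_on UNIV (\<lambda>x. (\<lambda>(x, y). XX gmul j (\<lambda>x. \<phi> (q x y)) x) (x, 0))"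
    by (rule continuous_on_compose2[OF XX_kernel_continuous[OF assms]]) (auto intro!: continuous_intros)
  then show ?thesis by simp
qed

end

section \<open>Mollification\<close>

text \<open>For an indicator the set is shrunk to a closed subset, then cut to a ball to become
  compact, and the indicator of the compact set is approximated by truncated distance functions.
  Sums and limits follow by induction on integrability.\<close>

lemma Cc_dense_L1:
  fixes h :: "'a::euclidean_space \<Rightarrow> real"
  assumes "integrable lborel h" "0 < e"
  shows "\<exists>\<psi> R. continuous_on UNIV \<psi> \<and> (\<forall>x. R < norm x \<longrightarrow> \<psi> x = 0) \<and> integrable lborel \<psi> \<and>
     (\<integral>x. \<bar>h x - \<psi> x\<bar> \<partial>lborel) < e"
  using assms
proof (induction arbitrary: e rule: integrable_induct)
  case (base A c)
  \<comment> \<open>Up to three approximations, each with error below \<open>b\<close>, are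
    multiplied by \<open>c\<close>; the added 1 avoids division by zero for
    \<open>c = 0\<close>.\<close>
  define b where "b = e / (3 * (\<bar>c\<bar> + 1))"
  have b: "b > 0" unfolding b_def using base(3) by simp
  have cb: "\<bar>c\<bar> * b < e / 3"
  proof -
    define D where "D = \<bar>c\<bar> + 1"
    have D: "D > 0" unfolding D_def by simp
    have "\<bar>c\<bar> * b < D * b" by (rule mult_strict_right_mono[OF _ b]) (simp add: D_def)
    also have "D * b = e / 3" unfolding b_def D_def[symmetric] using D by simp
    finally show ?thesis .
  qed
  have A: "A \<in> sets borel" "emeasure lborel A < \<infinity>" using base by auto
  have iA: "integrable lborel (indicat_real B :: 'a \<Rightarrow> real)" if "B \<in> sets borel" "B \<subseteq> A" for B
    using that A emeasure_mono[of B A lborel] by (intro integrable_real_indicator) auto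
  obtain T where T: "closed T" "T \<subseteq> A" "A - T \<in> lmeasurable" "emeasure lebesgue (A - T) < ennreal b"
    using sets_lebesgue_inner_closed[of A b] A b by auto
  have AT: "(\<integral>x. \<bar>indicat_real A x - indicat_real T x\<bar> \<partial>lborel) < b"
  proof -
    have "(\<integral>x. \<bar>indicat_real A x - indicat_real T x\<bar> \<partial>lborel) = (\<integral>x. indicat_real (A - T) x \<partial>lborel)"
      by (rule Bochner_Integration.integral_cong) (use T in \<open>auto simp: indicator_def\<close>)
    also have "\<dots> = measure lborel (A - T)" by simp
    also have "\<dots> < b"
    proof -
      have m: "A - T \<in> sets borel" using T(1) A by auto
      have lt: "emeasure lborel (A - T) < ennreal b" using T(4) m by simp
      then have "emeasure lborel (A - T) = ennreal (measure lborel (A - T))"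
        by (intro emeasure_eq_ennreal_measure) auto
      then show ?thesis using lt by (simp add: ennreal_less_iff)
    qed
    finally show ?thesis .
  qed
  have "(\<lambda>n. \<integral>x. \<bar>indicat_real T x - indicat_real (T \<inter> cball 0 (real n)) x\<bar> \<partial>lborel) \<longlonglongrightarrow> (\<integral>x. 0 \<partial>(lborel :: 'a measure))"
  proof (rule integral_dominated_convergence[of _ _ _ "indicat_real T"])
    show "AE x in lborel. (\<lambda>n. \<bar>indicat_real T x - indicat_real (T \<inter> cball 0 (real n)) x\<bar>) \<longlonglongrightarrow> (0::real)"
    proof (rule AE_I2, rule tendsto_eventually)
      fix x :: 'a
      obtain N :: nat where "norm x \<le> real N" using real_arch_simple by blast
      then show "\<forall>\<^sub>F n in sequentially. \<bar>indicat_real T x - indicat_real (T \<inter> cball 0 (real n)) x\<bar> = (0::real)"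
        by (intro eventually_sequentiallyI[of N]) (auto simp: indicator_def)
    qed
    have [measurable]: "T \<in> sets borel" "cball 0 r \<in> sets borel" for r using T by auto
    show "(\<lambda>x. \<bar>indicat_real T x - indicat_real (T \<inter> cball 0 (real n)) x\<bar>) \<in> borel_measurable lborel" for n
      by measurable
    show "integrable lborel (indicat_real T)" using T by (intro iA) auto
  qed (auto simp: indicator_def)
  then have "\<forall>\<^sub>F n in sequentially. (\<integral>x. \<bar>indicat_real T x - indicat_real (T \<inter> cball 0 (real n)) x\<bar> \<partial>lborel) < b"
    using b by (intro order_tendstoD(2)) auto
  then obtain n where n: "(\<integral>x. \<bar>indicat_real T x - indicat_real (T \<inter> cball 0 (real n)) x\<bar> \<partial>lborel) < b"
    using eventually_happens'[OF sequentially_bot] by blast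
  define K where "K = T \<inter> cball 0 (real n)"
  have K: "compact K" unfolding K_def using T by (simp add: closed_Int_compact)
  have KA: "K \<subseteq> A" "K \<in> sets borel" using T K unfolding K_def by auto
  \<comment> \<open>The empty set is treated apart, with the zero function: the distance to it is 0
    by convention, so the functions \<open>\<psi>\<close> would be 1 everywhere.\<close>
  show ?case
  proof (cases "K = {}")
    case True
    have "(\<integral>x. \<bar>indicat_real A x *\<^sub>R c\<bar> \<partial>lborel) \<le> \<bar>c\<bar> * (\<integral>x. \<bar>indicat_real A x - indicat_real T x\<bar> + \<bar>indicat_real T x - indicat_real K x\<bar> \<partial>lborel)"
      unfolding integral_mult_right_zero[symmetric]
    proof (rule integral_mono)
      show "\<bar>indicat_real A x *\<^sub>R c\<bar> \<le> \<bar>c\<bar> * (\<bar>indicat_real A x - indicat_real T x\<bar> + \<bar>indicat_real T x - indicat_real K x\<bar>)" for x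
        using True by (auto simp: indicator_def)
    qed (use iA[of A] iA[of T] iA[of K] A T KA in \<open>auto simp: abs_mult intro!: integrable_mult_right\<close>)
    also have "\<dots> \<le> \<bar>c\<bar> * (b + b)" using AT n iA[of A] iA[of T] iA[of K] A T KA 
      by (intro mult_left_mono) (auto simp: K_def)
    also have "\<dots> < e" unfolding distrib_left using cb base(3) by linarith
    finally show ?thesis by (intro exI[of _ "\<lambda>_. 0"]) auto
  next
    case False
    define \<psi> where "\<psi> m x = max 0 (1 - real m * infdist x K)" for m :: nat and x
    have \<psi>c: "continuous_on UNIV (\<psi> m)" for m unfolding \<psi>_def by (intro continuous_intros)
    have \<psi>01: "0 \<le> \<psi> m x" "\<psi> m x \<le> 1" for m x unfolding \<psi>_def using infdist_nonneg[of x K] by auto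
    have \<psi>K: "\<psi> m x = 1" if "x \<in> K" for m x unfolding \<psi>_def using that by simp
    have \<psi>0: "\<psi> m x = 0" if "real n + 1 < norm x" "m \<ge> 1" for m x
    proof -
      have "1 \<le> infdist x K"
      proof (subst infdist_notempty[OF False], rule cINF_greatest[OF False])
        fix y assume "y \<in> K"
        then have "norm y \<le> real n" unfolding K_def by simp
        then show "1 \<le> dist x y" using that norm_triangle_ineq2[of x y] by (simp add: dist_norm)
      qed
      then have "1 \<le> real m * infdist x K" using that(2) mult_mono[of 1 "real m" 1 "infdist x K"] by simp
      then show ?thesis unfolding \<psi>_def by simp
    qed
    have icb: "integrable lborel (indicat_real (cball 0 (real n + 1)) :: 'a \<Rightarrow> real)"
      by (intro integrable_real_indicator) (use emeasure_compact_finite[OF compact_cball] in auto)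
    have \<psi>i: "integrable lborel (\<psi> (Suc m))" for m
    proof (rule Bochner_Integration.integrable_bound[OF icb])
      show "AE x in lborel. norm (\<psi> (Suc m) x) \<le> norm (indicat_real (cball 0 (real n + 1)) x :: real)"
        using \<psi>0[of _ "Suc m"] \<psi>01[of "Suc m"] by (intro AE_I2) (auto simp: indicator_def not_le)
    qed (use \<psi>c in \<open>auto intro: borel_measurable_continuous_onI\<close>)
    have "(\<lambda>m. \<integral>x. \<bar>indicat_real K x - \<psi> (Suc m) x\<bar> \<partial>lborel) \<longlonglongrightarrow> (\<integral>x. 0 \<partial>(lborel :: 'a measure))"
    proof (rule integral_dominated_convergence[of _ _ _ "indicat_real (cball 0 (real n + 1))"])
      show "AE x in lborel. (\<lambda>m. \<bar>indicat_real K x - \<psi> (Suc m) x\<bar>) \<longlonglongrightarrow> 0"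
      proof (rule AE_I2, rule tendsto_eventually)
        fix x :: 'a
        show "\<forall>\<^sub>F m in sequentially. \<bar>indicat_real K x - \<psi> (Suc m) x\<bar> = 0"
        proof (cases "x \<in> K")
          case True then show ?thesis by (simp add: \<psi>K)
        next
          case x: False
          have "infdist x K > 0"
            using x K False infdist_nonneg[of x K] in_closed_iff_infdist_zero[of K x] compact_imp_closed
            by (metis less_eq_real_def)
          then obtain M :: nat where "1 < real M * infdist x K" using reals_Archimedean3 by blast
          then have "1 < real (Suc m) * infdist x K" if "m \<ge> M" for m
            using that \<open>infdist x K > 0\<close> by (smt (verit) mult_right_mono of_nat_mono le_SucI)
          then show ?thesis using x by (intro eventually_sequentiallyI[of M]) (simp add: \<psi>_def)
        qed
      qed
      show "AE x in lborel. norm \<bar>indicat_real K x - \<psi> (Suc m) x\<bar> \<le> indicat_real (cball 0 (real n + 1)) x" for m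
      proof (rule AE_I2)
        fix x :: 'a
        show "norm \<bar>indicat_real K x - \<psi> (Suc m) x\<bar> \<le> indicat_real (cball 0 (real n + 1)) x"
        proof (cases "real n + 1 < norm x")
          case True
          then have "x \<notin> K" unfolding K_def by auto
          then show ?thesis using \<psi>0[OF True, of "Suc m"] by simp
        next
          case False
          then show ?thesis using \<psi>01[of "Suc m" x] by (auto simp: indicator_def not_less)
        qed
      qed
    qed (use icb KA \<psi>i in auto)
    then have "\<forall>\<^sub>F m in sequentially. (\<integral>x. \<bar>indicat_real K x - \<psi> (Suc m) x\<bar> \<partial>lborel) < b"
      using b by (intro order_tendstoD(2)) auto
    then obtain m where m: "(\<integral>x. \<bar>indicat_real K x - \<psi> (Suc m) x\<bar> \<partial>lborel) < b"
      using eventually_happens'[OF sequentially_bot] by blast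
    note ii = iA[of A] iA[of T] iA[of K] \<psi>i[of m]
    have "(\<integral>x. \<bar>indicat_real A x *\<^sub>R c - c * \<psi> (Suc m) x\<bar> \<partial>lborel)
      \<le> \<bar>c\<bar> * (\<integral>x. \<bar>indicat_real A x - indicat_real T x\<bar> + \<bar>indicat_real T x - indicat_real K x\<bar> + \<bar>indicat_real K x - \<psi> (Suc m) x\<bar> \<partial>lborel)"
      unfolding integral_mult_right_zero[symmetric]
    proof (rule integral_mono)
      show "\<bar>indicat_real A x *\<^sub>R c - c * \<psi> (Suc m) x\<bar>
          \<le> \<bar>c\<bar> * (\<bar>indicat_real A x - indicat_real T x\<bar> + \<bar>indicat_real T x - indicat_real K x\<bar> + \<bar>indicat_real K x - \<psi> (Suc m) x\<bar>)" for x
      proof -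
        have "\<bar>indicat_real A x *\<^sub>R c - c * \<psi> (Suc m) x\<bar> = \<bar>c\<bar> * \<bar>indicat_real A x - \<psi> (Suc m) x\<bar>"
          by (simp add: abs_mult[symmetric] algebra_simps)
        also have "\<dots> \<le> \<bar>c\<bar> * (\<bar>indicat_real A x - indicat_real T x\<bar> + \<bar>indicat_real T x - indicat_real K x\<bar> + \<bar>indicat_real K x - \<psi> (Suc m) x\<bar>)"
          by (rule mult_left_mono) linarith+
        finally show ?thesis .
      qed
    qed (use ii A T KA in \<open>auto intro!: integrable_mult_right\<close>)
    also have "\<dots> \<le> \<bar>c\<bar> * (b + b + b)" using AT n m ii A T KA 
      by (intro mult_left_mono) (auto simp: K_def)
    also have "\<dots> < e" unfolding distrib_left using cb base(3) by linarith
    finally have "(\<integral>x. \<bar>indicat_real A x *\<^sub>R c - c * \<psi> (Suc m) x\<bar> \<partial>lborel) < e" .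
    then show ?thesis
      by (intro exI[of _ "\<lambda>x. c * \<psi> (Suc m) x"] exI[of _ "real n + 1"])
        (auto simp: \<psi>i \<psi>0 intro!: continuous_intros \<psi>c)
  qed
next
  case (add f g)
  obtain \<psi> R where 1: "continuous_on UNIV \<psi>" "\<And>x. R < norm x \<Longrightarrow> \<psi> x = 0" "integrable lborel \<psi>"
     "(\<integral>x. \<bar>f x - \<psi> x\<bar> \<partial>lborel) < e / 2" using add(3)[of "e/2"] add(5) by auto
  obtain \<omega> S where 2: "continuous_on UNIV \<omega>" "\<And>x. S < norm x \<Longrightarrow> \<omega> x = 0" "integrable lborel \<omega>"
     "(\<integral>x. \<bar>g x - \<omega> x\<bar> \<partial>lborel) < e / 2" using add(4)[of "e/2"] add(5) by auto
  have "(\<integral>x. \<bar>f x + g x - (\<psi> x + \<omega> x)\<bar> \<partial>lborel) \<le> (\<integral>x. \<bar>f x - \<psi> x\<bar> + \<bar>g x - \<omega> x\<bar> \<partial>lborel)"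
    by (rule integral_mono) (use 1 2 add in auto)
  also have "\<dots> < e" using 1 2 add by simp
  finally show ?case using 1 2
    by (intro exI[of _ "\<lambda>x. \<psi> x + \<omega> x"] exI[of _ "max R S"]) (auto intro!: continuous_intros)
next
  case (lim f s)
  have sh: "integrable lborel (\<lambda>x. \<bar>f x - s j x\<bar>)" for j using lim by auto
  have "(\<lambda>j. \<integral>x. \<bar>f x - s j x\<bar> \<partial>lborel) \<longlonglongrightarrow> (\<integral>x. 0 \<partial>(lborel :: 'a measure))"
  proof (rule integral_dominated_convergence[of _ _ _ "\<lambda>x. 3 * \<bar>f x\<bar>"])
    show "AE x in lborel. (\<lambda>j. \<bar>f x - s j x\<bar>) \<longlonglongrightarrow> 0"
    proof (rule AE_I2)
      fix x :: 'a assume "x \<in> space lborel"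
      then have "(\<lambda>j. \<bar>f x - s j x\<bar>) \<longlonglongrightarrow> \<bar>f x - f x\<bar>" by (intro tendsto_intros lim)
      then show "(\<lambda>j. \<bar>f x - s j x\<bar>) \<longlonglongrightarrow> 0" by simp
    qed
    show "AE x in lborel. norm \<bar>f x - s j x\<bar> \<le> 3 * \<bar>f x\<bar>" for j
    proof (rule AE_I2)
      fix x :: 'a assume "x \<in> space lborel"
      then have "\<bar>s j x\<bar> \<le> 2 * \<bar>f x\<bar>" using lim(3)[of x j] by simp
      then show "norm \<bar>f x - s j x\<bar> \<le> 3 * \<bar>f x\<bar>" by simp
    qed
  qed (use lim sh in auto)
  then have "\<forall>\<^sub>F j in sequentially. (\<integral>x. \<bar>f x - s j x\<bar> \<partial>lborel) < e / 2"
    using lim(6) by (intro order_tendstoD(2)) auto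
  then obtain j where j: "(\<integral>x. \<bar>f x - s j x\<bar> \<partial>lborel) < e / 2"
    using eventually_happens'[OF sequentially_bot] by blast
  obtain \<psi> R where 1: "continuous_on UNIV \<psi>" "\<And>x. R < norm x \<Longrightarrow> \<psi> x = 0" "integrable lborel \<psi>"
     "(\<integral>x. \<bar>s j x - \<psi> x\<bar> \<partial>lborel) < e / 2" using lim(5)[of "e/2" j] lim(6) by auto
  have "(\<integral>x. \<bar>f x - \<psi> x\<bar> \<partial>lborel) \<le> (\<integral>x. \<bar>f x - s j x\<bar> + \<bar>s j x - \<psi> x\<bar> \<partial>lborel)"
    by (rule integral_mono) (use 1 lim in auto)
  also have "\<dots> < e" using 1 j lim by simp
  finally show ?case using 1 by blast
qed

text \<open>The radius refers to the Euclidean norm, so that dilations and the homogeneous distance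
  disappear from the estimates; \<open>R\<close> tending to 0 takes the place of
  \<open>\<epsilon>\<close> tending to 0.\<close>

definition mollifier_kernel :: "real \<Rightarrow> ('a::euclidean_space \<Rightarrow> real) \<Rightarrow> bool" where
  "mollifier_kernel R \<kappa> \<longleftrightarrow> continuous_on UNIV \<kappa> \<and> (\<forall>x. 0 \<le> \<kappa> x) \<and> (\<forall>x. \<kappa> (- x) = \<kappa> x) \<and>
     (\<forall>x. R < norm x \<longrightarrow> \<kappa> x = 0) \<and> (\<integral>x. \<kappa> x \<partial>lborel) = 1"

lemma integrable_continuous_bounded_support:
  fixes f :: "'a::euclidean_space \<Rightarrow> real"
  assumes "continuous_on UNIV f" "\<And>x. R < norm x \<Longrightarrow> f x = 0"
  shows "integrable lborel f"
proof -
  have "integrable lborel (\<lambda>x. indicator (cball 0 R) x *\<^sub>R f x)"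
    by (rule borel_integrable_compact) (use continuous_on_subset[OF assms(1)] in auto)
  moreover have "(\<lambda>x. indicator (cball 0 R) x *\<^sub>R f x) = f"
    using assms(2) by (auto simp: indicator_def fun_eq_iff not_le)
  ultimately show ?thesis by simp
qed

context polynomial_group
begin

text \<open>Integration runs over the whole space; functions on \<open>\<Omega>\<close> enter
  extended by zero.\<close>

definition conv :: "(real^'n \<Rightarrow> real) \<Rightarrow> (real^'n \<Rightarrow> real) \<Rightarrow> real^'n \<Rightarrow> real" where
  "conv \<kappa> f x = (\<integral>y. \<kappa> (q x y) * f y \<partial>lborel)"

lemma kernelD:
  assumes "mollifier_kernel R \<kappa>"
  shows "continuous_on S \<kappa>" "0 \<le> \<kappa> x" "\<kappa> (q x y) = \<kappa> (q y x)" "\<And>x. R < norm x \<Longrightarrow> \<kappa> x = 0"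
    "\<kappa> \<in> borel_measurable borel" "integrable lborel \<kappa>"
    "integrable lborel (\<lambda>x. \<kappa> (q x y))" "(\<integral>x. \<kappa> (q x y) \<partial>lborel) = 1"
    "integrable lborel (\<lambda>y. \<kappa> (q x y))" "(\<integral>y. \<kappa> (q x y) \<partial>lborel) = 1"
proof -
  have c: "continuous_on UNIV \<kappa>" and 1: "(\<integral>x. \<kappa> x \<partial>lborel) = 1" and z: "\<And>x. R < norm x \<Longrightarrow> \<kappa> x = 0"
    using assms unfolding mollifier_kernel_def by auto
  show "continuous_on S \<kappa>" "0 \<le> \<kappa> x" "\<And>x. R < norm x \<Longrightarrow> \<kappa> x = 0"
    using assms c continuous_on_subset unfolding mollifier_kernel_def by auto
  show sym: "\<kappa> (q x y) = \<kappa> (q y x)" for x y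
    using assms minus_q[of x y] unfolding mollifier_kernel_def by metis
  show m: "\<kappa> \<in> borel_measurable borel" using c by (rule borel_measurable_continuous_onI)
  show i: "integrable lborel \<kappa>" by (rule integrable_continuous_bounded_support[OF c z])
  show a: "integrable lborel (\<lambda>x. \<kappa> (q x y))" "(\<integral>x. \<kappa> (q x y) \<partial>lborel) = 1" for y
    unfolding q_def using integrable_right_translate[OF i] integral_right_translate[OF m] 1 by auto
  show "integrable lborel (\<lambda>y. \<kappa> (q x y))" "(\<integral>y. \<kappa> (q x y) \<partial>lborel) = 1"
    unfolding sym[of x] by (rule a)+
qed

lemma conv_integrable:
  assumes k: "mollifier_kernel R \<kappa>" and f: "f \<in> borel_measurable borel" "\<And>x. \<bar>f x\<bar> \<le> C"
  shows "integrable lborel (\<lambda>y. \<kappa> (q x y) * f y)"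
  by (rule integrable_bounded_mult[OF _ kernelD(9)[OF k] f]) simp

lemma conv_bound:
  assumes k: "mollifier_kernel R \<kappa>" and f: "f \<in> borel_measurable borel" "\<And>x. \<bar>f x\<bar> \<le> C"
  shows "\<bar>conv \<kappa> f x\<bar> \<le> C"
proof -
  have "\<bar>conv \<kappa> f x\<bar> \<le> (\<integral>y. C * \<kappa> (q x y) \<partial>lborel)" unfolding conv_def
  proof (rule integral_abs_bound_integral[OF conv_integrable[OF k f]])
    show "\<bar>\<kappa> (q x y) * f y\<bar> \<le> C * \<kappa> (q x y)" for y
      using mult_right_mono[OF f(2)[of y] kernelD(2)[OF k, of "q x y"]] kernelD(2)[OF k, of "q x y"]
      by (simp add: abs_mult mult.commute)
  qed (use kernelD(9)[OF k] in auto)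
  then show ?thesis using kernelD(10)[OF k] by simp
qed

lemma conv_measurable [measurable]:
  assumes [measurable]: "\<kappa> \<in> borel_measurable borel" "f \<in> borel_measurable borel"
  shows "conv \<kappa> f \<in> borel_measurable borel"
proof -
  have "(\<lambda>x. \<integral>y. \<kappa> (q x y) * f y \<partial>lborel) \<in> borel_measurable borel"
    by (rule lborel.borel_measurable_lebesgue_integral) measurable
  then show ?thesis unfolding conv_def[abs_def] .
qed

text \<open>Pairing the mollified vector \<open>u\<close> with itself brings \<open>u\<close> under
  the integral, where Cauchy-Schwarz bounds the integrand by \<open>\<kappa>\<close> times
  \<open>L2_set u J * C\<close>; dividing by the norm of \<open>u\<close> gives the bound. Bounding
  the components separately would lose a factor depending on their number.\<close>

lemma conv_vector_bound:
  assumes k: "mollifier_kernel R \<kappa>" and J: "finite J" and f: "\<And>j. j \<in> J \<Longrightarrow> f j \<in> borel_measurable borel"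
    and bd: "\<And>y. sqrt (\<Sum>j\<in>J. (f j y)\<^sup>2) \<le> C"
  shows "sqrt (\<Sum>j\<in>J. (conv \<kappa> (f j) x)\<^sup>2) \<le> C"
proof -
  have fb: "\<bar>f j y\<bar> \<le> C" if "j \<in> J" for j y
  proof -
    have "\<bar>f j y\<bar> \<le> L2_set (\<lambda>j. f j y) J"
      using member_le_L2_set[OF J that, of "\<lambda>j. \<bar>f j y\<bar>"] by (simp add: L2_set_def)
    then show ?thesis using bd[of y] unfolding L2_set_def by linarith
  qed
  define u where "u j = conv \<kappa> (f j) x" for j
  have i: "integrable lborel (\<lambda>y. \<kappa> (q x y) * f j y)" if "j \<in> J" for j
    by (rule conv_integrable[OF k f[OF that] fb[OF that]])
  have "(\<Sum>j\<in>J. (u j)\<^sup>2) = (\<Sum>j\<in>J. u j * (\<integral>y. \<kappa> (q x y) * f j y \<partial>lborel))"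
    unfolding u_def conv_def by (simp add: power2_eq_square)
  also have "\<dots> = (\<integral>y. (\<Sum>j\<in>J. u j * (\<kappa> (q x y) * f j y)) \<partial>lborel)"
    using i by (subst Bochner_Integration.integral_sum) auto
  also have "\<dots> \<le> (\<integral>y. \<kappa> (q x y) * (L2_set u J * C) \<partial>lborel)"
  proof (rule integral_mono)
    fix y
    have "(\<Sum>j\<in>J. u j * f j y) \<le> (\<Sum>j\<in>J. \<bar>u j\<bar> * \<bar>f j y\<bar>)"
      by (rule sum_mono) (metis abs_ge_self abs_mult)
    also have "\<dots> \<le> L2_set u J * L2_set (\<lambda>j. f j y) J" by (rule L2_set_mult_ineq)
    also have "\<dots> \<le> L2_set u J * C" using bd[of y] by (intro mult_left_mono) (auto simp: L2_set_def intro: sum_nonneg)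
    finally have "\<kappa> (q x y) * (\<Sum>j\<in>J. u j * f j y) \<le> \<kappa> (q x y) * (L2_set u J * C)"
      by (rule mult_left_mono) (rule kernelD(2)[OF k])
    then show "(\<Sum>j\<in>J. u j * (\<kappa> (q x y) * f j y)) \<le> \<kappa> (q x y) * (L2_set u J * C)"
      by (simp add: sum_distrib_left mult_ac)
  qed (use i kernelD(9)[OF k] in \<open>auto intro!: Bochner_Integration.integrable_sum\<close>)
  also have "\<dots> = L2_set u J * C" using kernelD(10)[OF k] by simp
  finally have "(L2_set u J)\<^sup>2 \<le> L2_set u J * C"
    unfolding L2_set_def by (simp add: sum_nonneg)
  moreover have "0 \<le> L2_set u J" by (rule L2_set_nonneg)
  moreover have "0 \<le> C" using bd[of 0] by (meson order_trans real_sqrt_ge_zero sum_nonneg zero_le_power2)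
  ultimately have "L2_set u J \<le> C" by (cases "L2_set u J = 0") (auto simp: power2_eq_square)
  then show ?thesis unfolding L2_set_def u_def .
qed

text \<open>Fubini together with the symmetry of the kernel in \<open>x\<close> and
  \<open>y\<close>: mollification is self-adjoint.\<close>

lemma conv_duality:
  assumes k: "mollifier_kernel R \<kappa>" and f: "f \<in> borel_measurable borel" "\<And>x. \<bar>f x\<bar> \<le> C" and h: "integrable lborel h"
  shows "(\<integral>x. conv \<kappa> f x * h x \<partial>lborel) = (\<integral>x. f x * conv \<kappa> h x \<partial>lborel)"
proof -
  have [measurable]: "h \<in> borel_measurable borel" "\<kappa> \<in> borel_measurable borel" "f \<in> borel_measurable borel"
    using borel_measurable_integrable[OF h] kernelD(5)[OF k] f by auto
  have C: "0 \<le> C" using f(2)[of 0] by linarith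
  have "integrable (lborel \<Otimes>\<^sub>M lborel) (\<lambda>(x, y). h x * (\<kappa> (q x y) * f y))"
  proof (rule lborel_pair.Fubini_integrable)
    show "(\<lambda>(x, y). h x * (\<kappa> (q x y) * f y)) \<in> borel_measurable (lborel \<Otimes>\<^sub>M lborel)" by measurable
    have "integrable lborel (\<lambda>x. \<integral>y. norm (h x * (\<kappa> (q x y) * f y)) \<partial>lborel)"
    proof (rule Bochner_Integration.integrable_bound[of _ "\<lambda>x. C * h x"])
      show "(\<lambda>x. \<integral>y. norm (h x * (\<kappa> (q x y) * f y)) \<partial>lborel) \<in> borel_measurable lborel"
        by (rule lborel.borel_measurable_lebesgue_integral) measurable
      show "AE x in lborel. norm (\<integral>y. norm (h x * (\<kappa> (q x y) * f y)) \<partial>lborel) \<le> norm (C * h x)"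
      proof (rule AE_I2)
        fix x
        have "(\<integral>y. norm (h x * (\<kappa> (q x y) * f y)) \<partial>lborel) = \<bar>h x\<bar> * conv \<kappa> (\<lambda>y. \<bar>f y\<bar>) x"
          unfolding conv_def by (simp add: abs_mult kernelD(2)[OF k])
        moreover have "\<bar>conv \<kappa> (\<lambda>y. \<bar>f y\<bar>) x\<bar> \<le> C" by (rule conv_bound[OF k]) (use f in auto)
        moreover have "0 \<le> (\<integral>y. norm (h x * (\<kappa> (q x y) * f y)) \<partial>lborel)"
          by (rule Bochner_Integration.integral_nonneg) simp
        ultimately have "norm (\<integral>y. norm (h x * (\<kappa> (q x y) * f y)) \<partial>lborel)
            = \<bar>h x\<bar> * conv \<kappa> (\<lambda>y. \<bar>f y\<bar>) x" "conv \<kappa> (\<lambda>y. \<bar>f y\<bar>) x \<le> C" by simp_all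
        moreover have "norm (C * h x) = \<bar>h x\<bar> * C" using C by (simp add: abs_mult)
        ultimately show "norm (\<integral>y. norm (h x * (\<kappa> (q x y) * f y)) \<partial>lborel) \<le> norm (C * h x)"
          by (simp only: mult_left_mono[OF _ abs_ge_zero])
      qed
    qed (use h in simp)
    then show "integrable lborel (\<lambda>x. \<integral>y. norm ((\<lambda>(x, y). h x * (\<kappa> (q x y) * f y)) (x, y)) \<partial>lborel)" by simp
    show "AE x in lborel. integrable lborel (\<lambda>y. (\<lambda>(x, y). h x * (\<kappa> (q x y) * f y)) (x, y))"
      using conv_integrable[OF k f] by simp
  qed
  then have "(\<integral>y. \<integral>x. h x * (\<kappa> (q x y) * f y) \<partial>lborel \<partial>lborel) = (\<integral>x. \<integral>y. h x * (\<kappa> (q x y) * f y) \<partial>lborel \<partial>lborel)"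
    by (rule lborel_pair.Fubini_integral)
  moreover have "(\<integral>x. h x * (\<kappa> (q x y) * f y) \<partial>lborel) = f y * conv \<kappa> h y" for y
    unfolding conv_def kernelD(3)[OF k, of y] integral_mult_right_zero[symmetric] by (simp add: mult_ac)
  moreover have "(\<integral>y. h x * (\<kappa> (q x y) * f y) \<partial>lborel) = conv \<kappa> f x * h x" for x
    unfolding conv_def by simp
  ultimately show ?thesis by (simp only:)
qed

text \<open>Uniform continuity of the double product on a compact set, compared with its value at
  \<open>z = v = 0\<close>. The left factor accounts for the support of the kernel, the right one
  for the flow of a field \<open>X_j\<close>.\<close>

lemma gmul_near_identity:
  assumes K: "compact K" and \<delta>: "0 < \<delta>"
  obtains R where "0 < R" "R \<le> 1"
    "\<And>x z v. x \<in> K \<Longrightarrow> norm z \<le> R \<Longrightarrow> norm v \<le> R \<Longrightarrow> dist (gmul (gmul z x) v) x < \<delta>"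
proof -
  let ?S = "cball (0::real^'n) 1 \<times> K \<times> cball (0::real^'n) 1"
  let ?f = "\<lambda>w::(real^'n) \<times> (real^'n) \<times> (real^'n). gmul (gmul (fst w) (fst (snd w))) (snd (snd w))"
  have "uniformly_continuous_on ?S ?f"
    by (intro compact_uniformly_continuous compact_Times K compact_cball continuous_intros)
  then obtain r where r: "r > 0" "\<And>w w'. w \<in> ?S \<Longrightarrow> w' \<in> ?S \<Longrightarrow> dist w' w < r \<Longrightarrow> dist (?f w') (?f w) < \<delta>"
    unfolding uniformly_continuous_on_def using \<delta> by metis
  define R where "R = min 1 (r / 3)"
  show ?thesis
  proof (rule that[of R])
    show "0 < R" "R \<le> 1" unfolding R_def using r by auto
    fix x z v :: "real^'n" assume x: "x \<in> K" and z: "norm z \<le> R" and v: "norm v \<le> R"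
    have "dist (z, x, v) (0, x, 0) \<le> norm z + norm v"
      by (simp add: dist_Pair_Pair sqrt_sum_squares_le_sum)
    also have "\<dots> < r" using z v r(1) unfolding R_def by linarith
    finally have "dist (z, x, v) (0, x, 0) < r" .
    then have "dist (?f (z, x, v)) (?f (0, x, 0)) < \<delta>"
      by (intro r(2)) (use x z v in \<open>auto simp: R_def\<close>)
    then show "dist (gmul (gmul z x) v) x < \<delta>"
      by simp
  qed
qed

lemma Cc_translation_uniform:
  fixes \<psi> :: "real^'n \<Rightarrow> real"
  assumes c: "continuous_on UNIV \<psi>" and supp: "\<And>x. R0 < norm x \<Longrightarrow> \<psi> x = 0" and e: "0 < e"
  obtains R where "0 < R" "\<And>x z. norm z \<le> R \<Longrightarrow> \<bar>\<psi> (gmul z x) - \<psi> x\<bar> \<le> e"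
proof -
  let ?K = "cball (0::real^'n) (R0 + 1)"
  have "uniformly_continuous_on ?K \<psi>"
    by (rule compact_uniformly_continuous) (use c continuous_on_subset in auto)
  then obtain r where r: "r > 0" "\<And>x x'. x \<in> ?K \<Longrightarrow> x' \<in> ?K \<Longrightarrow> dist x' x < r \<Longrightarrow> dist (\<psi> x') (\<psi> x) < e"
    unfolding uniformly_continuous_on_def using e by metis
  obtain R where R: "0 < R"
    "\<And>x z v. x \<in> cball 0 R0 \<Longrightarrow> norm z \<le> R \<Longrightarrow> norm v \<le> R \<Longrightarrow> dist (gmul (gmul z x) v) x < min 1 r"
    by (rule gmul_near_identity[OF compact_cball, of "min 1 r" 0 R0]) (use r in \<open>simp, metis\<close>)
  have near: "\<bar>\<psi> (gmul z x) - \<psi> x\<bar> \<le> e" if x: "x \<in> cball 0 R0" and z: "norm z \<le> R" for x z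
  proof -
    have d: "dist (gmul z x) x < min 1 r" using R(2)[OF x z, of 0] R(1) by simp
    then have "norm (gmul z x) \<le> R0 + 1" using x
      by (smt (verit) dist_norm mem_cball_0 min_less_iff_conj norm_triangle_sub)
    then have "dist (\<psi> (gmul z x)) (\<psi> x) < e" using r(2)[of x "gmul z x"] x d by simp
    then show ?thesis by (simp add: dist_real_def)
  qed
  show ?thesis
  proof (rule that[OF R(1)])
    fix x z :: "real^'n" assume z: "norm z \<le> R"
    consider "x \<in> cball 0 R0" | "gmul z x \<in> cball 0 R0" | "x \<notin> cball 0 R0" "gmul z x \<notin> cball 0 R0" by blast
    then show "\<bar>\<psi> (gmul z x) - \<psi> x\<bar> \<le> e"
    proof cases
      case 1 then show ?thesis by (rule near[OF _ z])
    next
      \<comment> \<open>Here \<open>x\<close> itself may lie outside the ball; the estimate is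
        applied at \<open>gmul z x\<close>, which \<open>- z\<close> moves back to
        \<open>x\<close>.\<close>
      case 2
      from near[OF this, of "- z"] z show ?thesis by (simp add: abs_minus_commute)
    next
      case 3
      then have "\<psi> x = 0" "\<psi> (gmul z x) = 0" using supp by (auto simp: not_le)
      then show ?thesis using e by simp
    qed
  qed
qed

text \<open>The kernel sees only points \<open>y = gmul z x\<close> with
  \<open>norm z \<le> R\<close>, where \<open>\<psi>\<close> is within \<open>e\<close> of its value
  at \<open>x\<close>. So a cutoff commutes with mollification up to a uniform error, and with
  \<open>f = 1\<close> the same estimate compares \<open>\<psi>\<close> with its own
  mollification.\<close>

lemma conv_mult_near:
  assumes k: "mollifier_kernel R \<kappa>" and f: "f \<in> borel_measurable borel" "\<And>x. \<bar>f x\<bar> \<le> C"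
    and \<psi>: "\<psi> \<in> borel_measurable borel" "\<And>x. \<bar>\<psi> x\<bar> \<le> B"
    and near: "\<And>x z. norm z \<le> R \<Longrightarrow> \<bar>\<psi> (gmul z x) - \<psi> x\<bar> \<le> e"
  shows "\<bar>conv \<kappa> (\<lambda>y. \<psi> y * f y) x - \<psi> x * conv \<kappa> f x\<bar> \<le> e * C"
proof -
  have C: "0 \<le> C" using f(2)[of 0] by linarith
  have i1: "integrable lborel (\<lambda>y. \<kappa> (q x y) * f y)" by (rule conv_integrable[OF k f])
  have i2: "integrable lborel (\<lambda>y. \<kappa> (q x y) * (\<psi> y * f y))"
  proof (rule conv_integrable[OF k])
    show "(\<lambda>y. \<psi> y * f y) \<in> borel_measurable borel" using f \<psi> by measurable
    show "\<bar>\<psi> y * f y\<bar> \<le> B * C" for y unfolding abs_mult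
      by (rule mult_mono) (use f(2) \<psi>(2)[of y] in auto)
  qed
  have "conv \<kappa> (\<lambda>y. \<psi> y * f y) x - \<psi> x * conv \<kappa> f x
      = (\<integral>y. \<kappa> (q x y) * (\<psi> y * f y) - \<psi> x * (\<kappa> (q x y) * f y) \<partial>lborel)"
    unfolding conv_def using i1 i2 by simp
  also have "\<bar>\<dots>\<bar> \<le> (\<integral>y. e * C * \<kappa> (q x y) \<partial>lborel)"
  proof (rule integral_abs_bound_integral)
    fix y
    show "\<bar>\<kappa> (q x y) * (\<psi> y * f y) - \<psi> x * (\<kappa> (q x y) * f y)\<bar> \<le> e * C * \<kappa> (q x y)"
    proof (cases "R < norm (q x y)")
      case True then show ?thesis using kernelD(4)[OF k True] by simp
    next
      case False
      then have "\<bar>\<psi> (gmul (- q x y) x) - \<psi> x\<bar> \<le> e" by (intro near) simp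
      then have "\<bar>\<psi> y - \<psi> x\<bar> \<le> e" by (simp add: q_inverse)
      then have "\<bar>\<psi> y - \<psi> x\<bar> * \<bar>f y\<bar> \<le> e * C" using f(2)[of y] by (intro mult_mono) auto
      then have "\<kappa> (q x y) * (\<bar>\<psi> y - \<psi> x\<bar> * \<bar>f y\<bar>) \<le> \<kappa> (q x y) * (e * C)"
        by (rule mult_left_mono) (rule kernelD(2)[OF k])
      moreover have "\<kappa> (q x y) * (\<psi> y * f y) - \<psi> x * (\<kappa> (q x y) * f y) = \<kappa> (q x y) * ((\<psi> y - \<psi> x) * f y)"
        by (simp add: algebra_simps)
      ultimately show ?thesis using kernelD(2)[OF k, of "q x y"] by (simp add: abs_mult mult_ac)
    qed
  qed (use i1 i2 kernelD(9)[OF k] in auto)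
  also have "\<dots> = e * C" using kernelD(10)[OF k] by simp
  finally show ?thesis .
qed

text \<open>Self-adjointness moves the mollification from the bounded \<open>f\<close> to the
  integrable \<open>h\<close>, and density in \<open>L^1\<close> lets \<open>h\<close> be continuous
  with bounded support; its mollifications then converge uniformly and eventually stay in a fixed
  compact set.\<close>

lemma conv_weak_limit:
  assumes k: "\<And>n. mollifier_kernel (R n) (\<kappa> n)" and R: "R \<longlonglongrightarrow> 0"
    and f: "f \<in> borel_measurable borel" "\<And>x. \<bar>f x\<bar> \<le> C" and h: "integrable lborel h"
  shows "(\<lambda>n. \<integral>x. conv (\<kappa> n) f x * h x \<partial>lborel) \<longlonglongrightarrow> (\<integral>x. f x * h x \<partial>lborel)"
proof -
  have C: "0 \<le> C" using f(2)[of 0] by linarith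
  have [measurable]: "f \<in> borel_measurable borel" "\<kappa> n \<in> borel_measurable borel" for n
    using f kernelD(5)[OF k] by auto
  have cm: "conv (\<kappa> n) f \<in> borel_measurable borel" for n by measurable
  have cb: "\<bar>conv (\<kappa> n) f x\<bar> \<le> C" for n x by (rule conv_bound[OF k f])
  have i: "integrable lborel (\<lambda>x. u x * h x)"
    if "u \<in> borel_measurable borel" "\<And>x. \<bar>u x\<bar> \<le> C" "integrable lborel h" for u h :: "real^'n \<Rightarrow> real"
    using integrable_bounded_mult[OF _ that(3,1,2)] by (simp add: mult.commute)
  have diff: "\<bar>(\<integral>x. u x * h x \<partial>lborel) - (\<integral>x. u x * \<psi> x \<partial>lborel)\<bar> \<le> C * (\<integral>x. \<bar>h x - \<psi> x\<bar> \<partial>lborel)"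
    if u: "u \<in> borel_measurable borel" "\<And>x. \<bar>u x\<bar> \<le> C" and \<psi>: "integrable lborel \<psi>" for u \<psi> :: "real^'n \<Rightarrow> real"
  proof -
    have "(\<integral>x. u x * h x \<partial>lborel) - (\<integral>x. u x * \<psi> x \<partial>lborel) = (\<integral>x. u x * h x - u x * \<psi> x \<partial>lborel)"
      using i[OF u h] i[OF u \<psi>] by simp
    also have "\<bar>\<dots>\<bar> \<le> (\<integral>x. C * \<bar>h x - \<psi> x\<bar> \<partial>lborel)"
    proof (rule integral_abs_bound_integral)
      show "\<bar>u x * h x - u x * \<psi> x\<bar> \<le> C * \<bar>h x - \<psi> x\<bar>" for x
        using mult_right_mono[OF u(2)[of x] abs_ge_zero[of "h x - \<psi> x"]]
        by (simp only: right_diff_distrib[symmetric] abs_mult)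
    qed (use i[OF u h] i[OF u \<psi>] h \<psi> in auto)
    finally show ?thesis by simp
  qed
  show ?thesis
  proof (rule LIMSEQ_I)
    fix e :: real assume e: "0 < e"
    define b where "b = e / (4 * (C + 1))"
    have b: "0 < b" unfolding b_def using e C by simp
    have Cb: "C * b < e / 3"
    proof -
      have "C * b = e * (C / (C + 1)) / 4" unfolding b_def by (simp add: mult.commute algebra_simps)
      also have "\<dots> \<le> e * 1 / 4" using e C by (intro divide_right_mono mult_left_mono) auto
      finally show ?thesis using e by simp
    qed
    obtain \<psi> R0 where \<psi>: "continuous_on UNIV \<psi>" "\<And>x. R0 < norm x \<Longrightarrow> \<psi> x = 0" "integrable lborel \<psi>"
       "(\<integral>x. \<bar>h x - \<psi> x\<bar> \<partial>lborel) < b" using Cc_dense_L1[OF h b] by blast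
    have lim\<psi>: "(\<lambda>n. \<integral>x. conv (\<kappa> n) f x * \<psi> x \<partial>lborel) \<longlonglongrightarrow> (\<integral>x. f x * \<psi> x \<partial>lborel)"
    proof -
      \<comment> \<open>A compact set containing the support of \<open>\<psi>\<close> and of all its
        mollifications with radius at most 1; its finite volume turns uniform convergence into
        convergence of the integrals.\<close>
      define B where "B = (\<lambda>w. gmul (fst w) (snd w)) ` (cball 0 1 \<times> cball 0 R0) \<union> cball 0 R0"
      have "compact B" unfolding B_def
        by (intro compact_Un compact_continuous_image compact_Times compact_cball continuous_intros)
      then have Bm: "B \<in> sets borel" and Bf: "emeasure lborel B < \<infinity>"
        using emeasure_compact_finite by (auto intro: borel_closed compact_imp_closed)
      have iB: "integrable lborel (indicator B :: _ \<Rightarrow> real)"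
        using Bm Bf by (intro integrable_real_indicator) auto
      have "bounded (range \<psi>)"
      proof -
        have "compact (\<psi> ` cball 0 R0)"
          by (rule compact_continuous_image[OF continuous_on_subset[OF \<psi>(1)]]) auto
        then have "bounded (insert 0 (\<psi> ` cball 0 R0))" by (simp add: compact_imp_bounded)
        moreover have "range \<psi> \<subseteq> insert 0 (\<psi> ` cball 0 R0)" using \<psi>(2) by (force simp: not_le)
        ultimately show ?thesis by (rule bounded_subset)
      qed
      then obtain Bd where Bd: "\<And>x. \<bar>\<psi> x\<bar> \<le> Bd" unfolding bounded_iff by auto
      have \<psi>m: "\<psi> \<in> borel_measurable borel" using \<psi>(1) by (rule borel_measurable_continuous_onI)
      have "(\<lambda>n. (\<integral>x. f x * conv (\<kappa> n) \<psi> x \<partial>lborel) - (\<integral>x. f x * \<psi> x \<partial>lborel)) \<longlonglongrightarrow> 0"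
      proof (rule LIMSEQ_I)
        fix e' :: real assume e': "0 < e'"
        define D where "D = C * measure lborel B + 1"
        have D: "0 < D" unfolding D_def using C by (intro add_nonneg_pos) auto
        define a where "a = e' / (2 * D)"
        have a: "0 < a" unfolding a_def using e' D by (intro divide_pos_pos) auto
        obtain r where r: "0 < r" "\<And>x z. norm z \<le> r \<Longrightarrow> \<bar>\<psi> (gmul z x) - \<psi> x\<bar> \<le> a"
          using Cc_translation_uniform[OF \<psi>(1,2) a] by blast
        have "\<forall>\<^sub>F n in sequentially. R n < min 1 r" using order_tendstoD(2)[OF R, of "min 1 r"] r by simp
        then obtain N where N: "\<And>n. n \<ge> N \<Longrightarrow> R n < min 1 r" unfolding eventually_sequentially by blast
        show "\<exists>no. \<forall>n\<ge>no. norm ((\<integral>x. f x * conv (\<kappa> n) \<psi> x \<partial>lborel) - (\<integral>x. f x * \<psi> x \<partial>lborel) - 0) < e'"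
        proof (intro exI[of _ N] allI impI)
          fix n assume n: "n \<ge> N"
          \<comment> \<open>With \<open>f = 1\<close> the estimate \<open>conv_mult_near\<close>
            compares \<open>conv (\<kappa> n) \<psi>\<close> with \<open>\<psi>\<close> itself, as
            the kernels have integral 1.\<close>
          have c1: "conv (\<kappa> n) (\<lambda>_. 1) x = 1" for x unfolding conv_def using kernelD(10)[OF k] by simp
          have near: "\<bar>conv (\<kappa> n) \<psi> x - \<psi> x\<bar> \<le> a" for x
            using conv_mult_near[OF k[of n], of "\<lambda>_. 1" 1 \<psi> Bd a x] r(2) N[OF n] Bd \<psi>m by (force simp: c1)
          have zero: "conv (\<kappa> n) \<psi> x - \<psi> x = 0" if x: "x \<notin> B" for x
          proof -
            have "\<psi> x = 0" using x \<psi>(2) unfolding B_def by (auto simp: not_le)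
            moreover have "\<kappa> n (q x y) * \<psi> y = 0" for y
            proof (rule ccontr)
              assume "\<kappa> n (q x y) * \<psi> y \<noteq> 0"
              then have "norm (q x y) \<le> 1" "norm y \<le> R0"
                using kernelD(4)[OF k, of n "q x y"] \<psi>(2)[of y] N[OF n] by fastforce+
              then have "gmul (q x y) y \<in> B" unfolding B_def by (intro UnI1 image_eqI[of _ _ "(q x y, y)"]) auto
              then show False using x by (simp add: q_inverse)
            qed
            ultimately show ?thesis unfolding conv_def by (simp only: Bochner_Integration.integral_zero diff_0_right)
          qed
          have m: "conv (\<kappa> n) \<psi> \<in> borel_measurable borel" using \<psi>m by measurable
          have ip: "integrable lborel (\<lambda>x. f x * \<psi> x)" by (rule i[OF f \<psi>(3)])
          have idf: "integrable lborel (\<lambda>x. f x * (conv (\<kappa> n) \<psi> x - \<psi> x))"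
          proof (rule Bochner_Integration.integrable_bound[of _ "\<lambda>x. (C * a) * indicator B x"])
            show "AE x in lborel. norm (f x * (conv (\<kappa> n) \<psi> x - \<psi> x)) \<le> norm (C * a * indicator B x)"
            proof (rule AE_I2)
              fix x
              show "norm (f x * (conv (\<kappa> n) \<psi> x - \<psi> x)) \<le> norm (C * a * indicator B x)"
                using zero[of x] mult_mono[OF f(2)[of x] near[of x] C abs_ge_zero] C a
                by (cases "x \<in> B") (auto simp: abs_mult)
            qed
          qed (use iB m \<psi>m in auto)
          have ic: "integrable lborel (\<lambda>x. f x * conv (\<kappa> n) \<psi> x)"
            using Bochner_Integration.integrable_add[OF ip idf] by (simp add: algebra_simps)
          have "\<bar>(\<integral>x. f x * conv (\<kappa> n) \<psi> x \<partial>lborel) - (\<integral>x. f x * \<psi> x \<partial>lborel)\<bar>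
              = \<bar>\<integral>x. f x * (conv (\<kappa> n) \<psi> x - \<psi> x) \<partial>lborel\<bar>"
            using ic ip by (simp add: right_diff_distrib)
          also have "\<dots> \<le> (\<integral>x. (C * a) * indicator B x \<partial>lborel)"
          proof (rule integral_abs_bound_integral[OF idf])
            show "\<bar>f x * (conv (\<kappa> n) \<psi> x - \<psi> x)\<bar> \<le> C * a * indicator B x" for x
              using zero[of x] mult_mono[OF f(2)[of x] near[of x] C abs_ge_zero]
              by (cases "x \<in> B") (auto simp: abs_mult)
          qed (use iB in auto)
          also have "\<dots> = a * (C * measure lborel B)" by simp
          also have "\<dots> < e'"
          proof -
            have "a * (C * measure lborel B) \<le> a * D" using a unfolding D_def by simp
            also have "\<dots> = e' / 2" unfolding a_def using D by simp
            finally show ?thesis using e' by simp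
          qed
          finally show "norm ((\<integral>x. f x * conv (\<kappa> n) \<psi> x \<partial>lborel) - (\<integral>x. f x * \<psi> x \<partial>lborel) - 0) < e'" by simp
        qed
      qed
      then have "(\<lambda>n. \<integral>x. f x * conv (\<kappa> n) \<psi> x \<partial>lborel) \<longlonglongrightarrow> (\<integral>x. f x * \<psi> x \<partial>lborel)"
        by (simp add: LIM_zero_iff)
      then show ?thesis by (simp add: conv_duality[OF k f \<psi>(3)])
    qed
    obtain N where N: "\<And>n. n \<ge> N \<Longrightarrow> norm ((\<integral>x. conv (\<kappa> n) f x * \<psi> x \<partial>lborel) - (\<integral>x. f x * \<psi> x \<partial>lborel)) < e / 3"
      using LIMSEQ_D[OF lim\<psi>, of "e/3"] e by auto
    have Cd: "C * (\<integral>x. \<bar>h x - \<psi> x\<bar> \<partial>lborel) < e / 3"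
      using mult_left_mono[OF less_imp_le[OF \<psi>(4)] C] Cb by linarith
    show "\<exists>no. \<forall>n\<ge>no. norm ((\<integral>x. conv (\<kappa> n) f x * h x \<partial>lborel) - (\<integral>x. f x * h x \<partial>lborel)) < e"
    proof (intro exI[of _ N] allI impI)
      fix n assume "n \<ge> N"
      from N[OF this] diff[OF cm cb \<psi>(3), of n] diff[OF f \<psi>(3)] Cd
      show "norm ((\<integral>x. conv (\<kappa> n) f x * h x \<partial>lborel) - (\<integral>x. f x * h x \<partial>lborel)) < e"
        unfolding real_norm_def by linarith
    qed
  qed
qed

end

section \<open>A Gauss-Green formula\<close>

text \<open>Integrations against |div F|, |D_j g| and Lebesgue measure are exchanged repeatedly. A
  bounded Borel integrand that vanishes off a product of sets of finite measure is integrable for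
  the product measure, and its sections are bounded with support of finite measure.\<close>

lemma Fubini_bounded_support:
  fixes M :: "'a::second_countable_topology measure" and N :: "'b::second_countable_topology measure"
    and u :: "'a \<Rightarrow> 'b \<Rightarrow> real"
  assumes M: "sigma_finite_measure M" "sets M = sets borel" and N: "sigma_finite_measure N" "sets N = sets borel"
    and u: "(\<lambda>z. u (fst z) (snd z)) \<in> borel_measurable borel"
    and K: "K \<in> sets borel" "emeasure M K < \<infinity>" and Z: "Z \<in> sets borel" "emeasure N Z < \<infinity>"
    and bd: "\<And>x y. \<bar>u x y\<bar> \<le> B" and zero: "\<And>x y. x \<notin> K \<or> y \<notin> Z \<Longrightarrow> u x y = 0"
  shows "(\<integral>x. (\<integral>y. u x y \<partial>N) \<partial>M) = (\<integral>y. (\<integral>x. u x y \<partial>M) \<partial>N)"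
    and "integrable M (\<lambda>x. \<integral>y. u x y \<partial>N)" and "integrable N (\<lambda>y. \<integral>x. u x y \<partial>M)"
    and "\<And>x. integrable N (\<lambda>y. u x y)" and "\<And>y. integrable M (\<lambda>x. u x y)"
proof -
  interpret pair_sigma_finite M N by (intro pair_sigma_finite.intro M N)
  have sets: "sets (M \<Otimes>\<^sub>M N) = sets borel"
  proof -
    have "sets ((borel :: 'a measure) \<Otimes>\<^sub>M (borel :: 'b measure)) = sets borel"
      by (simp only: borel_prod)
    then show ?thesis using sets_pair_measure_cong[OF M(2) N(2)] by simp
  qed
  have um: "(\<lambda>z. u (fst z) (snd z)) \<in> borel_measurable (M \<Otimes>\<^sub>M N)"
    using u by (simp add: measurable_cong_sets[OF sets refl])
  have KZ: "K \<in> sets M" "Z \<in> sets N" using K Z M N by auto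
  have iKZ: "integrable (M \<Otimes>\<^sub>M N) (indicat_real (K \<times> Z))"
  proof (rule integrable_real_indicator)
    show "K \<times> Z \<in> sets (M \<Otimes>\<^sub>M N)" using KZ by simp
    show "emeasure (M \<Otimes>\<^sub>M N) (K \<times> Z) < \<infinity>"
      using K Z by (simp add: M2.emeasure_pair_measure_Times[OF KZ] ennreal_mult_less_top)
  qed
  have i: "integrable (M \<Otimes>\<^sub>M N) (\<lambda>z. u (fst z) (snd z))"
  proof (rule Bochner_Integration.integrable_bound[OF _ um])
    show "integrable (M \<Otimes>\<^sub>M N) (\<lambda>z. B * indicat_real (K \<times> Z) z)" using iKZ by simp
    show "AE z in M \<Otimes>\<^sub>M N. norm (u (fst z) (snd z)) \<le> norm (B * indicat_real (K \<times> Z) z)"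
    proof (rule AE_I2)
      fix z :: "'a \<times> 'b"
      show "norm (u (fst z) (snd z)) \<le> norm (B * indicat_real (K \<times> Z) z)"
        using bd[of "fst z" "snd z"] zero[of "fst z" "snd z"]
        by (cases "fst z \<in> K \<and> snd z \<in> Z") (auto simp: indicator_def mem_Times_iff)
    qed
  qed
  then have i': "integrable (M \<Otimes>\<^sub>M N) (\<lambda>(x, y). u x y)" by (simp only: case_prod_unfold)
  show "(\<integral>x. (\<integral>y. u x y \<partial>N) \<partial>M) = (\<integral>y. (\<integral>x. u x y \<partial>M) \<partial>N)"
    using Fubini_integral[OF i'] by simp
  show "integrable M (\<lambda>x. \<integral>y. u x y \<partial>N)" using integrable_fst[OF i'] by simp
  show "integrable N (\<lambda>y. \<integral>x. u x y \<partial>M)" using integrable_snd[OF i'] by simp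
  note mcM = measurable_cong_sets[OF M(2) refl] and mcN = measurable_cong_sets[OF N(2) refl]
  show "integrable N (\<lambda>y. u x y)" for x
  proof (rule Bochner_Integration.integrable_bound[of _ "\<lambda>y. B * indicat_real Z y"])
    show "integrable N (\<lambda>y. B * indicat_real Z y)"
      using KZ Z by (intro integrable_mult_right integrable_real_indicator) auto
    have "(\<lambda>y. (\<lambda>z. u (fst z) (snd z)) (x, y)) \<in> borel_measurable borel"
      by (rule measurable_compose[OF _ u]) (auto intro!: borel_measurable_continuous_onI continuous_intros)
    then show "(\<lambda>y. u x y) \<in> borel_measurable N" by (simp add: mcN)
    show "AE y in N. norm (u x y) \<le> norm (B * indicat_real Z y)"
    proof (rule AE_I2)
      fix y show "norm (u x y) \<le> norm (B * indicat_real Z y)"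
        using bd[of x y] zero[of x y] by (cases "y \<in> Z") auto
    qed
  qed
  show "integrable M (\<lambda>x. u x y)" for y
  proof (rule Bochner_Integration.integrable_bound[of _ "\<lambda>x. B * indicat_real K x"])
    show "integrable M (\<lambda>x. B * indicat_real K x)"
      using KZ K by (intro integrable_mult_right integrable_real_indicator) auto
    have "(\<lambda>x. (\<lambda>z. u (fst z) (snd z)) (x, y)) \<in> borel_measurable borel"
      by (rule measurable_compose[OF _ u]) (auto intro!: borel_measurable_continuous_onI continuous_intros)
    then show "(\<lambda>x. u x y) \<in> borel_measurable M" by (simp add: mcM)
    show "AE x in M. norm (u x y) \<le> norm (B * indicat_real K x)"
    proof (rule AE_I2)
      fix x show "norm (u x y) \<le> norm (B * indicat_real K x)"
        using bd[of x y] zero[of x y] by (cases "x \<in> K") auto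
    qed
  qed
qed

text \<open>The estimates are required only where the weight is nonzero, because mollified functions
  are approximated uniformly on compact sets only.\<close>

lemma integral_tendsto_uniform:
  fixes w :: "'a::topological_space \<Rightarrow> real"
  assumes M: "sets M = sets borel" and w: "integrable M w"
    and u: "\<And>n. u n \<in> borel_measurable borel" "v \<in> borel_measurable borel" 
    and bd: "\<And>x. w x \<noteq> 0 \<Longrightarrow> \<bar>v x\<bar> \<le> B"
    and lim: "\<And>n x. w x \<noteq> 0 \<Longrightarrow> \<bar>u n x - v x\<bar> \<le> c / real (Suc n)"
  shows "(\<lambda>n. \<integral>x. w x * u n x \<partial>M) \<longlonglongrightarrow> (\<integral>x. w x * v x \<partial>M)"
proof (rule integral_dominated_convergence[of _ _ _ "\<lambda>x. (\<bar>B\<bar> + \<bar>c\<bar>) * \<bar>w x\<bar>"])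
  note mc = measurable_cong_sets[OF M refl]
  have uM: "u n \<in> borel_measurable M" "v \<in> borel_measurable M" for n using u by (simp_all add: mc)
  show "(\<lambda>x. w x * v x) \<in> borel_measurable M" "\<And>n. (\<lambda>x. w x * u n x) \<in> borel_measurable M"
    using uM w by auto
  show "integrable M (\<lambda>x. (\<bar>B\<bar> + \<bar>c\<bar>) * \<bar>w x\<bar>)" using w by auto
  have c: "(\<lambda>n. c / real (Suc n)) \<longlonglongrightarrow> 0"
    using tendsto_mult_right_zero[OF LIMSEQ_inverse_real_of_nat, of c] by (simp add: divide_inverse)
  show "AE x in M. (\<lambda>n. w x * u n x) \<longlonglongrightarrow> w x * v x"
  proof (rule AE_I2)
    fix x
    show "(\<lambda>n. w x * u n x) \<longlonglongrightarrow> w x * v x"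
    proof (cases "w x = 0")
      case False
      have "(\<lambda>n. u n x - v x) \<longlonglongrightarrow> 0"
        by (rule Lim_null_comparison[OF _ c]) (use lim[OF False] in auto)
      then have "(\<lambda>n. u n x) \<longlonglongrightarrow> v x" by (simp add: LIM_zero_iff)
      then show ?thesis by (rule tendsto_mult_left)
    qed simp
  qed
  show "AE x in M. norm (w x * u n x) \<le> (\<bar>B\<bar> + \<bar>c\<bar>) * \<bar>w x\<bar>" for n
  proof (rule AE_I2)
    fix x
    show "norm (w x * u n x) \<le> (\<bar>B\<bar> + \<bar>c\<bar>) * \<bar>w x\<bar>"
    proof (cases "w x = 0")
      case False
      have "c / real (Suc n) \<le> \<bar>c\<bar>"
        using divide_left_mono[of 1 "real (Suc n)" "\<bar>c\<bar>"] divide_right_mono[OF abs_ge_self[of c], of "real (Suc n)"] by simp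
      then have "\<bar>u n x\<bar> \<le> \<bar>B\<bar> + \<bar>c\<bar>" using lim[OF False, of n] bd[OF False] by linarith
      then show ?thesis using mult_left_mono[OF _ abs_ge_zero[of "w x"]] by (simp add: abs_mult mult.commute[of _ "\<bar>w x\<bar>"])
    qed simp
  qed
qed

lemma finite_measure_integrable_bounded:
  assumes m: "finite_measure m" "sets m = sets borel" and f: "f \<in> borel_measurable borel" "\<And>x. \<bar>f x\<bar> \<le> (C::real)"
  shows "integrable m f"
proof -
  interpret finite_measure m by fact
  show ?thesis by (rule integrable_const_bound[of _ C])
    (use f in \<open>auto simp: measurable_cong_sets[OF m(2) refl]\<close>)
qed

lemma measure_integral_uniform:
  fixes a b :: "'a::euclidean_space \<Rightarrow> real"
  assumes m: "finite_measure m" "sets m = sets borel" and th: "\<theta> \<in> borel_measurable borel" "\<And>x. \<bar>\<theta> x\<bar> = 1"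
    and a: "a \<in> borel_measurable borel" "\<And>x. \<bar>a x\<bar> \<le> A" and b: "b \<in> borel_measurable borel" "\<And>x. \<bar>b x\<bar> \<le> A"
    and ab: "\<And>x. \<bar>a x - b x\<bar> \<le> c"
  shows "\<bar>(\<integral>y. \<theta> y * a y \<partial>m) - (\<integral>y. \<theta> y * b y \<partial>m)\<bar> \<le> c * measure m UNIV"
proof -
  interpret finite_measure m by fact
  have sp: "space m = UNIV" using sets_eq_imp_space_eq[OF m(2)] by simp
  have i: "integrable m (\<lambda>y. \<theta> y * a y)" "integrable m (\<lambda>y. \<theta> y * b y)"
    by (rule finite_measure_integrable_bounded[OF m, of _ A], use th a b in \<open>auto simp: abs_mult\<close>)+
  have "\<bar>(\<integral>y. \<theta> y * a y \<partial>m) - (\<integral>y. \<theta> y * b y \<partial>m)\<bar> = \<bar>\<integral>y. \<theta> y * a y - \<theta> y * b y \<partial>m\<bar>" using i by simp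
  also have "\<dots> \<le> (\<integral>y. c \<partial>m)"
  proof (rule integral_abs_bound_integral)
    show "\<bar>\<theta> y * a y - \<theta> y * b y\<bar> \<le> c" for y
      using ab[of y] th(2)[of y] by (simp add: right_diff_distrib[symmetric] abs_mult)
  qed (use i in auto)
  finally show ?thesis by (simp add: sp mult.commute)
qed

lemma compact_continuous_bound:
  fixes f :: "'a::topological_space \<Rightarrow> real"
  assumes "compact S" "continuous_on S f"
  obtains B where "\<And>x. x \<in> S \<Longrightarrow> \<bar>f x\<bar> \<le> B"
proof -
  have "bounded (f ` S)" using assms by (intro compact_imp_bounded compact_continuous_image)
  then obtain B where "\<forall>v\<in>f ` S. norm v \<le> B" unfolding bounded_iff by blast
  then show ?thesis by (intro that[of B]) simp
qed

lemma testfunD: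
  assumes "testfun \<Omega> \<phi>"
  shows "smooth_fun \<phi>" "compact (closure {x. \<phi> x \<noteq> 0})" "closure {x. \<phi> x \<noteq> 0} \<subseteq> \<Omega>"
  using assms unfolding testfun_def csupp_in_def by auto

lemma testfunI:
  assumes "smooth_fun \<phi>" "compact K" "K \<subseteq> \<Omega>" "\<And>x. \<phi> x \<noteq> 0 \<Longrightarrow> x \<in> K"
  shows "testfun \<Omega> \<phi>"
proof -
  have "closure {x. \<phi> x \<noteq> 0} \<subseteq> K"
    using assms by (intro closure_minimal) (auto simp: compact_imp_closed)
  then have "compact (closure {x. \<phi> x \<noteq> 0})" using assms(2) compact_Int_closed[of K "closure {x. \<phi> x \<noteq> 0}"]
    by (simp add: Int_absorb1)
  then show ?thesis unfolding testfun_def csupp_in_def using assms \<open>closure _ \<subseteq> K\<close> by auto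
qed

context polynomial_group
begin

text \<open>The derivative is the signed measure \<open>\<theta>\<close> times \<open>m\<close>, in
  polar form. \<open>G\<close> is integrated over the whole space; the test functions carry the
  restriction to \<open>\<Omega>\<close>.\<close>

definition weak_derivative :: "(real^'n) set \<Rightarrow> 'n \<Rightarrow> (real^'n \<Rightarrow> real) \<Rightarrow> (real^'n) measure \<Rightarrow> (real^'n \<Rightarrow> real) \<Rightarrow> bool" where
  "weak_derivative \<Omega> j G m \<theta> \<longleftrightarrow> finite_measure m \<and> sets m = sets borel \<and> \<theta> \<in> borel_measurable borel \<and>
     (\<forall>x. \<bar>\<theta> x\<bar> = 1) \<and>
     (\<forall>\<phi>. testfun \<Omega> \<phi> \<longrightarrow> (\<integral>x. G x * XX gmul j \<phi> x \<partial>lborel) = - (\<integral>x. \<theta> x * \<phi> x \<partial>m))"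

definition weak_divergence :: "(real^'n) set \<Rightarrow> 'n set \<Rightarrow> ('n \<Rightarrow> real^'n \<Rightarrow> real) \<Rightarrow> (real^'n) measure \<Rightarrow> (real^'n \<Rightarrow> real) \<Rightarrow> bool" where
  "weak_divergence \<Omega> J f m \<theta> \<longleftrightarrow> finite_measure m \<and> sets m = sets borel \<and> \<theta> \<in> borel_measurable borel \<and>
     (\<forall>x. \<bar>\<theta> x\<bar> = 1) \<and>
     (\<forall>\<phi>. testfun \<Omega> \<phi> \<longrightarrow> - (\<integral>x. (\<Sum>j\<in>J. f j x * XX gmul j \<phi> x) \<partial>lborel) = (\<integral>x. \<theta> x * \<phi> x \<partial>m))"

text \<open>The support consists of points \<open>gmul z x\<close> with
  \<open>norm z \<le> R\<close>, since \<open>y = gmul (- q x y) x\<close>; smoothness survives the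
  polynomial substitution.\<close>

lemma kernel_testfun:
  assumes "smooth_fun \<eta>" "\<And>z. R \<le> norm z \<Longrightarrow> \<eta> z = 0" and sub: "\<And>z. norm z \<le> R \<Longrightarrow> gmul z x \<in> \<Omega>"
  shows "testfun \<Omega> (\<lambda>y. \<eta> (q x y))"
proof (rule testfunI)
  show "smooth_fun (\<lambda>y. \<eta> (q x y))" unfolding q_def
    by (rule smooth_fun_compose_polynomial[OF assms(1)])
      (intro gmul_polynomial polynomial_function_const polynomial_function_minus polynomial_function_id)
  show "compact ((\<lambda>z. gmul z x) ` cball 0 R)"
    by (intro compact_continuous_image compact_cball continuous_intros)
  show "(\<lambda>z. gmul z x) ` cball 0 R \<subseteq> \<Omega>" using sub by auto
  fix y assume "\<eta> (q x y) \<noteq> 0"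
  then have "norm (q x y) \<le> R" using assms(2) by (meson linear)
  then show "y \<in> (\<lambda>z. gmul z x) ` cball 0 R"
    by (intro image_eqI[of _ _ "- q x y"]) (simp_all add: q_inverse)
qed

lemma kernel_support:
  assumes "\<And>z. R < norm z \<Longrightarrow> \<kappa> z = 0" "x \<in> K" "y \<notin> (\<lambda>w. gmul (fst w) (snd w)) ` (cball 0 R \<times> K)"
  shows "\<kappa> (q x y) = 0" "R < norm (q x y)"
proof -
  show "R < norm (q x y)"
  proof (rule ccontr)
    assume "\<not> R < norm (q x y)"
    then have "y \<in> (\<lambda>w. gmul (fst w) (snd w)) ` (cball 0 R \<times> K)"
      using assms(2) by (intro image_eqI[of _ _ "(- q x y, x)"]) (auto simp: q_inverse)
    then show False using assms(3) by simp
  qed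
  then show "\<kappa> (q x y) = 0" by (rule assms(1))
qed

text \<open>Differentiation under the integral puts the field on the kernel in \<open>x\<close>;
  \<open>XX_kernel_swap\<close> turns it into minus the field in \<open>y\<close>, and the
  definition of the weak derivative, tested with the kernel as a function of \<open>y\<close>,
  trades it for the measure. The result contains no derivative of \<open>\<eta>\<close>.\<close>

lemma smooth_conv_has_derivative:
  assumes sm: "smooth_fun \<eta>" and \<eta>0: "\<And>z. R \<le> norm z \<Longrightarrow> \<eta> z = 0"
    and G: "G \<in> borel_measurable borel" "\<And>x. \<bar>G x\<bar> \<le> C"
    and wd: "weak_derivative \<Omega> j G m \<theta>"
    and sub: "\<And>t z. \<bar>t\<bar> \<le> \<tau> \<Longrightarrow> norm z \<le> R \<Longrightarrow> gmul z (gmul x (E j t)) \<in> \<Omega>"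
    and t: "\<bar>t\<bar> < \<tau>"
  shows "((\<lambda>t. conv \<eta> G (gmul x (E j t))) has_real_derivative (\<integral>y. \<theta> y * \<eta> (q (gmul x (E j t)) y) \<partial>m)) (at t)"
proof -
  define X where "X t = gmul x (E j t)" for t
  define Y where "Y t y = XX gmul j (\<lambda>x. \<eta> (q x y)) (X t)" for t y
  \<comment> \<open>One compact set carries the kernels centred at all points of the curve with
    \<open>\<bar>t\<bar> \<le> \<tau>\<close>; on it the difference quotients have a common bound,
    which supplies the dominating function.\<close>
  define Z where "Z = (\<lambda>w. gmul (fst w) (snd w)) ` (cball 0 R \<times> X ` {-\<tau>..\<tau>})"
  have Xc: "continuous_on S X" for S unfolding X_def by (intro continuous_intros)
  have Zc: "compact Z" unfolding Z_def
    by (intro compact_continuous_image compact_Times compact_cball Xc compact_Icc continuous_intros)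
  have Zm: "Z \<in> sets borel" using Zc by (auto intro: borel_closed compact_imp_closed)
  have iZ: "integrable lborel (indicat_real Z)"
    using emeasure_compact_finite[OF Zc] Zm by (intro integrable_real_indicator) auto
  have d: "((\<lambda>t. \<eta> (q (X t) y)) has_real_derivative Y t y) (at t)" for t y
    unfolding X_def Y_def by (rule XX_kernel_has_derivative[OF sm])
  have Yc: "continuous_on UNIV (\<lambda>z. Y (fst z) (snd z))"
  proof -
    have "continuous_on UNIV (\<lambda>z. (\<lambda>(x, y). XX gmul j (\<lambda>x. \<eta> (q x y)) x) (X (fst z), snd z))"
      by (rule continuous_on_compose2[OF XX_kernel_continuous[OF sm]])
        (auto intro!: continuous_intros continuous_on_compose2[OF Xc[of UNIV]])
    then show ?thesis unfolding Y_def by simp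
  qed
  obtain B where B': "\<And>z. z \<in> {-\<tau>..\<tau>} \<times> Z \<Longrightarrow> \<bar>Y (fst z) (snd z)\<bar> \<le> B"
    by (rule compact_continuous_bound[OF compact_Times[OF compact_Icc Zc] continuous_on_subset[OF Yc]])
      (rule subset_UNIV, rule that, assumption)
  have B: "\<bar>Y t y\<bar> \<le> B" if "t \<in> {-\<tau>..\<tau>}" "y \<in> Z" for t y using B'[of "(t, y)"] that by simp
  have B0: "\<bar>Y t y\<bar> \<le> \<bar>B\<bar>" if "t \<in> {-\<tau>..\<tau>}" "y \<in> Z" for t y using B[OF that] by linarith
  have zero: "\<eta> (q (X t) y) = 0" if "t \<in> {-\<tau>..\<tau>}" "y \<notin> Z" for t y
    using kernel_support(1)[of R \<eta> "X t" "X ` {-\<tau>..\<tau>}" y] that \<eta>0 unfolding Z_def by force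
  have lip: "\<bar>\<eta> (q (X s) y) - \<eta> (q (X t) y)\<bar> \<le> \<bar>B\<bar> * \<bar>s - t\<bar> * indicat_real Z y"
    if st: "s \<in> {-\<tau>..\<tau>}" "t \<in> {-\<tau>..\<tau>}" for s t y
  proof (cases "y \<in> Z")
    case True
    have "norm (\<eta> (q (X s) y) - \<eta> (q (X t) y)) \<le> \<bar>B\<bar> * norm (s - t)"
    proof (rule field_differentiable_bound[of "{-\<tau>..\<tau>}" "\<lambda>t. \<eta> (q (X t) y)" "\<lambda>t. Y t y"])
      show "((\<lambda>t. \<eta> (q (X t) y)) has_real_derivative Y z y) (at z within {- \<tau>..\<tau>})" for z
        using d by (rule has_field_derivative_at_within)
    qed (use B0 True st in auto)
    then show ?thesis using True by simp
  next
    case False then show ?thesis using zero st by simp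
  qed
  have [measurable]: "\<eta> \<in> borel_measurable borel" "G \<in> borel_measurable borel"
    using G smooth_fun_continuous_on[OF sm] by (auto intro: borel_measurable_continuous_onI)
  have [measurable]: "(\<lambda>y. Y t y) \<in> borel_measurable borel" for t
  proof -
    have "continuous_on UNIV (\<lambda>y. Y (fst (t, y)) (snd (t, y)))"
      by (rule continuous_on_compose2[OF Yc]) (auto intro!: continuous_intros)
    then show ?thesis by (auto intro!: borel_measurable_continuous_onI)
  qed
  have gi: "integrable lborel (\<lambda>y. \<eta> (q (X t) y) * G y)" if "t \<in> {-\<tau>..\<tau>}" for t
  proof -
    have tf: "smooth_fun (\<lambda>y. \<eta> (q (X t) y))" "\<And>y. \<eta> (q (X t) y) \<noteq> 0 \<Longrightarrow> y \<in> Z"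
      using testfunD(1)[OF kernel_testfun[OF sm \<eta>0, where \<Omega> = UNIV]] zero[OF that] by auto
    obtain B' where B': "\<And>y. y \<in> Z \<Longrightarrow> \<bar>\<eta> (q (X t) y)\<bar> \<le> B'"
      by (rule compact_continuous_bound[OF Zc smooth_fun_continuous_on[OF tf(1)]]) (rule that, assumption)
    show ?thesis
    proof (rule Bochner_Integration.integrable_bound[of _ "\<lambda>y. (B' * C) * indicat_real Z y"])
      show "AE y in lborel. norm (\<eta> (q (X t) y) * G y) \<le> norm (B' * C * indicat_real Z y)"
      proof (rule AE_I2)
        fix y
        show "norm (\<eta> (q (X t) y) * G y) \<le> norm (B' * C * indicat_real Z y)"
        proof (cases "y \<in> Z")
          case True
          have "\<bar>\<eta> (q (X t) y)\<bar> * \<bar>G y\<bar> \<le> \<bar>B'\<bar> * \<bar>C\<bar>"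
            using B'[OF True] G(2)[of y] by (intro mult_mono) auto
          then show ?thesis using True by (simp add: abs_mult)
        next
          case False then show ?thesis using zero[OF that] by simp
        qed
      qed
    qed (use iZ in auto)
  qed
  have tf: "testfun \<Omega> (\<lambda>y. \<eta> (q (X t) y))"
    by (rule kernel_testfun[OF sm \<eta>0]) (use sub t in \<open>auto simp: X_def\<close>)
  have "((\<lambda>h. (conv \<eta> G (X (t + h)) - conv \<eta> G (X t)) / h) \<longlongrightarrow> (\<integral>y. Y t y * G y \<partial>lborel)) (at 0)"
    unfolding tendsto_at_iff_sequentially
  proof (intro allI impI)
    fix h :: "nat \<Rightarrow> real" assume h: "\<forall>i. h i \<in> UNIV - {0}" "h \<longlonglongrightarrow> 0"
    have "\<forall>\<^sub>F i in sequentially. \<bar>h i\<bar> < \<tau> - \<bar>t\<bar>"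
      using order_tendstoD(2)[OF tendsto_rabs_zero[OF h(2)]] t by simp
    then obtain N where N: "\<And>i. i \<ge> N \<Longrightarrow> \<bar>h i\<bar> < \<tau> - \<bar>t\<bar>" unfolding eventually_sequentially by blast
    \<comment> \<open>The shift by \<open>N\<close> keeps \<open>t + k i\<close> inside the interval
      for every index; it is undone at the end by \<open>LIMSEQ_offset\<close>.\<close>
    define k where "k i = h (i + N)" for i
    have k0: "k i \<noteq> 0" "\<bar>k i\<bar> < \<tau> - \<bar>t\<bar>" for i using h(1) N[of "i + N"] unfolding k_def by auto
    have kt: "t + k i \<in> {-\<tau>..\<tau>}" "t \<in> {-\<tau>..\<tau>}" for i using k0(2)[of i] t by auto
    have klim: "k \<longlonglongrightarrow> 0" unfolding k_def using h(2) by (rule LIMSEQ_ignore_initial_segment)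
    have "(\<lambda>i. \<integral>y. ((\<eta> (q (X (t + k i)) y) - \<eta> (q (X t) y)) / k i) * G y \<partial>lborel)
        \<longlonglongrightarrow> (\<integral>y. Y t y * G y \<partial>lborel)"
    proof (rule integral_dominated_convergence[of _ _ _ "\<lambda>y. (\<bar>B\<bar> * C) * indicat_real Z y"])
      show "AE y in lborel. (\<lambda>i. ((\<eta> (q (X (t + k i)) y) - \<eta> (q (X t) y)) / k i) * G y) \<longlonglongrightarrow> Y t y * G y"
      proof (rule AE_I2)
        fix y
        have "((\<lambda>h. (\<eta> (q (X (t + h)) y) - \<eta> (q (X t) y)) / h) \<longlongrightarrow> Y t y) (at 0)"
          using d[of y t] unfolding DERIV_def .
        then have "(\<lambda>i. (\<eta> (q (X (t + k i)) y) - \<eta> (q (X t) y)) / k i) \<longlonglongrightarrow> Y t y"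
          unfolding tendsto_at_iff_sequentially o_def using k0 klim by auto
        then show "(\<lambda>i. ((\<eta> (q (X (t + k i)) y) - \<eta> (q (X t) y)) / k i) * G y) \<longlonglongrightarrow> Y t y * G y"
          by (rule tendsto_mult_right)
      qed
      show "AE y in lborel. norm ((\<eta> (q (X (t + k i)) y) - \<eta> (q (X t) y)) / k i * G y) \<le> \<bar>B\<bar> * C * indicat_real Z y" for i
      proof (rule AE_I2)
        fix y
        have "\<bar>(\<eta> (q (X (t + k i)) y) - \<eta> (q (X t) y)) / k i\<bar> \<le> \<bar>B\<bar> * indicat_real Z y"
          using lip[OF kt, of i y] k0(1)[of i] by (simp add: abs_divide divide_le_eq mult_ac)
        then have "\<bar>(\<eta> (q (X (t + k i)) y) - \<eta> (q (X t) y)) / k i\<bar> * \<bar>G y\<bar> \<le> (\<bar>B\<bar> * indicat_real Z y) * C"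
          using G(2)[of y] by (intro mult_mono) auto
        then show "norm ((\<eta> (q (X (t + k i)) y) - \<eta> (q (X t) y)) / k i * G y) \<le> \<bar>B\<bar> * C * indicat_real Z y"
          by (simp add: abs_mult mult_ac)
      qed
    qed (use iZ in auto)
    moreover have "(\<integral>y. ((\<eta> (q (X (t + k i)) y) - \<eta> (q (X t) y)) / k i) * G y \<partial>lborel)
        = (conv \<eta> G (X (t + k i)) - conv \<eta> G (X t)) / k i" for i
    proof -
      have "(\<integral>y. ((\<eta> (q (X (t + k i)) y) - \<eta> (q (X t) y)) / k i) * G y \<partial>lborel)
        = (\<integral>y. (\<eta> (q (X (t + k i)) y) * G y - \<eta> (q (X t) y) * G y) / k i \<partial>lborel)"
        by (simp add: left_diff_distrib diff_divide_distrib)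
      also have "\<dots> = (\<integral>y. \<eta> (q (X (t + k i)) y) * G y - \<eta> (q (X t) y) * G y \<partial>lborel) / k i"
        by (rule integral_divide_zero)
      finally show ?thesis using gi[OF kt(1)[of i]] gi[OF kt(2)] unfolding conv_def by simp
    qed
    ultimately have "(\<lambda>i. (conv \<eta> G (X (t + k i)) - conv \<eta> G (X t)) / k i) \<longlonglongrightarrow> (\<integral>y. Y t y * G y \<partial>lborel)"
      by (simp only:)
    then show "((\<lambda>h. (conv \<eta> G (X (t + h)) - conv \<eta> G (X t)) / h) \<circ> h) \<longlonglongrightarrow> (\<integral>y. Y t y * G y \<partial>lborel)"
      unfolding k_def o_def by (rule LIMSEQ_offset)
  qed
  moreover have "(\<integral>y. Y t y * G y \<partial>lborel) = (\<integral>y. \<theta> y * \<eta> (q (X t) y) \<partial>m)"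
  proof -
    have "(\<integral>y. G y * XX gmul j (\<lambda>y. \<eta> (q (X t) y)) y \<partial>lborel) = - (\<integral>y. \<theta> y * \<eta> (q (X t) y) \<partial>m)"
      using wd tf unfolding weak_derivative_def by blast
    then show ?thesis unfolding XX_kernel_swap[OF sm] Y_def by (simp add: mult.commute)
  qed
  ultimately show ?thesis unfolding DERIV_def X_def by simp
qed

lemma kernel_bounded:
  fixes \<kappa> :: "real^'n \<Rightarrow> real"
  assumes "mollifier_kernel R \<kappa>" obtains A where "\<And>z. \<bar>\<kappa> z\<bar> \<le> A"
proof -
  obtain A where A: "\<And>z. z \<in> cball 0 R \<Longrightarrow> \<bar>\<kappa> z\<bar> \<le> A"
    by (rule compact_continuous_bound[OF compact_cball kernelD(1)[OF assms]]) (rule that, assumption)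
  have "\<bar>\<kappa> z\<bar> \<le> \<bar>A\<bar>" for z
    using A[of z] kernelD(4)[OF assms, of z] by (cases "norm z \<le> R") auto
  then show ?thesis by (rule that)
qed

text \<open>The slightly larger radius \<open>R'\<close> makes room for smooth cutoffs; the common
  bound is that of \<open>\<kappa>\<close> raised by 1, the largest error allowed.\<close>

lemma kernel_smooth_approximation:
  fixes \<kappa> :: "real^'n \<Rightarrow> real"
  assumes k: "mollifier_kernel R \<kappa>" and R: "R < R'" "0 < R'"
  obtains \<eta> A where "\<And>k::nat. smooth_fun (\<eta> k)" "\<And>k x. R' \<le> norm x \<Longrightarrow> \<eta> k x = 0"
    "\<And>k x. \<bar>\<eta> k x - \<kappa> x\<bar> \<le> 1 / real (Suc k)" "\<And>z. \<bar>\<kappa> z\<bar> \<le> A" "\<And>k z. \<bar>\<eta> k z\<bar> \<le> A"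
    "\<And>k. \<eta> k \<in> borel_measurable borel"
proof -
  have supp: "norm x \<le> R" if "\<kappa> x \<noteq> 0" for x using kernelD(4)[OF k, of x] that by (force simp: not_le)
  obtain \<eta> where \<eta>: "\<And>k::nat. smooth_fun (\<eta> k)" "\<And>k x. R' \<le> norm x \<Longrightarrow> \<eta> k x = 0"
    "\<And>k x. \<bar>\<eta> k x - \<kappa> x\<bar> \<le> 1 / real (Suc k)"
    using smooth_approximation[OF kernelD(1)[OF k] R supp] by blast
  obtain A where A: "\<And>z. \<bar>\<kappa> z\<bar> \<le> A" using kernel_bounded[OF k] by blast
  show ?thesis
  proof (rule that[of \<eta> "A + 1"])
    show "\<bar>\<kappa> z\<bar> \<le> A + 1" for z using A[of z] by simp
    show "\<bar>\<eta> k z\<bar> \<le> A + 1" for k z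
    proof -
      have "1 / real (Suc k) \<le> 1" by simp
      then show ?thesis using A[of z] \<eta>(3)[of k z] by linarith
    qed
    show "\<eta> k \<in> borel_measurable borel" for k
      using smooth_fun_continuous_on[OF \<eta>(1)] by (rule borel_measurable_continuous_onI)
  qed (use \<eta> in auto)
qed

text \<open>For \<open>x\<close> in \<open>K\<close> both integrands live on one compact set, whose
  volume turns closeness of the kernels into closeness of the convolutions, uniformly on
  \<open>K\<close>.\<close>

lemma conv_uniform_difference:
  assumes G: "G \<in> borel_measurable borel" "\<And>x. \<bar>G x\<bar> \<le> C" and K: "compact K" "x \<in> K"
    and a: "a \<in> borel_measurable borel" "\<And>z. \<bar>a z\<bar> \<le> A" "\<And>z. R < norm z \<Longrightarrow> a z = 0"
    and b: "b \<in> borel_measurable borel" "\<And>z. \<bar>b z\<bar> \<le> A" "\<And>z. R < norm z \<Longrightarrow> b z = 0"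
    and ab: "\<And>z. \<bar>a z - b z\<bar> \<le> c"
  shows "\<bar>conv a G x - conv b G x\<bar> \<le> c * C * measure lborel ((\<lambda>w. gmul (fst w) (snd w)) ` (cball 0 R \<times> K))"
    "integrable lborel (\<lambda>y. a (q x y) * G y)"
    "\<bar>conv b G x\<bar> \<le> A * C * measure lborel ((\<lambda>w. gmul (fst w) (snd w)) ` (cball 0 R \<times> K))"
proof -
  define Z where "Z = (\<lambda>w. gmul (fst w) (snd w)) ` (cball 0 R \<times> K)"
  have Zc: "compact Z" unfolding Z_def
    by (intro compact_continuous_image compact_Times compact_cball K continuous_intros)
  have Zm: "Z \<in> sets borel" using Zc by (auto intro: borel_closed compact_imp_closed)
  have iZ: "integrable lborel (indicat_real Z)"
    using emeasure_compact_finite[OF Zc] Zm by (intro integrable_real_indicator) auto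
  have zero: "a (q x y) = 0" "b (q x y) = 0" if "y \<notin> Z" for y
    using kernel_support(1)[OF _ K(2), of R a y] kernel_support(1)[OF _ K(2), of R b y] a b that
    unfolding Z_def by blast+
  have i: "integrable lborel (\<lambda>y. e (q x y) * G y)"
    if e: "e \<in> borel_measurable borel" "\<And>z. \<bar>e z\<bar> \<le> A" "\<And>y. y \<notin> Z \<Longrightarrow> e (q x y) = 0" for e
  proof (rule Bochner_Integration.integrable_bound[of _ "\<lambda>y. (A * C) * indicat_real Z y"])
    show "(\<lambda>y. e (q x y) * G y) \<in> borel_measurable lborel" using e(1) G(1) by measurable
    show "AE y in lborel. norm (e (q x y) * G y) \<le> norm (A * C * indicat_real Z y)"
    proof (rule AE_I2)
      fix y
      have "\<bar>e (q x y)\<bar> * \<bar>G y\<bar> \<le> \<bar>A\<bar> * \<bar>C\<bar>"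
        using e(2)[of "q x y"] G(2)[of y] by (intro mult_mono) auto
      then show "norm (e (q x y) * G y) \<le> norm (A * C * indicat_real Z y)"
        using e(3)[of y] by (cases "y \<in> Z") (auto simp: abs_mult)
    qed
  qed (use iZ in auto)
  show ia: "integrable lborel (\<lambda>y. a (q x y) * G y)" by (rule i[OF a(1,2) zero(1)])
  have ib: "integrable lborel (\<lambda>y. b (q x y) * G y)" by (rule i[OF b(1,2) zero(2)])
  have "\<bar>conv a G x - conv b G x\<bar> = \<bar>\<integral>y. a (q x y) * G y - b (q x y) * G y \<partial>lborel\<bar>"
    unfolding conv_def using ia ib by simp
  also have "\<dots> \<le> (\<integral>y. (c * C) * indicat_real Z y \<partial>lborel)"
  proof (rule integral_abs_bound_integral)
    fix y
    have "\<bar>a (q x y) - b (q x y)\<bar> * \<bar>G y\<bar> \<le> c * C"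
      by (rule mult_mono) (use ab G(2)[of y] order_trans[OF abs_ge_zero ab] in auto)
    then show "\<bar>a (q x y) * G y - b (q x y) * G y\<bar> \<le> c * C * indicat_real Z y"
      using zero[of y] by (cases "y \<in> Z") (auto simp: abs_mult left_diff_distrib[symmetric])
  qed (use ia ib iZ in auto)
  finally show "\<bar>conv a G x - conv b G x\<bar> \<le> c * C * measure lborel ((\<lambda>w. gmul (fst w) (snd w)) ` (cball 0 R \<times> K))"
    by (simp add: Z_def)
  have "\<bar>conv b G x\<bar> \<le> (\<integral>y. (A * C) * indicat_real Z y \<partial>lborel)" unfolding conv_def
  proof (rule integral_abs_bound_integral[OF ib])
    fix y
    have "\<bar>b (q x y)\<bar> * \<bar>G y\<bar> \<le> A * C"
      by (rule mult_mono) (use b(2) G(2)[of y] order_trans[OF abs_ge_zero b(2)] in auto)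
    then show "\<bar>b (q x y) * G y\<bar> \<le> A * C * indicat_real Z y"
      using zero[of y] by (cases "y \<in> Z") (auto simp: abs_mult)
  qed (use iZ in auto)
  then show "\<bar>conv b G x\<bar> \<le> A * C * measure lborel ((\<lambda>w. gmul (fst w) (snd w)) ` (cball 0 R \<times> K))"
    by (simp add: Z_def)
qed

text \<open>The kernel is merely continuous, so it is replaced by smooth \<open>\<eta> n\<close>.
  Along the curve through \<open>x\<close> the derivatives of the approximations are integrals of
  the kernels against the finite measure \<open>m\<close> and thus converge uniformly in
  \<open>t\<close>; hence the limit is differentiable with the limiting derivative. The horizontal
  derivative of \<open>conv \<kappa> G\<close> is the mollification of the derivative
  measure.\<close>

lemma XX_conv_kernel:
  assumes k: "mollifier_kernel R \<kappa>" and R: "R < R'" "0 < R'"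
    and G: "G \<in> borel_measurable borel" "\<And>x. \<bar>G x\<bar> \<le> C"
    and wd: "weak_derivative \<Omega> j G m \<theta>"
    and \<tau>: "0 < \<tau>" and sub: "\<And>t z. \<bar>t\<bar> \<le> \<tau> \<Longrightarrow> norm z \<le> R' \<Longrightarrow> gmul z (gmul x (E j t)) \<in> \<Omega>"
  shows "XX gmul j (conv \<kappa> G) x = (\<integral>y. \<theta> y * \<kappa> (q x y) \<partial>m)"
proof -
  have m: "finite_measure m" "sets m = sets borel" and th: "\<theta> \<in> borel_measurable borel" "\<And>x. \<bar>\<theta> x\<bar> = 1"
    using wd unfolding weak_derivative_def by auto
  obtain \<eta> A where sm: "\<And>k::nat. smooth_fun (\<eta> k)" and \<eta>0: "\<And>k x. R' \<le> norm x \<Longrightarrow> \<eta> k x = 0"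
    and ap: "\<And>k x. \<bar>\<eta> k x - \<kappa> x\<bar> \<le> 1 / real (Suc k)" and \<kappa>A: "\<And>z. \<bar>\<kappa> z\<bar> \<le> A" and \<eta>A: "\<And>k z. \<bar>\<eta> k z\<bar> \<le> A"
    and \<eta>m [measurable]: "\<And>k. \<eta> k \<in> borel_measurable borel"
    by (rule kernel_smooth_approximation[OF k R]) (rule that, assumption+)
  have [measurable]: "\<kappa> \<in> borel_measurable borel" by (rule kernelD(5)[OF k])
  define X where "X t = gmul x (E j t)" for t
  define K where "K = X ` {-\<tau>..\<tau>}"
  have K: "compact K" unfolding K_def X_def by (intro compact_continuous_image continuous_intros compact_Icc)
  define V where "V = measure lborel ((\<lambda>w. gmul (fst w) (snd w)) ` (cball 0 R' \<times> K))"
  define M where "M = measure m UNIV"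
  have inv0: "(\<lambda>n. 1 / real (Suc n)) \<longlonglongrightarrow> 0" using LIMSEQ_inverse_real_of_nat by (simp add: divide_inverse)
  have G_lim: "(\<lambda>n. conv (\<eta> n) G (X t)) \<longlonglongrightarrow> conv \<kappa> G (X t)" if "t \<in> {-\<tau><..<\<tau>}" for t
  proof -
    have b: "\<bar>conv (\<eta> n) G (X t) - conv \<kappa> G (X t)\<bar> \<le> 1 / real (Suc n) * (C * V)" for n
      using conv_uniform_difference(1)[OF G K, of "X t" "\<eta> n" A R' \<kappa> "1 / real (Suc n)"]
        that \<eta>0 \<eta>A \<kappa>A ap kernelD(4)[OF k] R by (auto simp: K_def V_def mult.assoc)
    have "(\<lambda>n. 1 / real (Suc n) * (C * V)) \<longlonglongrightarrow> 0" using tendsto_mult_left_zero[OF inv0] .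
    then have "(\<lambda>n. conv (\<eta> n) G (X t) - conv \<kappa> G (X t)) \<longlonglongrightarrow> 0"
      by (rule Lim_null_comparison[rotated]) (use b in auto)
    then show ?thesis by (simp add: LIM_zero_iff)
  qed
  have "\<exists>g. \<forall>t\<in>{-\<tau><..<\<tau>}. (\<lambda>n. conv (\<eta> n) G (X t)) \<longlonglongrightarrow> g t \<and>
      (g has_derivative (*) (\<integral>y. \<theta> y * \<kappa> (q (X t) y) \<partial>m)) (at t within {-\<tau><..<\<tau>})"
  proof (rule has_derivative_sequence)
    show "convex {-\<tau><..<\<tau>}" by simp
    show "((\<lambda>t. conv (\<eta> n) G (X t)) has_derivative (*) (\<integral>y. \<theta> y * \<eta> n (q (X t) y) \<partial>m)) (at t within {-\<tau><..<\<tau>})"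
      if "t \<in> {-\<tau><..<\<tau>}" for n t
      using smooth_conv_has_derivative[OF sm \<eta>0 G wd sub, of "R'" \<tau> t n] that
      unfolding X_def has_field_derivative_def by (auto intro: has_derivative_at_withinI)
    show "0 \<in> {-\<tau><..<\<tau>}" using \<tau> by simp
    show "(\<lambda>n. conv (\<eta> n) G (X 0)) \<longlonglongrightarrow> conv \<kappa> G (X 0)" by (rule G_lim) (use \<tau> in auto)
    fix e :: real assume e: "0 < e"
    have "(\<lambda>n. 1 / real (Suc n) * M) \<longlonglongrightarrow> 0" using tendsto_mult_left_zero[OF inv0] .
    then have "\<forall>\<^sub>F n in sequentially. 1 / real (Suc n) * M < e" using e by (rule order_tendstoD(2))
    then show "\<forall>\<^sub>F n in sequentially. \<forall>t\<in>{-\<tau><..<\<tau>}. \<forall>h. norm ((\<integral>y. \<theta> y * \<eta> n (q (X t) y) \<partial>m) * h - (\<integral>y. \<theta> y * \<kappa> (q (X t) y) \<partial>m) * h) \<le> e * norm h"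
    proof eventually_elim
      case (elim n)
      show ?case
      proof (intro ballI allI)
        fix t h
        have "\<bar>(\<integral>y. \<theta> y * \<eta> n (q (X t) y) \<partial>m) - (\<integral>y. \<theta> y * \<kappa> (q (X t) y) \<partial>m)\<bar> \<le> 1 / real (Suc n) * M"
          unfolding M_def by (rule measure_integral_uniform[OF m th, of _ A]) (use \<eta>A \<kappa>A ap in auto)
        then have "\<bar>(\<integral>y. \<theta> y * \<eta> n (q (X t) y) \<partial>m) - (\<integral>y. \<theta> y * \<kappa> (q (X t) y) \<partial>m)\<bar> * \<bar>h\<bar> \<le> e * \<bar>h\<bar>"
          using elim by (intro mult_right_mono) auto
        then show "norm ((\<integral>y. \<theta> y * \<eta> n (q (X t) y) \<partial>m) * h - (\<integral>y. \<theta> y * \<kappa> (q (X t) y) \<partial>m) * h) \<le> e * norm h"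
          by (simp only: left_diff_distrib[symmetric] real_norm_def abs_mult)
      qed
    qed
  qed
  then obtain g where g: "\<And>t. t \<in> {-\<tau><..<\<tau>} \<Longrightarrow> (\<lambda>n. conv (\<eta> n) G (X t)) \<longlonglongrightarrow> g t"
    "(g has_derivative (*) (\<integral>y. \<theta> y * \<kappa> (q (X 0) y) \<partial>m)) (at 0 within {-\<tau><..<\<tau>})" using \<tau> by force
  have gd: "(g has_real_derivative (\<integral>y. \<theta> y * \<kappa> (q (X 0) y) \<partial>m)) (at 0)"
    using g(2) \<tau> unfolding has_field_derivative_def by (simp add: at_within_open[of 0 "{-\<tau><..<\<tau>}"])
  have "((\<lambda>t. conv \<kappa> G (X t)) has_real_derivative (\<integral>y. \<theta> y * \<kappa> (q (X 0) y) \<partial>m)) (at 0)"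
    by (rule has_field_derivative_transform_within_open[OF gd, of "{-\<tau><..<\<tau>}"])
      (use \<tau> LIMSEQ_unique[OF g(1) G_lim] in auto)
  then show ?thesis unfolding XX_def X_def by (simp add: DERIV_imp_deriv)
qed

text \<open>Fubini between Lebesgue measure and \<open>m\<close>, and symmetry of the kernel, move
  the mollification from a measure to the function it is paired with.\<close>

lemma integral_conv_duality_measure:
  assumes k: "mollifier_kernel R \<kappa>" and m: "finite_measure m" "sets m = sets borel"
    and th: "\<theta> \<in> borel_measurable borel" "\<And>x. \<bar>\<theta> x\<bar> = 1"
    and \<psi>: "\<psi> \<in> borel_measurable borel" "\<And>x. \<bar>\<psi> x\<bar> \<le> B" and K: "compact K" "\<And>x. x \<notin> K \<Longrightarrow> \<psi> x = 0"
  shows "(\<integral>x. \<psi> x * (\<integral>y. \<theta> y * \<kappa> (q x y) \<partial>m) \<partial>lborel) = (\<integral>y. \<theta> y * conv \<kappa> \<psi> y \<partial>m)"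
    and "integrable lborel (\<lambda>x. \<psi> x * (\<integral>y. \<theta> y * \<kappa> (q x y) \<partial>m))"
proof -
  interpret m: finite_measure m by fact
  obtain A where A: "\<And>z. \<bar>\<kappa> z\<bar> \<le> A" using kernel_bounded[OF k] by blast
  have B0: "0 \<le> B" using \<psi>(2)[of 0] by linarith
  have [measurable]: "\<kappa> \<in> borel_measurable borel" "\<psi> \<in> borel_measurable borel" "\<theta> \<in> borel_measurable borel"
    using kernelD(5)[OF k] \<psi> th by auto
  have Km: "K \<in> sets borel" "emeasure lborel K < \<infinity>"
    using K emeasure_compact_finite by (auto intro: borel_closed compact_imp_closed)
  have bm: "(\<lambda>z :: (real^'n) \<times> (real^'n). \<psi> (fst z) * (\<theta> (snd z) * \<kappa> (q (fst z) (snd z)))) \<in> borel_measurable borel"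
  proof -
    have [measurable]: "fst \<in> borel_measurable (borel :: ((real^'n) \<times> (real^'n)) measure)"
      "snd \<in> borel_measurable (borel :: ((real^'n) \<times> (real^'n)) measure)"
      by (auto intro!: borel_measurable_continuous_onI continuous_intros)
    show ?thesis by measurable
  qed
  have bd: "\<bar>\<psi> x * (\<theta> y * \<kappa> (q x y))\<bar> \<le> B * A" for x y
    using mult_mono[OF \<psi>(2)[of x] A[of "q x y"] B0 abs_ge_zero] th(2)[of y] by (simp add: abs_mult)
  have mf: "emeasure m UNIV < \<infinity>" using m.emeasure_finite[of UNIV] by (simp add: less_top[symmetric])
  have zero: "\<psi> x * (\<theta> y * \<kappa> (q x y)) = 0" if "x \<notin> K \<or> y \<notin> UNIV" for x y using that K(2) by simp
  have U: "UNIV \<in> sets (borel :: (real^'n) measure)" by simp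
  note F = Fubini_bounded_support[where u = "\<lambda>x y. \<psi> x * (\<theta> y * \<kappa> (q x y))",
      OF lborel.sigma_finite_measure_axioms sets_lborel m.sigma_finite_measure_axioms m(2) bm Km U mf bd zero]
  note F1 = F(1) and F2 = F(2)
  have e: "(\<integral>x. \<psi> x * (\<theta> y * \<kappa> (q x y)) \<partial>lborel) = \<theta> y * conv \<kappa> \<psi> y" for y
  proof -
    have "(\<integral>x. \<psi> x * (\<theta> y * \<kappa> (q x y)) \<partial>lborel) = (\<integral>x. \<theta> y * (\<kappa> (q y x) * \<psi> x) \<partial>lborel)"
      unfolding kernelD(3)[OF k, of y] by (simp add: mult_ac)
    then show ?thesis unfolding conv_def by (simp only: integral_mult_right_zero)
  qed
  show "(\<integral>x. \<psi> x * (\<integral>y. \<theta> y * \<kappa> (q x y) \<partial>m) \<partial>lborel) = (\<integral>y. \<theta> y * conv \<kappa> \<psi> y \<partial>m)"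
    using F1 unfolding e integral_mult_right_zero .
  show "integrable lborel (\<lambda>x. \<psi> x * (\<integral>y. \<theta> y * \<kappa> (q x y) \<partial>m))"
    using F2 unfolding integral_mult_right_zero .
qed

text \<open>The complement of the support is open, so \<open>\<phi>\<close> vanishes on a short
  piece of the flow line through \<open>x\<close>.\<close>

lemma XX_support:
  assumes "testfun \<Omega> \<phi>" "x \<notin> closure {x. \<phi> x \<noteq> 0}"
  shows "\<phi> x = 0" "XX gmul j \<phi> x = 0"
proof -
  have z0: "\<phi> z = 0" if "z \<notin> closure {x. \<phi> x \<noteq> 0}" for z
  proof (rule ccontr)
    assume "\<phi> z \<noteq> 0"
    then have "z \<in> {x. \<phi> x \<noteq> 0}" by simp
    then have "z \<in> closure {x. \<phi> x \<noteq> 0}" by (rule subsetD[OF closure_subset])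
    then show False using that by contradiction
  qed
  then show "\<phi> x = 0" using assms(2) by blast
  have "\<forall>\<^sub>F t in nhds 0. gmul x (E j t) \<in> - closure {x. \<phi> x \<noteq> 0}"
  proof -
    have "open ((\<lambda>t. gmul x (E j t)) -` (- closure {x. \<phi> x \<noteq> 0}))"
      by (intro open_vimage continuous_intros) simp
    moreover have "0 \<in> (\<lambda>t. gmul x (E j t)) -` (- closure {x. \<phi> x \<noteq> 0})" using assms(2) by simp
    ultimately show ?thesis using eventually_nhds_in_open by fastforce
  qed
  then have "\<forall>\<^sub>F t in nhds 0. \<phi> (gmul x (E j t)) = 0"
    by (rule eventually_mono) (rule z0, simp)
  then have "((\<lambda>t. \<phi> (gmul x (E j t))) has_real_derivative 0) (at 0)"
    by (subst DERIV_cong_ev[OF refl _ refl, where g = "\<lambda>_. 0"]) auto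
  then show "XX gmul j \<phi> x = 0" unfolding XX_def by (rule DERIV_imp_deriv)
qed

text \<open>The test functions \<open>x \<mapsto> \<phi> x * \<eta> (q x y)\<close> are inserted into the definition of the divergence and the
  result is integrated against \<open>G y\<close>. By \<open>XX_kernel_swap\<close> the horizontal derivatives of
  \<open>\<eta> (q x y)\<close> can be taken in \<open>y\<close>, where they fall on \<open>G\<close>.\<close>
lemma gauss_green_smooth:
  assumes \<phi>: "testfun \<Omega> \<phi>" and K: "K = closure {x. \<phi> x \<noteq> 0}"
    and sub: "\<And>x z. x \<in> K \<Longrightarrow> norm z \<le> R \<Longrightarrow> gmul z x \<in> \<Omega>"
    and sm: "smooth_fun \<eta>" and \<eta>0: "\<And>z. R \<le> norm z \<Longrightarrow> \<eta> z = 0"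
    and G: "G \<in> borel_measurable borel" "\<And>x. \<bar>G x\<bar> \<le> C"
    and J: "finite J" and wd: "\<And>j. j \<in> J \<Longrightarrow> weak_derivative \<Omega> j G (m j) (\<theta> j)"
    and f: "\<And>j. j \<in> J \<Longrightarrow> f j \<in> borel_measurable borel" "\<And>j x. j \<in> J \<Longrightarrow> \<bar>f j x\<bar> \<le> Cf"
    and dv: "weak_divergence \<Omega> J f m0 \<theta>0"
  shows "(\<integral>x. \<theta>0 x * (\<phi> x * conv \<eta> G x) \<partial>m0) =
    - (\<integral>x. (\<Sum>j\<in>J. f j x * (XX gmul j \<phi> x * conv \<eta> G x + \<phi> x * (\<integral>y. \<theta> j y * \<eta> (q x y) \<partial>m j))) \<partial>lborel)"
proof -
  have m0: "finite_measure m0" "sets m0 = sets borel" "\<theta>0 \<in> borel_measurable borel" "\<And>x. \<bar>\<theta>0 x\<bar> = 1"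
    and dvt: "\<And>\<phi>. testfun \<Omega> \<phi> \<Longrightarrow> - (\<integral>x. (\<Sum>j\<in>J. f j x * XX gmul j \<phi> x) \<partial>lborel) = (\<integral>x. \<theta>0 x * \<phi> x \<partial>m0)"
    using dv unfolding weak_divergence_def by auto
  interpret m0: finite_measure m0 by (rule m0(1))
  note \<phi>D = testfunD[OF \<phi>, folded K]
  have Kc: "compact K" and KO: "K \<subseteq> \<Omega>" using \<phi>D by auto
  define Z where "Z = (\<lambda>w. gmul (fst w) (snd w)) ` (cball 0 R \<times> K)"
  have Zc: "compact Z" unfolding Z_def
    by (intro compact_continuous_image compact_Times compact_cball Kc continuous_intros)
  have KZ: "K \<in> sets borel" "Z \<in> sets borel" using Kc Zc by (auto intro: borel_closed compact_imp_closed)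
  have KZf: "emeasure lborel K < \<infinity>" "emeasure lborel Z < \<infinity>" "emeasure m0 K < \<infinity>"
    using emeasure_compact_finite[OF Kc] emeasure_compact_finite[OF Zc] m0.emeasure_finite[of K]
    by (simp_all add: less_top[symmetric])
  define Y where "Y j x y = XX gmul j (\<lambda>x. \<eta> (q x y)) x" for j x y
  have \<phi>0: "\<phi> x = 0" "XX gmul j \<phi> x = 0" if "x \<notin> K" for x j
    by (rule XX_support[OF \<phi>, folded K, OF that])+
  have \<eta>Z: "\<eta> (q x y) = 0" "Y j x y = 0" if "x \<in> K" "y \<notin> Z" for x y j
  proof -
    have "R < norm (q x y)" using kernel_support(2)[of R \<eta> x K y] that \<eta>0 unfolding Z_def by force
    then show "\<eta> (q x y) = 0" "Y j x y = 0" unfolding Y_def using \<eta>0 XX_kernel_zero[OF sm \<eta>0] by auto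
  qed
  have \<eta>c: "continuous_on S \<eta>" for S by (rule smooth_fun_continuous_on[OF sm])
  have \<phi>c: "continuous_on S \<phi>" for S by (rule smooth_fun_continuous_on[OF \<phi>D(1)])
  have X\<phi>c: "continuous_on UNIV (XX gmul j \<phi>)" for j by (rule XX_continuous[OF \<phi>D(1)])
  have Yc: "continuous_on UNIV (\<lambda>z. Y j (fst z) (snd z))" for j
    using XX_kernel_continuous[OF sm, of j] unfolding Y_def by (simp add: case_prod_unfold)
  have \<eta>qc: "continuous_on UNIV (\<lambda>z. \<eta> (q (fst z) (snd z)))"
    by (rule continuous_on_compose2[OF \<eta>c[of UNIV]]) (auto intro!: continuous_intros)
  have \<phi>fc: "continuous_on UNIV (\<lambda>z :: (real^'n) \<times> (real^'n). \<phi> (fst z))"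
    by (rule continuous_on_compose2[OF \<phi>c[of UNIV]]) (auto intro!: continuous_intros)
  have X\<phi>fc: "continuous_on UNIV (\<lambda>z :: (real^'n) \<times> (real^'n). XX gmul j \<phi> (fst z))" for j
    by (rule continuous_on_compose2[OF X\<phi>c]) (auto intro!: continuous_intros)
  \<comment> \<open>The field \<open>X_j\<close> applied in \<open>x\<close> to
    \<open>\<phi> x * \<eta> (q x y)\<close>, by the product rule; it vanishes off
    \<open>K \<times> Z\<close>.\<close>
  define c where "c j x y = XX gmul j \<phi> x * \<eta> (q x y) + \<phi> x * Y j x y" for j x y
  have cc: "continuous_on UNIV (\<lambda>z. c j (fst z) (snd z))" for j
    unfolding c_def by (intro continuous_intros X\<phi>fc \<eta>qc \<phi>fc Yc)
  have c0: "c j x y = 0" if "x \<notin> K \<or> y \<notin> Z" for j x y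
    using that \<phi>0(1)[of x] \<phi>0(2)[of x j] \<eta>Z(1)[of x y] \<eta>Z(2)[of x y j] unfolding c_def by (cases "x \<in> K") auto
  have "\<forall>j. \<exists>B. \<forall>z\<in>K \<times> Z. \<bar>c j (fst z) (snd z)\<bar> \<le> B"
    using compact_continuous_bound[OF compact_Times[OF Kc Zc] continuous_on_subset[OF cc subset_UNIV]] by metis
  then obtain B where "\<forall>j. \<forall>z\<in>K \<times> Z. \<bar>c j (fst z) (snd z)\<bar> \<le> B j" unfolding choice_iff by blast
  then have cB: "\<bar>c j x y\<bar> \<le> \<bar>B j\<bar>" for j x y
    using c0[of x y j] by (cases "x \<in> K \<and> y \<in> Z") (auto intro: order_trans[OF _ abs_ge_self])
  obtain B' where B'0: "\<And>z. z \<in> K \<times> Z \<Longrightarrow> \<bar>\<phi> (fst z) * \<eta> (q (fst z) (snd z))\<bar> \<le> B'"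
    by (rule compact_continuous_bound[OF compact_Times[OF Kc Zc]
          continuous_on_subset[OF continuous_on_mult[OF \<phi>fc \<eta>qc] subset_UNIV]]) (rule that, assumption)
  have B': "\<bar>\<phi> x * \<eta> (q x y)\<bar> \<le> \<bar>B'\<bar>" for x y
    using B'0[of "(x, y)"] \<phi>0(1)[of x] \<eta>Z(1)[of x y] by (cases "x \<in> K"; cases "y \<in> Z") auto
  have Cf0: "0 \<le> Cf" if "j \<in> J" for j using f(2)[OF that, of 0] by linarith
  have smy: "smooth_fun (\<lambda>x. \<eta> (q x y))" for y unfolding q_def
    by (rule smooth_fun_compose_polynomial[OF sm])
      (intro gmul_polynomial polynomial_function_const polynomial_function_id)
  have tf: "testfun \<Omega> (\<lambda>x. \<phi> x * \<eta> (q x y))" for y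
    by (rule testfunI[OF smooth_fun_mult[OF \<phi>D(1) smy] Kc KO]) (use \<phi>0 in force)
  have Xh: "XX gmul j (\<lambda>x. \<phi> x * \<eta> (q x y)) x = c j x y" for j x y
  proof -
    have "((\<lambda>t. \<phi> (gmul x (E j t)) * \<eta> (q (gmul x (E j t)) y)) has_real_derivative c j x y) (at 0)"
      using DERIV_mult[OF XX_has_derivative[OF \<phi>D(1), of x j 0] XX_kernel_has_derivative[OF sm, of x j y 0]]
      unfolding c_def Y_def by (simp add: mult.commute)
    then show ?thesis unfolding XX_def[of gmul j "\<lambda>x. \<phi> x * \<eta> (q x y)"] by (rule DERIV_imp_deriv)
  qed
  have [measurable]: "fst \<in> borel_measurable (borel :: ((real^'n) \<times> (real^'n)) measure)"
      "snd \<in> borel_measurable (borel :: ((real^'n) \<times> (real^'n)) measure)"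
    by (auto intro!: borel_measurable_continuous_onI continuous_intros)
  have [measurable]: "\<phi> \<in> borel_measurable borel" "\<eta> \<in> borel_measurable borel" "G \<in> borel_measurable borel"
      "\<theta>0 \<in> borel_measurable borel" using \<phi>c \<eta>c G m0 by (auto intro: borel_measurable_continuous_onI)
  have cm [measurable]: "(\<lambda>z. c j (fst z) (snd z)) \<in> borel_measurable borel" for j
    using cc by (rule borel_measurable_continuous_onI)
  \<comment> \<open>\<open>u1\<close> and \<open>u2\<close> are, up to sign, the integrands of the
    two sides of the divergence identity for fixed \<open>y\<close>, multiplied by
    \<open>G y\<close>; the first is integrated in \<open>x\<close> against the variation of the
    divergence, the second against Lebesgue measure.\<close>
  define u1 where "u1 x y = \<theta>0 x * (\<phi> x * (\<eta> (q x y) * G y))" for x y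
  have u1m: "(\<lambda>z. u1 (fst z) (snd z)) \<in> borel_measurable borel" unfolding u1_def by measurable
  have u1b: "\<bar>u1 x y\<bar> \<le> \<bar>B'\<bar> * C" for x y
  proof -
    have "\<bar>u1 x y\<bar> = \<bar>\<phi> x * \<eta> (q x y)\<bar> * \<bar>G y\<bar>" unfolding u1_def using m0(4)[of x] by (simp add: abs_mult)
    also have "\<dots> \<le> \<bar>B'\<bar> * C" by (rule mult_mono[OF B' G(2)]) auto
    finally show ?thesis .
  qed
  have u10: "u1 x y = 0" if "x \<notin> K \<or> y \<notin> Z" for x y
    using that \<phi>0(1)[of x] \<eta>Z(1)[of x y] unfolding u1_def by (cases "x \<in> K") auto
  note F1 = Fubini_bounded_support[where u = u1, OF m0.sigma_finite_measure_axioms m0(2) lborel.sigma_finite_measure_axioms sets_lborel u1m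
      KZ(1) KZf(3) KZ(2) KZf(2) u1b u10]
  define u2 where "u2 x y = (\<Sum>j\<in>J. f j x * c j x y) * G y" for x y
  have u2m: "(\<lambda>z. u2 (fst z) (snd z)) \<in> borel_measurable borel" unfolding u2_def
  proof (intro borel_measurable_times borel_measurable_sum)
    fix j assume "j \<in> J"
    then have [measurable]: "f j \<in> borel_measurable borel" by (rule f)
    show "(\<lambda>z :: (real^'n) \<times> (real^'n). f j (fst z)) \<in> borel_measurable borel" by measurable
    show "(\<lambda>z. c j (fst z) (snd z)) \<in> borel_measurable borel" by (rule cm)
  qed measurable
  have u2b: "\<bar>u2 x y\<bar> \<le> (\<Sum>j\<in>J. Cf * \<bar>B j\<bar>) * C" for x y
  proof -
    have "\<bar>\<Sum>j\<in>J. f j x * c j x y\<bar> \<le> (\<Sum>j\<in>J. Cf * \<bar>B j\<bar>)"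
    proof (rule order_trans[OF sum_abs sum_mono])
      fix j assume j: "j \<in> J"
      show "\<bar>f j x * c j x y\<bar> \<le> Cf * \<bar>B j\<bar>" unfolding abs_mult
        by (rule mult_mono[OF f(2)[OF j] cB Cf0[OF j]]) auto
    qed
    then show ?thesis unfolding u2_def abs_mult
      by (rule mult_mono[OF _ G(2)]) (use Cf0 in \<open>auto intro!: sum_nonneg\<close>)
  qed
  have u20: "u2 x y = 0" if "x \<notin> K \<or> y \<notin> Z" for x y unfolding u2_def using c0[OF that] by simp
  note F2 = Fubini_bounded_support[where u = u2, OF lborel.sigma_finite_measure_axioms sets_lborel lborel.sigma_finite_measure_axioms sets_lborel u2m
      KZ(1) KZf(1) KZ(2) KZf(2) u2b u20]
  have key: "(\<integral>x. u1 x y \<partial>m0) = - (\<integral>x. u2 x y \<partial>lborel)" for y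
  proof -
    have "(\<integral>x. u1 x y \<partial>m0) = (\<integral>x. (\<theta>0 x * (\<phi> x * \<eta> (q x y))) * G y \<partial>m0)" unfolding u1_def by (simp add: mult_ac)
    also have "\<dots> = (\<integral>x. \<theta>0 x * (\<phi> x * \<eta> (q x y)) \<partial>m0) * G y" by (rule integral_mult_left_zero)
    also have "\<dots> = - (\<integral>x. (\<Sum>j\<in>J. f j x * c j x y) \<partial>lborel) * G y"
      using dvt[OF tf, of y] by (simp only: Xh)
    also have "\<dots> = - (\<integral>x. u2 x y \<partial>lborel)" unfolding u2_def by simp
    finally show ?thesis .
  qed
  have R1: "(\<integral>y. u1 x y \<partial>lborel) = \<theta>0 x * (\<phi> x * conv \<eta> G x)" for x
    unfolding u1_def conv_def by simp
  \<comment> \<open>Integrating in \<open>y\<close> first moves the derivative of the kernel to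
    \<open>G\<close>. The kernel centred at a point of \<open>K\<close> is a test function in
    \<open>y\<close>, and \<open>\<phi>\<close> disposes of all other points.\<close>
  have R2: "(\<integral>y. u2 x y \<partial>lborel) = (\<Sum>j\<in>J. f j x * (XX gmul j \<phi> x * conv \<eta> G x + \<phi> x * (\<integral>y. \<theta> j y * \<eta> (q x y) \<partial>m j)))" for x
  proof (cases "x \<in> K")
    case False
    then show ?thesis using \<phi>0[OF False] u20[of x] by simp
  next
    case x: True
    have YG: "integrable lborel (\<lambda>y. Y j x y * G y)" "(\<integral>y. Y j x y * G y \<partial>lborel) = (\<integral>y. \<theta> j y * \<eta> (q x y) \<partial>m j)"
      if j: "j \<in> J" for j
    proof -
      have yc: "continuous_on UNIV (\<lambda>y. Y j x y)"
      proof -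
        have "continuous_on UNIV (\<lambda>y. Y j (fst (x, y)) (snd (x, y)))"
          by (rule continuous_on_compose2[OF Yc]) (auto intro!: continuous_intros)
        then show ?thesis by simp
      qed
      then have [measurable]: "(\<lambda>y. Y j x y) \<in> borel_measurable borel" by (rule borel_measurable_continuous_onI)
      obtain D where D: "\<And>y. y \<in> Z \<Longrightarrow> \<bar>Y j x y\<bar> \<le> D"
        by (rule compact_continuous_bound[OF Zc continuous_on_subset[OF yc subset_UNIV]]) (rule that, assumption)
      show "integrable lborel (\<lambda>y. Y j x y * G y)"
      proof (rule Bochner_Integration.integrable_bound[of _ "\<lambda>y. (D * C) * indicat_real Z y"])
        show "integrable lborel (\<lambda>y. (D * C) * indicat_real Z y)"
          using KZ KZf by (intro integrable_mult_right integrable_real_indicator) auto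
        show "AE y in lborel. norm (Y j x y * G y) \<le> norm (D * C * indicat_real Z y)"
        proof (rule AE_I2)
          fix y
          show "norm (Y j x y * G y) \<le> norm (D * C * indicat_real Z y)"
          proof (cases "y \<in> Z")
            case True
            have "\<bar>Y j x y\<bar> * \<bar>G y\<bar> \<le> \<bar>D\<bar> * \<bar>C\<bar>" using D[OF True] G(2)[of y] by (intro mult_mono) auto
            then show ?thesis using True by (simp add: abs_mult)
          qed (use \<eta>Z(2)[OF x] in simp)
        qed
      qed measurable
      have "testfun \<Omega> (\<lambda>y. \<eta> (q x y))" by (rule kernel_testfun[OF sm \<eta>0 sub[OF x]])
      then have "(\<integral>y. G y * XX gmul j (\<lambda>y. \<eta> (q x y)) y \<partial>lborel) = - (\<integral>y. \<theta> j y * \<eta> (q x y) \<partial>m j)"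
        using wd[OF j] unfolding weak_derivative_def by blast
      then show "(\<integral>y. Y j x y * G y \<partial>lborel) = (\<integral>y. \<theta> j y * \<eta> (q x y) \<partial>m j)"
        unfolding XX_kernel_swap[OF sm] Y_def by (simp add: mult.commute)
    qed
    have \<eta>G: "integrable lborel (\<lambda>y. \<eta> (q x y) * G y)"
    proof -
      obtain D where D: "\<And>y. y \<in> Z \<Longrightarrow> \<bar>\<eta> (q x y)\<bar> \<le> D"
        by (rule compact_continuous_bound[OF Zc, of "\<lambda>y. \<eta> (q x y)"])
          (auto intro!: continuous_on_compose2[OF \<eta>c[of UNIV]] continuous_intros)
      show ?thesis
      proof (rule Bochner_Integration.integrable_bound[of _ "\<lambda>y. (D * C) * indicat_real Z y"])
        show "integrable lborel (\<lambda>y. (D * C) * indicat_real Z y)"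
          using KZ KZf by (intro integrable_mult_right integrable_real_indicator) auto
        show "AE y in lborel. norm (\<eta> (q x y) * G y) \<le> norm (D * C * indicat_real Z y)"
        proof (rule AE_I2)
          fix y
          show "norm (\<eta> (q x y) * G y) \<le> norm (D * C * indicat_real Z y)"
          proof (cases "y \<in> Z")
            case True
            have "\<bar>\<eta> (q x y)\<bar> * \<bar>G y\<bar> \<le> \<bar>D\<bar> * \<bar>C\<bar>" using D[OF True] G(2)[of y] by (intro mult_mono) auto
            then show ?thesis using True by (simp add: abs_mult)
          qed (use \<eta>Z(1)[OF x] in simp)
        qed
      qed measurable
    qed
    have "(\<integral>y. u2 x y \<partial>lborel) = (\<integral>y. (\<Sum>j\<in>J. f j x * (XX gmul j \<phi> x * (\<eta> (q x y) * G y) + \<phi> x * (Y j x y * G y))) \<partial>lborel)"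
      unfolding u2_def c_def sum_distrib_right
      by (intro Bochner_Integration.integral_cong sum.cong refl) (simp add: algebra_simps)
    also have "\<dots> = (\<Sum>j\<in>J. \<integral>y. f j x * (XX gmul j \<phi> x * (\<eta> (q x y) * G y) + \<phi> x * (Y j x y * G y)) \<partial>lborel)"
      using \<eta>G YG(1) by (intro Bochner_Integration.integral_sum) auto
    also have "\<dots> = (\<Sum>j\<in>J. f j x * (XX gmul j \<phi> x * conv \<eta> G x + \<phi> x * (\<integral>y. \<theta> j y * \<eta> (q x y) \<partial>m j)))"
    proof (rule sum.cong[OF refl])
      fix j assume j: "j \<in> J"
      have "(\<integral>y. f j x * (XX gmul j \<phi> x * (\<eta> (q x y) * G y) + \<phi> x * (Y j x y * G y)) \<partial>lborel)
        = f j x * (\<integral>y. XX gmul j \<phi> x * (\<eta> (q x y) * G y) + \<phi> x * (Y j x y * G y) \<partial>lborel)" by (rule integral_mult_right_zero)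
      also have "(\<integral>y. XX gmul j \<phi> x * (\<eta> (q x y) * G y) + \<phi> x * (Y j x y * G y) \<partial>lborel)
        = XX gmul j \<phi> x * conv \<eta> G x + \<phi> x * (\<integral>y. Y j x y * G y \<partial>lborel)"
        using \<eta>G YG(1)[OF j] unfolding conv_def
        by (subst Bochner_Integration.integral_add) (auto simp: integral_mult_right_zero)
      finally show "(\<integral>y. f j x * (XX gmul j \<phi> x * (\<eta> (q x y) * G y) + \<phi> x * (Y j x y * G y)) \<partial>lborel)
        = f j x * (XX gmul j \<phi> x * conv \<eta> G x + \<phi> x * (\<integral>y. \<theta> j y * \<eta> (q x y) \<partial>m j))" by (simp only: YG(2)[OF j])
    qed
    finally show ?thesis .
  qed
  have "(\<integral>x. \<theta>0 x * (\<phi> x * conv \<eta> G x) \<partial>m0) = (\<integral>x. (\<integral>y. u1 x y \<partial>lborel) \<partial>m0)" by (simp only: R1)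
  also have "\<dots> = (\<integral>y. (\<integral>x. u1 x y \<partial>m0) \<partial>lborel)" by (rule F1(1))
  also have "\<dots> = - (\<integral>y. (\<integral>x. u2 x y \<partial>lborel) \<partial>lborel)" by (simp only: key integral_minus)
  also have "\<dots> = - (\<integral>x. (\<integral>y. u2 x y \<partial>lborel) \<partial>lborel)" by (simp only: F2(1))
  also have "\<dots> = - (\<integral>x. (\<Sum>j\<in>J. f j x * (XX gmul j \<phi> x * conv \<eta> G x + \<phi> x * (\<integral>y. \<theta> j y * \<eta> (q x y) \<partial>m j))) \<partial>lborel)"
    by (simp only: R2)
  finally show ?thesis .
qed

text \<open>A continuous kernel is approximated by smooth ones, and the derivative of \<open>G\<close> is moved off the kernel
  by Fubini, so that only quantities that are stable under uniform convergence remain.\<close>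
lemma gauss_green_kernel:
  assumes \<phi>: "testfun \<Omega> \<phi>" and K: "K = closure {x. \<phi> x \<noteq> 0}"
    and k: "mollifier_kernel R \<kappa>" and R: "R < R'" "0 < R'"
    and sub: "\<And>x z. x \<in> K \<Longrightarrow> norm z \<le> R' \<Longrightarrow> gmul z x \<in> \<Omega>"
    and G: "G \<in> borel_measurable borel" "\<And>x. \<bar>G x\<bar> \<le> C"
    and J: "finite J" and wd: "\<And>j. j \<in> J \<Longrightarrow> weak_derivative \<Omega> j G (m j) (\<theta> j)"
    and f: "\<And>j. j \<in> J \<Longrightarrow> f j \<in> borel_measurable borel" "\<And>j x. j \<in> J \<Longrightarrow> \<bar>f j x\<bar> \<le> Cf"
    and dv: "weak_divergence \<Omega> J f m0 \<theta>0"
  shows "(\<integral>x. \<theta>0 x * (\<phi> x * conv \<kappa> G x) \<partial>m0) =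
    - (\<integral>x. conv \<kappa> G x * (\<Sum>j\<in>J. f j x * XX gmul j \<phi> x) \<partial>lborel)
    - (\<Sum>j\<in>J. \<integral>y. \<theta> j y * conv \<kappa> (\<lambda>x. \<phi> x * f j x) y \<partial>m j)"
proof -
  have m0: "finite_measure m0" "sets m0 = sets borel" "\<theta>0 \<in> borel_measurable borel" "\<And>x. \<bar>\<theta>0 x\<bar> = 1"
    using dv unfolding weak_divergence_def by auto
  have mj: "finite_measure (m j)" "sets (m j) = sets borel" "\<theta> j \<in> borel_measurable borel" "\<And>x. \<bar>\<theta> j x\<bar> = 1"
    if "j \<in> J" for j using wd[OF that] unfolding weak_derivative_def by auto
  note \<phi>D = testfunD[OF \<phi>, folded K]
  have Kc: "compact K" using \<phi>D by auto
  have Km: "K \<in> sets borel" using Kc by (auto intro: borel_closed compact_imp_closed)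
  have iK: "integrable lborel (indicat_real K)"
    using emeasure_compact_finite[OF Kc] Km by (intro integrable_real_indicator) auto
  obtain \<eta> A where sm: "\<And>k::nat. smooth_fun (\<eta> k)" and \<eta>0: "\<And>k x. R' \<le> norm x \<Longrightarrow> \<eta> k x = 0"
    and ap: "\<And>k x. \<bar>\<eta> k x - \<kappa> x\<bar> \<le> 1 / real (Suc k)" and \<kappa>A: "\<And>z. \<bar>\<kappa> z\<bar> \<le> A" and \<eta>A: "\<And>k z. \<bar>\<eta> k z\<bar> \<le> A"
    and \<eta>m [measurable]: "\<And>k. \<eta> k \<in> borel_measurable borel"
    by (rule kernel_smooth_approximation[OF k R]) (rule that, assumption+)
  have \<kappa>m [measurable]: "\<kappa> \<in> borel_measurable borel" by (rule kernelD(5)[OF k])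
  have [measurable]: "G \<in> borel_measurable borel" by (rule G)
  define V where "V = measure lborel ((\<lambda>w. gmul (fst w) (snd w)) ` (cball 0 R' \<times> K))"
  have \<phi>0: "\<phi> x = 0" "XX gmul j \<phi> x = 0" if "x \<notin> K" for x j
    by (rule XX_support[OF \<phi>, folded K, OF that])+
  have \<phi>c: "continuous_on S \<phi>" for S by (rule smooth_fun_continuous_on[OF \<phi>D(1)])
  have X\<phi>c: "continuous_on UNIV (XX gmul j \<phi>)" for j by (rule XX_continuous[OF \<phi>D(1)])
  have \<phi>m [measurable]: "\<phi> \<in> borel_measurable borel" "XX gmul j \<phi> \<in> borel_measurable borel" for j
    using \<phi>c X\<phi>c by (auto intro: borel_measurable_continuous_onI)
  obtain B1 where B1': "\<And>x. x \<in> K \<Longrightarrow> \<bar>\<phi> x\<bar> \<le> B1"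
    by (rule compact_continuous_bound[OF Kc \<phi>c]) (rule that, assumption)
  have B1: "\<bar>\<phi> x\<bar> \<le> \<bar>B1\<bar>" for x using B1'[of x] \<phi>0(1)[of x] by (cases "x \<in> K") auto
  have "\<forall>j. \<exists>B. \<forall>x\<in>K. \<bar>XX gmul j \<phi> x\<bar> \<le> B"
    using compact_continuous_bound[OF Kc continuous_on_subset[OF X\<phi>c subset_UNIV]] by metis
  then obtain B2 where B2': "\<forall>j. \<forall>x\<in>K. \<bar>XX gmul j \<phi> x\<bar> \<le> B2 j" unfolding choice_iff by blast
  have B2: "\<bar>XX gmul j \<phi> x\<bar> \<le> \<bar>B2 j\<bar> * indicat_real K x" for x j
    using B2' \<phi>0(2)[of x j] by (cases "x \<in> K") (auto intro: order_trans[OF _ abs_ge_self])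
  have cvd: "\<bar>conv (\<eta> n) G x - conv \<kappa> G x\<bar> \<le> (C * V) / real (Suc n)" if "x \<in> K" for n x
    using conv_uniform_difference(1)[OF G Kc that, of "\<eta> n" A R' \<kappa> "1 / real (Suc n)"]
      \<eta>0 \<eta>A \<kappa>A ap kernelD(4)[OF k] R by (auto simp: V_def)
  have cvb: "\<bar>conv \<kappa> G x\<bar> \<le> C" for x by (rule conv_bound[OF k G])
  have cm: "conv \<kappa> G \<in> borel_measurable borel" "conv (\<eta> n) G \<in> borel_measurable borel" for n by measurable
  \<comment> \<open>\<open>D j\<close> is the derivative measure mollified by
    \<open>\<kappa>\<close>, \<open>Dn n j\<close> the same with the smooth kernel; they differ by
    at most the kernel error times the mass of \<open>m j\<close>.\<close>
  define D where "D j x = (\<integral>y. \<theta> j y * \<kappa> (q x y) \<partial>m j)" for j x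
  define Dn where "Dn n j x = (\<integral>y. \<theta> j y * \<eta> n (q x y) \<partial>m j)" for n j x
  have Dd: "\<bar>Dn n j x - D j x\<bar> \<le> measure (m j) UNIV / real (Suc n)" if j: "j \<in> J" for n j x
    using measure_integral_uniform[OF mj[OF j], of "\<lambda>y. \<eta> n (q x y)" A "\<lambda>y. \<kappa> (q x y)" "1 / real (Suc n)"]
      \<eta>A \<kappa>A ap unfolding Dn_def D_def by (auto simp: mult.commute)
  have Dm: "e \<in> borel_measurable borel \<Longrightarrow> (\<lambda>x. \<integral>y. \<theta> j y * e (q x y) \<partial>m j) \<in> borel_measurable borel"
    if j: "j \<in> J" for j and e :: "real^'n \<Rightarrow> real"
  proof -
    assume [measurable]: "e \<in> borel_measurable borel"
    interpret mj: finite_measure "m j" by (rule mj(1)[OF j])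
    have [measurable]: "\<theta> j \<in> borel_measurable borel" by (rule mj(3)[OF j])
    note [measurable_cong] = mj(2)[OF j]
    show "(\<lambda>x. \<integral>y. \<theta> j y * e (q x y) \<partial>m j) \<in> borel_measurable borel"
      by (rule mj.borel_measurable_lebesgue_integral) measurable
  qed
  have Db: "\<bar>D j x\<bar> \<le> A * measure (m j) UNIV" if j: "j \<in> J" for j x
    using measure_integral_uniform[OF mj[OF j], of "\<lambda>y. \<kappa> (q x y)" A "\<lambda>y. 0" A] \<kappa>A order_trans[OF abs_ge_zero \<kappa>A]
    unfolding D_def by auto
  have fi: "integrable lborel (\<lambda>x. f j x * g x)" if j: "j \<in> J" and g: "g \<in> borel_measurable borel"
      "\<And>x. \<bar>g x\<bar> \<le> Bg * indicat_real K x" for j g Bg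
  proof (rule Bochner_Integration.integrable_bound[of _ "\<lambda>x. (Cf * Bg) * indicat_real K x"])
    show "AE x in lborel. norm (f j x * g x) \<le> norm (Cf * Bg * indicat_real K x)"
    proof (rule AE_I2)
      fix x
      have "\<bar>f j x\<bar> * \<bar>g x\<bar> \<le> Cf * (Bg * indicat_real K x)"
        by (rule mult_mono[OF f(2)[OF j] g(2)]) (use f(2)[OF j, of x] in auto)
      then show "norm (f j x * g x) \<le> norm (Cf * Bg * indicat_real K x)"
        by (simp only: real_norm_def abs_mult[of "f j x"] mult.assoc)
    qed
  qed (use iK f(1)[OF j] g(1) in auto)
  \<comment> \<open>Both weights are integrable and vanish off \<open>K\<close>; the convolution
    estimate \<open>cvd\<close> is available only on \<open>K\<close>.\<close>
  define w1 where "w1 j x = f j x * XX gmul j \<phi> x" for j x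
  define w2 where "w2 j x = f j x * \<phi> x" for j x
  have w1i: "integrable lborel (w1 j)" if "j \<in> J" for j unfolding w1_def
    by (rule fi[OF that \<phi>m(2) B2])
  have w2i: "integrable lborel (w2 j)" if "j \<in> J" for j unfolding w2_def
    by (rule fi[OF that \<phi>m(1), of "\<bar>B1\<bar>"]) (use B1 \<phi>0 in \<open>auto simp: indicator_def\<close>)
  have wz: "w1 j x = 0" "w2 j x = 0" if "x \<notin> K" for j x using \<phi>0[OF that] unfolding w1_def w2_def by auto
  have lim1: "(\<lambda>n. \<integral>x. w1 j x * conv (\<eta> n) G x \<partial>lborel) \<longlonglongrightarrow> (\<integral>x. w1 j x * conv \<kappa> G x \<partial>lborel)" if j: "j \<in> J" for j
    by (rule integral_tendsto_uniform[OF sets_lborel w1i[OF j] cm(2) cm(1) cvb]) (rule cvd, use wz in blast)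
  have lim2: "(\<lambda>n. \<integral>x. w2 j x * Dn n j x \<partial>lborel) \<longlonglongrightarrow> (\<integral>x. w2 j x * D j x \<partial>lborel)" if j: "j \<in> J" for j
    by (rule integral_tendsto_uniform[OF sets_lborel w2i[OF j] _ _ Db[OF j] Dd[OF j]])
      (unfold Dn_def D_def, (rule Dm[OF j], simp)+)
  have lim0: "(\<lambda>n. \<integral>x. (\<theta>0 x * \<phi> x) * conv (\<eta> n) G x \<partial>m0) \<longlonglongrightarrow> (\<integral>x. (\<theta>0 x * \<phi> x) * conv \<kappa> G x \<partial>m0)"
  proof (rule integral_tendsto_uniform[OF m0(2) _ cm(2) cm(1) cvb])
    show "integrable m0 (\<lambda>x. \<theta>0 x * \<phi> x)"
      by (rule finite_measure_integrable_bounded[OF m0(1,2), of _ "\<bar>B1\<bar>"]) (use m0 B1 in \<open>auto simp: abs_mult\<close>)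
    show "\<bar>conv (\<eta> n) G x - conv \<kappa> G x\<bar> \<le> (C * V) / real (Suc n)" if "\<theta>0 x * \<phi> x \<noteq> 0" for n x
      by (rule cvd) (use that \<phi>0 in auto)
  qed
  have w1c: "integrable lborel (\<lambda>x. w1 j x * conv (\<eta> n) G x)" "integrable lborel (\<lambda>x. w1 j x * conv \<kappa> G x)" if j: "j \<in> J" for j n
  proof -
    show "integrable lborel (\<lambda>x. w1 j x * conv \<kappa> G x)"
      by (rule integrable_bounded_mult[OF sets_lborel w1i[OF j] cm(1) cvb])
    show "integrable lborel (\<lambda>x. w1 j x * conv (\<eta> n) G x)"
    proof (rule Bochner_Integration.integrable_bound[of _ "\<lambda>x. (C + \<bar>C * V\<bar>) * w1 j x"])
      show "AE x in lborel. norm (w1 j x * conv (\<eta> n) G x) \<le> norm ((C + \<bar>C * V\<bar>) * w1 j x)"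
      proof (rule AE_I2)
        fix x
        show "norm (w1 j x * conv (\<eta> n) G x) \<le> norm ((C + \<bar>C * V\<bar>) * w1 j x)"
        proof (cases "x \<in> K")
          case True
          have "(C * V) / real (Suc n) \<le> \<bar>C * V\<bar>"
            using divide_left_mono[of 1 "real (Suc n)" "\<bar>C * V\<bar>"] divide_right_mono[OF abs_ge_self[of "C * V"], of "real (Suc n)"] by simp
          then have "\<bar>conv (\<eta> n) G x\<bar> \<le> \<bar>C + \<bar>C * V\<bar>\<bar>" using cvd[OF True, of n] cvb[of x] by linarith
          then have "\<bar>w1 j x\<bar> * \<bar>conv (\<eta> n) G x\<bar> \<le> \<bar>w1 j x\<bar> * \<bar>C + \<bar>C * V\<bar>\<bar>" by (rule mult_left_mono) simp
          then show ?thesis by (simp only: real_norm_def abs_mult mult.commute)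
        qed (use wz in simp)
      qed
    qed (use w1i[OF j] cm in auto)
  qed
  have w2c: "integrable lborel (\<lambda>x. w2 j x * Dn n j x)" "integrable lborel (\<lambda>x. w2 j x * D j x)" if j: "j \<in> J" for j n
  proof -
    show "integrable lborel (\<lambda>x. w2 j x * D j x)"
      by (rule integrable_bounded_mult[OF sets_lborel w2i[OF j] _ Db[OF j]]) (use Dm[OF j] in \<open>auto simp: D_def[abs_def]\<close>)
    have b: "\<bar>Dn n j x\<bar> \<le> A * measure (m j) UNIV" for x
      using measure_integral_uniform[OF mj[OF j], of "\<lambda>y. \<eta> n (q x y)" A "\<lambda>y. 0" A] \<eta>A order_trans[OF abs_ge_zero \<kappa>A]
      unfolding Dn_def by auto
    show "integrable lborel (\<lambda>x. w2 j x * Dn n j x)"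
      by (rule integrable_bounded_mult[OF sets_lborel w2i[OF j] _ b]) (use Dm[OF j] in \<open>auto simp: Dn_def[abs_def]\<close>)
  qed
  have split: "(\<integral>x. (\<Sum>j\<in>J. f j x * (XX gmul j \<phi> x * e x + \<phi> x * d j x)) \<partial>lborel)
      = (\<Sum>j\<in>J. (\<integral>x. w1 j x * e x \<partial>lborel) + (\<integral>x. w2 j x * d j x \<partial>lborel))"
    if "\<And>j. j \<in> J \<Longrightarrow> integrable lborel (\<lambda>x. w1 j x * e x)" "\<And>j. j \<in> J \<Longrightarrow> integrable lborel (\<lambda>x. w2 j x * d j x)" for e d
  proof -
    have "(\<integral>x. (\<Sum>j\<in>J. f j x * (XX gmul j \<phi> x * e x + \<phi> x * d j x)) \<partial>lborel)
      = (\<integral>x. (\<Sum>j\<in>J. w1 j x * e x + w2 j x * d j x) \<partial>lborel)" unfolding w1_def w2_def by (simp add: algebra_simps)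
    also have "\<dots> = (\<Sum>j\<in>J. \<integral>x. w1 j x * e x + w2 j x * d j x \<partial>lborel)"
      by (rule Bochner_Integration.integral_sum) (use that in auto)
    also have "\<dots> = (\<Sum>j\<in>J. (\<integral>x. w1 j x * e x \<partial>lborel) + (\<integral>x. w2 j x * d j x \<partial>lborel))"
      by (intro sum.cong refl Bochner_Integration.integral_add that)
    finally show ?thesis .
  qed
  have "(\<integral>x. \<theta>0 x * (\<phi> x * conv (\<eta> n) G x) \<partial>m0) =
      - (\<Sum>j\<in>J. (\<integral>x. w1 j x * conv (\<eta> n) G x \<partial>lborel) + (\<integral>x. w2 j x * Dn n j x \<partial>lborel))" for n
  proof -
    have "(\<integral>x. \<theta>0 x * (\<phi> x * conv (\<eta> n) G x) \<partial>m0) =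
      - (\<integral>x. (\<Sum>j\<in>J. f j x * (XX gmul j \<phi> x * conv (\<eta> n) G x + \<phi> x * Dn n j x)) \<partial>lborel)"
      unfolding Dn_def by (rule gauss_green_smooth[OF \<phi> K sub sm \<eta>0 G J wd f dv])
    then show ?thesis by (simp only: split[OF w1c(1) w2c(1)])
  qed
  then have "(\<lambda>n. \<integral>x. (\<theta>0 x * \<phi> x) * conv (\<eta> n) G x \<partial>m0) \<longlonglongrightarrow>
      - (\<Sum>j\<in>J. (\<integral>x. w1 j x * conv \<kappa> G x \<partial>lborel) + (\<integral>x. w2 j x * D j x \<partial>lborel))"
    by (simp only: mult.assoc) (intro tendsto_intros lim1 lim2)
  then have "(\<integral>x. (\<theta>0 x * \<phi> x) * conv \<kappa> G x \<partial>m0) =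
      - (\<Sum>j\<in>J. (\<integral>x. w1 j x * conv \<kappa> G x \<partial>lborel) + (\<integral>x. w2 j x * D j x \<partial>lborel))"
    using LIMSEQ_unique[OF lim0] by blast
  also have "\<dots> = - (\<Sum>j\<in>J. \<integral>x. w1 j x * conv \<kappa> G x \<partial>lborel) - (\<Sum>j\<in>J. \<integral>x. w2 j x * D j x \<partial>lborel)"
    by (simp add: sum.distrib)
  also have "(\<Sum>j\<in>J. \<integral>x. w1 j x * conv \<kappa> G x \<partial>lborel) = (\<integral>x. (\<Sum>j\<in>J. w1 j x * conv \<kappa> G x) \<partial>lborel)"
    by (rule Bochner_Integration.integral_sum[symmetric]) (use w1c in auto)
  also have "\<dots> = (\<integral>x. conv \<kappa> G x * (\<Sum>j\<in>J. f j x * XX gmul j \<phi> x) \<partial>lborel)"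
    unfolding w1_def by (simp add: sum_distrib_left mult_ac)
  \<comment> \<open>Duality moves the kernel from the derivative measure to the product of
    \<open>\<phi>\<close> and \<open>f j\<close>.\<close>
  also have "(\<Sum>j\<in>J. \<integral>x. w2 j x * D j x \<partial>lborel) = (\<Sum>j\<in>J. \<integral>y. \<theta> j y * conv \<kappa> (\<lambda>x. \<phi> x * f j x) y \<partial>m j)"
  proof (rule sum.cong[OF refl])
    fix j assume j: "j \<in> J"
    have w2b: "\<bar>w2 j x\<bar> \<le> Cf * \<bar>B1\<bar>" for x unfolding w2_def abs_mult
      by (rule mult_mono[OF f(2)[OF j] B1]) (use f(2)[OF j, of x] in auto)
    have w2m: "w2 j \<in> borel_measurable borel" unfolding w2_def using f(1)[OF j] by measurable
    from integral_conv_duality_measure(1)[OF k mj[OF j] w2m w2b Kc wz(2)]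
    show "(\<integral>x. w2 j x * D j x \<partial>lborel) = (\<integral>y. \<theta> j y * conv \<kappa> (\<lambda>x. \<phi> x * f j x) y \<partial>m j)"
      unfolding D_def w2_def by (simp add: mult.commute)
  qed
  finally show ?thesis by (simp only: mult.assoc)
qed

end

section \<open>Passage to the limit\<close>

text \<open>Dilations map boxes to boxes and scale the volume by the product of the
  \<open>r ^ deg i\<close>, that is, by \<open>r\<close> to the homogeneous dimension.\<close>

lemma lborel_distr_dil:
  assumes r: "0 < r"
  shows "(lborel :: (real^'n::finite) measure) = density (distr lborel borel (dil deg r)) (\<lambda>_. ennreal (r ^ (\<Sum>i\<in>UNIV. deg i)))"
proof (rule lborel_eqI)
  fix l u :: "real^'n"
  assume lu: "\<And>b. b \<in> Basis \<Longrightarrow> l \<bullet> b \<le> u \<bullet> b"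
  define l' u' where "l' = (\<chi> i. l $ i / r ^ deg i)" "u' = (\<chi> i. u $ i / r ^ deg i)"
  have [measurable]: "dil deg r \<in> borel_measurable borel" unfolding dil_def
    by (intro borel_measurable_continuous_onI continuous_intros)
  have rp: "0 < r ^ deg i" for i using r by simp
  have vim: "dil deg r -` box l u = box l' u'"
    using rp by (auto simp: mem_box_cart l'_u'_def dil_def pos_divide_less_eq pos_less_divide_eq mult.commute)
  have le: "l $ i \<le> u $ i" for i using lu[of "axis i 1"] by (simp add: inner_axis)
  have le': "l' \<bullet> b \<le> u' \<bullet> b" if "b \<in> Basis" for b
    using that le rp by (auto simp: Basis_vec_def inner_axis l'_u'_def divide_right_mono less_imp_le)
  have "emeasure (density (distr lborel borel (dil deg r)) (\<lambda>_. ennreal (r ^ (\<Sum>i\<in>UNIV. deg i)))) (box l u)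
      = ennreal (r ^ (\<Sum>i\<in>UNIV. deg i)) * emeasure lborel (box l' u')"
    by (simp add: emeasure_density_const emeasure_distr vim)
  also have "emeasure lborel (box l' u') = ennreal (\<Prod>i\<in>UNIV. (u' - l') $ i)"
    using le' by (simp add: emeasure_lborel_box prod_Basis_vec)
  also have "ennreal (r ^ (\<Sum>i\<in>UNIV. deg i)) * ennreal (\<Prod>i\<in>UNIV. (u' - l') $ i)
      = ennreal (r ^ (\<Sum>i\<in>UNIV. deg i) * (\<Prod>i\<in>UNIV. (u' - l') $ i))"
    using r by (simp add: ennreal_mult')
  also have "r ^ (\<Sum>i\<in>UNIV. deg i) * (\<Prod>i\<in>UNIV. (u' - l') $ i) = (\<Prod>i\<in>UNIV. (u - l) $ i)"
    unfolding power_sum prod.distrib[symmetric]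
    by (rule prod.cong) (use r in \<open>auto simp: l'_u'_def field_simps\<close>)
  finally show "emeasure (density (distr lborel borel (dil deg r)) (\<lambda>_. ennreal (r ^ (\<Sum>i\<in>UNIV. deg i)))) (box l u)
      = (\<Prod>b\<in>Basis. (u - l) \<bullet> b)" by (simp add: prod_Basis_vec)
qed simp

text \<open>\<open>R0\<close> bounds the Euclidean norm on the support of \<open>\<rho>\<close>.
  Each coordinate is scaled by \<open>\<epsilon> ^ deg i\<close>, hence by at most the sum of these
  powers, which gives a Euclidean radius; the normalising factor in \<open>moll\<close> is the
  inverse of the Jacobian of the dilation by \<open>\<epsilon>\<close>.\<close>

lemma moll_kernel:
  fixes \<rho> :: "real^'n::finite \<Rightarrow> real"
  assumes \<rho>: "admissible_moll \<rho> d"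
  obtains R0 where "\<And>\<epsilon>. 0 < \<epsilon> \<Longrightarrow> mollifier_kernel (R0 * (\<Sum>i\<in>UNIV. \<epsilon> ^ deg i)) (moll deg \<rho> \<epsilon>)"
proof -
  have c: "continuous_on UNIV \<rho>" and cp: "compact (closure {x. \<rho> x \<noteq> 0})" and nn: "\<And>x. 0 \<le> \<rho> x"
    and sy: "\<And>x. \<rho> (- x) = \<rho> x" and one: "(LINT x|lebesgue. \<rho> x) = 1"
    using \<rho> unfolding admissible_moll_def by auto
  have m [measurable]: "\<rho> \<in> borel_measurable borel" using c by (rule borel_measurable_continuous_onI)
  have one': "(\<integral>x. \<rho> x \<partial>lborel) = 1" using one integral_completion[of \<rho> lborel] by simp
  obtain R0 where R0: "0 < R0" "\<And>x. x \<in> closure {x. \<rho> x \<noteq> 0} \<Longrightarrow> norm x \<le> R0"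
    using compact_imp_bounded[OF cp] unfolding bounded_pos by blast
  show ?thesis
  proof (rule that[of R0])
    fix \<epsilon> :: real assume e: "0 < \<epsilon>"
    have dc: "continuous_on UNIV (dil deg (1 / \<epsilon>))" unfolding dil_def[abs_def] by (intro continuous_intros)
    have [measurable]: "dil deg (1 / \<epsilon>) \<in> borel_measurable borel" using dc by (rule borel_measurable_continuous_onI)
    have "moll deg \<rho> \<epsilon> x = (1 / \<epsilon>) ^ (\<Sum>i\<in>UNIV. deg i) * \<rho> (dil deg (1 / \<epsilon>) x)" for x
    proof -
      have "\<epsilon> powr (- homdim deg) = (1 / \<epsilon>) ^ (\<Sum>i\<in>UNIV. deg i)"
        unfolding homdim_def powr_minus powr_realpow[OF e] by (simp add: power_one_over inverse_eq_divide)
      then show ?thesis unfolding moll_def by simp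
    qed
    note mo = this
    show "mollifier_kernel (R0 * (\<Sum>i\<in>UNIV. \<epsilon> ^ deg i)) (moll deg \<rho> \<epsilon>)"
      unfolding mollifier_kernel_def
    proof (intro conjI allI impI)
      show "continuous_on UNIV (moll deg \<rho> \<epsilon>)" unfolding mo[abs_def]
        by (intro continuous_intros continuous_on_compose2[OF c dc]) auto
      show "0 \<le> moll deg \<rho> \<epsilon> x" for x unfolding mo using nn e by simp
      show "moll deg \<rho> \<epsilon> (- x) = moll deg \<rho> \<epsilon> x" for x
      proof -
        have "dil deg (1 / \<epsilon>) (- x) = - dil deg (1 / \<epsilon>) x" unfolding dil_def by (simp add: vec_eq_iff)
        then show ?thesis unfolding mo by (simp add: sy)
      qed
      show "moll deg \<rho> \<epsilon> x = 0" if x: "R0 * (\<Sum>i\<in>UNIV. \<epsilon> ^ deg i) < norm x" for x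
      proof (rule ccontr)
        assume "moll deg \<rho> \<epsilon> x \<noteq> 0"
        then have "\<rho> (dil deg (1 / \<epsilon>) x) \<noteq> 0" unfolding mo by auto
        then have w: "norm (dil deg (1 / \<epsilon>) x) \<le> R0"
          using R0(2) closure_subset[of "{x. \<rho> x \<noteq> 0}"] by blast
        let ?s = "\<Sum>i\<in>UNIV. \<epsilon> ^ deg i"
        have s0: "0 \<le> ?s" using e by (intro sum_nonneg) auto
        have "norm x \<le> norm (?s *\<^sub>R dil deg (1 / \<epsilon>) x)"
        proof (rule norm_le_componentwise_cart)
          fix i
          have "x $ i = \<epsilon> ^ deg i * dil deg (1 / \<epsilon>) x $ i" unfolding dil_def using e by (simp add: power_one_over)
          then have "\<bar>x $ i\<bar> = \<epsilon> ^ deg i * \<bar>dil deg (1 / \<epsilon>) x $ i\<bar>" using e by (simp add: abs_mult)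
          also have "\<dots> \<le> ?s * \<bar>dil deg (1 / \<epsilon>) x $ i\<bar>"
            by (intro mult_right_mono member_le_sum) (use e in auto)
          finally show "norm (x $ i) \<le> norm ((?s *\<^sub>R dil deg (1 / \<epsilon>) x) $ i)" using s0 by (simp add: abs_mult)
        qed
        also have "\<dots> = ?s * norm (dil deg (1 / \<epsilon>) x)" using s0 by simp
        also have "\<dots> \<le> ?s * R0" using w s0 by (rule mult_left_mono)
        finally show False using x by (simp add: mult.commute)
      qed
      have "1 = (\<integral>x. \<rho> x \<partial>density (distr lborel borel (dil deg (1 / \<epsilon>))) (\<lambda>_. ennreal ((1 / \<epsilon>) ^ (\<Sum>i\<in>UNIV. deg i))))"
        using one' lborel_distr_dil[of "1 / \<epsilon>" deg] e by simp
      also have "\<dots> = (\<integral>x. (1 / \<epsilon>) ^ (\<Sum>i\<in>UNIV. deg i) * \<rho> x \<partial>distr lborel borel (dil deg (1 / \<epsilon>)))"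
        by (subst integral_density) (use e in auto)
      also have "\<dots> = (\<integral>x. (1 / \<epsilon>) ^ (\<Sum>i\<in>UNIV. deg i) * \<rho> (dil deg (1 / \<epsilon>) x) \<partial>lborel)"
        by (rule integral_distr) measurable
      finally show "(\<integral>x. moll deg \<rho> \<epsilon> x \<partial>lborel) = 1" unfolding mo by simp
    qed
  qed
qed

context polynomial_group
begin

text \<open>Compactness leaves a margin around \<open>K\<close> inside \<open>\<Omega>\<close>, and
  products with small factors on either side move points of \<open>K\<close> by less than this
  margin.\<close>

lemma compact_subset_open_translation:
  assumes K: "compact K" and O: "open \<Omega>" "K \<subseteq> \<Omega>"
  obtains R where "0 < R" "\<And>j x z t. x \<in> K \<Longrightarrow> norm z \<le> R \<Longrightarrow> \<bar>t\<bar> \<le> R \<Longrightarrow> gmul z (gmul x (E j t)) \<in> \<Omega>"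
    "\<And>x z. x \<in> K \<Longrightarrow> norm z \<le> R \<Longrightarrow> gmul z x \<in> \<Omega>"
proof -
  obtain \<delta> where \<delta>: "\<delta> > 0" "(\<Union>x\<in>K. ball x \<delta>) \<subseteq> \<Omega>"
    by (rule compact_subset_open_imp_ball_epsilon_subset[OF K O])
  obtain R where R: "0 < R"
    "\<And>x z v. x \<in> K \<Longrightarrow> norm z \<le> R \<Longrightarrow> norm v \<le> R \<Longrightarrow> dist (gmul (gmul z x) v) x < \<delta>"
    by (rule gmul_near_identity[OF K \<delta>(1)]) (rule that, assumption+)
  have in\<Omega>: "gmul (gmul z x) v \<in> \<Omega>" if "x \<in> K" "norm z \<le> R" "norm v \<le> R" for x z v
    by (rule subsetD[OF \<delta>(2)], rule UN_I[OF that(1)]) (use R(2)[OF that] in \<open>simp add: dist_commute\<close>)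
  show ?thesis
  proof (rule that[OF R(1)])
    show "gmul z (gmul x (E j t)) \<in> \<Omega>" if "x \<in> K" "norm z \<le> R" "\<bar>t\<bar> \<le> R" for j x z t
      using in\<Omega>[of x z "E j t"] that by (simp add: assoc)
    show "gmul z x \<in> \<Omega>" if "x \<in> K" "norm z \<le> R" for x z
      using in\<Omega>[of x z 0] that R(1) by simp
  qed
qed

text \<open>The commutator estimate \<open>conv_mult_near\<close> is uniform over all points, so it
  may be integrated against any finite measure, including one singular to Lebesgue measure.\<close>

lemma conv_mult_difference_tendsto:
  assumes k: "\<And>n. mollifier_kernel (R n) (\<kappa> n)" and R: "R \<longlonglongrightarrow> 0"
    and m: "finite_measure m" "sets m = sets borel" and th: "\<theta> \<in> borel_measurable borel" "\<And>x. \<bar>\<theta> x\<bar> = 1"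
    and f: "f \<in> borel_measurable borel" "\<And>x. \<bar>f x\<bar> \<le> C"
    and \<psi>: "continuous_on UNIV \<psi>" "\<And>x. R0 < norm x \<Longrightarrow> \<psi> x = 0"
  shows "(\<lambda>n. (\<integral>y. \<theta> y * conv (\<kappa> n) (\<lambda>x. \<psi> x * f x) y \<partial>m) - (\<integral>y. \<theta> y * (\<psi> y * conv (\<kappa> n) f y) \<partial>m)) \<longlonglongrightarrow> 0"
proof (rule LIMSEQ_I)
  fix e :: real assume e: "0 < e"
  have C: "0 \<le> C" using f(2)[of 0] by linarith
  define D where "D = C * measure m UNIV + 1"
  have D: "0 < D" unfolding D_def using C by (intro add_nonneg_pos) auto
  define a where "a = e / (2 * D)"
  have a: "0 < a" unfolding a_def using e D by (intro divide_pos_pos) auto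
  obtain r where r: "0 < r" "\<And>x z. norm z \<le> r \<Longrightarrow> \<bar>\<psi> (gmul z x) - \<psi> x\<bar> \<le> a"
    using Cc_translation_uniform[OF \<psi> a] by blast
  obtain B where B': "\<And>x. x \<in> cball 0 R0 \<Longrightarrow> \<bar>\<psi> x\<bar> \<le> B"
    by (rule compact_continuous_bound[OF compact_cball continuous_on_subset[OF \<psi>(1) subset_UNIV]]) (rule that, assumption)
  have B: "\<bar>\<psi> x\<bar> \<le> \<bar>B\<bar>" for x using B'[of x] \<psi>(2)[of x] by (cases "norm x \<le> R0") auto
  have \<psi>m [measurable]: "\<psi> \<in> borel_measurable borel" using \<psi>(1) by (rule borel_measurable_continuous_onI)
  have [measurable]: "\<kappa> n \<in> borel_measurable borel" "f \<in> borel_measurable borel" for n using kernelD(5)[OF k] f by auto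
  have "\<forall>\<^sub>F n in sequentially. R n < r" using order_tendstoD(2)[OF R r(1)] .
  then obtain N where N: "\<And>n. n \<ge> N \<Longrightarrow> R n < r" unfolding eventually_sequentially by blast
  have pb: "\<bar>\<psi> x * f x\<bar> \<le> \<bar>B\<bar> * C" for x unfolding abs_mult by (rule mult_mono[OF B f(2)]) auto
  have cb: "\<bar>conv (\<kappa> n) (\<lambda>x. \<psi> x * f x) y\<bar> \<le> \<bar>B\<bar> * C" for n y by (rule conv_bound[OF k _ pb]) measurable
  have cb2: "\<bar>\<psi> y * conv (\<kappa> n) f y\<bar> \<le> \<bar>B\<bar> * C" for n y
    unfolding abs_mult by (rule mult_mono[OF B conv_bound[OF k f]]) auto
  show "\<exists>no. \<forall>n\<ge>no. norm ((\<integral>y. \<theta> y * conv (\<kappa> n) (\<lambda>x. \<psi> x * f x) y \<partial>m) - (\<integral>y. \<theta> y * (\<psi> y * conv (\<kappa> n) f y) \<partial>m) - 0) < e"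
  proof (intro exI[of _ N] allI impI)
    fix n assume n: "n \<ge> N"
    have "\<bar>(\<integral>y. \<theta> y * conv (\<kappa> n) (\<lambda>x. \<psi> x * f x) y \<partial>m) - (\<integral>y. \<theta> y * (\<psi> y * conv (\<kappa> n) f y) \<partial>m)\<bar> \<le> (a * C) * measure m UNIV"
    proof (rule measure_integral_uniform[OF m th _ cb _ cb2])
      show "\<bar>conv (\<kappa> n) (\<lambda>x. \<psi> x * f x) y - \<psi> y * conv (\<kappa> n) f y\<bar> \<le> a * C" for y
        by (rule conv_mult_near[OF k f \<psi>m B]) (use r(2) N[OF n] in force)
    qed measurable
    also have "\<dots> \<le> a * D" using a unfolding D_def by (simp add: mult.assoc)
    also have "\<dots> < e" unfolding a_def using D e by simp
    finally show "norm ((\<integral>y. \<theta> y * conv (\<kappa> n) (\<lambda>x. \<psi> x * f x) y \<partial>m) - (\<integral>y. \<theta> y * (\<psi> y * conv (\<kappa> n) f y) \<partial>m) - 0) < e"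
      by simp
  qed
qed

text \<open>One subsequence serves the mollified \<open>G\<close> in the variation of the divergence
  and the mollified \<open>f j\<close> in the variation of the \<open>j\<close>-th derivative. The
  pairing of \<open>f\<close> with the gradient of the mollified \<open>G\<close> and the last term
  of the Gauss-Green formula, up to sign, have the same limit, because both reduce to integrals of
  mollifications of \<open>\<phi> x * f j x\<close> against the derivative measures.\<close>

lemma mollified_pairing_limit:
  assumes O: "open \<Omega>" and J: "finite J"
    and G: "G \<in> borel_measurable borel" "\<And>x. \<bar>G x\<bar> \<le> C"
    and f: "\<And>j. j \<in> J \<Longrightarrow> f j \<in> borel_measurable borel" "\<And>j x. j \<in> J \<Longrightarrow> \<bar>f j x\<bar> \<le> Cf"
    and wd: "\<And>j. j \<in> J \<Longrightarrow> weak_derivative \<Omega> j G (m j) (\<theta> j)"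
    and dv: "weak_divergence \<Omega> J f m0 \<theta>0"
    and k: "\<And>n. mollifier_kernel (R n) (\<kappa> n)" and R: "R \<longlonglongrightarrow> 0"
  obtains r gt Ft where "strict_mono (r :: nat \<Rightarrow> nat)"
    "gt \<in> borel_measurable borel" "\<And>x. \<bar>gt x\<bar> \<le> C"
    "\<And>h. integrable m0 h \<Longrightarrow> (\<lambda>n. \<integral>x. conv (\<kappa> (r n)) G x * h x \<partial>m0) \<longlonglongrightarrow> (\<integral>x. gt x * h x \<partial>m0)"
    "\<And>j. j \<in> J \<Longrightarrow> Ft j \<in> borel_measurable borel" "\<And>j x. j \<in> J \<Longrightarrow> \<bar>Ft j x\<bar> \<le> Cf"
    "\<And>j h. j \<in> J \<Longrightarrow> integrable (m j) h \<Longrightarrow>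
      (\<lambda>n. \<integral>x. conv (\<kappa> (r n)) (f j) x * h x \<partial>m j) \<longlonglongrightarrow> (\<integral>x. Ft j x * h x \<partial>m j)"
    "\<And>\<phi> K. continuous_on UNIV \<phi> \<Longrightarrow> compact K \<Longrightarrow> K \<subseteq> \<Omega> \<Longrightarrow> (\<And>x. x \<notin> K \<Longrightarrow> \<phi> x = 0) \<Longrightarrow>
      (\<lambda>n. \<integral>x. \<phi> x * (\<Sum>j\<in>J. f j x * XX gmul j (conv (\<kappa> (r n)) G) x) \<partial>lborel)
        \<longlonglongrightarrow> (\<Sum>j\<in>J. \<integral>x. (\<theta> j x * Ft j x) * \<phi> x \<partial>m j)"
    "\<And>\<phi>. testfun \<Omega> \<phi> \<Longrightarrow> - (\<integral>x. G x * (\<Sum>j\<in>J. f j x * XX gmul j \<phi> x) \<partial>lborel)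
        = (\<integral>x. (\<theta>0 x * gt x) * \<phi> x \<partial>m0) + (\<Sum>j\<in>J. \<integral>x. (\<theta> j x * Ft j x) * \<phi> x \<partial>m j)"
proof -
  have m0: "finite_measure m0" "sets m0 = sets borel" "\<theta>0 \<in> borel_measurable borel" "\<And>x. \<bar>\<theta>0 x\<bar> = 1"
    using dv unfolding weak_divergence_def by auto
  have mj: "finite_measure (m j)" "sets (m j) = sets borel" "\<theta> j \<in> borel_measurable borel" "\<And>x. \<bar>\<theta> j x\<bar> = 1"
    if "j \<in> J" for j using wd[OF that] unfolding weak_derivative_def by auto
  have [measurable]: "\<kappa> n \<in> borel_measurable borel" "G \<in> borel_measurable borel" for n using kernelD(5)[OF k] G by auto
  \<comment> \<open>\<open>None\<close> stands for the divergence measure and \<open>Some j\<close>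
    for the derivative in direction \<open>j\<close>, so that one extraction of a subsequence covers
    all of them.\<close>
  define I where "I = insert None (Some ` J)"
  define M where "M = case_option m0 m"
  define F where "F = case_option (\<lambda>n. conv (\<kappa> n) G) (\<lambda>j n. conv (\<kappa> n) (f j))"
  define B where "B = case_option C (\<lambda>_::'n. Cf)"
  have "\<exists>r g. strict_mono (r :: nat \<Rightarrow> nat) \<and> (\<forall>i\<in>I. g i \<in> borel_measurable borel \<and> (\<forall>x. \<bar>g i x\<bar> \<le> B i) \<and>
    (\<forall>h. integrable (M i) h \<longrightarrow>
      (\<lambda>k. \<integral>x. F i (r k) x * h x \<partial>M i) \<longlonglongrightarrow> (\<integral>x. g i x * h x \<partial>M i)))"
  proof (rule weak_star_compact_family)
    show "finite I" unfolding I_def using J by simp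
    fix i assume i: "i \<in> I"
    show "finite_measure (M i)" "sets (M i) = sets borel"
      using i m0 mj unfolding I_def M_def by auto
    show "F i n \<in> borel_measurable borel" for n
      using i f(1) unfolding I_def F_def by (auto intro!: conv_measurable kernelD(5)[OF k] G)
    show "\<bar>F i n x\<bar> \<le> B i" for n x
      using i conv_bound[OF k G] conv_bound[OF k f] unfolding I_def F_def B_def by auto
  qed
  then obtain r g where r: "strict_mono (r :: nat \<Rightarrow> nat)" and
    g: "\<forall>i\<in>I. g i \<in> borel_measurable borel \<and> (\<forall>x. \<bar>g i x\<bar> \<le> B i) \<and>
    (\<forall>h. integrable (M i) h \<longrightarrow>
      (\<lambda>k. \<integral>x. F i (r k) x * h x \<partial>M i) \<longlonglongrightarrow> (\<integral>x. g i x * h x \<partial>M i))" by blast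
  define gt where "gt = g None"
  define Ft where "Ft j = g (Some j)" for j
  have gt: "gt \<in> borel_measurable borel" "\<And>x. \<bar>gt x\<bar> \<le> C"
    "\<And>h. integrable m0 h \<Longrightarrow> (\<lambda>n. \<integral>x. conv (\<kappa> (r n)) G x * h x \<partial>m0) \<longlonglongrightarrow> (\<integral>x. gt x * h x \<partial>m0)"
    using bspec[OF g, of None] unfolding I_def gt_def M_def F_def B_def by simp_all
  have Ft: "Ft j \<in> borel_measurable borel" "\<And>x. \<bar>Ft j x\<bar> \<le> Cf"
    "\<And>h. integrable (m j) h \<Longrightarrow> (\<lambda>n. \<integral>x. conv (\<kappa> (r n)) (f j) x * h x \<partial>m j) \<longlonglongrightarrow> (\<integral>x. Ft j x * h x \<partial>m j)"
    if "j \<in> J" for j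
    using bspec[OF g, of "Some j"] that unfolding I_def Ft_def M_def F_def B_def by simp_all
  have kr: "mollifier_kernel (R (r n)) (\<kappa> (r n))" for n by (rule k)
  have Rr: "(\<lambda>n. R (r n)) \<longlonglongrightarrow> 0" using LIMSEQ_subseq_LIMSEQ[OF R r] by (simp add: o_def)
  \<comment> \<open>Pulling \<open>\<phi>\<close> out of the mollification costs an error tending to
    0; what remains is the weak limit \<open>Ft j\<close> tested with
    \<open>\<theta> j x * \<phi> x\<close>.\<close>
  have dual_lim: "(\<lambda>n. \<Sum>j\<in>J. \<integral>y. \<theta> j y * conv (\<kappa> (r n)) (\<lambda>x. \<phi> x * f j x) y \<partial>m j)
        \<longlonglongrightarrow> (\<Sum>j\<in>J. \<integral>x. (\<theta> j x * Ft j x) * \<phi> x \<partial>m j)"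
    if \<phi>: "continuous_on UNIV \<phi>" "\<And>x. R0 < norm x \<Longrightarrow> \<phi> x = 0" for \<phi> R0
  proof (rule tendsto_sum)
    fix j assume j: "j \<in> J"
    have \<phi>m: "\<phi> \<in> borel_measurable borel" using \<phi>(1) by (rule borel_measurable_continuous_onI)
    obtain b where b': "\<And>x. x \<in> cball 0 R0 \<Longrightarrow> \<bar>\<phi> x\<bar> \<le> b"
      by (rule compact_continuous_bound[OF compact_cball continuous_on_subset[OF \<phi>(1) subset_UNIV]]) (rule that, assumption)
    have b: "\<bar>\<phi> x\<bar> \<le> \<bar>b\<bar>" for x using b'[of x] \<phi>(2)[of x] by (cases "norm x \<le> R0") auto
    have "integrable (m j) (\<lambda>x. \<theta> j x * \<phi> x)"
      by (rule finite_measure_integrable_bounded[OF mj(1,2)[OF j], of _ "\<bar>b\<bar>"]) (use mj[OF j] \<phi>m b in \<open>auto simp: abs_mult\<close>)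
    then have "(\<lambda>n. \<integral>x. conv (\<kappa> (r n)) (f j) x * (\<theta> j x * \<phi> x) \<partial>m j) \<longlonglongrightarrow> (\<integral>x. Ft j x * (\<theta> j x * \<phi> x) \<partial>m j)"
      by (rule Ft(3)[OF j])
    then have "(\<lambda>n. \<integral>x. \<theta> j x * (\<phi> x * conv (\<kappa> (r n)) (f j) x) \<partial>m j) \<longlonglongrightarrow> (\<integral>x. (\<theta> j x * Ft j x) * \<phi> x \<partial>m j)"
      by (simp add: mult_ac)
    from tendsto_add[OF conv_mult_difference_tendsto[OF kr Rr mj[OF j] f(1)[OF j] f(2)[OF j] \<phi>] this]
    show "(\<lambda>n. \<integral>y. \<theta> j y * conv (\<kappa> (r n)) (\<lambda>x. \<phi> x * f j x) y \<partial>m j) \<longlonglongrightarrow> (\<integral>x. (\<theta> j x * Ft j x) * \<phi> x \<partial>m j)"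
      by simp
  qed
  have pair: "(\<lambda>n. \<integral>x. \<phi> x * (\<Sum>j\<in>J. f j x * XX gmul j (conv (\<kappa> (r n)) G) x) \<partial>lborel)
        \<longlonglongrightarrow> (\<Sum>j\<in>J. \<integral>x. (\<theta> j x * Ft j x) * \<phi> x \<partial>m j)"
    if \<phi>: "continuous_on UNIV \<phi>" and K: "compact K" "K \<subseteq> \<Omega>" "\<And>x. x \<notin> K \<Longrightarrow> \<phi> x = 0" for \<phi> K
  proof -
    obtain R0 where R0: "\<And>x. x \<in> K \<Longrightarrow> norm x \<le> R0" using compact_imp_bounded[OF K(1)] unfolding bounded_iff by blast
    have \<phi>0: "\<phi> x = 0" if "R0 < norm x" for x using K(3)[of x] R0[of x] that by force
    have \<phi>m: "\<phi> \<in> borel_measurable borel" using \<phi> by (rule borel_measurable_continuous_onI)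
    obtain b where b': "\<And>x. x \<in> K \<Longrightarrow> \<bar>\<phi> x\<bar> \<le> b"
      by (rule compact_continuous_bound[OF K(1) continuous_on_subset[OF \<phi> subset_UNIV]]) (rule that, assumption)
    have b: "\<bar>\<phi> x\<bar> \<le> \<bar>b\<bar>" for x using b'[of x] K(3)[of x] by (cases "x \<in> K") auto
    obtain R' where R': "0 < R'" "\<And>j x z t. x \<in> K \<Longrightarrow> norm z \<le> R' \<Longrightarrow> \<bar>t\<bar> \<le> R' \<Longrightarrow> gmul z (gmul x (E j t)) \<in> \<Omega>"
      by (rule compact_subset_open_translation[OF K(1) O K(2)]) (rule that, assumption+)
    have "\<forall>\<^sub>F n in sequentially. R (r n) < R'" using order_tendstoD(2)[OF Rr R'(1)] .
    then have "\<forall>\<^sub>F n in sequentially. (\<Sum>j\<in>J. \<integral>y. \<theta> j y * conv (\<kappa> (r n)) (\<lambda>x. \<phi> x * f j x) y \<partial>m j)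
       = (\<integral>x. \<phi> x * (\<Sum>j\<in>J. f j x * XX gmul j (conv (\<kappa> (r n)) G) x) \<partial>lborel)"
    proof eventually_elim
      case (elim n)
      \<comment> \<open>For radii below \<open>R'\<close> the derivative on \<open>K\<close> is the
        mollified derivative measure; off \<open>K\<close> the factor \<open>\<phi>\<close>
        vanishes, whatever the value of \<open>XX\<close> there.\<close>
      have X: "XX gmul j (conv (\<kappa> (r n)) G) x = (\<integral>y. \<theta> j y * \<kappa> (r n) (q x y) \<partial>m j)" if "j \<in> J" "x \<in> K" for j x
        by (rule XX_conv_kernel[OF kr elim R'(1) G wd[OF that(1)] R'(1)]) (use R'(2) that in auto)
      define D where "D j x = (\<integral>y. \<theta> j y * \<kappa> (r n) (q x y) \<partial>m j)" for j x
      have pm: "(\<lambda>x. \<phi> x * f j x) \<in> borel_measurable borel" if "j \<in> J" for j using \<phi>m f(1)[OF that] by measurable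
      have pb: "\<bar>\<phi> x * f j x\<bar> \<le> \<bar>b\<bar> * Cf" if "j \<in> J" for j x
        unfolding abs_mult by (rule mult_mono[OF b f(2)[OF that]]) auto
      have p0: "\<phi> x * f j x = 0" if "x \<notin> K" for j x using K(3)[OF that] by simp
      note dual = integral_conv_duality_measure[OF kr mj pm pb K(1) p0]
      have "(\<integral>x. \<phi> x * (\<Sum>j\<in>J. f j x * XX gmul j (conv (\<kappa> (r n)) G) x) \<partial>lborel)
          = (\<integral>x. (\<Sum>j\<in>J. (\<phi> x * f j x) * D j x) \<partial>lborel)"
      proof (rule Bochner_Integration.integral_cong[OF refl])
        fix x
        show "\<phi> x * (\<Sum>j\<in>J. f j x * XX gmul j (conv (\<kappa> (r n)) G) x) = (\<Sum>j\<in>J. (\<phi> x * f j x) * D j x)"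
          by (cases "x \<in> K") (auto simp: K(3) X D_def sum_distrib_left mult.assoc)
      qed
      also have "\<dots> = (\<Sum>j\<in>J. \<integral>x. (\<phi> x * f j x) * D j x \<partial>lborel)"
        by (rule Bochner_Integration.integral_sum) (use dual(2) in \<open>auto simp: D_def\<close>)
      also have "\<dots> = (\<Sum>j\<in>J. \<integral>y. \<theta> j y * conv (\<kappa> (r n)) (\<lambda>x. \<phi> x * f j x) y \<partial>m j)"
        by (rule sum.cong[OF refl]) (use dual(1) in \<open>simp add: D_def\<close>)
      finally show ?case by simp
    qed
    from Lim_transform_eventually[OF dual_lim[OF \<phi> \<phi>0] this] show ?thesis .
  qed
  have identity: "- (\<integral>x. G x * (\<Sum>j\<in>J. f j x * XX gmul j \<phi> x) \<partial>lborel)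
        = (\<integral>x. (\<theta>0 x * gt x) * \<phi> x \<partial>m0) + (\<Sum>j\<in>J. \<integral>x. (\<theta> j x * Ft j x) * \<phi> x \<partial>m j)"
    if \<phi>: "testfun \<Omega> \<phi>" for \<phi>
  proof -
    define K where "K = closure {x. \<phi> x \<noteq> 0}"
    note \<phi>D = testfunD[OF \<phi>, folded K_def]
    have \<phi>0: "\<phi> x = 0" "XX gmul j \<phi> x = 0" if "x \<notin> K" for x j
      by (rule XX_support[OF \<phi>, folded K_def, OF that])+
    have \<phi>c: "continuous_on S \<phi>" for S by (rule smooth_fun_continuous_on[OF \<phi>D(1)])
    have \<phi>m: "\<phi> \<in> borel_measurable borel" using \<phi>c by (rule borel_measurable_continuous_onI)
    obtain R0 where R0: "\<And>x. x \<in> K \<Longrightarrow> norm x \<le> R0" using compact_imp_bounded[OF \<phi>D(2)] unfolding bounded_iff by blast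
    have \<phi>R0: "\<phi> x = 0" if "R0 < norm x" for x using \<phi>0(1)[of x] R0[of x] that by force
    obtain b where b': "\<And>x. x \<in> K \<Longrightarrow> \<bar>\<phi> x\<bar> \<le> b"
      by (rule compact_continuous_bound[OF \<phi>D(2) \<phi>c]) (rule that, assumption)
    have b: "\<bar>\<phi> x\<bar> \<le> \<bar>b\<bar>" for x using b'[of x] \<phi>0(1)[of x] by (cases "x \<in> K") auto
    obtain R' where R': "0 < R'" "\<And>x z. x \<in> K \<Longrightarrow> norm z \<le> R' \<Longrightarrow> gmul z x \<in> \<Omega>"
      by (rule compact_subset_open_translation[OF \<phi>D(2) O \<phi>D(3)]) (rule that, assumption+)
    have i\<phi>: "integrable m0 (\<lambda>x. \<theta>0 x * \<phi> x)"
      by (rule finite_measure_integrable_bounded[OF m0(1,2), of _ "\<bar>b\<bar>"]) (use m0 \<phi>m b in \<open>auto simp: abs_mult\<close>)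
    have L0: "(\<lambda>n. \<integral>x. \<theta>0 x * (\<phi> x * conv (\<kappa> (r n)) G x) \<partial>m0) \<longlonglongrightarrow> (\<integral>x. (\<theta>0 x * gt x) * \<phi> x \<partial>m0)"
      using gt(3)[OF i\<phi>] by (simp add: mult_ac)
    have hi: "integrable lborel (\<lambda>x. \<Sum>j\<in>J. f j x * XX gmul j \<phi> x)"
    proof (rule Bochner_Integration.integrable_sum)
      fix j assume j: "j \<in> J"
      have Xi: "integrable lborel (XX gmul j \<phi>)"
        by (rule integrable_continuous_bounded_support[OF XX_continuous[OF \<phi>D(1)], of R0])
          (use \<phi>0(2) R0 in force)
      show "integrable lborel (\<lambda>x. f j x * XX gmul j \<phi> x)"
        using integrable_bounded_mult[OF sets_lborel Xi f(1)[OF j] f(2)[OF j]] by (simp add: mult.commute)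
    qed
    \<comment> \<open>In this term the integration is against Lebesgue measure, where mollification
      converges weakly to \<open>G\<close> itself; the other terms of the formula converge through
      the extracted limits.\<close>
    have L1: "(\<lambda>n. \<integral>x. conv (\<kappa> (r n)) G x * (\<Sum>j\<in>J. f j x * XX gmul j \<phi> x) \<partial>lborel)
        \<longlonglongrightarrow> (\<integral>x. G x * (\<Sum>j\<in>J. f j x * XX gmul j \<phi> x) \<partial>lborel)"
      by (rule conv_weak_limit[OF kr Rr G hi])
    have "\<forall>\<^sub>F n in sequentially. R (r n) < R'" using order_tendstoD(2)[OF Rr R'(1)] .
    then have ev: "\<forall>\<^sub>F n in sequentially. - (\<integral>x. conv (\<kappa> (r n)) G x * (\<Sum>j\<in>J. f j x * XX gmul j \<phi> x) \<partial>lborel)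
        - (\<Sum>j\<in>J. \<integral>y. \<theta> j y * conv (\<kappa> (r n)) (\<lambda>x. \<phi> x * f j x) y \<partial>m j)
       = (\<integral>x. \<theta>0 x * (\<phi> x * conv (\<kappa> (r n)) G x) \<partial>m0)"
    proof eventually_elim
      case (elim n)
      show ?case
        by (rule gauss_green_kernel[OF \<phi> K_def kr elim R'(1) R'(2) G J wd f dv, symmetric])
    qed
    have "(\<lambda>n. - (\<integral>x. conv (\<kappa> (r n)) G x * (\<Sum>j\<in>J. f j x * XX gmul j \<phi> x) \<partial>lborel)
        - (\<Sum>j\<in>J. \<integral>y. \<theta> j y * conv (\<kappa> (r n)) (\<lambda>x. \<phi> x * f j x) y \<partial>m j))
      \<longlonglongrightarrow> - (\<integral>x. G x * (\<Sum>j\<in>J. f j x * XX gmul j \<phi> x) \<partial>lborel)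
        - (\<Sum>j\<in>J. \<integral>x. (\<theta> j x * Ft j x) * \<phi> x \<partial>m j)"
      by (intro tendsto_diff tendsto_minus L1 dual_lim[OF \<phi>c \<phi>R0])
    from LIMSEQ_unique[OF Lim_transform_eventually[OF this ev] L0] show ?thesis by simp
  qed
  show ?thesis by (rule that[OF r gt Ft(1) Ft(2) Ft(3) pair identity])
qed

end

section \<open>Stratified groups\<close>

lemma stratified_exp_polynomial_group:
  assumes "stratified_exp gmul deg"
  shows "polynomial_group gmul"
  using assms unfolding stratified_exp_def by unfold_locales auto

text \<open>\<open>F\<close> and \<open>g\<close> are only Lebesgue measurable on
  \<open>\<Omega>\<close>, whereas the divergence and derivative measures live on Borel sets; zero
  extensions are therefore replaced by Borel functions equal to them almost everywhere.\<close>

lemma borel_version: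
  assumes "set_borel_measurable lebesgue \<Omega> u"
  shows "(\<lambda>x. indicator \<Omega> x * u x) \<in> borel_measurable lebesgue"
    and "\<exists>v\<in>borel_measurable borel. AE x in lborel. indicator \<Omega> x * u x = (v x :: real)"
proof -
  show m: "(\<lambda>x. indicator \<Omega> x * u x) \<in> borel_measurable lebesgue"
    using assms unfolding set_borel_measurable_def by simp
  show "\<exists>v\<in>borel_measurable borel. AE x in lborel. indicator \<Omega> x * u x = (v x :: real)"
    using completion_ex_borel_measurable_real[OF m] by simp
qed

lemma integral_lebesgue_eq_lborel:
  fixes u v :: "'a::euclidean_space \<Rightarrow> real"
  assumes "u \<in> borel_measurable lebesgue" "v \<in> borel_measurable borel" "AE x in lborel. u x = v x"
  shows "(\<integral>x. u x \<partial>lebesgue) = (\<integral>x. v x \<partial>lborel)"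
proof -
  have "(\<integral>x. u x \<partial>lebesgue) = (\<integral>x. v x \<partial>lebesgue)"
    by (rule integral_cong_AE) (use assms in \<open>auto intro: AE_completion measurable_completion\<close>)
  also have "\<dots> = (\<integral>x. v x \<partial>lborel)" by (rule integral_completion) (use assms in simp)
  finally show ?thesis .
qed

text \<open>The infimum of the essential bounds is itself one: the exceptional sets for the bounds
  \<open>Inf S + 1 / real (Suc n)\<close> have a null union.\<close>

lemma hsupnorm_AE:
  assumes "LinfH deg \<Omega> F"
  shows "0 \<le> hsupnorm deg \<Omega> F" "AE x in lborel. x \<in> \<Omega> \<longrightarrow> hnorm deg (F x) \<le> hsupnorm deg \<Omega> F"
proof -
  define S where "S = {C. C \<ge> 0 \<and> (AE x in lebesgue. x \<in> \<Omega> \<longrightarrow> hnorm deg (F x) \<le> C)}"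
  obtain C where "AE x in lebesgue. x \<in> \<Omega> \<longrightarrow> hnorm deg (F x) \<le> C" using assms unfolding LinfH_def by blast
  then have "AE x in lebesgue. x \<in> \<Omega> \<longrightarrow> hnorm deg (F x) \<le> max 0 C" by eventually_elim auto
  then have ne: "S \<noteq> {}" unfolding S_def by (auto intro!: exI[of _ "max 0 C"])
  have h: "hsupnorm deg \<Omega> F = Inf S" unfolding hsupnorm_def S_def ..
  show "0 \<le> hsupnorm deg \<Omega> F" unfolding h by (rule cInf_greatest[OF ne]) (auto simp: S_def)
  have bdd: "bdd_below S" unfolding S_def by (auto intro!: bdd_belowI[of _ 0])
  have "AE x in lborel. \<forall>n::nat. x \<in> \<Omega> \<longrightarrow> hnorm deg (F x) \<le> Inf S + 1 / real (Suc n)"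
    unfolding AE_all_countable
  proof
    fix n :: nat
    obtain C where "C \<in> S" "C < Inf S + 1 / real (Suc n)"
      using cInf_less_iff[OF ne bdd, of "Inf S + 1 / real (Suc n)"] by auto
    then have "AE x in lebesgue. x \<in> \<Omega> \<longrightarrow> hnorm deg (F x) \<le> Inf S + 1 / real (Suc n)"
      unfolding S_def by (auto elim!: eventually_mono)
    then show "AE x in lborel. x \<in> \<Omega> \<longrightarrow> hnorm deg (F x) \<le> Inf S + 1 / real (Suc n)"
      by (simp only: AE_completion_iff)
  qed
  then show "AE x in lborel. x \<in> \<Omega> \<longrightarrow> hnorm deg (F x) \<le> hsupnorm deg \<Omega> F"
  proof eventually_elim
    case (elim x)
    show ?case
    proof
      assume "x \<in> \<Omega>"
      then have le: "hnorm deg (F x) \<le> Inf S + 1 / real (Suc n)" for n using elim by blast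
      have "(\<lambda>n. Inf S + 1 / real (Suc n)) \<longlonglongrightarrow> Inf S + 0"
        using LIMSEQ_inverse_real_of_nat by (intro tendsto_add tendsto_const) (simp add: divide_inverse)
      then show "hnorm deg (F x) \<le> hsupnorm deg \<Omega> F" unfolding h
        using le by (intro LIMSEQ_le_const[of _ "Inf S"]) auto
    qed
  qed
qed

text \<open>Polar form of a set function, prepared for use: set values are stated for all Borel sets
  by intersecting with \<open>\<Omega>\<close>, integrals for bounded Borel integrands.\<close>

definition fsm_density :: "(real^'n::finite) set \<Rightarrow> ((real^'n) set \<Rightarrow> real) \<Rightarrow> (real^'n \<Rightarrow> real) \<Rightarrow> bool" where
  "fsm_density \<Omega> \<nu> \<theta> \<longleftrightarrow> finite_measure (tvm \<Omega> \<nu>) \<and> sets (tvm \<Omega> \<nu>) = sets borel \<and>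
    emeasure (tvm \<Omega> \<nu>) (-\<Omega>) = 0 \<and> \<theta> \<in> borel_measurable borel \<and> (\<forall>x. \<bar>\<theta> x\<bar> = 1) \<and>
    (\<forall>A\<in>sets borel. tvar \<Omega> \<nu> A = measure (tvm \<Omega> \<nu>) A) \<and>
    (\<forall>f C. f \<in> borel_measurable borel \<longrightarrow> (\<forall>x. \<bar>f x\<bar> \<le> C) \<longrightarrow> sint \<Omega> \<nu> f = (\<integral>x. \<theta> x * f x \<partial>tvm \<Omega> \<nu>)) \<and>
    (\<forall>A\<in>sets borel. \<nu> (A \<inter> \<Omega>) = (\<integral>x. \<theta> x * indicator A x \<partial>tvm \<Omega> \<nu>))"

lemma fsm_density_exists:
  fixes \<Omega> :: "(real^'n::finite) set"
  assumes fsm: "fsm \<Omega> \<nu>" and Om: "\<Omega> \<in> sets borel"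
  shows "\<exists>\<theta>. fsm_density \<Omega> \<nu> \<theta>"
proof -
  obtain \<theta> where fin: "finite_measure (tvm \<Omega> \<nu>)" and sm: "sets (tvm \<Omega> \<nu>) = sets borel"
    and out: "emeasure (tvm \<Omega> \<nu>) (-\<Omega>) = 0"
    and tv: "\<And>A. A \<in> sets borel \<Longrightarrow> tvar \<Omega> \<nu> A = measure (tvm \<Omega> \<nu>) A"
    and th: "\<theta> \<in> borel_measurable borel" "\<And>x. \<bar>\<theta> x\<bar> = 1"
    and si: "\<And>f. f \<in> borel_measurable borel \<Longrightarrow> integrable (tvm \<Omega> \<nu>) f \<Longrightarrow>
        sint \<Omega> \<nu> f = (\<integral>x. \<theta> x * f x \<partial>tvm \<Omega> \<nu>)"
    and rep: "\<And>A. A \<in> sets borel \<Longrightarrow> A \<subseteq> \<Omega> \<Longrightarrow> \<nu> A = (\<integral>x. \<theta> x * indicator A x \<partial>tvm \<Omega> \<nu>)"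
    by (rule fsm_representation[OF fsm Om]) (rule that, assumption+)
  note mc = measurable_cong_sets[OF sm refl]
  have ae: "AE x in tvm \<Omega> \<nu>. x \<notin> -\<Omega>" using sm out Om by (intro AE_not_in) (auto simp: null_sets_def)
  have all: "\<nu> (A \<inter> \<Omega>) = (\<integral>x. \<theta> x * indicator A x \<partial>tvm \<Omega> \<nu>)" if A: "A \<in> sets borel" for A
  proof -
    have "\<nu> (A \<inter> \<Omega>) = (\<integral>x. \<theta> x * indicator (A \<inter> \<Omega>) x \<partial>tvm \<Omega> \<nu>)" by (rule rep) (use A Om in auto)
    also have "\<dots> = (\<integral>x. \<theta> x * indicator A x \<partial>tvm \<Omega> \<nu>)"
    proof (rule integral_cong_AE)
      show "AE x in tvm \<Omega> \<nu>. \<theta> x * indicator (A \<inter> \<Omega>) x = \<theta> x * indicator A x"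
        using ae by eventually_elim (auto simp: indicator_def)
      have "A \<in> sets borel" "A \<inter> \<Omega> \<in> sets borel" using A Om by auto
      then show "(\<lambda>x. \<theta> x * indicator (A \<inter> \<Omega>) x) \<in> borel_measurable (tvm \<Omega> \<nu>)"
        "(\<lambda>x. \<theta> x * indicator A x) \<in> borel_measurable (tvm \<Omega> \<nu>)"
        using th(1) by (auto simp: mc intro!: borel_measurable_times borel_measurable_indicator)
    qed
    finally show ?thesis .
  qed
  show ?thesis unfolding fsm_density_def
    by (intro exI[of _ \<theta>] conjI fin sm out th ballI allI impI tv all si)
      (auto intro: finite_measure_integrable_bounded[OF fin sm])
qed

lemma fsm_densityD:
  assumes "fsm_density \<Omega> \<nu> \<theta>"
  shows "finite_measure (tvm \<Omega> \<nu>)" "sets (tvm \<Omega> \<nu>) = sets borel" "emeasure (tvm \<Omega> \<nu>) (-\<Omega>) = 0"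
    "\<theta> \<in> borel_measurable borel" "\<And>x. \<bar>\<theta> x\<bar> = 1"
    "\<And>A. A \<in> sets borel \<Longrightarrow> tvar \<Omega> \<nu> A = measure (tvm \<Omega> \<nu>) A"
    "\<And>f C. f \<in> borel_measurable borel \<Longrightarrow> (\<And>x. \<bar>f x\<bar> \<le> C) \<Longrightarrow> sint \<Omega> \<nu> f = (\<integral>x. \<theta> x * f x \<partial>tvm \<Omega> \<nu>)"
    "\<And>A. A \<in> sets borel \<Longrightarrow> \<nu> (A \<inter> \<Omega>) = (\<integral>x. \<theta> x * indicator A x \<partial>tvm \<Omega> \<nu>)"
  using assms unfolding fsm_density_def by blast+

lemma fsm_density_integrable:
  assumes "fsm_density \<Omega> \<nu> \<theta>" "f \<in> borel_measurable borel" "\<And>x. \<bar>f x\<bar> \<le> C"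
  shows "integrable (tvm \<Omega> \<nu>) (\<lambda>x. \<theta> x * f x)" "integrable (tvm \<Omega> \<nu>) f"
proof -
  note d = fsm_densityD[OF assms(1)]
  show "integrable (tvm \<Omega> \<nu>) f" by (rule finite_measure_integrable_bounded[OF d(1,2) assms(2,3)])
  show "integrable (tvm \<Omega> \<nu>) (\<lambda>x. \<theta> x * f x)"
    by (rule finite_measure_integrable_bounded[OF d(1,2), of _ C]) (use d(4,5) assms in \<open>auto simp: abs_mult\<close>)
qed

lemma fsm_density_abs_le:
  assumes d: "fsm_density \<Omega> \<nu> \<theta>" and B: "B \<in> sets borel" "B \<subseteq> A" "B \<subseteq> \<Omega>" "A \<in> sets borel"
  shows "\<bar>\<nu> B\<bar> \<le> tvar \<Omega> \<nu> A"
proof -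
  note D = fsm_densityD[OF d]
  interpret finite_measure "tvm \<Omega> \<nu>" by (rule D(1))
  have sp: "space (tvm \<Omega> \<nu>) = UNIV" using sets_eq_imp_space_eq[OF D(2)] by simp
  have i1: "integrable (tvm \<Omega> \<nu>) (\<lambda>x. \<theta> x * indicat_real B x)" "integrable (tvm \<Omega> \<nu>) (indicat_real B)"
    by (rule fsm_density_integrable[OF d, of _ 1]; use B in \<open>auto simp: indicator_le_1\<close>)+
  have "\<nu> B = (\<integral>x. \<theta> x * indicator B x \<partial>tvm \<Omega> \<nu>)" using D(8)[OF B(1)] B(3) by (simp add: Int_absorb2)
  also have "\<bar>\<dots>\<bar> \<le> (\<integral>x. indicator B x \<partial>tvm \<Omega> \<nu>)"
    by (rule integral_abs_bound_integral[OF i1]) (simp add: abs_mult D(5))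
  also have "\<dots> = measure (tvm \<Omega> \<nu>) B" by (simp add: sp)
  also have "\<dots> \<le> measure (tvm \<Omega> \<nu>) A" by (rule finite_measure_mono) (use B D(2) in auto)
  finally show ?thesis using D(6)[OF B(4)] by simp
qed

text \<open>\<open>XX\<close> is a \<open>deriv\<close>, so its measurability is not visible from
  the definition. On \<open>K\<close> and for small radii it equals an integral depending measurably
  on \<open>x\<close>, and \<open>\<phi>\<close> removes the remaining points.\<close>

lemma (in polynomial_group) mollified_XX_measurable:
  assumes O: "open \<Omega>" and G: "G \<in> borel_measurable borel" "\<And>x. \<bar>G x\<bar> \<le> C"
    and wd: "weak_derivative \<Omega> j G m \<theta>"
    and k: "\<And>n. mollifier_kernel (R n) (\<kappa> n)" and R: "R \<longlonglongrightarrow> 0"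
    and \<phi>: "\<phi> \<in> borel_measurable borel" and K: "compact K" "K \<subseteq> \<Omega>" "\<And>x. x \<notin> K \<Longrightarrow> \<phi> x = 0"
  shows "\<forall>\<^sub>F n in sequentially. (\<lambda>x. \<phi> x * XX gmul j (conv (\<kappa> n) G) x) \<in> borel_measurable borel"
proof -
  have m: "finite_measure m" "sets m = sets borel" and th [measurable]: "\<theta> \<in> borel_measurable borel"
    using wd unfolding weak_derivative_def by auto
  interpret m: finite_measure m by (rule m(1))
  obtain R' where R': "0 < R'" "\<And>j x z t. x \<in> K \<Longrightarrow> norm z \<le> R' \<Longrightarrow> \<bar>t\<bar> \<le> R' \<Longrightarrow> gmul z (gmul x (E j t)) \<in> \<Omega>"
    by (rule compact_subset_open_translation[OF K(1) O K(2)]) (rule that, assumption+)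
  have "\<forall>\<^sub>F n in sequentially. R n < R'" using order_tendstoD(2)[OF R R'(1)] .
  then show ?thesis
  proof eventually_elim
    case (elim n)
    have X: "XX gmul j (conv (\<kappa> n) G) x = (\<integral>y. \<theta> y * \<kappa> n (q x y) \<partial>m)" if "x \<in> K" for x
      by (rule XX_conv_kernel[OF k elim R'(1) G wd R'(1)]) (use R'(2) that in auto)
    have e: "\<phi> x * XX gmul j (conv (\<kappa> n) G) x = \<phi> x * (\<integral>y. \<theta> y * \<kappa> n (q x y) \<partial>m)" for x
      by (cases "x \<in> K") (auto simp: K(3) X)
    have [measurable]: "\<kappa> n \<in> borel_measurable borel" by (rule kernelD(5)[OF k])
    note [measurable_cong] = m(2)
    have "(\<lambda>x. \<integral>y. \<theta> y * \<kappa> n (q x y) \<partial>m) \<in> borel_measurable borel"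
      by (rule m.borel_measurable_lebesgue_integral) measurable
    then show ?case unfolding e using \<phi> by measurable
  qed
qed

theorem theorem1p2:
  fixes gmul :: "real^'n::finite \<Rightarrow> real^'n \<Rightarrow> real^'n"
    and deg :: "'n \<Rightarrow> nat"
    and d :: "real^'n \<Rightarrow> real^'n \<Rightarrow> real"
    and \<Omega> :: "(real^'n) set"
    and F :: "real^'n \<Rightarrow> real^'n"
    and divF :: "(real^'n) set \<Rightarrow> real"
    and g :: "real^'n \<Rightarrow> real"
    and Dg Ds :: "'n \<Rightarrow> (real^'n) set \<Rightarrow> real"
    and ng :: "real^'n \<Rightarrow> real^'n"
    and \<rho> :: "real^'n \<Rightarrow> real"
  assumes grp: "stratified_exp gmul deg"
    and dist: "homdist gmul deg d"
    and opn: "open \<Omega>"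
    and F_DM: "DMinf gmul deg \<Omega> F"
    and divF: "is_hdiv gmul deg \<Omega> F divF"
    and g_inf: "Linf_on \<Omega> g"
    and g_var: "Hvar gmul deg \<Omega> g < \<infinity>"
    and Dg: "is_DH gmul deg \<Omega> g Dg"
    and ng_int: "\<forall>j\<in>hor deg. set_integrable lebesgue \<Omega> (\<lambda>x. ng x $ j)"
    and Ds: "\<forall>j\<in>hor deg. fsm \<Omega> (Ds j) \<and> sing_leb \<Omega> (Ds j)"
    and Dg_dec: "\<forall>j\<in>hor deg. \<forall>A\<in>sets borel. A \<subseteq> \<Omega> \<longrightarrow>
                   Dg j A = (LINT x:A|lebesgue. ng x $ j) + Ds j A"
    and moll: "admissible_moll \<rho> d"
  shows "DMinf gmul deg \<Omega> (\<lambda>x. g x *\<^sub>R F x) \<and>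
    (\<forall>e::nat \<Rightarrow> real. (\<forall>k. e k > 0) \<and> e \<longlonglongrightarrow> 0 \<longrightarrow>
      (\<exists>r gt P. strict_mono r \<and>
         gt \<in> borel_measurable (tvm \<Omega> divF) \<and>
         (\<exists>C. AE x in tvm \<Omega> divF. \<bar>gt x\<bar> \<le> C) \<and>
         (\<forall>h. integrable (tvm \<Omega> divF) h \<longrightarrow>
            (\<lambda>k. \<integral>x. mconv gmul deg \<Omega> \<rho> (e (r k)) g x * h x \<partial>tvm \<Omega> divF)
              \<longlonglongrightarrow> (\<integral>x. gt x * h x \<partial>tvm \<Omega> divF)) \<and>
         fsm \<Omega> P \<and>
         (\<forall>\<phi>. Ccfun \<Omega> \<phi> \<longrightarrow>
            (\<lambda>k. LINT x|lebesgue. \<phi> x *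
                 hinner deg (F x) (hgrad gmul (mconv gmul deg \<Omega> \<rho> (e (r k)) g) x))
              \<longlonglongrightarrow> sint \<Omega> P \<phi>) \<and>
         (\<exists>dv. is_hdiv gmul deg \<Omega> (\<lambda>x. g x *\<^sub>R F x) dv \<and>
             (\<forall>A\<in>sets borel. A \<subseteq> \<Omega> \<longrightarrow>
                dv A = sint \<Omega> divF (\<lambda>x. indicator A x * gt x) + P A)) \<and>
         (\<forall>A\<in>sets borel. A \<subseteq> \<Omega> \<longrightarrow>
            tvar \<Omega> P A \<le> hsupnorm deg \<Omega> F * tvarv (hor deg) \<Omega> Dg A) \<and>
         sing_leb \<Omega> (\<lambda>A. P A - (LINT x:A|lebesgue. hinner deg (F x) (ng x))) \<and>
         (\<forall>A\<in>sets borel. A \<subseteq> \<Omega> \<longrightarrow>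
            tvar \<Omega> (\<lambda>A. P A - (LINT x:A|lebesgue. hinner deg (F x) (ng x))) A
              \<le> hsupnorm deg \<Omega> F * tvarv (hor deg) \<Omega> Ds A)))"
proof -
  interpret polynomial_group gmul by (rule stratified_exp_polynomial_group[OF grp])
  let ?J = "hor deg"
  have J: "finite ?J" by simp
  have Om: "\<Omega> \<in> sets borel" using opn by simp
  have F_inf: "LinfH deg \<Omega> F" using F_DM unfolding DMinf_def by simp
  define CF where "CF = hsupnorm deg \<Omega> F"
  have CF0: "0 \<le> CF" and CF: "AE x in lborel. x \<in> \<Omega> \<longrightarrow> hnorm deg (F x) \<le> CF"
    unfolding CF_def using hsupnorm_AE[OF F_inf] by auto

  \<comment> \<open>Borel representatives with bounds at every point\<close>
  have gm: "(\<lambda>x. indicator \<Omega> x * g x) \<in> borel_measurable lebesgue"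
    using g_inf borel_version(1) unfolding Linf_on_def by blast
  obtain G0 where G0: "G0 \<in> borel_measurable borel" "AE x in lborel. indicator \<Omega> x * g x = G0 x"
    using g_inf borel_version(2) unfolding Linf_on_def by blast
  obtain C0 where "AE x in lebesgue. x \<in> \<Omega> \<longrightarrow> \<bar>g x\<bar> \<le> C0" using g_inf unfolding Linf_on_def by blast
  then have C0: "AE x in lborel. x \<in> \<Omega> \<longrightarrow> \<bar>g x\<bar> \<le> C0" by (simp only: AE_completion_iff)
  define C where "C = max 0 C0"
  \<comment> \<open>Zero off \<open>\<Omega>\<close> and bounded at every point, as the convolution
    lemmas require; it differs from the zero extension of \<open>g\<close> on a Lebesgue null set
    only, which mollification does not see.\<close>
  define G where "G x = (if x \<in> \<Omega> \<and> \<bar>G0 x\<bar> \<le> C then G0 x else 0)" for x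
  have Gm [measurable]: "G \<in> borel_measurable borel"
  proof -
    have [measurable]: "\<Omega> \<in> sets borel" "G0 \<in> borel_measurable borel" using Om G0 by auto
    show ?thesis unfolding G_def[abs_def] by measurable
  qed
  have Gb: "\<bar>G x\<bar> \<le> C" for x unfolding G_def C_def by auto
  have Gae: "AE x in lborel. indicator \<Omega> x * g x = G x"
    using G0(2) C0
  proof eventually_elim
    case (elim x)
    then show ?case by (cases "x \<in> \<Omega>") (auto simp: G_def C_def)
  qed

  have Fm: "(\<lambda>x. indicator \<Omega> x * F x $ j) \<in> borel_measurable lebesgue" if "j \<in> ?J" for j
    using F_inf borel_version(1)[of \<Omega> "\<lambda>x. F x $ j"] that unfolding LinfH_def by blast
  have "\<exists>v. v \<in> borel_measurable borel \<and> (AE x in lborel. indicator \<Omega> x * F x $ j = v x)" if "j \<in> ?J" for j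
  proof -
    have "set_borel_measurable lebesgue \<Omega> (\<lambda>x. F x $ j)" using F_inf that unfolding LinfH_def by blast
    from borel_version(2)[OF this] show ?thesis by blast
  qed
  then have "\<exists>f0. \<forall>j\<in>?J. f0 j \<in> borel_measurable borel \<and> (AE x in lborel. indicator \<Omega> x * F x $ j = f0 j x)"
    by (intro bchoice) blast
  then obtain f0 where "\<forall>j\<in>?J. f0 j \<in> borel_measurable borel \<and> (AE x in lborel. indicator \<Omega> x * F x $ j = f0 j x)" ..
  then have f0: "\<And>j. j \<in> ?J \<Longrightarrow> f0 j \<in> borel_measurable borel"
    "\<And>j. j \<in> ?J \<Longrightarrow> AE x in lborel. indicator \<Omega> x * F x $ j = f0 j x" by blast+
  \<comment> \<open>The cutoff uses the Euclidean norm of the whole vector, so that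
    \<open>hsupnorm\<close> bounds the field at every point and with it all mollifications.\<close>
  define f where "f j x = (if x \<in> \<Omega> \<and> sqrt (\<Sum>i\<in>?J. (f0 i x)\<^sup>2) \<le> CF then f0 j x else 0)" for j x
  have fm: "f j \<in> borel_measurable borel" if "j \<in> ?J" for j
  proof -
    have [measurable]: "\<Omega> \<in> sets borel" "f0 j \<in> borel_measurable borel" using Om f0 that by auto
    have "(\<lambda>x. \<Sum>i\<in>?J. (f0 i x)\<^sup>2) \<in> borel_measurable borel"
      by (intro borel_measurable_sum borel_measurable_power f0(1))
    then have [measurable]: "(\<lambda>x. sqrt (\<Sum>i\<in>?J. (f0 i x)\<^sup>2)) \<in> borel_measurable borel"
      by measurable
    show ?thesis unfolding f_def[abs_def] by measurable
  qed
  have fb: "sqrt (\<Sum>j\<in>?J. (f j x)\<^sup>2) \<le> CF" for x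
    using CF0 by (cases "x \<in> \<Omega> \<and> sqrt (\<Sum>i\<in>?J. (f0 i x)\<^sup>2) \<le> CF") (auto simp: f_def)
  have fb1: "\<bar>f j x\<bar> \<le> CF" if "j \<in> ?J" for j x
  proof -
    have "\<bar>f j x\<bar> \<le> L2_set (\<lambda>j. f j x) ?J"
      using member_le_L2_set[OF J that, of "\<lambda>j. \<bar>f j x\<bar>"] by (simp add: L2_set_def)
    then show ?thesis using fb[of x] unfolding L2_set_def by linarith
  qed
  have fae: "AE x in lborel. \<forall>j\<in>?J. indicator \<Omega> x * F x $ j = f j x"
  proof -
    have "AE x in lborel. \<forall>j\<in>?J. indicator \<Omega> x * F x $ j = f0 j x"
      using f0(2) by (intro AE_finite_allI[OF J])
    then show ?thesis using CF
    proof eventually_elim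
      case (elim x)
      show ?case
      proof (cases "x \<in> \<Omega>")
        case True
        then have e: "f0 j x = F x $ j" if "j \<in> ?J" for j using elim(1) that by auto
        then have "(\<Sum>j\<in>?J. (f0 j x)\<^sup>2) = (\<Sum>j\<in>?J. (F x $ j)\<^sup>2)" by (intro sum.cong) auto
        then show ?thesis using elim(2) True e unfolding f_def hnorm_def by auto
      qed (simp add: f_def)
    qed
  qed

  have nm: "(\<lambda>x. indicator \<Omega> x * ng x $ j) \<in> borel_measurable lebesgue"
    and ni: "integrable lebesgue (\<lambda>x. indicator \<Omega> x * ng x $ j)" if "j \<in> ?J" for j
    using ng_int that unfolding set_integrable_def by auto
  have "\<forall>j\<in>?J. \<exists>v. v \<in> borel_measurable borel \<and> (AE x in lborel. indicator \<Omega> x * ng x $ j = v x)"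
  proof
    fix j assume "j \<in> ?J"
    from completion_ex_borel_measurable_real[OF nm[OF this]]
    show "\<exists>v. v \<in> borel_measurable borel \<and> (AE x in lborel. indicator \<Omega> x * ng x $ j = v x)" by auto
  qed
  then have "\<exists>n0. \<forall>j\<in>?J. n0 j \<in> borel_measurable borel \<and> (AE x in lborel. indicator \<Omega> x * ng x $ j = n0 j x)"
    by (intro bchoice) blast
  then obtain n0 where "\<forall>j\<in>?J. n0 j \<in> borel_measurable borel \<and> (AE x in lborel. indicator \<Omega> x * ng x $ j = n0 j x)" ..
  then have n0: "\<And>j. j \<in> ?J \<Longrightarrow> n0 j \<in> borel_measurable borel"
    "\<And>j. j \<in> ?J \<Longrightarrow> AE x in lborel. indicator \<Omega> x * ng x $ j = n0 j x" by blast+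
  have nb: "n0 j \<in> borel_measurable lborel" if "j \<in> ?J" for j using n0(1)[OF that] by simp
  have nint: "integrable lborel (n0 j)" if j: "j \<in> ?J" for j
  proof -
    have "integrable lebesgue (n0 j)"
      by (rule integrable_cong_AE_imp[OF ni[OF j]])
        (use measurable_completion[OF nb[OF j]] AE_completion[OF n0(2)[OF j]] in auto)
    then show ?thesis using integrable_completion[OF nb[OF j]] by simp
  qed
  have nae: "AE x in lborel. \<forall>j\<in>?J. indicator \<Omega> x * ng x $ j = n0 j x"
    using n0(2) by (intro AE_finite_allI[OF J])

  \<comment> \<open>Polar forms of the divergence, the derivative and its singular part\<close>
  obtain \<theta>0 where d0: "fsm_density \<Omega> divF \<theta>0"
    using fsm_density_exists[OF _ Om] divF unfolding is_hdiv_def by blast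
  have fsmD: "\<forall>j\<in>?J. fsm \<Omega> (Dg j)" using Dg unfolding is_DH_def by blast
  have fsmS: "\<forall>j\<in>?J. fsm \<Omega> (Ds j)" using Ds by blast
  have "\<forall>j\<in>?J. \<exists>\<theta>. fsm_density \<Omega> (Dg j) \<theta>" using fsmD fsm_density_exists[OF _ Om] by blast
  then obtain \<theta> where d: "\<And>j. j \<in> ?J \<Longrightarrow> fsm_density \<Omega> (Dg j) (\<theta> j)" by metis
  have "\<forall>j\<in>?J. \<exists>\<theta>. fsm_density \<Omega> (Ds j) \<theta>" using fsmS fsm_density_exists[OF _ Om] by blast
  then obtain \<sigma> where s: "\<And>j. j \<in> ?J \<Longrightarrow> fsm_density \<Omega> (Ds j) (\<sigma> j)" by metis
  define m0 where "m0 = tvm \<Omega> divF"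
  define m where "m j = tvm \<Omega> (Dg j)" for j
  define ms where "ms j = tvm \<Omega> (Ds j)" for j
  note D0 = fsm_densityD[OF d0, folded m0_def]
  note D = fsm_densityD[OF d, folded m_def]
  note S = fsm_densityD[OF s, folded ms_def]

  \<comment> \<open>Weak derivative and divergence of the representatives\<close>
  have tf_facts: "\<phi> \<in> borel_measurable borel" "\<exists>B. \<forall>x. \<bar>\<phi> x\<bar> \<le> B" "XX gmul j \<phi> \<in> borel_measurable borel"
    if \<phi>: "testfun \<Omega> \<phi>" for \<phi> j
  proof -
    note \<phi>D = testfunD[OF \<phi>]
    have c: "continuous_on S \<phi>" for S by (rule smooth_fun_continuous_on[OF \<phi>D(1)])
    show "\<phi> \<in> borel_measurable borel" using c by (rule borel_measurable_continuous_onI)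
    show "XX gmul j \<phi> \<in> borel_measurable borel"
      using XX_continuous[OF \<phi>D(1)] by (rule borel_measurable_continuous_onI)
    obtain B where B: "\<And>x. x \<in> closure {x. \<phi> x \<noteq> 0} \<Longrightarrow> \<bar>\<phi> x\<bar> \<le> B"
      by (rule compact_continuous_bound[OF \<phi>D(2) c]) (rule that, assumption)
    have "\<bar>\<phi> x\<bar> \<le> \<bar>B\<bar>" for x
      using B[of x] XX_support(1)[OF \<phi>, of x] by (cases "x \<in> closure {x. \<phi> x \<noteq> 0}") auto
    then show "\<exists>B. \<forall>x. \<bar>\<phi> x\<bar> \<le> B" by blast
  qed
  have wd: "weak_derivative \<Omega> j G (m j) (\<theta> j)" if j: "j \<in> ?J" for j
    unfolding weak_derivative_def
  proof (intro conjI allI impI)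
    fix \<phi> assume \<phi>: "testfun \<Omega> \<phi>"
    note [measurable] = tf_facts(3)[OF \<phi>, of j]
    obtain B where B: "\<And>x. \<bar>\<phi> x\<bar> \<le> B" using tf_facts(2)[OF \<phi>] by blast
    have "(LINT x:\<Omega>|lebesgue. g x * XX gmul j \<phi> x) = (\<integral>x. G x * XX gmul j \<phi> x \<partial>lborel)"
      unfolding set_lebesgue_integral_def
    proof (rule integral_lebesgue_eq_lborel)
      have "XX gmul j \<phi> \<in> borel_measurable lebesgue" by (rule measurable_completion) measurable
      then have "(\<lambda>x. (indicator \<Omega> x * g x) * XX gmul j \<phi> x) \<in> borel_measurable lebesgue" using gm by measurable
      then show "(\<lambda>x. indicator \<Omega> x *\<^sub>R (g x * XX gmul j \<phi> x)) \<in> borel_measurable lebesgue" by (simp add: mult.assoc)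
      show "AE x in lborel. indicator \<Omega> x *\<^sub>R (g x * XX gmul j \<phi> x) = G x * XX gmul j \<phi> x"
        using Gae by eventually_elim (simp add: mult.assoc[symmetric])
    qed measurable
    moreover have "(LINT x:\<Omega>|lebesgue. g x * XX gmul j \<phi> x) = - sint \<Omega> (Dg j) \<phi>"
      using Dg j \<phi> unfolding is_DH_def by blast
    moreover have "sint \<Omega> (Dg j) \<phi> = (\<integral>x. \<theta> j x * \<phi> x \<partial>m j)" by (rule D(7)[OF j tf_facts(1)[OF \<phi>] B])
    ultimately show "(\<integral>x. G x * XX gmul j \<phi> x \<partial>lborel) = - (\<integral>x. \<theta> j x * \<phi> x \<partial>m j)" by simp
  qed (use D[OF j] in auto)
  \<comment> \<open>The factor \<open>u\<close> vanishes off \<open>\<Omega>\<close>, so the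
    components of \<open>F\<close> may be multiplied by the indicator of \<open>\<Omega>\<close>
    before they are replaced by Borel representatives.\<close>
  have hinner_eq: "(\<integral>x. u x * hinner deg (F x) (w x) \<partial>lebesgue) = (\<integral>x. v x * (\<Sum>j\<in>?J. f j x * w x $ j) \<partial>lborel)"
    if u: "u \<in> borel_measurable lebesgue" "\<And>x. x \<notin> \<Omega> \<Longrightarrow> u x = 0" and v: "v \<in> borel_measurable borel" "AE x in lborel. u x = v x"
      and w: "\<And>j. j \<in> ?J \<Longrightarrow> (\<lambda>x. w x $ j) \<in> borel_measurable borel" for u v and w :: "real^'n \<Rightarrow> real^'n"
  proof (rule integral_lebesgue_eq_lborel)
    have e: "u x * hinner deg (F x) (w x) = u x * (\<Sum>j\<in>?J. (indicator \<Omega> x * F x $ j) * w x $ j)" for x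
      using u(2)[of x] unfolding hinner_def by (cases "x \<in> \<Omega>") auto
    have wl: "(\<lambda>x. w x $ j) \<in> borel_measurable lebesgue" if "j \<in> ?J" for j
      by (rule measurable_completion) (use w[OF that] in simp)
    show "(\<lambda>x. u x * hinner deg (F x) (w x)) \<in> borel_measurable lebesgue" unfolding e
      by (intro borel_measurable_times borel_measurable_sum u(1) Fm wl)
    show "(\<lambda>x. v x * (\<Sum>j\<in>?J. f j x * w x $ j)) \<in> borel_measurable borel"
      by (intro borel_measurable_times borel_measurable_sum v(1) fm w)
    show "AE x in lborel. u x * hinner deg (F x) (w x) = v x * (\<Sum>j\<in>?J. f j x * w x $ j)"
      unfolding e using v(2) fae by eventually_elim simp
  qed
  have dv: "weak_divergence \<Omega> ?J f m0 \<theta>0" unfolding weak_divergence_def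
  proof (intro conjI allI impI)
    fix \<phi> assume \<phi>: "testfun \<Omega> \<phi>"
    obtain B where B: "\<And>x. \<bar>\<phi> x\<bar> \<le> B" using tf_facts(2)[OF \<phi>] by blast
    have iO: "indicat_real \<Omega> \<in> borel_measurable borel" using Om by simp
    have iL: "indicat_real \<Omega> \<in> borel_measurable lebesgue" by (rule measurable_completion) (use iO in simp)
    have "(LINT x:\<Omega>|lebesgue. hinner deg (F x) (hgrad gmul \<phi> x))
        = (\<integral>x. indicator \<Omega> x * (\<Sum>j\<in>?J. f j x * hgrad gmul \<phi> x $ j) \<partial>lborel)"
      unfolding set_lebesgue_integral_def real_scaleR_def
      by (rule hinner_eq) (use iO iL tf_facts(3)[OF \<phi>] Om in \<open>auto simp: hgrad_def\<close>)
    also have "\<dots> = (\<integral>x. (\<Sum>j\<in>?J. f j x * XX gmul j \<phi> x) \<partial>lborel)"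
      by (rule Bochner_Integration.integral_cong) (auto simp: hgrad_def f_def indicator_def)
    finally have "- (\<integral>x. (\<Sum>j\<in>?J. f j x * XX gmul j \<phi> x) \<partial>lborel) = sint \<Omega> divF \<phi>"
      using divF \<phi> unfolding is_hdiv_def by auto
    also have "\<dots> = (\<integral>x. \<theta>0 x * \<phi> x \<partial>m0)" by (rule D0(7)[OF tf_facts(1)[OF \<phi>] B])
    finally show "- (\<integral>x. (\<Sum>j\<in>?J. f j x * XX gmul j \<phi> x) \<partial>lborel) = (\<integral>x. \<theta>0 x * \<phi> x \<partial>m0)" .
  qed (use D0 in auto)

  \<comment> \<open>Kernels of the mollification\<close>
  obtain R0 where ker: "\<And>\<epsilon>. 0 < \<epsilon> \<Longrightarrow> mollifier_kernel (R0 * (\<Sum>i\<in>UNIV. \<epsilon> ^ deg i)) (moll deg \<rho> \<epsilon>)"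
    using moll_kernel[OF moll] by blast
  have deg1: "deg i \<ge> 1" for i using grp unfolding stratified_exp_def by blast
  \<comment> \<open>The integral over \<open>\<Omega>\<close> in \<open>mconv\<close> becomes one
    over the whole space, since \<open>G\<close> is almost everywhere the zero extension of
    \<open>g\<close>.\<close>
  have mc: "mconv gmul deg \<Omega> \<rho> \<epsilon> g = conv (moll deg \<rho> \<epsilon>) G" if \<epsilon>: "0 < \<epsilon>" for \<epsilon>
  proof
    fix x
    note km [measurable] = kernelD(5)[OF ker[OF \<epsilon>]]
    show "mconv gmul deg \<Omega> \<rho> \<epsilon> g x = conv (moll deg \<rho> \<epsilon>) G x"
      unfolding mconv_def conv_def set_lebesgue_integral_def q_def[symmetric]
    proof (rule integral_lebesgue_eq_lborel)
      have "(\<lambda>y. moll deg \<rho> \<epsilon> (q x y)) \<in> borel_measurable lebesgue" by (rule measurable_completion) measurable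
      then have "(\<lambda>y. moll deg \<rho> \<epsilon> (q x y) * (indicator \<Omega> y * g y)) \<in> borel_measurable lebesgue" using gm by measurable
      then show "(\<lambda>y. indicator \<Omega> y *\<^sub>R (moll deg \<rho> \<epsilon> (q x y) * g y)) \<in> borel_measurable lebesgue"
        by (simp add: mult_ac)
      show "(\<lambda>y. moll deg \<rho> \<epsilon> (q x y) * G y) \<in> borel_measurable borel" by measurable
      show "AE y in lborel. indicator \<Omega> y *\<^sub>R (moll deg \<rho> \<epsilon> (q x y) * g y) = moll deg \<rho> \<epsilon> (q x y) * G y"
        using Gae by eventually_elim (auto simp: mult_ac)
    qed
  qed

  \<comment> \<open>Limits along a subsequence and their properties\<close>
  have main: "\<exists>r gt P. strict_mono r \<and>
         gt \<in> borel_measurable (tvm \<Omega> divF) \<and>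
         (\<exists>C. AE x in tvm \<Omega> divF. \<bar>gt x\<bar> \<le> C) \<and>
         (\<forall>h. integrable (tvm \<Omega> divF) h \<longrightarrow>
            (\<lambda>k. \<integral>x. mconv gmul deg \<Omega> \<rho> (e (r k)) g x * h x \<partial>tvm \<Omega> divF)
              \<longlonglongrightarrow> (\<integral>x. gt x * h x \<partial>tvm \<Omega> divF)) \<and>
         fsm \<Omega> P \<and>
         (\<forall>\<phi>. Ccfun \<Omega> \<phi> \<longrightarrow>
            (\<lambda>k. LINT x|lebesgue. \<phi> x *
                 hinner deg (F x) (hgrad gmul (mconv gmul deg \<Omega> \<rho> (e (r k)) g) x))
              \<longlonglongrightarrow> sint \<Omega> P \<phi>) \<and>
         (\<exists>dv. is_hdiv gmul deg \<Omega> (\<lambda>x. g x *\<^sub>R F x) dv \<and>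
             (\<forall>A\<in>sets borel. A \<subseteq> \<Omega> \<longrightarrow>
                dv A = sint \<Omega> divF (\<lambda>x. indicator A x * gt x) + P A)) \<and>
         (\<forall>A\<in>sets borel. A \<subseteq> \<Omega> \<longrightarrow>
            tvar \<Omega> P A \<le> hsupnorm deg \<Omega> F * tvarv (hor deg) \<Omega> Dg A) \<and>
         sing_leb \<Omega> (\<lambda>A. P A - (LINT x:A|lebesgue. hinner deg (F x) (ng x))) \<and>
         (\<forall>A\<in>sets borel. A \<subseteq> \<Omega> \<longrightarrow>
            tvar \<Omega> (\<lambda>A. P A - (LINT x:A|lebesgue. hinner deg (F x) (ng x))) A
              \<le> hsupnorm deg \<Omega> F * tvarv (hor deg) \<Omega> Ds A)"
    if e: "\<And>k. e k > 0" "e \<longlonglongrightarrow> 0" for e :: "nat \<Rightarrow> real"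
  proof -
    define \<kappa> where "\<kappa> k = moll deg \<rho> (e k)" for k
    define R where "R k = R0 * (\<Sum>i\<in>UNIV. e k ^ deg i)" for k
    have k: "mollifier_kernel (R n) (\<kappa> n)" for n unfolding R_def \<kappa>_def by (rule ker[OF e(1)])
    \<comment> \<open>Every \<open>deg i\<close> is at least 1, so each \<open>0 ^ deg i\<close> is
      0 and the radii tend to 0.\<close>
    have "(\<lambda>k. R0 * (\<Sum>i\<in>UNIV. e k ^ deg i)) \<longlonglongrightarrow> R0 * (\<Sum>i\<in>UNIV. 0 ^ deg i)"
      by (intro tendsto_intros e)
    moreover have "(0::real) ^ deg i = 0" for i using deg1[of i] by (simp add: power_0_left)
    ultimately have R: "R \<longlonglongrightarrow> 0" unfolding R_def by simp
    obtain r gt Ft where r: "strict_mono (r :: nat \<Rightarrow> nat)"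
      and gt: "gt \<in> borel_measurable borel" "\<And>x. \<bar>gt x\<bar> \<le> C"
      and gt_lim: "\<And>h. integrable m0 h \<Longrightarrow> (\<lambda>n. \<integral>x. conv (\<kappa> (r n)) G x * h x \<partial>m0) \<longlonglongrightarrow> (\<integral>x. gt x * h x \<partial>m0)"
      and Ft: "\<And>j. j \<in> ?J \<Longrightarrow> Ft j \<in> borel_measurable borel" "\<And>j x. j \<in> ?J \<Longrightarrow> \<bar>Ft j x\<bar> \<le> CF"
      and Ft_lim: "\<And>j h. j \<in> ?J \<Longrightarrow> integrable (m j) h \<Longrightarrow>
        (\<lambda>n. \<integral>x. conv (\<kappa> (r n)) (f j) x * h x \<partial>m j) \<longlonglongrightarrow> (\<integral>x. Ft j x * h x \<partial>m j)"
      and pair: "\<And>\<phi> K. continuous_on UNIV \<phi> \<Longrightarrow> compact K \<Longrightarrow> K \<subseteq> \<Omega> \<Longrightarrow> (\<And>x. x \<notin> K \<Longrightarrow> \<phi> x = 0) \<Longrightarrow>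
        (\<lambda>n. \<integral>x. \<phi> x * (\<Sum>j\<in>?J. f j x * XX gmul j (conv (\<kappa> (r n)) G) x) \<partial>lborel)
          \<longlonglongrightarrow> (\<Sum>j\<in>?J. \<integral>x. (\<theta> j x * Ft j x) * \<phi> x \<partial>m j)"
      and ident: "\<And>\<phi>. testfun \<Omega> \<phi> \<Longrightarrow> - (\<integral>x. G x * (\<Sum>j\<in>?J. f j x * XX gmul j \<phi> x) \<partial>lborel)
          = (\<integral>x. (\<theta>0 x * gt x) * \<phi> x \<partial>m0) + (\<Sum>j\<in>?J. \<integral>x. (\<theta> j x * Ft j x) * \<phi> x \<partial>m j)"
      apply (rule mollified_pairing_limit[OF opn J Gm Gb fm fb1 wd dv k R])
          apply assumption+
      subgoal premises p for r gt Ft by (rule p(1)) (fact p)+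
      done
    \<comment> \<open>The pairing is \<open>Ft j\<close> times the measure \<open>Dg j\<close>,
      summed over the horizontal directions; adding \<open>gt\<close> times the divergence of
      \<open>F\<close> gives the divergence of the product.\<close>
    define P where "P A = (\<Sum>j\<in>?J. \<integral>x. (\<theta> j x * Ft j x) * indicator A x \<partial>m j)" for A
    define dv' where "dv' A = (\<integral>x. (\<theta>0 x * gt x) * indicator A x \<partial>m0) + P A" for A
    have iP: "integrable (m j) (\<lambda>x. \<theta> j x * Ft j x)" if "j \<in> ?J" for j
      using fsm_density_integrable(1)[OF d[OF that] Ft(1)[OF that] Ft(2)[OF that]] unfolding m_def .
    have i0: "integrable m0 (\<lambda>x. \<theta>0 x * gt x)"
      using fsm_density_integrable(1)[OF d0 gt] unfolding m0_def .
    have fsmP: "fsm \<Omega> P"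
      by (rule fsm_sum_density[OF J D(2) iP]) (simp_all add: P_def)
    have sintP: "sint \<Omega> P \<phi> = (\<Sum>j\<in>?J. \<integral>x. (\<theta> j x * Ft j x) * \<phi> x \<partial>m j)"
      if "\<phi> \<in> borel_measurable borel" "\<And>x. \<bar>\<phi> x\<bar> \<le> B" for \<phi> B
      by (rule sint_sum_density[OF J D(2) iP _ D(3) Om that]) (simp_all add: P_def)
    define I where "I = insert None (Some ` ?J)"
    define M where "M = case_option m0 m"
    define kk where "kk = case_option (\<lambda>x. \<theta>0 x * gt x) (\<lambda>j x. \<theta> j x * Ft j x)"
    have I: "finite I" unfolding I_def by simp
    have M: "sets (M i) = sets borel" "emeasure (M i) (-\<Omega>) = 0" "integrable (M i) (kk i)" if "i \<in> I" for i
      using that D0(2,3) D(2,3) iP i0 unfolding I_def M_def kk_def by auto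
    have Isum: "(\<Sum>i\<in>I. \<integral>x. kk i x * h x \<partial>M i) = (\<integral>x. (\<theta>0 x * gt x) * h x \<partial>m0) + (\<Sum>j\<in>?J. \<integral>x. (\<theta> j x * Ft j x) * h x \<partial>m j)" for h
      unfolding I_def M_def kk_def by (simp add: sum.reindex)
    have dvI: "dv' A = (\<Sum>i\<in>I. \<integral>x. kk i x * indicator A x \<partial>M i)" for A
      unfolding Isum dv'_def P_def ..
    have fsmdv: "fsm \<Omega> dv'" by (rule fsm_sum_density[OF I M(1) M(3)]) (simp_all add: dvI)
    have sintdv: "sint \<Omega> dv' \<phi> = (\<integral>x. (\<theta>0 x * gt x) * \<phi> x \<partial>m0) + (\<Sum>j\<in>?J. \<integral>x. (\<theta> j x * Ft j x) * \<phi> x \<partial>m j)"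
      if "\<phi> \<in> borel_measurable borel" "\<And>x. \<bar>\<phi> x\<bar> \<le> B" for \<phi> B
      unfolding Isum[symmetric] by (rule sint_sum_density[OF I M(1) M(3) _ M(2) Om that]) (simp_all add: dvI)
    have kr: "mollifier_kernel (R (r n)) (\<kappa> (r n))" for n by (rule k)
    have Rr: "(\<lambda>n. R (r n)) \<longlonglongrightarrow> 0" using LIMSEQ_subseq_LIMSEQ[OF R r] by (simp add: o_def)
    have mcr: "mconv gmul deg \<Omega> \<rho> (e (r n)) g = conv (\<kappa> (r n)) G" for n unfolding \<kappa>_def by (rule mc[OF e(1)])

    have c1: "gt \<in> borel_measurable (tvm \<Omega> divF)" using gt(1) D0(2) unfolding m0_def by (simp add: measurable_cong_sets[OF D0(2)[unfolded m0_def] refl])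
    have c2: "\<exists>C. AE x in tvm \<Omega> divF. \<bar>gt x\<bar> \<le> C" using gt(2) by (intro exI[of _ C]) simp
    have c3: "(\<lambda>k. \<integral>x. mconv gmul deg \<Omega> \<rho> (e (r k)) g x * h x \<partial>tvm \<Omega> divF)
              \<longlonglongrightarrow> (\<integral>x. gt x * h x \<partial>tvm \<Omega> divF)" if "integrable (tvm \<Omega> divF) h" for h
      using gt_lim[of h] that unfolding mcr m0_def by blast
    have c4: "(\<lambda>k. LINT x|lebesgue. \<phi> x * hinner deg (F x) (hgrad gmul (mconv gmul deg \<Omega> \<rho> (e (r k)) g) x))
              \<longlonglongrightarrow> sint \<Omega> P \<phi>" if \<phi>: "Ccfun \<Omega> \<phi>" for \<phi>
    proof -
      define K where "K = closure {x. \<phi> x \<noteq> 0}"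
      have \<phi>c: "continuous_on UNIV \<phi>" and K: "compact K" "K \<subseteq> \<Omega>"
        using \<phi> unfolding Ccfun_def csupp_in_def K_def by auto
      have K0: "\<phi> x = 0" if "x \<notin> K" for x
        using that subsetD[OF closure_subset, of x "{x. \<phi> x \<noteq> 0}"] unfolding K_def by blast
      have \<phi>m: "\<phi> \<in> borel_measurable borel" using \<phi>c by (rule borel_measurable_continuous_onI)
      obtain B where B': "\<And>x. x \<in> K \<Longrightarrow> \<bar>\<phi> x\<bar> \<le> B"
        by (rule compact_continuous_bound[OF K(1) continuous_on_subset[OF \<phi>c subset_UNIV]]) (rule that, assumption)
      have B: "\<bar>\<phi> x\<bar> \<le> \<bar>B\<bar>" for x using B'[of x] K0[of x] by (cases "x \<in> K") auto
      have "\<forall>\<^sub>F n in sequentially. \<forall>j\<in>?J. (\<lambda>x. \<phi> x * XX gmul j (conv (\<kappa> (r n)) G) x) \<in> borel_measurable borel"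
        by (intro eventually_ball_finite J ballI mollified_XX_measurable[OF opn Gm Gb wd kr Rr \<phi>m K K0])
      then have ev: "\<forall>\<^sub>F n in sequentially. (\<integral>x. \<phi> x * (\<Sum>j\<in>?J. f j x * XX gmul j (conv (\<kappa> (r n)) G) x) \<partial>lborel)
          = (LINT x|lebesgue. \<phi> x * hinner deg (F x) (hgrad gmul (mconv gmul deg \<Omega> \<rho> (e (r n)) g) x))"
      proof eventually_elim
        case (elim n)
        \<comment> \<open>\<open>\<phi>\<close> is placed inside the field because the derivatives
          of the mollified function are known to be measurable only after multiplication by
          it.\<close>
        define w where "w x = (\<chi> j. \<phi> x * XX gmul j (conv (\<kappa> (r n)) G) x)" for x
        have iO: "indicat_real \<Omega> \<in> borel_measurable borel" using Om by simp
        have iL: "indicat_real \<Omega> \<in> borel_measurable lebesgue" by (rule measurable_completion) (use iO in simp)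
        have z: "\<phi> x = 0" if "x \<notin> \<Omega>" for x using K0 K(2) that by blast
        have "(LINT x|lebesgue. indicator \<Omega> x * hinner deg (F x) (w x))
            = (\<integral>x. indicator \<Omega> x * (\<Sum>j\<in>?J. f j x * w x $ j) \<partial>lborel)"
          by (rule hinner_eq) (use iO iL elim Om in \<open>auto simp: w_def\<close>)
        moreover have "indicator \<Omega> x * hinner deg (F x) (w x)
            = \<phi> x * hinner deg (F x) (hgrad gmul (mconv gmul deg \<Omega> \<rho> (e (r n)) g) x)" for x
          unfolding mcr w_def hinner_def hgrad_def using z[of x]
          by (cases "x \<in> \<Omega>") (auto simp: sum_distrib_left mult_ac)
        moreover have "indicator \<Omega> x * (\<Sum>j\<in>?J. f j x * w x $ j) = \<phi> x * (\<Sum>j\<in>?J. f j x * XX gmul j (conv (\<kappa> (r n)) G) x)" for x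
          unfolding w_def using z[of x] by (cases "x \<in> \<Omega>") (auto simp: sum_distrib_left mult_ac)
        ultimately show ?case by (simp only:)
      qed
      show ?thesis unfolding sintP[OF \<phi>m B]
        by (rule Lim_transform_eventually[OF pair[OF \<phi>c K K0] ev])
    qed
    have c5: "is_hdiv gmul deg \<Omega> (\<lambda>x. g x *\<^sub>R F x) dv'" unfolding is_hdiv_def
    proof (intro conjI fsmdv allI impI)
      fix \<phi> assume \<phi>: "testfun \<Omega> \<phi>"
      obtain B where B: "\<And>x. \<bar>\<phi> x\<bar> \<le> B" using tf_facts(2)[OF \<phi>] by blast
      have "(LINT x:\<Omega>|lebesgue. hinner deg (g x *\<^sub>R F x) (hgrad gmul \<phi> x))
          = (LINT x|lebesgue. (indicator \<Omega> x * g x) * hinner deg (F x) (hgrad gmul \<phi> x))"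
        unfolding set_lebesgue_integral_def hinner_def by (simp add: sum_distrib_left mult_ac)
      also have "\<dots> = (\<integral>x. G x * (\<Sum>j\<in>?J. f j x * hgrad gmul \<phi> x $ j) \<partial>lborel)"
        by (rule hinner_eq[OF gm _ Gm Gae]) (use tf_facts(3)[OF \<phi>] in \<open>auto simp: hgrad_def\<close>)
      also have "\<dots> = (\<integral>x. G x * (\<Sum>j\<in>?J. f j x * XX gmul j \<phi> x) \<partial>lborel)" by (simp add: hgrad_def)
      finally show "- (LINT x:\<Omega>|lebesgue. hinner deg (g x *\<^sub>R F x) (hgrad gmul \<phi> x)) = sint \<Omega> dv' \<phi>"
        unfolding sintdv[OF tf_facts(1)[OF \<phi>] B] using ident[OF \<phi>] by simp
    qed
    have c6: "dv' A = sint \<Omega> divF (\<lambda>x. indicator A x * gt x) + P A" if A: "A \<in> sets borel" for A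
    proof -
      have "sint \<Omega> divF (\<lambda>x. indicator A x * gt x) = (\<integral>x. \<theta>0 x * (indicator A x * gt x) \<partial>m0)"
        by (rule D0(7)[of _ C]) (use gt A order_trans[OF abs_ge_zero gt(2)] in \<open>auto simp: indicator_def intro!: borel_measurable_times borel_measurable_indicator\<close>)
      then show ?thesis unfolding dv'_def by (simp add: mult_ac)
    qed
    \<comment> \<open>The estimates use the mollified field, whose Euclidean norm is at most
      \<open>CF\<close> at each point; the components \<open>Ft j\<close> are limits with respect to
      different measures and are bounded only one by one.\<close>
    define u where "u n j = conv (\<kappa> (r n)) (f j)" for n j
    have um: "u n j \<in> borel_measurable borel" if "j \<in> ?J" for n j
      unfolding u_def by (rule conv_measurable[OF kernelD(5)[OF kr] fm[OF that]])
    have ub: "sqrt (\<Sum>j\<in>?J. (u n j x)\<^sup>2) \<le> CF" for n x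
      unfolding u_def by (rule conv_vector_bound[OF kr J fm fb])
    have ub1: "\<bar>u n j x\<bar> \<le> CF" if "j \<in> ?J" for n j x
      unfolding u_def by (rule conv_bound[OF kr fm[OF that] fb1[OF that]])
    have lim_fixed: "(\<lambda>n. \<Sum>j\<in>?J. \<integral>x. \<theta> j x * (u n j x * indicator B x) \<partial>m j) \<longlonglongrightarrow> P B"
      if B: "B \<in> sets borel" for B
      unfolding P_def
    proof (rule tendsto_sum)
      fix j assume j: "j \<in> ?J"
      have "integrable (m j) (\<lambda>x. \<theta> j x * indicat_real B x)"
        unfolding m_def by (rule fsm_density_integrable(1)[OF d[OF j], of _ 1]) (use B in \<open>auto simp: indicator_le_1\<close>)
      from Ft_lim[OF j this]
      show "(\<lambda>n. \<integral>x. \<theta> j x * (u n j x * indicator B x) \<partial>m j) \<longlonglongrightarrow> (\<integral>x. (\<theta> j x * Ft j x) * indicator B x \<partial>m j)"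
        unfolding u_def by (simp add: mult_ac)
    qed
    have thi: "integrable (m j) (\<theta> j)" if "j \<in> ?J" for j
      using fsm_density_integrable(1)[OF d[OF that], of "\<lambda>_. 1" 1] unfolding m_def by simp
    have sii: "integrable (ms j) (\<sigma> j)" if "j \<in> ?J" for j
      using fsm_density_integrable(1)[OF s[OF that], of "\<lambda>_. 1" 1] unfolding ms_def by simp
    have repD: "Dg j A = (\<integral>x. \<theta> j x * indicator A x \<partial>m j)" if "j \<in> ?J" "A \<in> sets borel" "A \<subseteq> \<Omega>" for j A
      using D(8)[OF that(1,2)] that(3) by (simp add: Int_absorb2)
    have repS: "Ds j A = (\<integral>x. \<sigma> j x * indicator A x \<partial>ms j)" if "j \<in> ?J" "A \<in> sets borel" "A \<subseteq> \<Omega>" for j A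
      using S(8)[OF that(1,2)] that(3) by (simp add: Int_absorb2)
    \<comment> \<open>For each \<open>n\<close> the density estimate applies, and its right-hand
      side does not depend on \<open>n\<close>, so the bound persists in the limit.\<close>
    have Pb: "\<bar>P B\<bar> \<le> CF * tvarv ?J \<Omega> Dg B" if B: "B \<in> sets borel" "B \<subseteq> \<Omega>" for B
    proof (rule LIMSEQ_le_const2[OF tendsto_rabs[OF lim_fixed[OF B(1)]]], intro exI allI impI)
      show "\<bar>\<Sum>j\<in>?J. \<integral>x. \<theta> j x * (u n j x * indicator B x) \<partial>m j\<bar> \<le> CF * tvarv ?J \<Omega> Dg B" for n
        by (rule sum_density_le_tvarv[OF J fsmD Om D(2) thi repD um ub B])
    qed
    \<comment> \<open>The candidate for the singular part: a bound by the variation of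
      \<open>Ds\<close> will also show that it is concentrated on a Lebesgue null set.\<close>
    define Q where "Q A = P A - (LINT x:A|lebesgue. hinner deg (F x) (ng x))" for A
    have acint: "(LINT x:B|lebesgue. hinner deg (F x) (ng x)) = (\<Sum>j\<in>?J. \<integral>x. f j x * (n0 j x * indicator B x) \<partial>lborel)"
      if B: "B \<in> sets borel" "B \<subseteq> \<Omega>" for B
    proof -
      have iB: "indicat_real B \<in> borel_measurable borel" using B by simp
      have e: "indicator B x *\<^sub>R hinner deg (F x) (ng x) = (\<Sum>j\<in>?J. (indicator \<Omega> x * F x $ j) * ((indicator \<Omega> x * ng x $ j) * indicator B x))" for x
        unfolding hinner_def using B(2) by (auto simp: indicator_def)
      have "(LINT x:B|lebesgue. hinner deg (F x) (ng x)) = (\<integral>x. (\<Sum>j\<in>?J. f j x * (n0 j x * indicator B x)) \<partial>lborel)"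
        unfolding set_lebesgue_integral_def e
      proof (rule integral_lebesgue_eq_lborel)
        have iBl: "indicat_real B \<in> borel_measurable lebesgue" by (rule measurable_completion) (use iB in simp)
        show "(\<lambda>x. \<Sum>j\<in>?J. (indicator \<Omega> x * F x $ j) * ((indicator \<Omega> x * ng x $ j) * indicator B x)) \<in> borel_measurable lebesgue"
          by (intro borel_measurable_sum borel_measurable_times Fm nm iBl)
        show "(\<lambda>x. \<Sum>j\<in>?J. f j x * (n0 j x * indicator B x)) \<in> borel_measurable borel"
          by (intro borel_measurable_sum borel_measurable_times fm n0(1) iB)
        show "AE x in lborel. (\<Sum>j\<in>?J. (indicator \<Omega> x * F x $ j) * ((indicator \<Omega> x * ng x $ j) * indicator B x))
            = (\<Sum>j\<in>?J. f j x * (n0 j x * indicator B x))"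
          using fae nae by eventually_elim (rule sum.cong, auto)
      qed
      also have "\<dots> = (\<Sum>j\<in>?J. \<integral>x. f j x * (n0 j x * indicator B x) \<partial>lborel)"
      proof (rule Bochner_Integration.integral_sum)
        fix j assume j: "j \<in> ?J"
        have "integrable lborel (\<lambda>x. n0 j x * (f j x * indicator B x))"
          by (rule integrable_bounded_mult[OF sets_lborel nint[OF j] borel_measurable_times[OF fm[OF j] iB], of CF])
            (use fb1[OF j] CF0 in \<open>auto simp: indicator_def\<close>)
        then show "integrable lborel (\<lambda>x. f j x * (n0 j x * indicator B x))" by (simp add: mult_ac)
      qed
      finally show ?thesis .
    qed
    \<comment> \<open>The decomposition of \<open>Dg j\<close> is assumed for sets; writing it as a
      vanishing sum of three densities extends it to bounded Borel functions.\<close>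
    have split3: "(\<integral>x. \<theta> j x * w x \<partial>m j) = (\<integral>x. n0 j x * w x \<partial>lborel) + (\<integral>x. \<sigma> j x * w x \<partial>ms j)"
      if j: "j \<in> ?J" and w: "w \<in> borel_measurable borel" "\<And>x. \<bar>w x\<bar> \<le> B" for j w B
    proof -
      define N where "N i = (if i = 0 then m j else if i = 1 then lborel else ms j)" for i :: nat
      define l where "l i = (if i = 0 then \<theta> j else if i = 1 then (\<lambda>x. - n0 j x) else (\<lambda>x. - \<sigma> j x))" for i :: nat
      have "(\<Sum>i\<in>{0,1,2}. \<integral>x. l i x * w x \<partial>N i) = 0"
      proof (rule sum_integral_zero[OF _ _ _ _ w])
        show "finite {0,1,2::nat}" by simp
        show "sets (N i) = sets borel" for i unfolding N_def using D(2)[OF j] S(2)[OF j] by simp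
        show "integrable (N i) (l i)" for i unfolding N_def l_def using thi[OF j] sii[OF j] nint[OF j] by simp
        fix A :: "(real^'n) set" assume A: "A \<in> sets borel"
        have AO: "A \<inter> \<Omega> \<in> sets borel" "A \<inter> \<Omega> \<subseteq> \<Omega>" using A Om by auto
        have iA: "indicat_real A \<in> borel_measurable borel" using A by simp
        have iAl: "indicat_real A \<in> borel_measurable lebesgue" by (rule measurable_completion) (use iA in simp)
        have e: "indicator (A \<inter> \<Omega>) x *\<^sub>R ng x $ j = (indicator \<Omega> x * ng x $ j) * indicator A x" for x
          by (auto simp: indicator_def)
        have L: "(LINT x:A \<inter> \<Omega>|lebesgue. ng x $ j) = (\<integral>x. n0 j x * indicator A x \<partial>lborel)"
          unfolding set_lebesgue_integral_def e
          by (rule integral_lebesgue_eq_lborel)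
            (use nm[OF j] iAl n0(1)[OF j] iA n0(2)[OF j] in \<open>auto elim!: eventually_mono\<close>)
        have "Dg j (A \<inter> \<Omega>) = (LINT x:A \<inter> \<Omega>|lebesgue. ng x $ j) + Ds j (A \<inter> \<Omega>)"
          using Dg_dec j AO by blast
        then have "(\<integral>x. \<theta> j x * indicator A x \<partial>m j) = (\<integral>x. n0 j x * indicator A x \<partial>lborel) + (\<integral>x. \<sigma> j x * indicator A x \<partial>ms j)"
          using D(8)[OF j A] S(8)[OF j A] L by simp
        then show "(\<Sum>i\<in>{0,1,2}. \<integral>x. l i x * indicator A x \<partial>N i) = 0" unfolding N_def l_def by simp
      qed
      then show ?thesis unfolding N_def l_def by simp
    qed
    \<comment> \<open>Against the Lebesgue part the mollified field converges weakly to
      \<open>f\<close>. Subtracting this limit from the one for \<open>P\<close> leaves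
      \<open>Q\<close>, now expressed through the singular measures alone.\<close>
    have limQ: "(\<lambda>n. \<Sum>j\<in>?J. \<integral>x. \<sigma> j x * (u n j x * indicator B x) \<partial>ms j) \<longlonglongrightarrow> Q B"
      if B: "B \<in> sets borel" "B \<subseteq> \<Omega>" for B
    proof -
      have iB: "indicat_real B \<in> borel_measurable borel" using B by simp
      have eq: "(\<Sum>j\<in>?J. \<integral>x. \<sigma> j x * (u n j x * indicator B x) \<partial>ms j)
          = (\<Sum>j\<in>?J. \<integral>x. \<theta> j x * (u n j x * indicator B x) \<partial>m j) - (\<Sum>j\<in>?J. \<integral>x. u n j x * (n0 j x * indicator B x) \<partial>lborel)" for n
      proof -
        have "(\<integral>x. \<sigma> j x * (u n j x * indicator B x) \<partial>ms j)
          = (\<integral>x. \<theta> j x * (u n j x * indicator B x) \<partial>m j) - (\<integral>x. u n j x * (n0 j x * indicator B x) \<partial>lborel)" if j: "j \<in> ?J" for j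
        proof -
          have "(\<lambda>x. u n j x * indicator B x) \<in> borel_measurable borel"
            by (intro borel_measurable_times um[OF j] iB)
          moreover have "\<bar>u n j x * indicator B x\<bar> \<le> CF" for x
            using ub1[OF j, of n x] CF0 by (simp add: indicator_def)
          ultimately show ?thesis using split3[OF j, of "\<lambda>x. u n j x * indicator B x" CF]
            by (simp add: mult.left_commute)
        qed
        then show ?thesis by (simp add: sum_subtractf)
      qed
      have "(\<lambda>n. \<Sum>j\<in>?J. \<integral>x. u n j x * (n0 j x * indicator B x) \<partial>lborel) \<longlonglongrightarrow> (\<Sum>j\<in>?J. \<integral>x. f j x * (n0 j x * indicator B x) \<partial>lborel)"
      proof (rule tendsto_sum)
        fix j assume j: "j \<in> ?J"
        have "integrable lborel (\<lambda>x. n0 j x * indicator B x)"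
          by (rule integrable_bounded_mult[OF sets_lborel nint[OF j] iB, of 1]) (simp add: indicator_le_1)
        then show "(\<lambda>n. \<integral>x. u n j x * (n0 j x * indicator B x) \<partial>lborel) \<longlonglongrightarrow> (\<integral>x. f j x * (n0 j x * indicator B x) \<partial>lborel)"
          unfolding u_def by (rule conv_weak_limit[OF kr Rr fm[OF j] fb1[OF j]])
      qed
      from tendsto_diff[OF lim_fixed[OF B(1)] this] show ?thesis
        unfolding eq Q_def acint[OF B] .
    qed
    have Qb: "\<bar>Q B\<bar> \<le> CF * tvarv ?J \<Omega> Ds B" if B: "B \<in> sets borel" "B \<subseteq> \<Omega>" for B
    proof (rule LIMSEQ_le_const2[OF tendsto_rabs[OF limQ[OF B]]], intro exI allI impI)
      show "\<bar>\<Sum>j\<in>?J. \<integral>x. \<sigma> j x * (u n j x * indicator B x) \<partial>ms j\<bar> \<le> CF * tvarv ?J \<Omega> Ds B" for n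
        by (rule sum_density_le_tvarv[OF J fsmS Om S(2) sii repS um ub B])
    qed
    have c7: "tvar \<Omega> P A \<le> CF * tvarv ?J \<Omega> Dg A" for A
      by (rule tvar_le_tvarv[OF J fsmD Om CF0 Pb])
    have c8: "tvar \<Omega> Q A \<le> CF * tvarv ?J \<Omega> Ds A" for A
      by (rule tvar_le_tvarv[OF J fsmS Om CF0 Qb])
    have c9: "sing_leb \<Omega> Q"
    proof -
      have "\<forall>j\<in>?J. \<exists>N\<in>sets borel. N \<subseteq> \<Omega> \<and> emeasure lebesgue N = 0 \<and> tvar \<Omega> (Ds j) (\<Omega> - N) = 0"
        using Ds unfolding sing_leb_def by blast
      then have "\<exists>N. \<forall>j\<in>?J. N j \<in> sets borel \<and> N j \<subseteq> \<Omega> \<and> emeasure lebesgue (N j) = 0 \<and> tvar \<Omega> (Ds j) (\<Omega> - N j) = 0"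
        by (intro bchoice) blast
      then obtain N where "\<forall>j\<in>?J. N j \<in> sets borel \<and> N j \<subseteq> \<Omega> \<and> emeasure lebesgue (N j) = 0 \<and> tvar \<Omega> (Ds j) (\<Omega> - N j) = 0" ..
      then have N: "\<And>j. j \<in> ?J \<Longrightarrow> N j \<in> sets borel" "\<And>j. j \<in> ?J \<Longrightarrow> N j \<subseteq> \<Omega>"
        "\<And>j. j \<in> ?J \<Longrightarrow> emeasure lebesgue (N j) = 0" "\<And>j. j \<in> ?J \<Longrightarrow> tvar \<Omega> (Ds j) (\<Omega> - N j) = 0" by blast+
      \<comment> \<open>A common null set: on Borel sets off \<open>N'\<close> all components of
        \<open>Ds\<close> vanish, hence so do their vector variation and \<open>Q\<close>.\<close>
      define N' where "N' = (\<Union>j\<in>?J. N j)"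
      have N'b: "N' \<in> sets borel" unfolding N'_def using N(1) J by (intro sets.finite_UN) auto
      have "N' \<in> null_sets lebesgue" unfolding N'_def
        by (intro null_sets.finite_UN J) (use N in \<open>auto simp: null_sets_def\<close>)
      then have N'0: "emeasure lebesgue N' = 0" by (auto simp: null_sets_def)
      have DsB: "Ds j B = 0" if "j \<in> ?J" "B \<in> sets borel" "B \<subseteq> \<Omega> - N'" for j B
        using fsm_density_abs_le[OF s[OF that(1)] that(2), of "\<Omega> - N j"] that N(1,4)[OF that(1)] Om
        unfolding N'_def by auto
      have QB: "Q B = 0" if B: "B \<in> sets borel" "B \<subseteq> \<Omega> - N'" for B
      proof -
        have "tvarv ?J \<Omega> Ds B \<le> 0" unfolding tvarv_def
        proof (rule cSup_least)
          show "{\<Sum>B\<in>P. sqrt (\<Sum>j\<in>?J. (Ds j B)\<^sup>2) |P. finite P \<and> disjoint P \<and> (\<forall>D\<in>P. D \<in> sets borel \<and> D \<subseteq> B \<inter> \<Omega>)} \<noteq> {}"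
            by (auto intro!: exI[of _ "{}"] simp: disjoint_def)
          fix y assume "y \<in> {\<Sum>B\<in>P. sqrt (\<Sum>j\<in>?J. (Ds j B)\<^sup>2) |P. finite P \<and> disjoint P \<and> (\<forall>D\<in>P. D \<in> sets borel \<and> D \<subseteq> B \<inter> \<Omega>)}"
          then obtain P where y: "y = (\<Sum>B\<in>P. sqrt (\<Sum>j\<in>?J. (Ds j B)\<^sup>2))" "\<And>D. D \<in> P \<Longrightarrow> D \<in> sets borel \<and> D \<subseteq> B \<inter> \<Omega>" by auto
          have "y = 0" unfolding y(1)
          proof (rule sum.neutral, rule ballI)
            fix A assume A: "A \<in> P"
            then have "(\<Sum>j\<in>?J. (Ds j A)\<^sup>2) = 0"
              using DsB y(2)[OF A] B(2) by (intro sum.neutral ballI) auto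
            then show "sqrt (\<Sum>j\<in>?J. (Ds j A)\<^sup>2) = 0" by simp
          qed
          then show "y \<le> 0" by simp
        qed
        then have "CF * tvarv ?J \<Omega> Ds B \<le> 0" using CF0 by (simp add: mult_nonneg_nonpos)
        moreover have "\<bar>Q B\<bar> \<le> CF * tvarv ?J \<Omega> Ds B" by (rule Qb) (use B in auto)
        ultimately show ?thesis by simp
      qed
      have "tvar \<Omega> Q (\<Omega> - N') = 0"
      proof -
        have "{\<Sum>B\<in>P. \<bar>Q B\<bar> |P. finite P \<and> disjoint P \<and> (\<forall>B\<in>P. B \<in> sets borel \<and> B \<subseteq> (\<Omega> - N') \<inter> \<Omega>)} = {0}"
        proof (intro equalityI subsetI)
          fix y assume "y \<in> {\<Sum>B\<in>P. \<bar>Q B\<bar> |P. finite P \<and> disjoint P \<and> (\<forall>B\<in>P. B \<in> sets borel \<and> B \<subseteq> (\<Omega> - N') \<inter> \<Omega>)}"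
          then obtain P where y: "y = (\<Sum>B\<in>P. \<bar>Q B\<bar>)" "\<And>B. B \<in> P \<Longrightarrow> B \<in> sets borel \<and> B \<subseteq> (\<Omega> - N') \<inter> \<Omega>" by auto
          have "y = 0" unfolding y(1) by (rule sum.neutral) (use y(2) QB in auto)
          then show "y \<in> {0}" by simp
        next
          fix y :: real assume "y \<in> {0}"
          then show "y \<in> {\<Sum>B\<in>P. \<bar>Q B\<bar> |P. finite P \<and> disjoint P \<and> (\<forall>B\<in>P. B \<in> sets borel \<and> B \<subseteq> (\<Omega> - N') \<inter> \<Omega>)}"
            by (auto intro!: exI[of _ "{}"] simp: disjoint_def)
        qed
        then show ?thesis unfolding tvar_def by (simp only: cSup_singleton)
      qed
      moreover have "N' \<subseteq> \<Omega>" unfolding N'_def using N(2) by blast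
      ultimately show ?thesis unfolding sing_leb_def using N'b N'0 by blast
    qed
    note c7' = c7[unfolded CF_def] and c8' = c8[unfolded CF_def Q_def[abs_def]] and c9' = c9[unfolded Q_def[abs_def]]
    show ?thesis
      by (rule exI[of _ r], rule exI[of _ gt], rule exI[of _ P], intro conjI allI impI ballI)
        ((rule r c1 c2 c3 fsmP c4 c7' c8' c9'; assumption)
          | (rule exI[of _ dv'], (intro conjI ballI impI c5 c6; assumption)))+
  qed

  \<comment> \<open>Essential boundedness of the product field\<close>
  have gF: "LinfH deg \<Omega> (\<lambda>x. g x *\<^sub>R F x)" unfolding LinfH_def
  proof (intro conjI ballI)
    fix j assume j: "j \<in> ?J"
    have "(\<lambda>x. (indicator \<Omega> x * g x) * (indicator \<Omega> x * F x $ j)) \<in> borel_measurable lebesgue"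
      using gm Fm[OF j] by (rule borel_measurable_times)
    moreover have "(indicator \<Omega> x * g x) * (indicator \<Omega> x * F x $ j) = indicator \<Omega> x *\<^sub>R ((g x *\<^sub>R F x) $ j)" for x
      by (simp add: indicator_def)
    ultimately show "set_borel_measurable lebesgue \<Omega> (\<lambda>x. (g x *\<^sub>R F x) $ j)"
      unfolding set_borel_measurable_def by simp
  next
    have "AE x in lborel. x \<in> \<Omega> \<longrightarrow> hnorm deg (g x *\<^sub>R F x) \<le> C * CF"
      using C0 CF
    proof eventually_elim
      case (elim x)
      show ?case
      proof
        assume x: "x \<in> \<Omega>"
        have "hnorm deg (g x *\<^sub>R F x) = \<bar>g x\<bar> * hnorm deg (F x)"
          unfolding hnorm_def by (simp add: power_mult_distrib sum_distrib_left[symmetric] real_sqrt_mult)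
        also have "\<dots> \<le> C * CF"
          by (rule mult_mono) (use elim x in \<open>auto simp: C_def hnorm_def intro: sum_nonneg\<close>)
        finally show "hnorm deg (g x *\<^sub>R F x) \<le> C * CF" .
      qed
    qed
    then show "\<exists>C. AE x in lebesgue. x \<in> \<Omega> \<longrightarrow> hnorm deg (g x *\<^sub>R F x) \<le> C"
      by (intro exI[of _ "C * CF"] AE_completion)
  qed
  \<comment> \<open>The membership statement mentions no sequence; any positive null sequence, here
    \<open>inverse (real (Suc k))\<close>, supplies the divergence measure.\<close>
  have "DMinf gmul deg \<Omega> (\<lambda>x. g x *\<^sub>R F x)"
    using gF main[of "\<lambda>k. inverse (real (Suc k))"] LIMSEQ_inverse_real_of_nat unfolding DMinf_def by auto
  then show ?thesis using main by blast
qed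

end
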